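(* Let $u\colon R\to U$ be a flat epimorphism of commutative rings, and let $\mathbb{G}$ be the set of all ideals $I\subset R$ such that $R/I\otimes_R U=0$. Assume that for every $I\in\mathbb{G}$ the quotient ring $R/I$ is semilocal of Krull dimension zero. Then an $R$-module $C$ is a $u$-contramodule if and only if it is isomorphic to a product $$C\simeq\prod_{\mathfrak{m}\in\mathbb{G}\cap\operatorname{Max}R}C(\mathfrak{m})$$ of some $\mathfrak{m}$-contramodule $R$-modules $C(\mathfrak{m})$ over the maximal ideals $\mathfrak{m}\in\mathbb{G}\cap\operatorname{Max}R$. Such an infinite product decomposition is unique and functorial when it exists, and the $R$-modules $C(\mathfrak{m})$ can be recovered as the colocalizations $C(\mathfrak{m})=\operatorname{Hom}_R(R_{\mathfrak{m}},C)$.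
   Context: A flat epimorphism of commutative rings is a homomorphism $u\colon R\to U$ of commutative rings such that $U$ is a flat $R$-module and the multiplication map $U\otimes_R U\to U$ is an isomorphism. A commutative ring is semilocal if it has only finitely many maximal ideals; it has Krull dimension zero if all its prime ideals are maximal (the zero ring satisfies both vacuously). $\operatorname{Max}R$ is the set of all maximal ideals of $R$. An $R$-module $C$ is a $u$-contramodule if $\operatorname{Hom}_R(U,C)=0=\operatorname{Ext}^1_R(U,C)$. For $t\in R$, an $R$-module $C$ is a $t$-contramodule if $\operatorname{Hom}_R(R[t^{-1}],C)=0=\operatorname{Ext}^1_R(R[t^{-1}],C)$; for an ideal $I\subset R$, $C$ is an $I$-contramodule if it is a $t$-contramodule for every $t\in I$. "Unique and functorial" means that, for families of $\mathfrak{m}$-contramodule $R$-modules $C(\mathfrak{m})$ and $D(\mathfrak{m})$, every $R$-module morphism $\prod_{\mathfrak{m}}C(\mathfrak{m})\to\prod_{\mathfrak{m}}D(\mathfrak{m})$ is the product of a unique family of $R$-module morphisms $C(\mathfrak{m})\to D(\mathfrak{m})$. *)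

theory Defs
  imports "HOL-Algebra.QuotRing" "HOL-Algebra.Module"
begin

section \<open>Basic constructions on modules\<close>

text \<open>
  The record type of modules extends the one of rings, so it has fields \<^const>\<open>mult\<close> and
  \<^const>\<open>one\<close>, which the locale \<^locale>\<open>module\<close> ignores. They are left \<^const>\<open>undefined\<close>
  in the constructions below that carry no ring structure.
\<close>

definition zero_module :: "('a, 'b, 'm) module_scheme \<Rightarrow> bool" where
  "zero_module M \<longleftrightarrow> carrier M = {\<zero>\<^bsub>M\<^esub>}"

text \<open>Homomorphisms are extensional, so that equality in the set is equality of maps.\<close>

definition module_hom ::
    "('a, 'r) ring_scheme \<Rightarrow> ('a, 'b, 'm) module_scheme \<Rightarrow> ('a, 'c, 'n) module_scheme \<Rightarrow> ('b \<Rightarrow> 'c) set" where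
  "module_hom R M N = {h \<in> carrier M \<rightarrow>\<^sub>E carrier N.
     (\<forall>x\<in>carrier M. \<forall>y\<in>carrier M. h (x \<oplus>\<^bsub>M\<^esub> y) = h x \<oplus>\<^bsub>N\<^esub> h y) \<and>
     (\<forall>r\<in>carrier R. \<forall>x\<in>carrier M. h (r \<odot>\<^bsub>M\<^esub> x) = r \<odot>\<^bsub>N\<^esub> h x)}"

definition module_iso ::
    "('a, 'r) ring_scheme \<Rightarrow> ('a, 'b, 'm) module_scheme \<Rightarrow> ('a, 'c, 'n) module_scheme \<Rightarrow> ('b \<Rightarrow> 'c) set" where
  "module_iso R M N = {h \<in> module_hom R M N. bij_betw h (carrier M) (carrier N)}"

definition Hom_module ::
    "('a, 'r) ring_scheme \<Rightarrow> ('a, 'b, 'm) module_scheme \<Rightarrow> ('a, 'c, 'n) module_scheme \<Rightarrow> ('a, 'b \<Rightarrow> 'c) module" where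
  "Hom_module R M N =
    \<lparr>carrier = module_hom R M N, mult = undefined, one = undefined,
     zero = (\<lambda>x\<in>carrier M. \<zero>\<^bsub>N\<^esub>),
     add = (\<lambda>f g. \<lambda>x\<in>carrier M. f x \<oplus>\<^bsub>N\<^esub> g x),
     smult = (\<lambda>r f. \<lambda>x\<in>carrier M. r \<odot>\<^bsub>N\<^esub> f x)\<rparr>"

definition product_module :: "'i set \<Rightarrow> ('i \<Rightarrow> ('a, 'b, 'm) module_scheme) \<Rightarrow> ('a, 'i \<Rightarrow> 'b) module" where
  "product_module I M =
    \<lparr>carrier = (\<Pi>\<^sub>E i\<in>I. carrier (M i)), mult = undefined, one = undefined,
     zero = (\<lambda>i\<in>I. \<zero>\<^bsub>M i\<^esub>),
     add = (\<lambda>x y. \<lambda>i\<in>I. x i \<oplus>\<^bsub>M i\<^esub> y i),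
     smult = (\<lambda>r x. \<lambda>i\<in>I. r \<odot>\<^bsub>M i\<^esub> x i)\<rparr>"

text \<open>The product of a family of maps.\<close>

definition product_map ::
    "'i set \<Rightarrow> ('i \<Rightarrow> ('a, 'b, 'm) module_scheme) \<Rightarrow> ('i \<Rightarrow> 'b \<Rightarrow> 'c) \<Rightarrow> ('i \<Rightarrow> 'b) \<Rightarrow> ('i \<Rightarrow> 'c)" where
  "product_map I M g = (\<lambda>x\<in>carrier (product_module I M). \<lambda>i\<in>I. g i (x i))"

definition quotient_module :: "('a, 'b, 'm) module_scheme \<Rightarrow> 'b set \<Rightarrow> ('a, 'b set) module" where
  "quotient_module M N =
    \<lparr>carrier = a_rcosets\<^bsub>M\<^esub> N, mult = undefined, one = undefined,
     zero = N, add = set_add M,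
     smult = (\<lambda>r X. \<Union>x\<in>X. N +>\<^bsub>M\<^esub> (r \<odot>\<^bsub>M\<^esub> x))\<rparr>"

definition generated_submodule ::
    "('a, 'r) ring_scheme \<Rightarrow> ('a, 'b, 'm) module_scheme \<Rightarrow> 'b set \<Rightarrow> 'b set" where
  "generated_submodule R M X = \<Inter>{N. submodule N R M \<and> X \<subseteq> N}"

text \<open>The \<open>R\<close>-module underlying a ring \<open>A\<close> with a ring homomorphism \<open>u : R \<rightarrow> A\<close>.\<close>

definition restrict_scalars :: "('a \<Rightarrow> 'b) \<Rightarrow> ('b, 'm) ring_scheme \<Rightarrow> ('a, 'b) module" where
  "restrict_scalars u A =
    \<lparr>carrier = carrier A, mult = mult A, one = \<one>\<^bsub>A\<^esub>, zero = \<zero>\<^bsub>A\<^esub>, add = add A,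
     smult = (\<lambda>r x. u r \<otimes>\<^bsub>A\<^esub> x)\<rparr>"


section \<open>Free modules and tensor products\<close>

definition free_module :: "('a, 'r) ring_scheme \<Rightarrow> 'x set \<Rightarrow> ('a, 'x \<Rightarrow> 'a) module" where
  "free_module R S =
    \<lparr>carrier = {f. range f \<subseteq> carrier R \<and> finite {x. f x \<noteq> \<zero>\<^bsub>R\<^esub>} \<and> {x. f x \<noteq> \<zero>\<^bsub>R\<^esub>} \<subseteq> S},
     mult = undefined, one = undefined,
     zero = (\<lambda>x. \<zero>\<^bsub>R\<^esub>), add = (\<lambda>f g x. f x \<oplus>\<^bsub>R\<^esub> g x), smult = (\<lambda>r f x. r \<otimes>\<^bsub>R\<^esub> f x)\<rparr>"

definition free_gen :: "('a, 'r) ring_scheme \<Rightarrow> 'x \<Rightarrow> 'x \<Rightarrow> 'a" where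
  "free_gen R x = (\<lambda>y. if y = x then \<one>\<^bsub>R\<^esub> else \<zero>\<^bsub>R\<^esub>)"

text \<open>The linear map from the free module on \<open>S\<close> to \<open>P\<close> that sends the generator \<open>x\<close> to \<open>b x\<close>.\<close>

definition free_lift ::
    "('a, 'r) ring_scheme \<Rightarrow> 'x set \<Rightarrow> ('a, 'p, 'm) module_scheme \<Rightarrow> ('x \<Rightarrow> 'p) \<Rightarrow> ('x \<Rightarrow> 'a) \<Rightarrow> 'p" where
  "free_lift R S P b =
    (\<lambda>f\<in>carrier (free_module R S). \<Oplus>\<^bsub>P\<^esub>x\<in>{x. f x \<noteq> \<zero>\<^bsub>R\<^esub>}. f x \<odot>\<^bsub>P\<^esub> b x)"

definition tensor_relations ::
    "('a, 'r) ring_scheme \<Rightarrow> ('a, 'b, 'm) module_scheme \<Rightarrow> ('a, 'c, 'n) module_scheme \<Rightarrow> ('b \<times> 'c \<Rightarrow> 'a) set" where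
  "tensor_relations R M N =
    (let F = free_module R (carrier M \<times> carrier N); e = free_gen R in
     {e (x \<oplus>\<^bsub>M\<^esub> x', y) \<ominus>\<^bsub>F\<^esub> (e (x, y) \<oplus>\<^bsub>F\<^esub> e (x', y)) | x x' y.
        x \<in> carrier M \<and> x' \<in> carrier M \<and> y \<in> carrier N} \<union>
     {e (x, y \<oplus>\<^bsub>N\<^esub> y') \<ominus>\<^bsub>F\<^esub> (e (x, y) \<oplus>\<^bsub>F\<^esub> e (x, y')) | x y y'.
        x \<in> carrier M \<and> y \<in> carrier N \<and> y' \<in> carrier N} \<union>
     {e (r \<odot>\<^bsub>M\<^esub> x, y) \<ominus>\<^bsub>F\<^esub> r \<odot>\<^bsub>F\<^esub> e (x, y) | r x y.
        r \<in> carrier R \<and> x \<in> carrier M \<and> y \<in> carrier N} \<union>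
     {e (x, r \<odot>\<^bsub>N\<^esub> y) \<ominus>\<^bsub>F\<^esub> r \<odot>\<^bsub>F\<^esub> e (x, y) | r x y.
        r \<in> carrier R \<and> x \<in> carrier M \<and> y \<in> carrier N})"

definition tensor_kernel ::
    "('a, 'r) ring_scheme \<Rightarrow> ('a, 'b, 'm) module_scheme \<Rightarrow> ('a, 'c, 'n) module_scheme \<Rightarrow> ('b \<times> 'c \<Rightarrow> 'a) set" where
  "tensor_kernel R M N =
    generated_submodule R (free_module R (carrier M \<times> carrier N)) (tensor_relations R M N)"

definition tensor_module ::
    "('a, 'r) ring_scheme \<Rightarrow> ('a, 'b, 'm) module_scheme \<Rightarrow> ('a, 'c, 'n) module_scheme \<Rightarrow>
     ('a, ('b \<times> 'c \<Rightarrow> 'a) set) module" where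
  "tensor_module R M N =
    quotient_module (free_module R (carrier M \<times> carrier N)) (tensor_kernel R M N)"

definition pure_tensor ::
    "('a, 'r) ring_scheme \<Rightarrow> ('a, 'b, 'm) module_scheme \<Rightarrow> ('a, 'c, 'n) module_scheme \<Rightarrow>
     'b \<Rightarrow> 'c \<Rightarrow> ('b \<times> 'c \<Rightarrow> 'a) set" where
  "pure_tensor R M N x y =
    tensor_kernel R M N +>\<^bsub>free_module R (carrier M \<times> carrier N)\<^esub> free_gen R (x, y)"

text \<open>
  The linear map \<open>x \<otimes> y \<mapsto> b x y\<close> out of the tensor product. For bilinear \<open>b\<close> the
  lift to the free module is constant on each coset, and \<^const>\<open>the_elem\<close> picks its value there.
\<close>

definition tensor_lift ::
    "('a, 'r) ring_scheme \<Rightarrow> ('a, 'b, 'm) module_scheme \<Rightarrow> ('a, 'c, 'n) module_scheme \<Rightarrow>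
     ('a, 'p, 'k) module_scheme \<Rightarrow> ('b \<Rightarrow> 'c \<Rightarrow> 'p) \<Rightarrow> ('b \<times> 'c \<Rightarrow> 'a) set \<Rightarrow> 'p" where
  "tensor_lift R M N P b = (\<lambda>X\<in>carrier (tensor_module R M N).
     the_elem (free_lift R (carrier M \<times> carrier N) P (\<lambda>(x, y). b x y) ` X))"

text \<open>The map \<open>f \<otimes> id : M \<otimes> U \<rightarrow> N \<otimes> U\<close>.\<close>

definition tensor_map ::
    "('a, 'r) ring_scheme \<Rightarrow> ('a, 'b, 'm) module_scheme \<Rightarrow> ('a, 'c, 'n) module_scheme \<Rightarrow>
     ('a, 'd, 'k) module_scheme \<Rightarrow> ('b \<Rightarrow> 'c) \<Rightarrow>
     ('b \<times> 'd \<Rightarrow> 'a) set \<Rightarrow> ('c \<times> 'd \<Rightarrow> 'a) set" where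
  "tensor_map R M N U f =
    tensor_lift R M U (tensor_module R N U) (\<lambda>x y. pure_tensor R N U (f x) y)"


section \<open>Flat ring epimorphisms\<close>

text \<open>
  Flatness: the functor \<open>- \<otimes> U\<close> preserves injectivity. A definition cannot quantify over
  types, so the test modules live on one type. It is large enough to hold a copy of every
  subquotient of a module \<open>R\<^sup>n\<close> (as a set of cosets of finite sequences, padded to
  functions on the naturals), hence of every submodule of a finitely generated module. A relation in a
  tensor product involves only finitely many elements, so injectivity for these modules gives it
  for \<open>R\<close>-modules over any type.
\<close>

definition flat_module :: "('a, 'r) ring_scheme \<Rightarrow> ('a, 'b, 'm) module_scheme \<Rightarrow> bool" where
  "flat_module R U \<longleftrightarrow> module R U \<and>
    (\<forall>(M :: ('a, (nat \<Rightarrow> 'a) set) module) (N :: ('a, (nat \<Rightarrow> 'a) set) module).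
       module R M \<and> module R N \<longrightarrow>
       (\<forall>f\<in>module_hom R M N. inj_on f (carrier M) \<longrightarrow>
          inj_on (tensor_map R M N U f) (carrier (tensor_module R M U))))"

definition flat_epimorphism ::
    "('a, 'r) ring_scheme \<Rightarrow> ('b, 's) ring_scheme \<Rightarrow> ('a \<Rightarrow> 'b) \<Rightarrow> bool" where
  "flat_epimorphism R U u \<longleftrightarrow>
    cring R \<and> cring U \<and> u \<in> ring_hom R U \<and>
    flat_module R (restrict_scalars u U) \<and>
    (let V = restrict_scalars u U
     in tensor_lift R V V V (\<lambda>x y. x \<otimes>\<^bsub>U\<^esub> y) \<in> module_iso R (tensor_module R V V) V)"

text \<open>The ideals \<open>I\<close> with \<open>R/I \<otimes> U = 0\<close>.\<close>

definition gabriel_ideals ::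
    "('a, 'r) ring_scheme \<Rightarrow> ('b, 's) ring_scheme \<Rightarrow> ('a \<Rightarrow> 'b) \<Rightarrow> 'a set set" where
  "gabriel_ideals R U u = {I. ideal I R \<and>
     zero_module (tensor_module R (restrict_scalars (\<lambda>r. I +>\<^bsub>R\<^esub> r) (R Quot I)) (restrict_scalars u U))}"

definition Max_ideals :: "('a, 'r) ring_scheme \<Rightarrow> 'a set set" where
  "Max_ideals R = {I. maximalideal I R}"

definition semilocal :: "('a, 'r) ring_scheme \<Rightarrow> bool" where
  "semilocal R \<longleftrightarrow> finite (Max_ideals R)"

definition krull_dim_zero :: "('a, 'r) ring_scheme \<Rightarrow> bool" where
  "krull_dim_zero R \<longleftrightarrow> (\<forall>P. primeideal P R \<longrightarrow> maximalideal P R)"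


section \<open>Ext\<close>

text \<open>
  The canonical free resolution \<open>\<dots> \<rightarrow> F\<^sub>2 \<rightarrow> F\<^sub>1 \<rightarrow> F\<^sub>0 \<rightarrow> M \<rightarrow> 0\<close>: each
  term is free on the set of all elements of the kernel of the preceding map (\<open>F\<^sub>0\<close> on the set of
  all elements of \<open>M\<close>), and \<open>Ext\<^sup>1(M, C)\<close> is the first cohomology of \<open>Hom(F\<^sub>\<bullet>, C)\<close>.
\<close>

definition free_cover ::
    "('a, 'r) ring_scheme \<Rightarrow> ('a, 'b, 'm) module_scheme \<Rightarrow> ('a, 'b \<Rightarrow> 'a) module" where
  "free_cover R M = free_module R (carrier M)"

definition cover_map ::
    "('a, 'r) ring_scheme \<Rightarrow> ('a, 'b, 'm) module_scheme \<Rightarrow> ('b \<Rightarrow> 'a) \<Rightarrow> 'b" where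
  "cover_map R M = free_lift R (carrier M) M (\<lambda>x. x)"

definition syzygy ::
    "('a, 'r) ring_scheme \<Rightarrow> ('a, 'b, 'm) module_scheme \<Rightarrow> ('a, 'b \<Rightarrow> 'a) module" where
  "syzygy R M = (free_cover R M)\<lparr>carrier := {f \<in> carrier (free_cover R M). cover_map R M f = \<zero>\<^bsub>M\<^esub>}\<rparr>"

text \<open>
  \<open>F\<^sub>1\<close> and \<open>F\<^sub>2\<close> are the free covers of the first and of the second syzygy. As a map into
  \<open>F\<^sub>0\<close> (resp. \<open>F\<^sub>1\<close>), the differential is the covering map itself.
\<close>

definition Ext1 ::
    "('a, 'r) ring_scheme \<Rightarrow> ('a, 'b, 'm) module_scheme \<Rightarrow> ('a, 'c, 'n) module_scheme \<Rightarrow>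
     ('a, ((('b \<Rightarrow> 'a) \<Rightarrow> 'a) \<Rightarrow> 'c) set) module" where
  "Ext1 R M C =
    (let F0 = free_cover R M;
         F1 = free_cover R (syzygy R M);
         F2 = free_cover R (syzygy R (syzygy R M));
         d1 = cover_map R (syzygy R M);
         d2 = cover_map R (syzygy R (syzygy R M));
         H = Hom_module R F1 C;
         cocycles = {h \<in> carrier H. compose (carrier F2) h d2 = \<zero>\<^bsub>Hom_module R F2 C\<^esub>};
         coboundaries = (\<lambda>k. compose (carrier F1) k d1) ` carrier (Hom_module R F0 C)
     in quotient_module (H\<lparr>carrier := cocycles\<rparr>) coboundaries)"


section \<open>Localization and contramodules\<close>

text \<open>The fraction \<open>a/s\<close>, as the class of all pairs \<open>(b, t)\<close> equivalent to \<open>(a, s)\<close>.\<close>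

definition fraction :: "('a, 'r) ring_scheme \<Rightarrow> 'a set \<Rightarrow> 'a \<Rightarrow> 'a \<Rightarrow> ('a \<times> 'a) set" where
  "fraction R S a s = {(b, t). b \<in> carrier R \<and> t \<in> S \<and>
     (\<exists>v\<in>S. v \<otimes>\<^bsub>R\<^esub> (t \<otimes>\<^bsub>R\<^esub> a) = v \<otimes>\<^bsub>R\<^esub> (s \<otimes>\<^bsub>R\<^esub> b))}"

definition localization :: "('a, 'r) ring_scheme \<Rightarrow> 'a set \<Rightarrow> ('a, ('a \<times> 'a) set) module" where
  "localization R S =
    \<lparr>carrier = {fraction R S a s | a s. a \<in> carrier R \<and> s \<in> S},
     mult = (\<lambda>X Y. \<Union>(a, s)\<in>X. \<Union>(b, t)\<in>Y. fraction R S (a \<otimes>\<^bsub>R\<^esub> b) (s \<otimes>\<^bsub>R\<^esub> t)),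
     one = fraction R S \<one>\<^bsub>R\<^esub> \<one>\<^bsub>R\<^esub>,
     zero = fraction R S \<zero>\<^bsub>R\<^esub> \<one>\<^bsub>R\<^esub>,
     add = (\<lambda>X Y. \<Union>(a, s)\<in>X. \<Union>(b, t)\<in>Y.
              fraction R S (t \<otimes>\<^bsub>R\<^esub> a \<oplus>\<^bsub>R\<^esub> s \<otimes>\<^bsub>R\<^esub> b) (s \<otimes>\<^bsub>R\<^esub> t)),
     smult = (\<lambda>r X. \<Union>(a, s)\<in>X. fraction R S (r \<otimes>\<^bsub>R\<^esub> a) s)\<rparr>"

definition localization_elem :: "('a, 'r) ring_scheme \<Rightarrow> 'a \<Rightarrow> ('a, ('a \<times> 'a) set) module" where
  "localization_elem R t = localization R (range (\<lambda>n::nat. t [^]\<^bsub>R\<^esub> n))"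

definition localization_prime :: "('a, 'r) ring_scheme \<Rightarrow> 'a set \<Rightarrow> ('a, ('a \<times> 'a) set) module" where
  "localization_prime R P = localization R (carrier R - P)"

definition u_contramodule ::
    "('a, 'r) ring_scheme \<Rightarrow> ('b, 's) ring_scheme \<Rightarrow> ('a \<Rightarrow> 'b) \<Rightarrow> ('a, 'c, 'n) module_scheme \<Rightarrow> bool" where
  "u_contramodule R U u C \<longleftrightarrow> module R C \<and>
     zero_module (Hom_module R (restrict_scalars u U) C) \<and>
     zero_module (Ext1 R (restrict_scalars u U) C)"

definition elem_contramodule ::
    "('a, 'r) ring_scheme \<Rightarrow> 'a \<Rightarrow> ('a, 'c, 'n) module_scheme \<Rightarrow> bool" where
  "elem_contramodule R t C \<longleftrightarrow> module R C \<and>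
     zero_module (Hom_module R (localization_elem R t) C) \<and>
     zero_module (Ext1 R (localization_elem R t) C)"

definition ideal_contramodule ::
    "('a, 'r) ring_scheme \<Rightarrow> 'a set \<Rightarrow> ('a, 'c, 'n) module_scheme \<Rightarrow> bool" where
  "ideal_contramodule R I C \<longleftrightarrow> (\<forall>t\<in>I. elem_contramodule R t C)"

definition contramodule_family ::
    "('a, 'r) ring_scheme \<Rightarrow> 'a set set \<Rightarrow> ('a set \<Rightarrow> ('a, 'c, 'n) module_scheme) \<Rightarrow> bool" where
  "contramodule_family R \<Lambda> D \<longleftrightarrow> (\<forall>m\<in>\<Lambda>. module R (D m) \<and> ideal_contramodule R m (D m))"

end

theory Submission
  imports Defs
begin

text \<open>
  Let \<open>\<Lambda>\<close> be the set of maximal ideals in \<open>\<GG>\<close>. By flatness and the epimorphism property, for \<open>x \<in> U\<close> the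
  ideal of all \<open>r\<close> with \<open>u r \<cdot> x \<in> u R\<close> lies in \<open>\<GG>\<close>. The quotients of \<open>R\<close> by members of \<open>\<GG>\<close> are
  zero-dimensional and semilocal, so \<open>x\<close> can be compared with elements of almost all \<open>R\<^sub>m\<close>, \<open>m \<in> \<Lambda>\<close>. This
  gives a gluing module \<open>B \<subseteq> U \<times> \<Prod> R\<^sub>m\<close> with exact sequences
  \<open>0 \<rightarrow> \<Oplus> R\<^sub>m \<rightarrow> B \<rightarrow> U \<rightarrow> 0\<close> and \<open>0 \<rightarrow> R \<rightarrow> B \<rightarrow> \<Oplus> U\<^sub>m \<rightarrow> 0\<close>. If \<open>C\<close> is a \<open>u\<close>-contramodule,
  then \<open>Hom(-, C)\<close> and \<open>Ext\<^sup>1(-, C)\<close> vanish on all \<open>U\<close>-modules, so \<open>Hom(B, C)\<close> is at the same time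
  \<open>\<Prod> Hom(R\<^sub>m, C)\<close> and \<open>C\<close>.

  Conversely, over a \<open>t\<close>-contramodule \<open>D\<close> the sums \<open>\<Sum> t\<^sup>n x\<^sub>n\<close> make sense. If \<open>1 = \<Sum> u t\<^sub>i \<cdot> y\<^sub>i\<close> in \<open>U\<close> with
  \<open>t\<^sub>i \<in> m\<close>, the operators \<open>t\<^sub>i y\<^sub>i\<close> on \<open>Hom(U, D)\<close> and on \<open>Ext\<^sup>1(U, D)\<close> commute, allow such sums and add up
  to the identity, which makes both modules vanish.

  An element of \<open>\<Prod> D(m)\<close> supported away from \<open>m\<close> is a finite sum of elements that are infinitely
  divisible by some \<open>t \<in> m\<close>, hence is killed by every map to an \<open>m\<close>-contramodule. This gives uniqueness,
  functoriality and the recovery of the factors.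
\<close>

\<comment> \<open>For injective \<open>u\<close> one would decompose \<open>U/R\<close> into its
  localizations; in general \<open>R -> U\<close> is only a two-term complex. The gluing module
  expresses the decomposition of that complex by honest modules: the complex from \<open>R\<close>
  plus the sum of the \<open>R_m\<close> to \<open>B\<close> is quasi-isomorphic both to
  \<open>R -> U\<close> and to the sum of the \<open>R_m -> U_m\<close>, and the two exact sequences
  say so without derived categories. Accordingly, Ext is always handled as an extension or lifting
  problem for linear maps: it vanishes when every map on the first syzygy extends to the free cover,
  or when every extension has a section. For the converse direction no convenient resolution of
  \<open>U\<close> is at hand. The summation operators therefore act directly on the maps out of
  \<open>U\<close> and out of its syzygy. Two constraints come from fixed types. Flatness is known
  only for test modules on one type, so a vanishing tensor is first moved into a finitely generated
  submodule. The factors of \<open>C\<close> have to live on the type of \<open>C\<close>, so a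
  colocalization is represented by its image in \<open>C\<close> under evaluation at 1.\<close>
text \<open>Structures in indexed notation are also written as plain subscripts, as in \<open>x \<oplus>\<^sub>M y\<close>.\<close>

syntax (input) "_index" :: "logic \<Rightarrow> index"  (\<open>\<^sub>_\<close> [1000] 1000)

section \<open>Linear maps\<close>

text \<open>Unlike \<open>module_hom\<close>, this puts no condition on values outside the carrier,
  so composites and pointwise sums are linear without being restricted first.\<close>

definition lin ::
    "('a, 'r) ring_scheme \<Rightarrow> ('a, 'b, 'm) module_scheme \<Rightarrow> ('a, 'c, 'n) module_scheme \<Rightarrow> ('b \<Rightarrow> 'c) \<Rightarrow> bool" where
  "lin R M N h \<longleftrightarrow> (\<forall>x\<in>carrier M. h x \<in> carrier N) \<and>
     (\<forall>x\<in>carrier M. \<forall>y\<in>carrier M. h (x \<oplus>\<^sub>M y) = h x \<oplus>\<^sub>N h y) \<and>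
     (\<forall>r\<in>carrier R. \<forall>x\<in>carrier M. h (r \<odot>\<^sub>M x) = r \<odot>\<^sub>N h x)"

lemma linI:
  assumes "\<And>x. x \<in> carrier M \<Longrightarrow> h x \<in> carrier N"
    and "\<And>x y. x \<in> carrier M \<Longrightarrow> y \<in> carrier M \<Longrightarrow> h (x \<oplus>\<^sub>M y) = h x \<oplus>\<^sub>N h y"
    and "\<And>r x. r \<in> carrier R \<Longrightarrow> x \<in> carrier M \<Longrightarrow> h (r \<odot>\<^sub>M x) = r \<odot>\<^sub>N h x"
  shows "lin R M N h"
  using assms by (auto simp: lin_def)

lemma lin_closed: "lin R M N h \<Longrightarrow> x \<in> carrier M \<Longrightarrow> h x \<in> carrier N"
  and lin_add: "lin R M N h \<Longrightarrow> x \<in> carrier M \<Longrightarrow> y \<in> carrier M \<Longrightarrow> h (x \<oplus>\<^sub>M y) = h x \<oplus>\<^sub>N h y"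
  and lin_smult: "lin R M N h \<Longrightarrow> r \<in> carrier R \<Longrightarrow> x \<in> carrier M \<Longrightarrow> h (r \<odot>\<^sub>M x) = r \<odot>\<^sub>N h x"
  by (auto simp: lin_def)

lemma module_hom_iff: "h \<in> module_hom R M N \<longleftrightarrow> lin R M N h \<and> h \<in> extensional (carrier M)"
  by (auto simp: module_hom_def lin_def PiE_def)

lemma module_hom_lin: "h \<in> module_hom R M N \<Longrightarrow> lin R M N h"
  by (simp add: module_hom_iff)

lemma lin_cong:
  assumes "module R M" and "lin R M N h" and "\<And>x. x \<in> carrier M \<Longrightarrow> h x = g x"
  shows "lin R M N g"
proof -
  interpret module R M by fact
  show ?thesis
    using assms(2,3) by (auto simp: lin_def)
qed

lemma lin_restrict:
  assumes "module R M" and "lin R M N h"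
  shows "restrict h (carrier M) \<in> module_hom R M N"
  using lin_cong[OF assms] by (auto simp: module_hom_iff)

lemma lin_zero:
  assumes "module R M" "module R N" "lin R M N h"
  shows "h \<zero>\<^sub>M = \<zero>\<^sub>N"
proof -
  interpret M: module R M by fact
  interpret N: module R N by fact
  have "h (\<zero>\<^sub>R \<odot>\<^sub>M \<zero>\<^sub>M) = \<zero>\<^sub>R \<odot>\<^sub>N h \<zero>\<^sub>M"
    by (rule lin_smult[OF assms(3)]) auto
  then show ?thesis
    using lin_closed[OF assms(3), of "\<zero>\<^sub>M"] by simp
qed

lemma lin_neg:
  assumes "module R M" "module R N" "lin R M N h" "x \<in> carrier M"
  shows "h (\<ominus>\<^sub>M x) = \<ominus>\<^sub>N h x"
proof -
  interpret M: module R M by fact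
  interpret N: module R N by fact
  have "h ((\<ominus>\<^sub>R \<one>\<^sub>R) \<odot>\<^sub>M x) = (\<ominus>\<^sub>R \<one>\<^sub>R) \<odot>\<^sub>N h x"
    by (rule lin_smult[OF assms(3)]) (use assms in auto)
  then show ?thesis
    using lin_closed[OF assms(3), of x] assms(4) by (simp add: M.smult_l_minus N.smult_l_minus)
qed

lemma lin_minus:
  assumes "module R M" "module R N" "lin R M N h" "x \<in> carrier M" "y \<in> carrier M"
  shows "h (x \<ominus>\<^sub>M y) = h x \<ominus>\<^sub>N h y"
proof -
  interpret M: module R M by fact
  show ?thesis
    using assms(4,5) by (simp add: a_minus_def lin_add[OF assms(3)] lin_neg[OF assms(1-3)])
qed

lemma lin_comp: "lin R M N h \<Longrightarrow> lin R N P g \<Longrightarrow> lin R M P (\<lambda>x. g (h x))"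
  by (auto simp: lin_def)

lemma lin_plus:
  assumes "module R N" "lin R M N h" "lin R M N g"
  shows "lin R M N (\<lambda>x. h x \<oplus>\<^sub>N g x)"
proof -
  interpret N: module R N by fact
  show ?thesis
    by (rule linI) (use assms(2,3) in \<open>simp_all add: lin_closed lin_add lin_smult N.smult_r_distr N.a_ac\<close>)
qed

lemma lin_scale:
  assumes "module R N" "lin R M N h" "r \<in> carrier R"
  shows "lin R M N (\<lambda>x. r \<odot>\<^sub>N h x)"
proof -
  interpret N: module R N by fact
  show ?thesis
    by (rule linI) (use assms(2,3) in \<open>simp_all add: lin_closed lin_add lin_smult N.smult_r_distr N.m_comm flip: N.smult_assoc1\<close>)
qed

lemma lin_diff:
  assumes "module R N" "lin R M N h" "lin R M N g"
  shows "lin R M N (\<lambda>x. h x \<ominus>\<^sub>N g x)"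
proof -
  interpret N: module R N by fact
  show ?thesis
    by (rule linI) (use assms(2,3) in \<open>simp_all add: a_minus_def lin_closed lin_add lin_smult N.smult_r_distr N.smult_r_minus N.minus_add N.a_ac\<close>)
qed

lemma lin_zero_map: "module R N \<Longrightarrow> lin R M N (\<lambda>x. \<zero>\<^sub>N)"
  by (rule linI) (simp_all add: module.smult_r_null abelian_group.axioms(1)[OF module.axioms(2)] abelian_monoid.zero_closed abelian_monoid.l_zero)

text \<open>A linear map is obtained from its graph; single-valuedness only has to be checked at zero.\<close>

lemma lin_of_rel:
  assumes "module R B" "module R C"
    and tot: "\<And>b. b \<in> carrier B \<Longrightarrow> \<exists>v\<in>carrier C. P b v"
    and add: "\<And>b v b' v'. \<lbrakk>b \<in> carrier B; v \<in> carrier C; b' \<in> carrier B; v' \<in> carrier C; P b v; P b' v'\<rbrakk>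
                \<Longrightarrow> P (b \<oplus>\<^sub>B b') (v \<oplus>\<^sub>C v')"
    and smul: "\<And>r b v. \<lbrakk>r \<in> carrier R; b \<in> carrier B; v \<in> carrier C; P b v\<rbrakk> \<Longrightarrow> P (r \<odot>\<^sub>B b) (r \<odot>\<^sub>C v)"
    and zero: "\<And>v. v \<in> carrier C \<Longrightarrow> P \<zero>\<^sub>B v \<Longrightarrow> v = \<zero>\<^sub>C"
  obtains \<kappa> where "lin R B C \<kappa>" "\<And>b v. b \<in> carrier B \<Longrightarrow> v \<in> carrier C \<Longrightarrow> P b v \<Longrightarrow> \<kappa> b = v"
    "\<And>b. b \<in> carrier B \<Longrightarrow> P b (\<kappa> b)"
proof -
  interpret B: module R B by fact
  interpret C: module R C by fact
  have uniq: "v = v'" if "b \<in> carrier B" "v \<in> carrier C" "v' \<in> carrier C" "P b v" "P b v'" for b v v'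
  proof -
    have "P ((\<ominus>\<^sub>R \<one>\<^sub>R) \<odot>\<^sub>B b) ((\<ominus>\<^sub>R \<one>\<^sub>R) \<odot>\<^sub>C v')"
      by (rule smul) (use that in auto)
    then have "P (\<ominus>\<^sub>B b) (\<ominus>\<^sub>C v')"
      using that by (simp add: B.smult_l_minus C.smult_l_minus)
    then have "P (b \<oplus>\<^sub>B \<ominus>\<^sub>B b) (v \<oplus>\<^sub>C \<ominus>\<^sub>C v')"
      using that add by auto
    then have "v \<oplus>\<^sub>C \<ominus>\<^sub>C v' = \<zero>\<^sub>C"
      using zero that by (simp add: B.r_neg)
    then show ?thesis using that
      by (metis C.minus_minus C.a_inv_closed C.minus_equality)
  qed
  define \<kappa> where "\<kappa> b = (SOME v. v \<in> carrier C \<and> P b v)" for b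
  have \<kappa>: "\<kappa> b \<in> carrier C \<and> P b (\<kappa> b)" if "b \<in> carrier B" for b
    unfolding \<kappa>_def by (rule someI_ex) (use tot[OF that] in auto)
  have "lin R B C \<kappa>"
  proof (rule linI)
    show "\<kappa> (x \<oplus>\<^sub>B y) = \<kappa> x \<oplus>\<^sub>C \<kappa> y" if "x \<in> carrier B" "y \<in> carrier B" for x y
      using uniq[of "x \<oplus>\<^sub>B y"] \<kappa> add that by auto
    show "\<kappa> (r \<odot>\<^sub>B x) = r \<odot>\<^sub>C \<kappa> x" if "r \<in> carrier R" "x \<in> carrier B" for r x
      using uniq[of "r \<odot>\<^sub>B x"] \<kappa> smul that by auto
  qed (use \<kappa> in auto)
  then show thesis
    using that[of \<kappa>] \<kappa> uniq by blast
qed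

text \<open>This is the universal property of a surjection. The graph of \<open>h\<close> is the
  image of \<open>W\<close> under the pair of \<open>\<pi>\<close> and \<open>\<delta>\<close>, and
  the condition on the kernel of \<open>\<pi>\<close> is single-valuedness at zero.\<close>

lemma lin_factor:
  assumes W: "module R W" and X: "module R X" and C: "module R C"
    and \<pi>: "lin R W X \<pi>" "\<And>x. x \<in> carrier X \<Longrightarrow> \<exists>w\<in>carrier W. \<pi> w = x"
    and \<delta>: "lin R W C \<delta>" "\<And>w. w \<in> carrier W \<Longrightarrow> \<pi> w = \<zero>\<^sub>X \<Longrightarrow> \<delta> w = \<zero>\<^sub>C"
  obtains h where "lin R X C h" "\<And>w. w \<in> carrier W \<Longrightarrow> h (\<pi> w) = \<delta> w"
proof -
  interpret W: module R W by (rule W)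
  let ?P = "\<lambda>x v. \<exists>w\<in>carrier W. \<pi> w = x \<and> \<delta> w = v"
  obtain h where h: "lin R X C h" "\<And>x v. x \<in> carrier X \<Longrightarrow> v \<in> carrier C \<Longrightarrow> ?P x v \<Longrightarrow> h x = v"
  proof (rule lin_of_rel[OF X C, of ?P])
    fix b v b' v' assume "?P b v" "?P b' v'"
    then obtain w w' where "w \<in> carrier W" "\<pi> w = b" "\<delta> w = v" "w' \<in> carrier W" "\<pi> w' = b'" "\<delta> w' = v'" by blast
    then show "?P (b \<oplus>\<^sub>X b') (v \<oplus>\<^sub>C v')"
      using lin_add[OF \<pi>(1)] lin_add[OF \<delta>(1)] by (intro bexI[of _ "w \<oplus>\<^sub>W w'"]) auto
  next
    fix r b v assume r: "r \<in> carrier R" and "?P b v"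
    then obtain w where "w \<in> carrier W" "\<pi> w = b" "\<delta> w = v" by blast
    then show "?P (r \<odot>\<^sub>X b) (r \<odot>\<^sub>C v)"
      using lin_smult[OF \<pi>(1) r] lin_smult[OF \<delta>(1) r] r by (intro bexI[of _ "r \<odot>\<^sub>W w"]) auto
  next
    fix b assume "b \<in> carrier X"
    then show "\<exists>v\<in>carrier C. ?P b v" using \<pi>(2) lin_closed[OF \<delta>(1)] by blast
  qed (use \<delta>(2) in blast)+
  have "h (\<pi> w) = \<delta> w" if w: "w \<in> carrier W" for w
    by (rule h(2)[OF lin_closed[OF \<pi>(1) w] lin_closed[OF \<delta>(1) w]]) (use w in blast)
  then show thesis using that h(1) by blast
qed

text \<open>This is the universal property of an injection: \<open>\<beta> f = \<phi> x\<close> is a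
  linear relation between \<open>x\<close> and \<open>f\<close>, and injectivity of
  \<open>\<beta>\<close> makes it single-valued at zero.\<close>

lemma lin_lift:
  assumes K: "module R K" and F: "module R F" and B: "module R B" and \<phi>: "lin R K B \<phi>"
    and \<beta>: "lin R F B \<beta>" "\<And>f. f \<in> carrier F \<Longrightarrow> \<beta> f = \<zero>\<^sub>B \<Longrightarrow> f = \<zero>\<^sub>F"
    and im: "\<And>x. x \<in> carrier K \<Longrightarrow> \<exists>f\<in>carrier F. \<beta> f = \<phi> x"
  obtains \<psi> where "lin R K F \<psi>" "\<And>x. x \<in> carrier K \<Longrightarrow> \<beta> (\<psi> x) = \<phi> x"
proof -
  obtain \<psi> where "lin R K F \<psi>" "\<And>x. x \<in> carrier K \<Longrightarrow> \<beta> (\<psi> x) = \<phi> x"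
  proof (rule lin_of_rel[OF K F, of "\<lambda>x f. \<beta> f = \<phi> x"])
    fix f assume "f \<in> carrier F" "\<beta> f = \<phi> \<zero>\<^sub>K"
    then show "f = \<zero>\<^sub>F" using \<beta>(2) lin_zero[OF K B \<phi>] by metis
  qed (use im in \<open>simp_all add: lin_add[OF \<phi>] lin_smult[OF \<phi>] lin_add[OF \<beta>(1)] lin_smult[OF \<beta>(1)]\<close>)
  then show thesis by (rule that)
qed

section \<open>Constructions of modules\<close>

lemma module_submodule:
  assumes "module R M" "H \<subseteq> carrier M" "\<zero>\<^sub>M \<in> H"
    and "\<And>x y. x \<in> H \<Longrightarrow> y \<in> H \<Longrightarrow> x \<oplus>\<^sub>M y \<in> H"
    and sm: "\<And>r x. r \<in> carrier R \<Longrightarrow> x \<in> H \<Longrightarrow> r \<odot>\<^sub>M x \<in> H"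
  shows "submodule H R M" "module R (M\<lparr>carrier := H\<rparr>)"
proof -
  interpret module R M by fact
  have "\<ominus>\<^sub>M x \<in> H" if "x \<in> H" for x
    using sm[of "\<ominus>\<^sub>R \<one>\<^sub>R" x] that assms(2) by (auto simp: smult_l_minus subset_iff)
  then show *: "submodule H R M"
    by (intro submoduleI) (use assms in auto)
  show "module R (M\<lparr>carrier := H\<rparr>)"
    by (rule submodule.submodule_is_module[OF * assms(1)])
qed

text \<open>Restriction of scalars for an arbitrary module, where \<open>restrict_scalars\<close>
  treats the ring as a module over itself.\<close>

definition restrict_module :: "('a \<Rightarrow> 'b) \<Rightarrow> ('b, 'c, 'm) module_scheme \<Rightarrow> ('a, 'c) module" where
  "restrict_module u D =
    \<lparr>carrier = carrier D, mult = undefined, one = undefined, zero = \<zero>\<^sub>D, add = add D,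
     smult = (\<lambda>r x. u r \<odot>\<^sub>D x)\<rparr>"

lemma restrict_module_simps [simp]:
  "carrier (restrict_module u D) = carrier D" "\<zero>\<^bsub>restrict_module u D\<^esub> = \<zero>\<^sub>D"
  "x \<oplus>\<^bsub>restrict_module u D\<^esub> y = x \<oplus>\<^sub>D y" "r \<odot>\<^bsub>restrict_module u D\<^esub> x = u r \<odot>\<^sub>D x"
  by (simp_all add: restrict_module_def)

lemma restrict_scalars_simps [simp]:
  "carrier (restrict_scalars u A) = carrier A" "\<zero>\<^bsub>restrict_scalars u A\<^esub> = \<zero>\<^sub>A"
  "x \<oplus>\<^bsub>restrict_scalars u A\<^esub> y = x \<oplus>\<^sub>A y" "r \<odot>\<^bsub>restrict_scalars u A\<^esub> x = u r \<otimes>\<^sub>A x"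
  by (simp_all add: restrict_scalars_def)

lemma module_restrict_module:
  assumes "cring R" "u \<in> ring_hom R A" "module A D"
  shows "module R (restrict_module u D)"
proof -
  interpret D: module A D by fact
  interpret R: cring R by fact
  have u: "u r \<in> carrier A" if "r \<in> carrier R" for r
    using assms(2) that by (rule ring_hom_closed)
  show ?thesis
  proof (rule moduleI)
    show "abelian_group (restrict_module u D)"
      by (rule abelian_groupI) (auto simp: D.a_ac intro: D.l_neg D.a_inv_closed)
  qed (use assms(2) u in \<open>simp_all add: assms(1) D.smult_l_distr D.smult_r_distr D.smult_assoc1 ring_hom_add ring_hom_mult ring_hom_one\<close>)
qed

lemma module_restrict_scalars:
  assumes "cring R" "u \<in> ring_hom R A" "cring A"
  shows "module R (restrict_scalars u A)"
proof -
  interpret A: cring A by fact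
  interpret R: cring R by fact
  have u: "u r \<in> carrier A" if "r \<in> carrier R" for r
    using assms(2) that by (rule ring_hom_closed)
  show ?thesis
  proof (rule moduleI)
    show "abelian_group (restrict_scalars u A)"
      by (rule abelian_groupI) (auto simp: A.a_ac intro: A.l_neg A.a_inv_closed)
  qed (use assms(2) u in \<open>simp_all add: assms(1) A.l_distr A.r_distr A.m_assoc ring_hom_add ring_hom_mult ring_hom_one\<close>)
qed

abbreviation self_module :: "('a, 'r) ring_scheme \<Rightarrow> ('a, 'a) module" where
  "self_module R \<equiv> restrict_scalars (\<lambda>r. r) R"

lemma module_self: "cring R \<Longrightarrow> module R (self_module R)"
  by (rule module_restrict_scalars) (auto intro: ring_hom_memI)

text \<open>A binary product whose two factors may have different element types, in contrast to
  \<open>product_module\<close>.\<close>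

definition pair_module :: "('a, 'b, 'm) module_scheme \<Rightarrow> ('a, 'c, 'n) module_scheme \<Rightarrow> ('a, 'b \<times> 'c) module" where
  "pair_module M N =
    \<lparr>carrier = carrier M \<times> carrier N, mult = undefined, one = undefined, zero = (\<zero>\<^sub>M, \<zero>\<^sub>N),
     add = (\<lambda>x y. (fst x \<oplus>\<^sub>M fst y, snd x \<oplus>\<^sub>N snd y)),
     smult = (\<lambda>r x. (r \<odot>\<^sub>M fst x, r \<odot>\<^sub>N snd x))\<rparr>"

lemma pair_module_simps [simp]:
  "carrier (pair_module M N) = carrier M \<times> carrier N" "\<zero>\<^bsub>pair_module M N\<^esub> = (\<zero>\<^sub>M, \<zero>\<^sub>N)"
  "x \<oplus>\<^bsub>pair_module M N\<^esub> y = (fst x \<oplus>\<^sub>M fst y, snd x \<oplus>\<^sub>N snd y)"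
  "r \<odot>\<^bsub>pair_module M N\<^esub> x = (r \<odot>\<^sub>M fst x, r \<odot>\<^sub>N snd x)"
  by (simp_all add: pair_module_def)

lemma module_pair:
  assumes "module R M" "module R N"
  shows "module R (pair_module M N)"
proof -
  interpret M: module R M by fact
  interpret N: module R N by fact
  show ?thesis
  proof (rule moduleI)
    show "abelian_group (pair_module M N)"
    proof (rule abelian_groupI)
      fix x assume "x \<in> carrier (pair_module M N)"
      then show "\<exists>y\<in>carrier (pair_module M N). y \<oplus>\<^bsub>pair_module M N\<^esub> x = \<zero>\<^bsub>pair_module M N\<^esub>"
        by (intro bexI[of _ "(\<ominus>\<^sub>M fst x, \<ominus>\<^sub>N snd x)"]) (auto simp: M.l_neg N.l_neg)
    qed (auto simp: M.a_ac N.a_ac)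
  qed (use M.is_cring in \<open>auto simp: M.smult_l_distr N.smult_l_distr M.smult_r_distr N.smult_r_distr M.smult_assoc1 N.smult_assoc1\<close>)
qed

lemma product_module_simps [simp]:
  "carrier (product_module I M) = (\<Pi>\<^sub>E i\<in>I. carrier (M i))" "\<zero>\<^bsub>product_module I M\<^esub> = (\<lambda>i\<in>I. \<zero>\<^bsub>M i\<^esub>)"
  "x \<oplus>\<^bsub>product_module I M\<^esub> y = (\<lambda>i\<in>I. x i \<oplus>\<^bsub>M i\<^esub> y i)"
  "r \<odot>\<^bsub>product_module I M\<^esub> x = (\<lambda>i\<in>I. r \<odot>\<^bsub>M i\<^esub> x i)"
  by (simp_all add: product_module_def)

lemma module_product:
  assumes "cring R" and M: "\<And>i. i \<in> I \<Longrightarrow> module R (M i)"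
  shows "module R (product_module I M)"
proof -
  let ?P = "product_module I M"
  have ag: "abelian_group (M i)" "abelian_monoid (M i)" if "i \<in> I" for i
    using M[OF that] by (auto simp: module_def abelian_group_def)
  have px: "\<forall>i\<in>I. x i \<in> carrier (M i)" if "x \<in> carrier ?P" for x
    using that by auto
  note cl = abelian_monoid.a_closed[OF ag(2)] abelian_monoid.zero_closed[OF ag(2)] module.smult_closed[OF M]
  show ?thesis
  proof (rule moduleI)
    show "abelian_group ?P"
    proof (rule abelian_groupI)
      fix x assume x: "x \<in> carrier ?P"
      have "(\<lambda>i\<in>I. (\<ominus>\<^bsub>M i\<^esub> x i) \<oplus>\<^bsub>M i\<^esub> x i) = (\<lambda>i\<in>I. \<zero>\<^bsub>M i\<^esub>)"
        by (rule restrict_ext) (use px[OF x] ag in \<open>auto intro!: abelian_group.l_neg\<close>)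
      then show "\<exists>y\<in>carrier ?P. y \<oplus>\<^sub>?P x = \<zero>\<^sub>?P"
        by (intro bexI[of _ "\<lambda>i\<in>I. \<ominus>\<^bsub>M i\<^esub> x i"])
          (use px[OF x] ag in \<open>auto intro!: abelian_group.a_inv_closed cong: restrict_cong\<close>)
      show "\<zero>\<^sub>?P \<oplus>\<^sub>?P x = x"
        using x px[OF x] by (auto simp: fun_eq_iff abelian_monoid.l_zero[OF ag(2)] PiE_arb[of x])
      fix y assume y: "y \<in> carrier ?P"
      show "x \<oplus>\<^sub>?P y = y \<oplus>\<^sub>?P x"
        using px[OF x] px[OF y] by (auto simp: fun_eq_iff intro!: abelian_monoid.a_comm[OF ag(2)])
      show "x \<oplus>\<^sub>?P y \<in> carrier ?P"
        using px[OF x] px[OF y] by (auto intro!: cl)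
      fix z assume z: "z \<in> carrier ?P"
      show "x \<oplus>\<^sub>?P y \<oplus>\<^sub>?P z = x \<oplus>\<^sub>?P (y \<oplus>\<^sub>?P z)"
        using px[OF x] px[OF y] px[OF z] by (auto simp: fun_eq_iff intro!: abelian_monoid.a_assoc[OF ag(2)])
    qed (auto intro!: cl)
  next
    fix a x assume a: "a \<in> carrier R" and x: "x \<in> carrier ?P"
    then show "a \<odot>\<^sub>?P x \<in> carrier ?P"
      using px[OF x] by (auto intro!: cl)
    fix y assume y: "y \<in> carrier ?P"
    then show "a \<odot>\<^sub>?P (x \<oplus>\<^sub>?P y) = a \<odot>\<^sub>?P x \<oplus>\<^sub>?P a \<odot>\<^sub>?P y"
      using a px[OF x] px[OF y] by (auto simp: fun_eq_iff module.smult_r_distr[OF M])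
  next
    fix a b x assume ab: "a \<in> carrier R" "b \<in> carrier R" and x: "x \<in> carrier ?P"
    then show "(a \<oplus>\<^sub>R b) \<odot>\<^sub>?P x = a \<odot>\<^sub>?P x \<oplus>\<^sub>?P b \<odot>\<^sub>?P x"
      using px[OF x] by (auto simp: fun_eq_iff module.smult_l_distr[OF M])
    show "(a \<otimes>\<^sub>R b) \<odot>\<^sub>?P x = a \<odot>\<^sub>?P (b \<odot>\<^sub>?P x)"
      using ab px[OF x] by (auto simp: fun_eq_iff module.smult_assoc1[OF M])
  next
    fix x assume x: "x \<in> carrier ?P"
    then show "\<one>\<^sub>R \<odot>\<^sub>?P x = x"
      using px[OF x] by (auto simp: fun_eq_iff module.smult_one[OF M] PiE_arb[of x])
  qed (rule assms(1))
qed

lemma Hom_module_simps [simp]: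
  "carrier (Hom_module R M N) = module_hom R M N" "\<zero>\<^bsub>Hom_module R M N\<^esub> = (\<lambda>x\<in>carrier M. \<zero>\<^sub>N)"
  "f \<oplus>\<^bsub>Hom_module R M N\<^esub> g = (\<lambda>x\<in>carrier M. f x \<oplus>\<^sub>N g x)"
  "r \<odot>\<^bsub>Hom_module R M N\<^esub> f = (\<lambda>x\<in>carrier M. r \<odot>\<^sub>N f x)"
  by (simp_all add: Hom_module_def)

lemma module_Hom:
  assumes "module R M" "module R N"
  shows "module R (Hom_module R M N)"
proof -
  interpret M: module R M by fact
  interpret N: module R N by fact
  note mem = lin_restrict[OF assms(1)] module_hom_lin
  have ext: "f x = undefined" if "f \<in> module_hom R M N" "x \<notin> carrier M" for f x
    using that by (auto simp: module_hom_iff extensional_def)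
  note cl = lin_closed[OF module_hom_lin]
  have hom: "(\<lambda>x\<in>carrier M. f x \<oplus>\<^sub>N g x) \<in> module_hom R M N"
    if "f \<in> module_hom R M N" "g \<in> module_hom R M N" for f g
    using that by (intro lin_restrict lin_plus lin_zero_map assms; auto intro: module_hom_lin)+
  have hom': "(\<lambda>x\<in>carrier M. r \<odot>\<^sub>N f x) \<in> module_hom R M N"
    if "r \<in> carrier R" "f \<in> module_hom R M N" for r f
    using that by (intro lin_restrict lin_scale assms; auto intro: module_hom_lin)+
  have hom0: "(\<lambda>x\<in>carrier M. \<zero>\<^sub>N) \<in> module_hom R M N"
    by (intro lin_restrict lin_zero_map assms)
  show ?thesis
  proof (rule moduleI)
    show "abelian_group (Hom_module R M N)"
    proof (rule abelian_groupI)
      fix f assume f: "f \<in> carrier (Hom_module R M N)"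
      have "lin R M N (\<lambda>x. \<zero>\<^sub>N \<ominus>\<^sub>N f x)"
        using f by (intro lin_diff lin_zero_map assms) (auto intro: module_hom_lin)
      then have "(\<lambda>x\<in>carrier M. \<zero>\<^sub>N \<ominus>\<^sub>N f x) \<in> module_hom R M N" by (rule mem)
      moreover have "(\<lambda>x\<in>carrier M. (\<lambda>x\<in>carrier M. \<zero>\<^sub>N \<ominus>\<^sub>N f x) x \<oplus>\<^sub>N f x) = (\<lambda>x\<in>carrier M. \<zero>\<^sub>N)"
        by (rule restrict_ext) (use f in \<open>auto simp: a_minus_def N.l_neg cl\<close>)
      ultimately show "\<exists>y\<in>carrier (Hom_module R M N). y \<oplus>\<^bsub>Hom_module R M N\<^esub> f = \<zero>\<^bsub>Hom_module R M N\<^esub>"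
        unfolding Hom_module_simps by (intro bexI)
    qed (auto simp: hom hom0 fun_eq_iff cl ext N.a_ac)
  qed (auto simp: M.is_cring hom' fun_eq_iff cl ext N.smult_l_distr N.smult_r_distr N.smult_assoc1)
qed

lemma free_module_simps [simp]:
  "carrier (free_module R S) = {f. range f \<subseteq> carrier R \<and> finite {x. f x \<noteq> \<zero>\<^sub>R} \<and> {x. f x \<noteq> \<zero>\<^sub>R} \<subseteq> S}"
  "\<zero>\<^bsub>free_module R S\<^esub> = (\<lambda>x. \<zero>\<^sub>R)" "f \<oplus>\<^bsub>free_module R S\<^esub> g = (\<lambda>x. f x \<oplus>\<^sub>R g x)"
  "r \<odot>\<^bsub>free_module R S\<^esub> f = (\<lambda>x. r \<otimes>\<^sub>R f x)"
  by (simp_all add: free_module_def)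

lemma module_free:
  assumes "cring R" shows "module R (free_module R S)"
proof -
  interpret R: cring R by fact
  have c: "f x \<in> carrier R" if "range f \<subseteq> carrier R" for f :: "_ \<Rightarrow> _" and x using that by auto
  show ?thesis
  proof (rule moduleI)
    show "abelian_group (free_module R S)"
    proof (rule abelian_groupI)
      fix f g assume fg: "f \<in> carrier (free_module R S)" "g \<in> carrier (free_module R S)"
      have "{x. f x \<oplus>\<^sub>R g x \<noteq> \<zero>\<^sub>R} \<subseteq> {x. f x \<noteq> \<zero>\<^sub>R} \<union> {x. g x \<noteq> \<zero>\<^sub>R}" by auto
      then show "f \<oplus>\<^bsub>free_module R S\<^esub> g \<in> carrier (free_module R S)"
        using fg by (auto intro: finite_subset simp: c)
    next
      fix f assume f: "f \<in> carrier (free_module R S)"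
      have "{x. \<ominus>\<^sub>R f x \<noteq> \<zero>\<^sub>R} \<subseteq> {x. f x \<noteq> \<zero>\<^sub>R}" by auto
      then show "\<exists>y\<in>carrier (free_module R S). y \<oplus>\<^bsub>free_module R S\<^esub> f = \<zero>\<^bsub>free_module R S\<^esub>"
        using f by (intro bexI[of _ "\<lambda>x. \<ominus>\<^sub>R f x"]) (auto intro: finite_subset simp: c R.l_neg)
    qed (auto simp: fun_eq_iff R.a_ac c)
  next
    fix r f assume r: "r \<in> carrier R" and f: "f \<in> carrier (free_module R S)"
    have "{x. r \<otimes>\<^sub>R f x \<noteq> \<zero>\<^sub>R} \<subseteq> {x. f x \<noteq> \<zero>\<^sub>R}" using r by auto
    then show "r \<odot>\<^bsub>free_module R S\<^esub> f \<in> carrier (free_module R S)"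
      using f r by (auto intro: finite_subset simp: c)
  qed (auto simp: assms fun_eq_iff R.l_distr R.r_distr R.m_assoc c)
qed

section \<open>Quotient modules\<close>

lemma quotient_module_simps [simp]:
  "carrier (quotient_module M N) = a_rcosets\<^bsub>M\<^esub> N" "\<zero>\<^bsub>quotient_module M N\<^esub> = N"
  "X \<oplus>\<^bsub>quotient_module M N\<^esub> Y = X <+>\<^sub>M Y"
  "r \<odot>\<^bsub>quotient_module M N\<^esub> X = (\<Union>x\<in>X. N +>\<^sub>M (r \<odot>\<^sub>M x))"
  by (simp_all add: quotient_module_def)

lemma submodule_abelian_subgroup:
  assumes "module R M" "submodule N R M" shows "abelian_subgroup N M"
proof -
  interpret module R M by fact
  show ?thesis
    by (rule abelian_subgroupI3)
      (use assms(2) in \<open>auto simp: submodule_def additive_subgroup_def abelian_group_axioms\<close>)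
qed

lemma
  assumes "module R M" "submodule N R M" "x \<in> carrier M"
  shows coset_in_quotient: "N +>\<^sub>M x \<in> carrier (quotient_module M N)"
    and coset_add: "y \<in> carrier M \<Longrightarrow>
      (N +>\<^sub>M x) \<oplus>\<^bsub>quotient_module M N\<^esub> (N +>\<^sub>M y) = N +>\<^sub>M (x \<oplus>\<^sub>M y)"
    and coset_smult: "r \<in> carrier R \<Longrightarrow>
      r \<odot>\<^bsub>quotient_module M N\<^esub> (N +>\<^sub>M x) = N +>\<^sub>M (r \<odot>\<^sub>M x)"
    and coset_eq_iff: "y \<in> carrier M \<Longrightarrow> N +>\<^sub>M x = N +>\<^sub>M y \<longleftrightarrow> x \<ominus>\<^sub>M y \<in> N"
    and coset_zero_iff: "N +>\<^sub>M x = N \<longleftrightarrow> x \<in> N"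
proof -
  interpret module R M by fact
  interpret N: abelian_subgroup N M by (rule submodule_abelian_subgroup[OF assms(1,2)])
  have sm: "r \<odot>\<^sub>M n \<in> N" if "r \<in> carrier R" "n \<in> N" for r n
    using assms(2) that by (rule submodule.smult_closed)
  show "N +>\<^sub>M x \<in> carrier (quotient_module M N)"
    using assms(3) by (simp add: a_rcosetsI N.a_subset)
  show "(N +>\<^sub>M x) \<oplus>\<^bsub>quotient_module M N\<^esub> (N +>\<^sub>M y) = N +>\<^sub>M (x \<oplus>\<^sub>M y)" if "y \<in> carrier M"
    using assms(3) that by (simp add: N.a_rcos_sum)
  show iff: "N +>\<^sub>M x = N +>\<^sub>M y \<longleftrightarrow> x \<ominus>\<^sub>M y \<in> N" if "y \<in> carrier M" for y
  proof -
    have "N +>\<^sub>M x = N +>\<^sub>M y \<longleftrightarrow> x \<in> N +>\<^sub>M y"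
      using N.a_repr_independence'[of x y] N.a_rcos_self[of x] assms(3) that by auto
    then show ?thesis
      using N.a_rcos_module[OF that assms(3)] by (simp add: a_minus_def)
  qed
  show "N +>\<^sub>M x = N \<longleftrightarrow> x \<in> N"
    using iff[of "\<zero>\<^sub>M"] assms(3) N.a_subset M.minus_equality[of "\<zero>\<^sub>M" "\<zero>\<^sub>M"] by (simp add: a_minus_def)
  show "r \<odot>\<^bsub>quotient_module M N\<^esub> (N +>\<^sub>M x) = N +>\<^sub>M (r \<odot>\<^sub>M x)" if r: "r \<in> carrier R"
  proof -
    have "N +>\<^sub>M (r \<odot>\<^sub>M y) = N +>\<^sub>M (r \<odot>\<^sub>M x)" if "y \<in> N +>\<^sub>M x" for y
    proof -
      obtain n where n: "n \<in> N" "y = n \<oplus>\<^sub>M x"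
        using \<open>y \<in> _\<close> by (auto simp: a_r_coset_def')
      then have "r \<odot>\<^sub>M y = r \<odot>\<^sub>M n \<oplus>\<^sub>M r \<odot>\<^sub>M x"
        using r assms(3) N.a_subset by (auto simp: smult_r_distr)
      then have "r \<odot>\<^sub>M y \<in> N +>\<^sub>M (r \<odot>\<^sub>M x)"
        using sm[OF r n(1)] by (auto simp: a_r_coset_def')
      then show ?thesis
        using N.a_repr_independence' r assms(3) by auto
    qed
    then have "(\<Union>y\<in>N +>\<^sub>M x. N +>\<^sub>M (r \<odot>\<^sub>M y)) = (\<Union>y\<in>N +>\<^sub>M x. N +>\<^sub>M (r \<odot>\<^sub>M x))"
      by (rule SUP_cong[OF refl])
    then show ?thesis using N.a_rcos_self[OF assms(3)] by auto
  qed
qed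

lemma quotient_elem:
  assumes "X \<in> carrier (quotient_module M N)"
  obtains x where "x \<in> carrier M" "X = N +>\<^sub>M x"
  using assms by (auto simp: A_RCOSETS_def RCOSETS_def a_r_coset_def)

lemma module_quotient:
  assumes "module R M" "submodule N R M"
  shows "module R (quotient_module M N)"
proof -
  interpret module R M by fact
  let ?Q = "quotient_module M N"
  define q where "q x = N +>\<^sub>M x" for x
  have s: "q x \<in> carrier ?Q" "q x \<oplus>\<^sub>?Q q y = q (x \<oplus>\<^sub>M y)" "r \<odot>\<^sub>?Q q x = q (r \<odot>\<^sub>M x)"
    if "x \<in> carrier M" "y \<in> carrier M" "r \<in> carrier R" for x y r
    unfolding q_def
    using coset_in_quotient[OF assms that(1)] coset_add[OF assms that(1,2)] coset_smult[OF assms that(1,3)] by blast+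
  have z: "\<zero>\<^sub>?Q = q \<zero>\<^sub>M" 
  proof -
    interpret N: abelian_subgroup N M by (rule submodule_abelian_subgroup[OF assms])
    show ?thesis using coset_zero_iff[OF assms M.zero_closed] N.zero_closed by (simp add: q_def)
  qed
  have q: thesis if "X \<in> carrier ?Q" "\<And>x. x \<in> carrier M \<Longrightarrow> X = q x \<Longrightarrow> thesis" for X thesis
    using quotient_elem[OF that(1)] that(2) by (auto simp: q_def)
  note quotient_module_simps [simp del]
  show ?thesis
  proof (rule moduleI)
    show "abelian_group ?Q"
    proof (rule abelian_groupI)
      show "\<zero>\<^sub>?Q \<in> carrier ?Q" unfolding z by (rule s(1)) auto
      fix X assume X: "X \<in> carrier ?Q"
      then obtain x where x: "x \<in> carrier M" "X = q x" by (rule q)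
      have "q (\<ominus>\<^sub>M x) \<oplus>\<^sub>?Q X = \<zero>\<^sub>?Q"
        using x by (simp add: z s(2)[OF _ _ R.one_closed] M.l_neg)
      then show "\<exists>Y\<in>carrier ?Q. Y \<oplus>\<^sub>?Q X = \<zero>\<^sub>?Q"
        using s(1)[of "\<ominus>\<^sub>M x" x "\<one>\<^sub>R"] x by auto
      show "\<zero>\<^sub>?Q \<oplus>\<^sub>?Q X = X"
        using x by (simp add: z s(2)[OF _ _ R.one_closed])
      fix Y assume Y: "Y \<in> carrier ?Q"
      then obtain y where y: "y \<in> carrier M" "Y = q y" by (rule q)
      show "X \<oplus>\<^sub>?Q Y \<in> carrier ?Q" "X \<oplus>\<^sub>?Q Y = Y \<oplus>\<^sub>?Q X"
        using x y by (simp_all add: s(2)[OF _ _ R.one_closed] s(1)[OF _ _ R.one_closed, of _ "\<zero>\<^sub>M"] M.a_comm)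
      fix Z assume "Z \<in> carrier ?Q"
      then obtain w where w: "w \<in> carrier M" "Z = q w" by (rule q)
      show "X \<oplus>\<^sub>?Q Y \<oplus>\<^sub>?Q Z = X \<oplus>\<^sub>?Q (Y \<oplus>\<^sub>?Q Z)"
        using x y w by (simp add: s(2)[OF _ _ R.one_closed] M.a_assoc)
    qed
  next
    fix a X assume a: "a \<in> carrier R" and X: "X \<in> carrier ?Q"
    from X obtain x where x: "x \<in> carrier M" "X = q x" by (rule q)
    show "a \<odot>\<^sub>?Q X \<in> carrier ?Q"
      using x a s(1)[of "a \<odot>\<^sub>M x" x a] s(3)[of x x a] by simp
    fix Y assume "Y \<in> carrier ?Q"
    then obtain y where y: "y \<in> carrier M" "Y = q y" by (rule q)
    show "a \<odot>\<^sub>?Q (X \<oplus>\<^sub>?Q Y) = a \<odot>\<^sub>?Q X \<oplus>\<^sub>?Q a \<odot>\<^sub>?Q Y"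
      using x y a by (simp add: s(2)[OF _ _ R.one_closed] s(3)[of _ "\<zero>\<^sub>M"] smult_r_distr)
  next
    fix a b X assume ab: "a \<in> carrier R" "b \<in> carrier R" and X: "X \<in> carrier ?Q"
    from X obtain x where x: "x \<in> carrier M" "X = q x" by (rule q)
    show "(a \<oplus>\<^sub>R b) \<odot>\<^sub>?Q X = a \<odot>\<^sub>?Q X \<oplus>\<^sub>?Q b \<odot>\<^sub>?Q X"
      "(a \<otimes>\<^sub>R b) \<odot>\<^sub>?Q X = a \<odot>\<^sub>?Q (b \<odot>\<^sub>?Q X)"
      using x ab by (simp_all add: s(2)[OF _ _ R.one_closed] s(3)[of _ "\<zero>\<^sub>M"] smult_l_distr smult_assoc1)
  next
    fix X assume X: "X \<in> carrier ?Q"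
    then obtain x where x: "x \<in> carrier M" "X = q x" by (rule q)
    then show "\<one>\<^sub>R \<odot>\<^sub>?Q X = X" by (simp add: s(3)[of _ "\<zero>\<^sub>M"])
  qed (rule R.is_cring)
qed

section \<open>Free modules and direct sums\<close>

lemma free_gen_closed:
  assumes "cring R" "x \<in> S"
  shows "free_gen R x \<in> carrier (free_module R S)"
proof -
  interpret cring R by fact
  have "finite {y. free_gen R x y \<noteq> \<zero>\<^sub>R}"
    by (rule finite_subset[of _ "{x}"]) (auto simp: free_gen_def)
  then show ?thesis
    using assms(2) by (auto simp: free_gen_def split: if_splits)
qed

lemma free_induct [consumes 2, case_names zero step]:
  assumes "cring R" "f \<in> carrier (free_module R S)"
    and zero: "P \<zero>\<^bsub>free_module R S\<^esub>"
    and step: "\<And>r x f. r \<in> carrier R \<Longrightarrow> x \<in> S \<Longrightarrow> f \<in> carrier (free_module R S) \<Longrightarrow> P f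
      \<Longrightarrow> P (r \<odot>\<^bsub>free_module R S\<^esub> free_gen R x \<oplus>\<^bsub>free_module R S\<^esub> f)"
  shows "P f"
proof -
  interpret cring R by fact
  have "finite {x. f x \<noteq> \<zero>\<^sub>R}" using assms(2) by simp
  then show ?thesis
    using assms(2)
  proof (induction "{x. f x \<noteq> \<zero>\<^sub>R}" arbitrary: f rule: finite_induct)
    case empty
    then have "f = \<zero>\<^bsub>free_module R S\<^esub>" by (auto simp: fun_eq_iff)
    then show ?case using zero by simp
  next
    case (insert x A)
    let ?g = "f(x := \<zero>\<^sub>R)"
    have A: "A = {y. ?g y \<noteq> \<zero>\<^sub>R}" using insert(2,4) by auto
    then have g: "?g \<in> carrier (free_module R S)"
      using insert.prems insert(1,4) by (auto split: if_splits)
    have x: "f x \<in> carrier R" "x \<in> S" using insert.prems insert(4) by auto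
    have "f = f x \<odot>\<^bsub>free_module R S\<^esub> free_gen R x \<oplus>\<^bsub>free_module R S\<^esub> ?g"
      using insert.prems x by (auto simp: fun_eq_iff free_gen_def image_subset_iff)
    then show ?case
      using step[OF x g insert(3)[OF A g]] by simp
  qed
qed

lemma lin_free_eq:
  assumes "cring R" "lin R (free_module R S) P g" "lin R (free_module R S) P h" "module R P"
    and "\<And>x. x \<in> S \<Longrightarrow> g (free_gen R x) = h (free_gen R x)"
    and "f \<in> carrier (free_module R S)"
  shows "g f = h f"
  using assms(1,6)
proof (induction rule: free_induct)
  case zero
  then show ?case using lin_zero[OF module_free assms(4)] assms(1-3) by metis
next
  case (step r x f)
  interpret F: module R "free_module R S" by (rule module_free) fact
  have x: "free_gen R x \<in> carrier (free_module R S)" using assms(1) step by (simp only: free_gen_closed)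
  show ?case
    using step x F.smult_closed[OF step(1) x] by (simp only: lin_add[OF assms(2)] lin_add[OF assms(3)] lin_smult[OF assms(2)] lin_smult[OF assms(3)] assms(5))
qed

text \<open>The defining sum runs over the exact support, which changes under addition. Terms
  outside the support vanish, so any finite index set containing it may be used, in particular one
  common to two summands.\<close>

lemma free_lift_eq:
  assumes "module R P" "\<And>x. x \<in> S \<Longrightarrow> b x \<in> carrier P" "f \<in> carrier (free_module R S)"
    "finite A" "{x. f x \<noteq> \<zero>\<^sub>R} \<subseteq> A" "A \<subseteq> S"
  shows "free_lift R S P b f = (\<Oplus>\<^sub>P x\<in>A. f x \<odot>\<^sub>P b x)"
proof -
  interpret P: module R P by fact
  have "f x \<in> carrier R" for x using assms(3) by auto
  then show ?thesis
    using assms(2-6) unfolding free_lift_def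
    by (auto intro!: P.add.finprod_mono_neutral_cong_left)
qed

lemma
  assumes "module R P" and b: "\<And>x. x \<in> S \<Longrightarrow> b x \<in> carrier P"
  shows lin_free_lift: "lin R (free_module R S) P (free_lift R S P b)"
    and free_lift_gen: "\<And>x. x \<in> S \<Longrightarrow> free_lift R S P b (free_gen R x) = b x"
proof -
  interpret P: module R P by fact
  interpret F: module R "free_module R S" by (rule module_free) (rule P.is_cring)
  have eq: "free_lift R S P b f = (\<Oplus>\<^sub>P x\<in>A. f x \<odot>\<^sub>P b x)"
    if "f \<in> carrier (free_module R S)" "finite A" "{x. f x \<noteq> \<zero>\<^sub>R} \<subseteq> A" "A \<subseteq> S" for f A
    using free_lift_eq[OF assms(1), of S b f A] b that by simp
  show "lin R (free_module R S) P (free_lift R S P b)"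
  proof (rule linI)
    fix f assume f: "f \<in> carrier (free_module R S)"
    have c: "f x \<in> carrier R" for x using f by auto
    show "free_lift R S P b f \<in> carrier P"
      using f b c by (subst eq[OF f]) (auto intro!: P.finsum_closed)
    fix g assume g: "g \<in> carrier (free_module R S)"
    have d: "g x \<in> carrier R" for x using g by auto
    let ?A = "{x. f x \<noteq> \<zero>\<^sub>R} \<union> {x. g x \<noteq> \<zero>\<^sub>R}"
    have A: "finite ?A" "?A \<subseteq> S" using f g by auto
    have bA: "b x \<in> carrier P" if "x \<in> ?A" for x using b that A(2) by blast
    have "free_lift R S P b (f \<oplus>\<^bsub>free_module R S\<^esub> g) = (\<Oplus>\<^sub>P x\<in>?A. (f x \<oplus>\<^sub>R g x) \<odot>\<^sub>P b x)"
      using A by (subst eq[OF F.a_closed[OF f g], of ?A]) auto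
    also have "\<dots> = (\<Oplus>\<^sub>P x\<in>?A. f x \<odot>\<^sub>P b x \<oplus>\<^sub>P g x \<odot>\<^sub>P b x)"
      using bA c d by (intro P.finsum_cong') (auto simp: P.smult_l_distr)
    also have "\<dots> = (\<Oplus>\<^sub>P x\<in>?A. f x \<odot>\<^sub>P b x) \<oplus>\<^sub>P (\<Oplus>\<^sub>P x\<in>?A. g x \<odot>\<^sub>P b x)"
      using bA c d by (intro P.finsum_addf) auto
    finally show "free_lift R S P b (f \<oplus>\<^bsub>free_module R S\<^esub> g) = free_lift R S P b f \<oplus>\<^sub>P free_lift R S P b g"
      using A by (simp add: eq[OF f, of ?A] eq[OF g, of ?A])
  next
    fix r f assume r: "r \<in> carrier R" and f: "f \<in> carrier (free_module R S)"
    have c: "f x \<in> carrier R" for x using f by auto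
    let ?A = "{x. f x \<noteq> \<zero>\<^sub>R}"
    have A: "finite ?A" "?A \<subseteq> S" using f by auto
    have bA: "b x \<in> carrier P" if "x \<in> ?A" for x using b that A(2) by blast
    have "free_lift R S P b (r \<odot>\<^bsub>free_module R S\<^esub> f) = (\<Oplus>\<^sub>P x\<in>?A. (r \<otimes>\<^sub>R f x) \<odot>\<^sub>P b x)"
      using A r by (subst eq[OF F.smult_closed[OF r f], of ?A]) auto
    also have "\<dots> = (\<Oplus>\<^sub>P x\<in>?A. r \<odot>\<^sub>P (f x \<odot>\<^sub>P b x))"
      using bA c r by (intro P.finsum_cong') (auto simp: P.smult_assoc1)
    also have "\<dots> = r \<odot>\<^sub>P (\<Oplus>\<^sub>P x\<in>?A. f x \<odot>\<^sub>P b x)"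
      using bA c r A by (intro P.finsum_smult_ldistr[symmetric]) auto
    finally show "free_lift R S P b (r \<odot>\<^bsub>free_module R S\<^esub> f) = r \<odot>\<^sub>P free_lift R S P b f"
      using A by (simp add: eq[OF f, of ?A])
  qed
  show "free_lift R S P b (free_gen R x) = b x" if "x \<in> S" for x
  proof -
    have "free_lift R S P b (free_gen R x) = (\<Oplus>\<^sub>P y\<in>{x}. free_gen R x y \<odot>\<^sub>P b y)"
      by (rule eq) (use that free_gen_closed[OF P.is_cring that] in \<open>auto simp: free_gen_def\<close>)
    also have "\<dots> = b x"
      using b[OF that] by (simp add: free_gen_def P.finsum_insert)
    finally show ?thesis .
  qed
qed

section \<open>Direct sums\<close>

definition dsum_module :: "'i set \<Rightarrow> ('i \<Rightarrow> ('a, 'b, 'm) module_scheme) \<Rightarrow> ('a, 'i \<Rightarrow> 'b) module" where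
  "dsum_module I M = (product_module I M)\<lparr>carrier := {x \<in> \<Pi>\<^sub>E i\<in>I. carrier (M i). finite {i \<in> I. x i \<noteq> \<zero>\<^bsub>M i\<^esub>}}\<rparr>"

definition dsum_inj :: "'i set \<Rightarrow> ('i \<Rightarrow> ('a, 'b, 'm) module_scheme) \<Rightarrow> 'i \<Rightarrow> 'b \<Rightarrow> 'i \<Rightarrow> 'b" where
  "dsum_inj I M i x = (\<lambda>j\<in>I. if j = i then x else \<zero>\<^bsub>M j\<^esub>)"

definition dsum_lift :: "'i set \<Rightarrow> ('i \<Rightarrow> ('a, 'b, 'm) module_scheme) \<Rightarrow> ('a, 'c, 'n) module_scheme \<Rightarrow>
    ('i \<Rightarrow> 'b \<Rightarrow> 'c) \<Rightarrow> ('i \<Rightarrow> 'b) \<Rightarrow> 'c" where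
  "dsum_lift I M C h x = (\<Oplus>\<^sub>C i\<in>{i \<in> I. x i \<noteq> \<zero>\<^bsub>M i\<^esub>}. h i (x i))"

lemma dsum_module_simps [simp]:
  "carrier (dsum_module I M) = {x \<in> \<Pi>\<^sub>E i\<in>I. carrier (M i). finite {i \<in> I. x i \<noteq> \<zero>\<^bsub>M i\<^esub>}}"
  "\<zero>\<^bsub>dsum_module I M\<^esub> = (\<lambda>i\<in>I. \<zero>\<^bsub>M i\<^esub>)"
  "x \<oplus>\<^bsub>dsum_module I M\<^esub> y = (\<lambda>i\<in>I. x i \<oplus>\<^bsub>M i\<^esub> y i)"
  "r \<odot>\<^bsub>dsum_module I M\<^esub> x = (\<lambda>i\<in>I. r \<odot>\<^bsub>M i\<^esub> x i)"
  by (simp_all add: dsum_module_def)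

lemma module_zero_closed: "module R M \<Longrightarrow> \<zero>\<^sub>M \<in> carrier M"
  and module_add_closed: "module R M \<Longrightarrow> x \<in> carrier M \<Longrightarrow> y \<in> carrier M \<Longrightarrow> x \<oplus>\<^sub>M y \<in> carrier M"
  and module_minus_closed: "module R M \<Longrightarrow> x \<in> carrier M \<Longrightarrow> y \<in> carrier M \<Longrightarrow> x \<ominus>\<^sub>M y \<in> carrier M"
  and module_l_zero: "module R M \<Longrightarrow> x \<in> carrier M \<Longrightarrow> \<zero>\<^sub>M \<oplus>\<^sub>M x = x"
  and module_r_zero: "module R M \<Longrightarrow> x \<in> carrier M \<Longrightarrow> x \<oplus>\<^sub>M \<zero>\<^sub>M = x"
  and module_minus_self: "module R M \<Longrightarrow> x \<in> carrier M \<Longrightarrow> x \<ominus>\<^sub>M x = \<zero>\<^sub>M"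
  and module_diff_eq_zero: "module R M \<Longrightarrow> x \<in> carrier M \<Longrightarrow> y \<in> carrier M \<Longrightarrow> x \<ominus>\<^sub>M y = \<zero>\<^sub>M \<longleftrightarrow> x = y"
  and module_diff_add: "module R M \<Longrightarrow> x \<in> carrier M \<Longrightarrow> y \<in> carrier M \<Longrightarrow> (x \<ominus>\<^sub>M y) \<oplus>\<^sub>M y = x"
  and module_add_diff: "module R M \<Longrightarrow> x \<in> carrier M \<Longrightarrow> y \<in> carrier M \<Longrightarrow> y \<oplus>\<^sub>M (x \<ominus>\<^sub>M y) = x"
proof -
  assume "module R M"
  then interpret module R M .
  show "\<zero>\<^sub>M \<in> carrier M" by simp
  show "x \<oplus>\<^sub>M y \<in> carrier M" if "x \<in> carrier M" "y \<in> carrier M" using that by simp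
  show "x \<ominus>\<^sub>M y \<in> carrier M" if "x \<in> carrier M" "y \<in> carrier M" using that by simp
  show "\<zero>\<^sub>M \<oplus>\<^sub>M x = x" if "x \<in> carrier M" using that by simp
  show "x \<oplus>\<^sub>M \<zero>\<^sub>M = x" if "x \<in> carrier M" using that by simp
  show "x \<ominus>\<^sub>M x = \<zero>\<^sub>M" if "x \<in> carrier M" using that by (simp add: a_minus_def M.r_neg)
  show "x \<ominus>\<^sub>M y = \<zero>\<^sub>M \<longleftrightarrow> x = y" if "x \<in> carrier M" "y \<in> carrier M"
    using that by (metis M.minus_minus M.a_inv_closed M.minus_equality M.r_neg a_minus_def)
  show "(x \<ominus>\<^sub>M y) \<oplus>\<^sub>M y = x" if "x \<in> carrier M" "y \<in> carrier M"
    using that by (simp add: a_minus_def M.a_assoc M.l_neg)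
  then show "y \<oplus>\<^sub>M (x \<ominus>\<^sub>M y) = x" if "x \<in> carrier M" "y \<in> carrier M"
    using that by (simp add: M.a_comm)
qed

lemma module_dsum:
  assumes "cring R" "\<And>i. i \<in> I \<Longrightarrow> module R (M i)"
  shows "module R (dsum_module I M)"
  unfolding dsum_module_def
proof (rule module_submodule(2))
  note cl = module_zero_closed[OF assms(2)] module_add_closed[OF assms(2)] module.smult_closed[OF assms(2)]
  have px: "x i \<in> carrier (M i)" if "x \<in> (\<Pi>\<^sub>E i\<in>I. carrier (M i))" "i \<in> I" for x i
    using that by auto
  show "module R (product_module I M)" by (rule module_product) fact+
  let ?H = "{x \<in> \<Pi>\<^sub>E i\<in>I. carrier (M i). finite {i \<in> I. x i \<noteq> \<zero>\<^bsub>M i\<^esub>}}"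
  show "?H \<subseteq> carrier (product_module I M)" "\<zero>\<^bsub>product_module I M\<^esub> \<in> ?H"
    by (auto simp: cl)
  fix x assume x: "x \<in> ?H"
  {
    fix y assume y: "y \<in> ?H"
    have "{i \<in> I. x i \<oplus>\<^bsub>M i\<^esub> y i \<noteq> \<zero>\<^bsub>M i\<^esub>} \<subseteq> {i \<in> I. x i \<noteq> \<zero>\<^bsub>M i\<^esub>} \<union> {i \<in> I. y i \<noteq> \<zero>\<^bsub>M i\<^esub>}"
      using module_l_zero[OF assms(2)] cl by auto
    then have "finite {i \<in> I. x i \<oplus>\<^bsub>M i\<^esub> y i \<noteq> \<zero>\<^bsub>M i\<^esub>}"
      by (rule finite_subset) (use x y in auto)
    then show "x \<oplus>\<^bsub>product_module I M\<^esub> y \<in> ?H"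
      using x y by (auto simp: cl px cong: conj_cong)
  next
    fix r assume r: "r \<in> carrier R"
    have "{i \<in> I. r \<odot>\<^bsub>M i\<^esub> x i \<noteq> \<zero>\<^bsub>M i\<^esub>} \<subseteq> {i \<in> I. x i \<noteq> \<zero>\<^bsub>M i\<^esub>}"
      using module.smult_r_null[OF assms(2) r] by auto
    then have "finite {i \<in> I. r \<odot>\<^bsub>M i\<^esub> x i \<noteq> \<zero>\<^bsub>M i\<^esub>}"
      by (rule finite_subset) (use x in auto)
    then show "r \<odot>\<^bsub>product_module I M\<^esub> x \<in> ?H"
      using x r by (auto simp: cl px cong: conj_cong)
  }
qed

lemma dsum_inj_supp: "{j \<in> I. dsum_inj I M i x j \<noteq> \<zero>\<^bsub>M j\<^esub>} \<subseteq> {i}"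
  by (auto simp: dsum_inj_def)

lemma lin_dsum_inj:
  assumes "\<And>i. i \<in> I \<Longrightarrow> module R (M i)" "i \<in> I"
  shows "lin R (M i) (dsum_module I M) (dsum_inj I M i)"
proof (rule linI)
  note z = module_zero_closed[OF assms(1)] module_l_zero[OF assms(1)] module.smult_r_null[OF assms(1)]
  show "dsum_inj I M i x \<in> carrier (dsum_module I M)" if "x \<in> carrier (M i)" for x
    using finite_subset[OF dsum_inj_supp[of I M i x]] that z by (auto simp: dsum_inj_def)
qed (use assms(2) module_zero_closed[OF assms(1)] module_l_zero[OF assms(1)] module.smult_r_null[OF assms(1)]
    in \<open>auto simp: dsum_inj_def fun_eq_iff\<close>)

lemma dsum_induct:
  assumes M: "\<And>i. i \<in> I \<Longrightarrow> module R (M i)" and "x \<in> carrier (dsum_module I M)"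
    and zero: "P \<zero>\<^bsub>dsum_module I M\<^esub>"
    and step: "\<And>i x y. i \<in> I \<Longrightarrow> x \<in> carrier (M i) \<Longrightarrow> y \<in> carrier (dsum_module I M) \<Longrightarrow> P y
      \<Longrightarrow> P (dsum_inj I M i x \<oplus>\<^bsub>dsum_module I M\<^esub> y)"
  shows "P x"
proof -
  have "finite {i \<in> I. x i \<noteq> \<zero>\<^bsub>M i\<^esub>}" using assms(2) by simp
  then show ?thesis
    using assms(2)
  proof (induction "{i \<in> I. x i \<noteq> \<zero>\<^bsub>M i\<^esub>}" arbitrary: x rule: finite_induct)
    case empty
    then have "x = \<zero>\<^bsub>dsum_module I M\<^esub>" by (auto simp: fun_eq_iff PiE_def extensional_def)
    then show ?case using zero by (simp only:)
  next
    case (insert i A)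
    let ?g = "x(i := \<zero>\<^bsub>M i\<^esub>)"
    have i: "i \<in> I" using insert(4) by auto
    have A: "A = {j \<in> I. ?g j \<noteq> \<zero>\<^bsub>M j\<^esub>}" using insert(2,4) by auto
    then have g: "?g \<in> carrier (dsum_module I M)"
      using insert.prems insert(1,4) i module_zero_closed[OF M] by (auto split: if_splits simp: PiE_def extensional_def Pi_def)
    have x: "x i \<in> carrier (M i)" using insert.prems i by auto
    have "x = dsum_inj I M i (x i) \<oplus>\<^bsub>dsum_module I M\<^esub> ?g"
      using insert.prems module_l_zero[OF M] module_r_zero[OF M]
      by (auto simp: fun_eq_iff dsum_inj_def PiE_def extensional_def Pi_def)
    then show ?case
      using step[OF i x g insert(3)[OF A g]] by simp
  qed
qed

lemma lin_dsum_eq: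
  assumes "cring R" and M: "\<And>i. i \<in> I \<Longrightarrow> module R (M i)" and C: "module R C"
    and g: "lin R (dsum_module I M) C g" and h: "lin R (dsum_module I M) C h"
    and eq: "\<And>i x. i \<in> I \<Longrightarrow> x \<in> carrier (M i) \<Longrightarrow> g (dsum_inj I M i x) = h (dsum_inj I M i x)"
    and x: "x \<in> carrier (dsum_module I M)"
  shows "g x = h x"
proof (rule dsum_induct[where P = "\<lambda>x. g x = h x", OF M x])
  have D: "module R (dsum_module I M)" by (rule module_dsum) fact+
  show "g \<zero>\<^bsub>dsum_module I M\<^esub> = h \<zero>\<^bsub>dsum_module I M\<^esub>"
    by (simp only: lin_zero[OF D C g] lin_zero[OF D C h])
next
  fix i x y assume step: "i \<in> I" "x \<in> carrier (M i)" "y \<in> carrier (dsum_module I M)" "g y = h y"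
  have "dsum_inj I M i x \<in> carrier (dsum_module I M)"
    by (rule lin_closed[OF lin_dsum_inj[of I R M i, OF M step(1)] step(2)])
  then show "g (dsum_inj I M i x \<oplus>\<^bsub>dsum_module I M\<^esub> y) = h (dsum_inj I M i x \<oplus>\<^bsub>dsum_module I M\<^esub> y)"
    using step by (simp only: lin_add[OF g] lin_add[OF h] eq)
qed

lemma
  assumes "cring R" and M: "\<And>i. i \<in> I \<Longrightarrow> module R (M i)" and C: "module R C"
    and h: "\<And>i. i \<in> I \<Longrightarrow> lin R (M i) C (h i)"
  shows lin_dsum_lift: "lin R (dsum_module I M) C (dsum_lift I M C h)"
    and dsum_lift_inj: "\<And>i x. i \<in> I \<Longrightarrow> x \<in> carrier (M i) \<Longrightarrow> dsum_lift I M C h (dsum_inj I M i x) = h i x"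
proof -
  interpret C: module R C by fact
  have px: "x i \<in> carrier (M i)" if "x \<in> carrier (dsum_module I M)" "i \<in> I" for x i
    using that by auto
  have hc: "h i (x i) \<in> carrier C" if "x \<in> carrier (dsum_module I M)" "i \<in> I" for x i
    using lin_closed[OF h] that px by auto
  have hz: "h i \<zero>\<^bsub>M i\<^esub> = \<zero>\<^sub>C" if "i \<in> I" for i
    using lin_zero[OF M C h] that by auto
  have eq: "dsum_lift I M C h x = (\<Oplus>\<^sub>C i\<in>A. h i (x i))"
    if "x \<in> carrier (dsum_module I M)" "finite A" "A \<subseteq> I" "{i \<in> I. x i \<noteq> \<zero>\<^bsub>M i\<^esub>} \<subseteq> A" for x A
    unfolding dsum_lift_def
  proof (rule C.add.finprod_mono_neutral_cong_left)
    fix i assume "i \<in> A - {i \<in> I. x i \<noteq> \<zero>\<^bsub>M i\<^esub>}"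
    then show "h i (x i) = \<zero>\<^sub>C" using hz[of i] that by auto
  next
    show "(\<lambda>i. h i (x i)) \<in> A \<rightarrow> carrier C" using that hc by auto
  qed (use that in auto)
  interpret D: module R "dsum_module I M" by (rule module_dsum) fact+
  show "lin R (dsum_module I M) C (dsum_lift I M C h)"
  proof (rule linI)
    fix x assume x: "x \<in> carrier (dsum_module I M)"
    let ?S = "\<lambda>x. {i \<in> I. x i \<noteq> \<zero>\<^bsub>M i\<^esub>}"
    show "dsum_lift I M C h x \<in> carrier C"
      unfolding dsum_lift_def using hc[OF x] by (auto intro!: C.finsum_closed)
    fix y assume y: "y \<in> carrier (dsum_module I M)"
    let ?A = "?S x \<union> ?S y"
    have A: "finite ?A" "?A \<subseteq> I" using x y by auto
    have "dsum_lift I M C h (x \<oplus>\<^bsub>dsum_module I M\<^esub> y) = (\<Oplus>\<^sub>C i\<in>?A. h i ((x \<oplus>\<^bsub>dsum_module I M\<^esub> y) i))"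
    proof (rule eq[OF D.a_closed[OF x y] A])
      have "(x \<oplus>\<^bsub>dsum_module I M\<^esub> y) i = \<zero>\<^bsub>M i\<^esub>" if "i \<in> I" "x i = \<zero>\<^bsub>M i\<^esub>" "y i = \<zero>\<^bsub>M i\<^esub>" for i
        using that module_l_zero[OF M[OF that(1)] module_zero_closed[OF M[OF that(1)]]] by simp
      then show "?S (x \<oplus>\<^bsub>dsum_module I M\<^esub> y) \<subseteq> ?A" by blast
    qed
    also have "\<dots> = (\<Oplus>\<^sub>C i\<in>?A. h i (x i) \<oplus>\<^sub>C h i (y i))"
      using px[OF x] px[OF y] hc[OF x] hc[OF y] by (intro C.finsum_cong') (auto simp: lin_add[OF h])
    also have "\<dots> = (\<Oplus>\<^sub>C i\<in>?A. h i (x i)) \<oplus>\<^sub>C (\<Oplus>\<^sub>C i\<in>?A. h i (y i))"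
      using hc[OF x] hc[OF y] by (intro C.finsum_addf) auto
    also have "\<dots> = dsum_lift I M C h x \<oplus>\<^sub>C dsum_lift I M C h y"
      by (simp only: eq[OF x A Un_upper1] eq[OF y A Un_upper2])
    finally show "dsum_lift I M C h (x \<oplus>\<^bsub>dsum_module I M\<^esub> y) = dsum_lift I M C h x \<oplus>\<^sub>C dsum_lift I M C h y" .
  next
    fix r x assume r: "r \<in> carrier R" and x: "x \<in> carrier (dsum_module I M)"
    let ?A = "{i \<in> I. x i \<noteq> \<zero>\<^bsub>M i\<^esub>}"
    have A: "finite ?A" using x by auto
    have "dsum_lift I M C h (r \<odot>\<^bsub>dsum_module I M\<^esub> x) = (\<Oplus>\<^sub>C i\<in>?A. h i ((r \<odot>\<^bsub>dsum_module I M\<^esub> x) i))"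
    proof (rule eq[OF D.smult_closed[OF r x] A])
      have "(r \<odot>\<^bsub>dsum_module I M\<^esub> x) i = \<zero>\<^bsub>M i\<^esub>" if "i \<in> I" "x i = \<zero>\<^bsub>M i\<^esub>" for i
        using that module.smult_r_null[OF M[OF that(1)] r] by simp
      then show "{i \<in> I. (r \<odot>\<^bsub>dsum_module I M\<^esub> x) i \<noteq> \<zero>\<^bsub>M i\<^esub>} \<subseteq> ?A" by blast
    qed simp
    also have "\<dots> = (\<Oplus>\<^sub>C i\<in>?A. r \<odot>\<^sub>C h i (x i))"
      using px[OF x] r hc[OF x] by (intro C.finsum_cong') (auto simp: lin_smult[OF h])
    also have "\<dots> = r \<odot>\<^sub>C dsum_lift I M C h x"
      unfolding dsum_lift_def using hc[OF x] r A by (intro C.finsum_smult_ldistr[symmetric]) auto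
    finally show "dsum_lift I M C h (r \<odot>\<^bsub>dsum_module I M\<^esub> x) = r \<odot>\<^sub>C dsum_lift I M C h x" .
  qed
  show "dsum_lift I M C h (dsum_inj I M i x) = h i x" if "i \<in> I" "x \<in> carrier (M i)" for i x
  proof -
    have "dsum_lift I M C h (dsum_inj I M i x) = (\<Oplus>\<^sub>C j\<in>{i}. h j (dsum_inj I M i x j))"
      by (rule eq[OF lin_closed[OF lin_dsum_inj[of I R M i, OF M that(1)] that(2)] _ _ dsum_inj_supp]) (use that in simp_all)
    then show ?thesis
      using that lin_closed[OF h[OF that(1)] that(2)] by (simp add: dsum_inj_def C.finsum_insert)
  qed
qed

lemma module_diff_zero: "module R M \<Longrightarrow> x \<in> carrier M \<Longrightarrow> x \<ominus>\<^sub>M \<zero>\<^sub>M = x"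
  using module_diff_add[of R M x "\<zero>\<^sub>M"] module_r_zero[of R M "x \<ominus>\<^sub>M \<zero>\<^sub>M"]
  by (simp add: module_zero_closed module_minus_closed)

lemma lin_quotient:
  assumes M: "module R M" and N: "submodule N R M"
  shows "lin R M (quotient_module M N) (\<lambda>x. N +>\<^bsub>M\<^esub> x)" "X \<in> carrier (quotient_module M N) \<Longrightarrow> \<exists>x\<in>carrier M. N +>\<^bsub>M\<^esub> x = X"
  by (rule linI) (simp_all only: coset_in_quotient[OF assms] coset_add[OF assms] coset_smult[OF assms], use quotient_elem in blast)

lemma lin_image_submodule:
  assumes M: "module R M" and N: "module R N" and f: "lin R M N f"
  shows "submodule (f ` carrier M) R N"
proof (rule module_submodule(1)[OF N])
  show "f ` carrier M \<subseteq> carrier N" using lin_closed[OF f] by auto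
  show "\<zero>\<^sub>N \<in> f ` carrier M" using lin_zero[OF M N f] module_zero_closed[OF M] by (metis imageI)
  show "x \<oplus>\<^sub>N y \<in> f ` carrier M" if "x \<in> f ` carrier M" "y \<in> f ` carrier M" for x y
    using that module_add_closed[OF M] by (auto simp: lin_add[OF f, symmetric])
  show "r \<odot>\<^sub>N x \<in> f ` carrier M" if "r \<in> carrier R" "x \<in> f ` carrier M" for r x
    using that module.smult_closed[OF M] by (auto simp: lin_smult[OF f, symmetric])
qed

lemma lin_multiples:
  assumes "module R C" "c \<in> carrier C" shows "lin R (self_module R) C (\<lambda>r. r \<odot>\<^sub>C c)"
proof -
  interpret C: module R C by fact
  show ?thesis by (rule linI) (use assms(2) in \<open>simp_all add: C.smult_l_distr C.smult_assoc1\<close>)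
qed

section \<open>Vanishing of Ext\<close>

lemma module_sub_kernel:
  assumes "module R M" "module R N" "lin R M N h"
  shows "module R (M\<lparr>carrier := {x \<in> carrier M. h x = \<zero>\<^sub>N}\<rparr>)"
proof -
  interpret M: module R M by fact
  interpret N: module R N by fact
  show ?thesis
    by (rule module_submodule(2)) (use assms lin_zero[OF assms] in \<open>auto simp: lin_add lin_smult\<close>)
qed

lemma syzygy_simps [simp]:
  "carrier (syzygy R M) = {f \<in> carrier (free_cover R M). cover_map R M f = \<zero>\<^sub>M}"
  "\<zero>\<^bsub>syzygy R M\<^esub> = \<zero>\<^bsub>free_cover R M\<^esub>" "f \<oplus>\<^bsub>syzygy R M\<^esub> g = f \<oplus>\<^bsub>free_cover R M\<^esub> g"
  "r \<odot>\<^bsub>syzygy R M\<^esub> f = r \<odot>\<^bsub>free_cover R M\<^esub> f"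
  by (simp_all add: syzygy_def)

lemma
  assumes "module R M"
  shows module_free_cover: "module R (free_cover R M)"
    and lin_cover_map: "lin R (free_cover R M) M (cover_map R M)"
    and free_gen_cover: "\<And>x. x \<in> carrier M \<Longrightarrow> free_gen R x \<in> carrier (free_cover R M)"
    and cover_map_gen: "\<And>x. x \<in> carrier M \<Longrightarrow> cover_map R M (free_gen R x) = x"
    and module_syzygy: "module R (syzygy R M)"
proof -
  interpret M: module R M by fact
  show *: "module R (free_cover R M)"
    unfolding free_cover_def by (rule module_free[OF M.is_cring])
  show **: "lin R (free_cover R M) M (cover_map R M)"
    unfolding free_cover_def cover_map_def by (rule lin_free_lift[OF assms])
  show "free_gen R x \<in> carrier (free_cover R M)" if "x \<in> carrier M" for x
    unfolding free_cover_def using M.is_cring that by (rule free_gen_closed)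
  show "cover_map R M (free_gen R x) = x" if "x \<in> carrier M" for x
    unfolding cover_map_def by (rule free_lift_gen[OF assms]) (use that in auto)
  show "module R (syzygy R M)"
    unfolding syzygy_def using module_sub_kernel[OF * assms **] .
qed

lemma zero_quotient_iff:
  assumes "module R M" "submodule N R M"
  shows "zero_module (quotient_module M N) \<longleftrightarrow> carrier M \<subseteq> N"
proof -
  interpret Q: module R "quotient_module M N" by (rule module_quotient) fact+
  show ?thesis
  proof
    assume z: "zero_module (quotient_module M N)"
    show "carrier M \<subseteq> N"
    proof
      fix x assume x: "x \<in> carrier M"
      then have "N +>\<^sub>M x \<in> {N}"
        using coset_in_quotient[OF assms x] z by (simp add: zero_module_def)
      then show "x \<in> N" using coset_zero_iff[OF assms x] by simp
    qed
  next
    assume "carrier M \<subseteq> N"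
    then have "X = N" if "X \<in> carrier (quotient_module M N)" for X
      using coset_zero_iff[OF assms] quotient_elem[OF that] by (metis subsetD)
    then show "zero_module (quotient_module M N)"
      using Q.zero_closed by (auto simp: zero_module_def simp del: quotient_module_simps(1))
  qed
qed

text \<open>\<open>d2\<close> is onto the second syzygy, so a cocycle is a map on \<open>F1\<close>
  that vanishes on the kernel of \<open>d1\<close>. As \<open>d1\<close> is onto the first syzygy,
  this is the same as a map on the first syzygy composed with \<open>d1\<close>; it is a coboundary
  exactly when that map extends to the free cover.\<close>

lemma zero_Ext1_iff:
  assumes M: "module R M" and C: "module R C"
  shows "zero_module (Ext1 R M C) \<longleftrightarrow>
    (\<forall>h. lin R (syzygy R M) C h \<longrightarrow> (\<exists>k. lin R (free_cover R M) C k \<and> (\<forall>f\<in>carrier (syzygy R M). k f = h f)))"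
proof -
  define K where "K = syzygy R M"
  define F0 where "F0 = free_cover R M"
  define F1 where "F1 = free_cover R K"
  define K2 where "K2 = syzygy R K"
  define F2 where "F2 = free_cover R K2"
  define d1 where "d1 = cover_map R K"
  define d2 where "d2 = cover_map R K2"
  define H where "H = Hom_module R F1 C"
  define Z where "Z = {h \<in> carrier H. compose (carrier F2) h d2 = \<zero>\<^bsub>Hom_module R F2 C\<^esub>}"
  define Bd where "Bd = (\<lambda>k. compose (carrier F1) k d1) ` carrier (Hom_module R F0 C)"
  have Ext: "Ext1 R M C = quotient_module (H\<lparr>carrier := Z\<rparr>) Bd"
    by (simp add: Ext1_def Let_def K_def F0_def F1_def K2_def F2_def d1_def d2_def H_def Z_def Bd_def)
  interpret C: module R C by fact
  have K: "module R K" unfolding K_def by (rule module_syzygy) fact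
  have K2: "module R K2" unfolding K2_def by (rule module_syzygy) fact
  have F0: "module R F0" unfolding F0_def by (rule module_free_cover) fact
  have F1: "module R F1" unfolding F1_def by (rule module_free_cover) fact
  have F2: "module R F2" unfolding F2_def by (rule module_free_cover) fact
  have H: "module R H" unfolding H_def by (rule module_Hom) fact+
  interpret K: module R K by fact
  interpret F1: module R F1 by fact
  have d1: "lin R F1 K d1" "lin R F1 F0 d1"
    using lin_cover_map[OF K] by (auto simp: F1_def d1_def K_def F0_def lin_def)
  have K2car: "carrier K2 = {f \<in> carrier F1. d1 f = \<zero>\<^sub>K}"
    by (simp add: K2_def F1_def d1_def)
  have d2: "lin R F2 K2 d2" "\<And>f. f \<in> carrier K2 \<Longrightarrow> \<exists>g\<in>carrier F2. d2 g = f"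
    using lin_cover_map[OF K2] cover_map_gen[OF K2] free_gen_cover[OF K2] by (auto simp: F2_def d2_def)
  have Z: "Z = {h \<in> module_hom R F1 C. \<forall>f\<in>carrier K2. h f = \<zero>\<^sub>C}"
  proof -
    have "compose (carrier F2) h d2 = \<zero>\<^bsub>Hom_module R F2 C\<^esub> \<longleftrightarrow> (\<forall>f\<in>carrier F2. h (d2 f) = \<zero>\<^sub>C)" for h
      by (auto simp: compose_def fun_eq_iff)
    moreover have "(\<forall>f\<in>carrier F2. h (d2 f) = \<zero>\<^sub>C) \<longleftrightarrow> (\<forall>f\<in>carrier K2. h f = \<zero>\<^sub>C)" for h
      using d2(2) lin_closed[OF d2(1)] by metis
    ultimately show ?thesis by (simp add: Z_def H_def)
  qed
  have hz: "module R (H\<lparr>carrier := Z\<rparr>)"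
  proof (rule module_submodule(2)[OF H])
    interpret H: module R H by fact
    show "Z \<subseteq> carrier H" by (auto simp: Z_def)
    show "\<zero>\<^sub>H \<in> Z" using H.zero_closed K2car by (auto simp: Z H_def)
    show "x \<oplus>\<^sub>H y \<in> Z" if "x \<in> Z" "y \<in> Z" for x y
      using H.a_closed[of x y] that K2car by (auto simp: Z H_def)
    show "r \<odot>\<^sub>H x \<in> Z" if "r \<in> carrier R" "x \<in> Z" for r x
      using H.smult_closed[of r x] that K2car by (auto simp: Z H_def)
  qed
  have Bd: "Bd = {h \<in> extensional (carrier F1). \<exists>k. lin R F0 C k \<and> (\<forall>f\<in>carrier F1. h f = k (d1 f))}"
  proof (intro equalityI subsetI)
    fix h assume "h \<in> {h \<in> extensional (carrier F1). \<exists>k. lin R F0 C k \<and> (\<forall>f\<in>carrier F1. h f = k (d1 f))}"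
    then obtain k where k: "h \<in> extensional (carrier F1)" "lin R F0 C k" "\<And>f. f \<in> carrier F1 \<Longrightarrow> h f = k (d1 f)"
      by auto
    have "h = compose (carrier F1) (restrict k (carrier F0)) d1"
      using k(1,3) lin_closed[OF d1(2)] by (auto simp: fun_eq_iff compose_def extensional_def)
    then show "h \<in> Bd" using lin_restrict[OF F0 k(2)] by (auto simp: Bd_def)
  qed (auto simp: Bd_def compose_def intro: module_hom_lin)
  have sub: "submodule Bd R (H\<lparr>carrier := Z\<rparr>)"
  proof (rule module_submodule(1)[OF hz])
    show "Bd \<subseteq> carrier (H\<lparr>carrier := Z\<rparr>)"
    proof
      fix h assume "h \<in> Bd"
      then obtain k where k: "h \<in> extensional (carrier F1)" "lin R F0 C k" "\<And>f. f \<in> carrier F1 \<Longrightarrow> h f = k (d1 f)"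
        by (auto simp: Bd)
      have "k \<zero>\<^sub>K = \<zero>\<^sub>C" using lin_zero[OF F0 C k(2)] by (simp add: K_def F0_def)
      then show "h \<in> carrier (H\<lparr>carrier := Z\<rparr>)"
        using lin_cong[OF F1 lin_comp[OF d1(2) k(2)]] k K2car by (auto simp: Z module_hom_iff)
    qed
    show "\<zero>\<^bsub>H\<lparr>carrier := Z\<rparr>\<^esub> \<in> Bd"
      using lin_zero_map[OF C, of F0] by (auto simp: Bd H_def)
    show "x \<oplus>\<^bsub>H\<lparr>carrier := Z\<rparr>\<^esub> y \<in> Bd" if xy: "x \<in> Bd" "y \<in> Bd" for x y
    proof -
      obtain k l where "lin R F0 C k" "\<forall>f\<in>carrier F1. x f = k (d1 f)" "lin R F0 C l" "\<forall>f\<in>carrier F1. y f = l (d1 f)"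
        using xy unfolding Bd by blast
      then show ?thesis
        using lin_plus[OF C, of F0 k l] by (auto simp: Bd H_def intro!: exI[of _ "\<lambda>x. k x \<oplus>\<^sub>C l x"])
    qed
    show "r \<odot>\<^bsub>H\<lparr>carrier := Z\<rparr>\<^esub> x \<in> Bd" if rx: "r \<in> carrier R" "x \<in> Bd" for r x
    proof -
      obtain k where "lin R F0 C k" "\<forall>f\<in>carrier F1. x f = k (d1 f)"
        using rx unfolding Bd by blast
      then show ?thesis
        using lin_scale[OF C, of F0 k r] rx by (auto simp: Bd H_def intro!: exI[of _ "\<lambda>x. r \<odot>\<^sub>C k x"])
    qed
  qed
  have "zero_module (Ext1 R M C) \<longleftrightarrow> Z \<subseteq> Bd"
    using zero_quotient_iff[OF hz sub] by (simp add: Ext)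
  also have "\<dots> \<longleftrightarrow> (\<forall>h. lin R K C h \<longrightarrow> (\<exists>k. lin R F0 C k \<and> (\<forall>f\<in>carrier K. k f = h f)))"
  proof (intro iffI allI impI subsetI)
    fix h assume "Z \<subseteq> Bd" and h: "lin R K C h"
    have "h \<zero>\<^sub>K = \<zero>\<^sub>C" using lin_zero[OF K C h] .
    then have "restrict (\<lambda>f. h (d1 f)) (carrier F1) \<in> Z"
      using lin_restrict[OF F1 lin_comp[OF d1(1) h]] K2car by (auto simp: Z)
    then obtain k where k: "lin R F0 C k" "\<And>f. f \<in> carrier F1 \<Longrightarrow> h (d1 f) = k (d1 f)"
      using \<open>Z \<subseteq> Bd\<close> by (fastforce simp: Bd)
    then show "\<exists>k. lin R F0 C k \<and> (\<forall>f\<in>carrier K. k f = h f)"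
      using cover_map_gen[OF K] free_gen_cover[OF K] by (metis F1_def d1_def)
  next
    fix h assume ext: "\<forall>h. lin R K C h \<longrightarrow> (\<exists>k. lin R F0 C k \<and> (\<forall>f\<in>carrier K. k f = h f))" and hZ: "h \<in> Z"
    have h: "lin R F1 C h" "\<And>f. f \<in> carrier F1 \<Longrightarrow> d1 f = \<zero>\<^sub>K \<Longrightarrow> h f = \<zero>\<^sub>C"
      using hZ K2car by (auto simp: Z intro: module_hom_lin)
    obtain g where g: "lin R K C g" "\<And>f. f \<in> carrier F1 \<Longrightarrow> g (d1 f) = h f"
    proof (rule lin_factor[OF F1 K C d1(1) _ h])
      show "\<exists>f\<in>carrier F1. d1 f = y" if "y \<in> carrier K" for y
        using cover_map_gen[OF K that] free_gen_cover[OF K that] by (auto simp: d1_def F1_def)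
    qed (assumption | rule that)+
    obtain k where k: "lin R F0 C k" "\<And>f. f \<in> carrier K \<Longrightarrow> k f = g f" using ext g(1) by blast
    have "h f = k (d1 f)" if "f \<in> carrier F1" for f
      using g(2) k(2) lin_closed[OF d1(1)] that by simp
    then show "h \<in> Bd" using k(1) hZ by (auto simp: Bd Z module_hom_iff)
  qed
  finally show ?thesis by (simp add: K_def F0_def)
qed

text \<open>The part of the long exact sequence of \<open>0 \<rightarrow> F \<rightarrow> B \<rightarrow> M \<rightarrow> 0\<close> around \<open>Ext\<^sup>1(M, C)\<close>.\<close>

lemma Ext1_extend:
  assumes Ext: "zero_module (Ext1 R M C)"
    and mods: "module R M" "module R C" "module R B" "module R F"
    and \<beta>: "lin R F B \<beta>" "\<And>f. f \<in> carrier F \<Longrightarrow> \<beta> f = \<zero>\<^sub>B \<Longrightarrow> f = \<zero>\<^sub>F"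
    and p: "lin R B M p" "\<And>x. x \<in> carrier M \<Longrightarrow> \<exists>b\<in>carrier B. p b = x"
    and exact: "\<And>b. b \<in> carrier B \<Longrightarrow> p b = \<zero>\<^sub>M \<Longrightarrow> \<exists>f\<in>carrier F. b = \<beta> f"
      "\<And>f. f \<in> carrier F \<Longrightarrow> p (\<beta> f) = \<zero>\<^sub>M"
    and k: "lin R F C k"
  obtains \<kappa> where "lin R B C \<kappa>" "\<And>f. f \<in> carrier F \<Longrightarrow> \<kappa> (\<beta> f) = k f"
proof -
  interpret B: module R B by fact
  interpret C: module R C by fact
  let ?K = "syzygy R M" and ?F0 = "free_cover R M"
  note K = module_syzygy[OF mods(1)] and F0 = module_free_cover[OF mods(1)]
  obtain s where s: "\<And>x. x \<in> carrier M \<Longrightarrow> s x \<in> carrier B \<and> p (s x) = x"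
    using p(2) by metis
  \<comment> \<open>A set-theoretic section of \<open>p\<close> extends linearly to the free cover
    of \<open>M\<close>.\<close>
  define \<phi> where "\<phi> = free_lift R (carrier M) B s"
  have \<phi>: "lin R ?F0 B \<phi>" and \<phi>g: "\<And>x. x \<in> carrier M \<Longrightarrow> \<phi> (free_gen R x) = s x"
    using lin_free_lift[OF mods(3), of "carrier M" s] free_lift_gen[OF mods(3), of "carrier M" s] s
    by (auto simp: \<phi>_def free_cover_def)
  have p\<phi>: "p (\<phi> f) = cover_map R M f" if "f \<in> carrier ?F0" for f
    by (rule lin_free_eq[OF module.axioms(1)[OF mods(1)] lin_comp[OF \<phi> p(1), unfolded free_cover_def] lin_cover_map[OF mods(1), unfolded free_cover_def] mods(1)])
      (use that s \<phi>g cover_map_gen[OF mods(1)] in \<open>auto simp: free_cover_def\<close>)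
  \<comment> \<open>On syzygies \<open>\<phi>\<close> takes values in the kernel of
    \<open>p\<close>, which is the image of \<open>F\<close>.\<close>
  obtain \<psi> where \<psi>: "lin R ?K F \<psi>" "\<And>f. f \<in> carrier ?K \<Longrightarrow> \<beta> (\<psi> f) = \<phi> f"
  proof (rule lin_lift[OF K mods(4,3) _ \<beta>])
    show "lin R ?K B \<phi>" using \<phi> by (simp add: lin_def)
    fix f assume "f \<in> carrier ?K"
    then have "f \<in> carrier ?F0" "p (\<phi> f) = \<zero>\<^sub>M" using p\<phi>[of f] by simp_all
    then show "\<exists>g\<in>carrier F. \<beta> g = \<phi> f" using exact(1)[OF lin_closed[OF \<phi>]] by metis
  qed ((assumption | rule that)+)
  obtain k0 where k0: "lin R ?F0 C k0" "\<And>f. f \<in> carrier ?K \<Longrightarrow> k0 f = k (\<psi> f)"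
    using zero_Ext1_iff[OF mods(1,2)] Ext lin_comp[OF \<psi>(1) k] by blast
  \<comment> \<open>\<open>B\<close> is a quotient of the free cover plus \<open>F\<close>. On this
    sum the wanted map is given by \<open>k0\<close> and \<open>k\<close>; it descends because
    \<open>k0\<close> agrees with \<open>k\<close> after \<open>\<psi>\<close> on the syzygies,
    which is where the two summands overlap in \<open>B\<close>.\<close>
  let ?W = "pair_module ?F0 F"
  have W: "module R ?W" by (rule module_pair[OF F0 mods(4)])
  have fs: "lin R ?W ?F0 fst" "lin R ?W F snd" by (auto intro!: linI)
  obtain \<kappa> where \<kappa>: "lin R B C \<kappa>" "\<And>w. w \<in> carrier ?W \<Longrightarrow> \<kappa> (\<phi> (fst w) \<oplus>\<^sub>B \<beta> (snd w)) = k0 (fst w) \<oplus>\<^sub>C k (snd w)"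
  proof (rule lin_factor[OF W mods(3,2) lin_plus[OF mods(3) lin_comp[OF fs(1) \<phi>] lin_comp[OF fs(2) \<beta>(1)]] _
        lin_plus[OF mods(2) lin_comp[OF fs(1) k0(1)] lin_comp[OF fs(2) k]]])
    fix b assume b: "b \<in> carrier B"
    let ?f = "free_gen R (p b)"
    have f: "?f \<in> carrier ?F0" "cover_map R M ?f = p b"
      using free_gen_cover[OF mods(1)] cover_map_gen[OF mods(1)] lin_closed[OF p(1) b] by auto
    have c: "\<phi> ?f \<in> carrier B" by (rule lin_closed[OF \<phi> f(1)])
    have "p (b \<ominus>\<^sub>B \<phi> ?f) = \<zero>\<^sub>M"
      using lin_minus[OF mods(3,1) p(1) b c] p\<phi>[OF f(1)] f(2) module_minus_self[OF mods(1) lin_closed[OF p(1) b]] by simp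
    then obtain g where g: "g \<in> carrier F" "b \<ominus>\<^sub>B \<phi> ?f = \<beta> g" using exact(1) b c by blast
    then show "\<exists>w\<in>carrier ?W. \<phi> (fst w) \<oplus>\<^sub>B \<beta> (snd w) = b"
      using module_add_diff[OF mods(3) b c] f by (intro bexI[of _ "(?f, g)"]) auto
  next
    fix w assume w: "w \<in> carrier ?W" and z: "\<phi> (fst w) \<oplus>\<^sub>B \<beta> (snd w) = \<zero>\<^sub>B"
    have c: "fst w \<in> carrier ?F0" "snd w \<in> carrier F" using w by auto
    have "p (\<phi> (fst w)) \<oplus>\<^sub>M p (\<beta> (snd w)) = \<zero>\<^sub>M"
      using z lin_add[OF p(1) lin_closed[OF \<phi> c(1)] lin_closed[OF \<beta>(1) c(2)]] lin_zero[OF mods(3,1) p(1)] by simp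
    then have "cover_map R M (fst w) = \<zero>\<^sub>M"
      using exact(2)[OF c(2)] p\<phi>[OF c(1)] module_r_zero[OF mods(1) lin_closed[OF lin_cover_map[OF mods(1)] c(1)]] by simp
    then have fK: "fst w \<in> carrier ?K" using c by simp
    note c\<psi> = lin_closed[OF \<psi>(1) fK]
    have "\<psi> (fst w) \<oplus>\<^sub>F snd w = \<zero>\<^sub>F"
      using \<beta>(2)[OF module_add_closed[OF mods(4) c\<psi> c(2)]] lin_add[OF \<beta>(1) c\<psi> c(2)] \<psi>(2)[OF fK] z by simp
    then show "k0 (fst w) \<oplus>\<^sub>C k (snd w) = \<zero>\<^sub>C"
      using k0(2)[OF fK] lin_add[OF k c\<psi> c(2)] lin_zero[OF mods(4,2) k] by simp
  qed (rule that)
  have "\<kappa> (\<beta> f) = k f" if f: "f \<in> carrier F" for f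
    using \<kappa>(2)[of "(\<zero>\<^bsub>?F0\<^esub>, f)"] f module_zero_closed[OF F0] lin_zero[OF F0 mods(3) \<phi>] lin_zero[OF F0 mods(2) k0(1)]
      lin_closed[OF \<beta>(1) f] lin_closed[OF k f] by simp
  then show thesis using that \<kappa>(1) by blast
qed

section \<open>Short exact sequences \<open>0 -> C -> E -> D -> 0\<close>\<close>

definition extension where
  "extension R C E D j \<pi> \<longleftrightarrow> module R C \<and> module R E \<and> module R D \<and> lin R C E j \<and> lin R E D \<pi> \<and>
    (\<forall>c\<in>carrier C. j c = \<zero>\<^sub>E \<longrightarrow> c = \<zero>\<^sub>C) \<and> (\<forall>d\<in>carrier D. \<exists>x\<in>carrier E. \<pi> x = d) \<and>
    (\<forall>c\<in>carrier C. \<pi> (j c) = \<zero>\<^sub>D) \<and> (\<forall>x\<in>carrier E. \<pi> x = \<zero>\<^sub>D \<longrightarrow> (\<exists>c\<in>carrier C. j c = x))"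

lemma extensionD:
  assumes "extension R C E D j \<pi>"
  shows "module R C" "module R E" "module R D" "lin R C E j" "lin R E D \<pi>"
    "\<And>c. c \<in> carrier C \<Longrightarrow> j c = \<zero>\<^sub>E \<Longrightarrow> c = \<zero>\<^sub>C" "\<And>d. d \<in> carrier D \<Longrightarrow> \<exists>x\<in>carrier E. \<pi> x = d"
    "\<And>c. c \<in> carrier C \<Longrightarrow> \<pi> (j c) = \<zero>\<^sub>D" "\<And>x. x \<in> carrier E \<Longrightarrow> \<pi> x = \<zero>\<^sub>D \<Longrightarrow> \<exists>c\<in>carrier C. j c = x"
  using assms by (auto simp: extension_def)

lemma lin_extension_kernel:
  assumes E: "extension R C E D j \<pi>" and X: "module R X" and f: "lin R X E f" "\<And>x. x \<in> carrier X \<Longrightarrow> \<pi> (f x) = \<zero>\<^sub>D"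
  obtains k where "lin R X C k" "\<And>x. x \<in> carrier X \<Longrightarrow> j (k x) = f x"
proof -
  note e = extensionD[OF E]
  show thesis
  proof (rule lin_lift[OF X e(1,2) f(1) e(4)])
    show "\<exists>c\<in>carrier C. j c = f x" if "x \<in> carrier X" for x by (rule e(9)[OF lin_closed[OF f(1) that] f(2)[OF that]])
  qed (use e(6) that in blast)+
qed

text \<open>The extension is the pushout of the free presentation of \<open>D\<close> along a map from the syzygies to \<open>C\<close>.\<close>

lemma Ext1_zero_of_sections:
  fixes D :: "('a, 'b, 'm) module_scheme" and C :: "('a, 'c, 'n) module_scheme"
  assumes D: "module R D" and C: "module R C"
    and sect: "\<And>(E :: ('a, (('b \<Rightarrow> 'a) \<times> 'c) set) module) j \<pi>. extension R C E D j \<pi> \<Longrightarrow> \<exists>s. lin R D E s \<and> (\<forall>d\<in>carrier D. \<pi> (s d) = d)"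
  shows "zero_module (Ext1 R D C)"
proof -
  let ?B = "free_cover R D" and ?S = "syzygy R D" and ?c = "cover_map R D"
  note B = module_free_cover[OF D] and S = module_syzygy[OF D] and c = lin_cover_map[OF D]
  interpret C: module R C by (rule C)
  interpret B: module R ?B by (rule B)
  let ?W = "pair_module ?B C"
  have W: "module R ?W" by (rule module_pair[OF B C])
  have "\<exists>k. lin R ?B C k \<and> (\<forall>f\<in>carrier ?S. k f = h f)" if h: "lin R ?S C h" for h
  proof -
    \<comment> \<open>Dividing by the graph of \<open>- h\<close> identifies each syzygy
      \<open>f\<close> with the element \<open>h f\<close> of \<open>C\<close>.\<close>
    define N where "N = (\<lambda>f. (f, \<ominus>\<^sub>C h f)) ` carrier ?S"
    have hB: "h (x \<oplus>\<^bsub>?B\<^esub> y) = h x \<oplus>\<^sub>C h y" "r \<in> carrier R \<Longrightarrow> h (r \<odot>\<^bsub>?B\<^esub> x) = r \<odot>\<^sub>C h x" "x \<in> carrier ?B"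
      if "x \<in> carrier ?S" "y \<in> carrier ?S" for x y r
      using lin_add[OF h that] lin_smult[OF h _ that(1), of r] that by simp_all
    have "lin R ?S ?W (\<lambda>f. (f, \<ominus>\<^sub>C h f))"
      by (rule linI) (use lin_closed[OF h] hB in \<open>simp_all add: C.minus_add C.smult_r_minus del: syzygy_simps(1)\<close>)
    then have N: "submodule N R ?W" unfolding N_def by (rule lin_image_submodule[OF S W])
    let ?E = "quotient_module ?W N"
    define q where "q z = N +>\<^bsub>?W\<^esub> z" for z
    have E: "module R ?E" by (rule module_quotient[OF W N])
    have q: "lin R ?W ?E q" "\<And>X. X \<in> carrier ?E \<Longrightarrow> \<exists>z\<in>carrier ?W. q z = X"
      using lin_quotient[OF W N] by (simp_all add: q_def[abs_def])
    have q0: "q z = \<zero>\<^bsub>?E\<^esub> \<longleftrightarrow> z \<in> N" if "z \<in> carrier ?W" for z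
      using coset_zero_iff[OF W N that] by (simp add: q_def)
    obtain \<pi> where \<pi>: "lin R ?E D \<pi>" "\<And>z. z \<in> carrier ?W \<Longrightarrow> \<pi> (q z) = ?c (fst z)"
    proof (rule lin_factor[OF W E D q lin_comp[OF _ c]])
      show "lin R ?W ?B fst" by (rule linI) auto
      show "?c (fst z) = \<zero>\<^sub>D" if "z \<in> carrier ?W" "q z = \<zero>\<^bsub>?E\<^esub>" for z using that q0 by (auto simp: N_def)
    qed (assumption | rule that)+
    have inB: "lin R ?B ?W (\<lambda>b. (b, \<zero>\<^sub>C))" and inC: "lin R C ?W (\<lambda>v. (\<zero>\<^bsub>?B\<^esub>, v))" by (rule linI; simp)+
    have Sq: "q (f, v) = q (\<zero>\<^bsub>?B\<^esub>, h f \<oplus>\<^sub>C v)" if f: "f \<in> carrier ?S" and v: "v \<in> carrier C" for f v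
    proof -
      note hf = lin_closed[OF h f]
      have w: "(f, \<ominus>\<^sub>C h f) \<in> carrier ?W" "(\<zero>\<^bsub>?B\<^esub>, h f \<oplus>\<^sub>C v) \<in> carrier ?W" using f v hf by simp_all
      have "q (f, v) = q ((f, \<ominus>\<^sub>C h f) \<oplus>\<^bsub>?W\<^esub> (\<zero>\<^bsub>?B\<^esub>, h f \<oplus>\<^sub>C v))" using f v hf by (simp add: C.r_neg1)
      also have "\<dots> = q (\<zero>\<^bsub>?B\<^esub>, h f \<oplus>\<^sub>C v)"
        unfolding lin_add[OF q(1) w] using q0[OF w(1)] f module_l_zero[OF E lin_closed[OF q(1) w(2)]] by (simp add: N_def)
      finally show ?thesis .
    qed
    let ?j = "\<lambda>v. q (\<zero>\<^bsub>?B\<^esub>, v)"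
    have ext: "extension R C ?E D ?j \<pi>"
      unfolding extension_def
    proof (intro conjI ballI impI C E D \<pi>(1) lin_comp[OF inC q(1)])
      fix v assume v: "v \<in> carrier C" "?j v = \<zero>\<^bsub>?E\<^esub>"
      then show "v = \<zero>\<^sub>C" using q0[of "(\<zero>\<^bsub>?B\<^esub>, v)"] lin_zero[OF S C h] by (auto simp: N_def)
    next
      fix d assume d: "d \<in> carrier D"
      then show "\<exists>x\<in>carrier ?E. \<pi> x = d"
        using \<pi>(2)[of "(free_gen R d, \<zero>\<^sub>C)"] free_gen_cover[OF D d] cover_map_gen[OF D d] lin_closed[OF q(1), of "(free_gen R d, \<zero>\<^sub>C)"]
        by (intro bexI[of _ "q (free_gen R d, \<zero>\<^sub>C)"]) simp_all
    next
      fix v assume "v \<in> carrier C"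
      then show "\<pi> (?j v) = \<zero>\<^sub>D" using \<pi>(2)[of "(\<zero>\<^bsub>?B\<^esub>, v)"] lin_zero[OF B D c] by simp
    next
      fix x assume x: "x \<in> carrier ?E" "\<pi> x = \<zero>\<^sub>D"
      obtain f v where z: "f \<in> carrier ?B" "v \<in> carrier C" "x = q (f, v)" using q(2)[OF x(1)] by auto
      then have f: "f \<in> carrier ?S" using \<pi>(2)[of "(f, v)"] x(2) by simp
      then show "\<exists>v\<in>carrier C. ?j v = x" using Sq[OF f z(2)] z lin_closed[OF h f] by (intro bexI[of _ "h f \<oplus>\<^sub>C v"]) simp_all
    qed
    obtain s where s: "lin R D ?E s" "\<And>d. d \<in> carrier D \<Longrightarrow> \<pi> (s d) = d" using sect[OF ext] by blast
    note qB = lin_comp[OF inB q(1)] and sc = lin_comp[OF c s(1)]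
    \<comment> \<open>The canonical map of the free cover to \<open>?E\<close> and the section
      applied to its image in \<open>D\<close> differ by an element of \<open>C\<close>. This
      difference is the extension of \<open>h\<close>: on a syzygy the section contributes nothing
      and the canonical map gives \<open>h f\<close>.\<close>
    obtain k where k: "lin R ?B C k" "\<And>b. b \<in> carrier ?B \<Longrightarrow> ?j (k b) = q (b, \<zero>\<^sub>C) \<ominus>\<^bsub>?E\<^esub> s (?c b)"
    proof (rule lin_extension_kernel[OF ext B lin_diff[OF E qB sc]])
      fix b assume b: "b \<in> carrier ?B"
      show "\<pi> (q (b, \<zero>\<^sub>C) \<ominus>\<^bsub>?E\<^esub> s (?c b)) = \<zero>\<^sub>D"
        unfolding lin_minus[OF E D \<pi>(1) lin_closed[OF qB b] lin_closed[OF sc b]] s(2)[OF lin_closed[OF c b]]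
        using \<pi>(2)[of "(b, \<zero>\<^sub>C)"] b module_minus_self[OF D lin_closed[OF c b]] by simp
    qed (rule that)
    have "k f = h f" if f: "f \<in> carrier ?S" for f
    proof -
      have fB: "f \<in> carrier ?B" "?c f = \<zero>\<^sub>D" using f by simp_all
      note kf = lin_closed[OF k(1) fB(1)] and hf = lin_closed[OF h f] and jl = lin_comp[OF inC q(1)]
      have "?j (k f) = q (f, \<zero>\<^sub>C)"
        unfolding k(2)[OF fB(1)] fB(2) lin_zero[OF D E s(1)]
        by (rule module_diff_zero[OF E lin_closed[OF qB fB(1)]])
      also have "\<dots> = ?j (h f)" using Sq[OF f C.zero_closed] hf by simp
      finally have "?j (k f \<ominus>\<^sub>C h f) = \<zero>\<^bsub>?E\<^esub>"
        unfolding lin_minus[OF C E jl kf hf] using module_minus_self[OF E lin_closed[OF jl hf]] by simp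
      then show ?thesis using extensionD(6)[OF ext] module_diff_eq_zero[OF C kf hf] C.minus_closed[OF kf hf] by blast
    qed
    then show ?thesis using k(1) by blast
  qed
  then show ?thesis unfolding zero_Ext1_iff[OF D C] by blast
qed

text \<open>Pull the extension back along \<open>g\<close>. The fibre product \<open>P\<close> is an
  extension of \<open>V\<close> by \<open>C\<close>, and the vanishing Ext provides a retraction
  \<open>\<kappa>\<close> of \<open>P\<close> onto \<open>C\<close>. The first projection minus
  \<open>j\<close> after \<open>\<kappa>\<close> then vanishes on the copy of \<open>C\<close> in
  \<open>P\<close> and descends to \<open>V\<close>.\<close>

lemma Ext1_lift:
  assumes Ext: "zero_module (Ext1 R V C)" and V: "module R V" and ext: "extension R C E D j \<pi>" and g: "lin R V D g"
  obtains \<gamma> where "lin R V E \<gamma>" "\<And>x. x \<in> carrier V \<Longrightarrow> \<pi> (\<gamma> x) = g x"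
proof -
  note e = extensionD[OF ext]
  note C = e(1) and E = e(2) and D = e(3) and j = e(4) and \<pi> = e(5)
  let ?W = "pair_module E V"
  have W: "module R ?W" by (rule module_pair[OF E V])
  have "lin R ?W E fst" "lin R ?W V snd" by (auto intro!: linI)
  note fs = lin_comp[OF this(1) \<pi>] lin_comp[OF this(2) g]
  define P where "P = ?W\<lparr>carrier := {z \<in> carrier ?W. \<pi> (fst z) \<ominus>\<^sub>D g (snd z) = \<zero>\<^sub>D}\<rparr>"
  have P: "module R P" unfolding P_def by (rule module_sub_kernel[OF W D lin_diff[OF D fs]])
  have P_mem: "(x, y) \<in> carrier P \<longleftrightarrow> x \<in> carrier E \<and> y \<in> carrier V \<and> \<pi> x = g y" for x y
    using module_diff_eq_zero[OF D lin_closed[OF \<pi>] lin_closed[OF g], of x y] by (auto simp: P_def)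
  have P_ops: "\<zero>\<^sub>P = (\<zero>\<^sub>E, \<zero>\<^sub>V)" "(x, y) \<oplus>\<^sub>P (x', y') = (x \<oplus>\<^sub>E x', y \<oplus>\<^sub>V y')" "r \<odot>\<^sub>P (x, y) = (r \<odot>\<^sub>E x, r \<odot>\<^sub>V y)" for x y x' y' r
    by (simp_all add: P_def)
  have Pf: "lin R P E fst" "lin R P V snd" by (auto simp: P_def intro!: linI)
  note g0 = lin_zero[OF V D g] and z = module_zero_closed[OF V]
  have lift: "\<exists>w\<in>carrier P. snd w = y" if y: "y \<in> carrier V" for y
  proof -
    obtain x where "x \<in> carrier E" "\<pi> x = g y" using e(7)[OF lin_closed[OF g y]] by blast
    then show ?thesis using y by (intro bexI[of _ "(x, y)"]) (simp_all add: P_mem)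
  qed
  have ker: "\<exists>c\<in>carrier C. w = (j c, \<zero>\<^sub>V)" if w: "w \<in> carrier P" "snd w = \<zero>\<^sub>V" for w
  proof -
    have w': "w = (fst w, \<zero>\<^sub>V)" using w(2) by (metis prod.collapse)
    then have "(fst w, \<zero>\<^sub>V) \<in> carrier P" using w(1) by simp
    then have "fst w \<in> carrier E" "\<pi> (fst w) = \<zero>\<^sub>D" unfolding P_mem g0 by simp_all
    then obtain c where "c \<in> carrier C" "j c = fst w" using e(9) by blast
    then show ?thesis using w' by metis
  qed
  have \<beta>: "lin R C P (\<lambda>c. (j c, \<zero>\<^sub>V))"
    by (rule linI) (use z in \<open>simp_all add: P_mem P_ops g0 e(8) lin_closed[OF j] lin_add[OF j] lin_smult[OF j] module_l_zero[OF V] module.smult_r_null[OF V]\<close>)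
  have id: "lin R C C (\<lambda>c. c)" by (rule linI) auto
  obtain \<kappa> where \<kappa>: "lin R P C \<kappa>" "\<And>c. c \<in> carrier C \<Longrightarrow> \<kappa> (j c, \<zero>\<^sub>V) = c"
  proof (rule Ext1_extend[OF Ext V C P C \<beta> _ Pf(2) lift _ _ id])
    fix c assume "c \<in> carrier C" "(j c, \<zero>\<^sub>V) = \<zero>\<^sub>P"
    then show "c = \<zero>\<^sub>C" using e(6) by (simp add: P_ops)
  qed (use ker that in \<open>simp_all\<close>)
  note j\<kappa> = lin_comp[OF \<kappa>(1) j]
  obtain \<gamma> where \<gamma>: "lin R V E \<gamma>" "\<And>w. w \<in> carrier P \<Longrightarrow> \<gamma> (snd w) = fst w \<ominus>\<^sub>E j (\<kappa> w)"
  proof (rule lin_factor[OF P V E Pf(2) lift lin_diff[OF E Pf(1) j\<kappa>]])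
    fix w assume "w \<in> carrier P" "snd w = \<zero>\<^sub>V"
    then obtain c where c: "c \<in> carrier C" "w = (j c, \<zero>\<^sub>V)" using ker by blast
    then show "fst w \<ominus>\<^sub>E j (\<kappa> w) = \<zero>\<^sub>E" using \<kappa>(2) module_minus_self[OF E lin_closed[OF j c(1)]] by simp
  qed (assumption | rule that)+
  have "\<pi> (\<gamma> y) = g y" if y: "y \<in> carrier V" for y
  proof -
    obtain x where w: "(x, y) \<in> carrier P" using lift[OF y] by force
    have x: "x \<in> carrier E" "\<pi> x = g y" using w by (simp_all add: P_mem)
    note jk = lin_closed[OF \<kappa>(1) w]
    have "\<gamma> y = x \<ominus>\<^sub>E j (\<kappa> (x, y))" using \<gamma>(2)[OF w] by simp
    then have "\<pi> (\<gamma> y) = g y \<ominus>\<^sub>D \<zero>\<^sub>D" using lin_minus[OF E D \<pi> x(1) lin_closed[OF j jk]] e(8)[OF jk] x(2) by simp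
    then show ?thesis using module_diff_zero[OF D lin_closed[OF g y]] by simp
  qed
  then show thesis using that \<gamma>(1) by blast
qed

section \<open>Tensor products\<close>

lemma generated_submodule:
  assumes "module R M" "X \<subseteq> carrier M"
  shows "submodule (generated_submodule R M X) R M" "X \<subseteq> generated_submodule R M X"
    "\<And>N. submodule N R M \<Longrightarrow> X \<subseteq> N \<Longrightarrow> generated_submodule R M X \<subseteq> N"
proof -
  interpret module R M by fact
  let ?G = "generated_submodule R M X"
  have G: "?G = {x. \<forall>N. submodule N R M \<longrightarrow> X \<subseteq> N \<longrightarrow> x \<in> N}"
    by (auto simp: generated_submodule_def)
  have sub: "N \<subseteq> carrier M" "\<zero>\<^sub>M \<in> N" "\<And>x y. x \<in> N \<Longrightarrow> y \<in> N \<Longrightarrow> x \<oplus>\<^sub>M y \<in> N"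
    "\<And>r x. r \<in> carrier R \<Longrightarrow> x \<in> N \<Longrightarrow> r \<odot>\<^sub>M x \<in> N" if "submodule N R M" for N
  proof -
    interpret N: abelian_subgroup N M by (rule submodule_abelian_subgroup) fact+
    show "N \<subseteq> carrier M" by (rule N.a_subset)
    show "\<zero>\<^sub>M \<in> N" by (rule N.zero_closed)
  qed (use submoduleE[OF that] in auto)
  show "submodule ?G R M"
  proof (rule module_submodule(1)[OF assms(1)])
    show "?G \<subseteq> carrier M"
      using carrier_is_submodule assms(2) unfolding G by blast
  qed (use sub in \<open>auto simp: G\<close>)
qed (auto simp: generated_submodule_def)

lemma submodule_props:
  assumes "module R M" "submodule N R M"
  shows "N \<subseteq> carrier M" "\<zero>\<^sub>M \<in> N" "\<And>x y. x \<in> N \<Longrightarrow> y \<in> N \<Longrightarrow> x \<oplus>\<^sub>M y \<in> N"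
    "\<And>r x. r \<in> carrier R \<Longrightarrow> x \<in> N \<Longrightarrow> r \<odot>\<^sub>M x \<in> N"
    "\<And>x y. x \<in> N \<Longrightarrow> y \<in> N \<Longrightarrow> x \<ominus>\<^sub>M y \<in> N"
proof -
  interpret module R M by fact
  interpret N: abelian_subgroup N M by (rule submodule_abelian_subgroup) fact+
  show "N \<subseteq> carrier M" by (rule N.a_subset)
  show "\<zero>\<^sub>M \<in> N" by (rule N.zero_closed)
  show "\<And>r x. r \<in> carrier R \<Longrightarrow> x \<in> N \<Longrightarrow> r \<odot>\<^sub>M x \<in> N"
    using submoduleE[OF assms(2)] by auto
  show "\<And>x y. x \<in> N \<Longrightarrow> y \<in> N \<Longrightarrow> x \<ominus>\<^sub>M y \<in> N" "\<And>x y. x \<in> N \<Longrightarrow> y \<in> N \<Longrightarrow> x \<oplus>\<^sub>M y \<in> N"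
    using submoduleE[OF assms(2)] by (auto simp: a_minus_def)
qed

locale two_modules =
  fixes R :: "('a, 'r) ring_scheme" and M :: "('a, 'b, 'm) module_scheme" and N :: "('a, 'c, 'n) module_scheme"
  assumes M: "module R M" and N: "module R N"
begin

sublocale M: module R M by (rule M)
sublocale N: module R N by (rule N)

abbreviation "F \<equiv> free_module R (carrier M \<times> carrier N)"
abbreviation "K \<equiv> tensor_kernel R M N"
abbreviation "T \<equiv> tensor_module R M N"
abbreviation "e \<equiv> free_gen R"

lemma F: "module R F" by (rule module_free) (rule M.is_cring)

sublocale F: module R F by (rule F)

lemma e_closed: "x \<in> carrier M \<Longrightarrow> y \<in> carrier N \<Longrightarrow> e (x, y) \<in> carrier F"
  by (rule free_gen_closed) (auto simp: M.is_cring)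

lemma relations_subset: "tensor_relations R M N \<subseteq> carrier F"
  unfolding tensor_relations_def Let_def
  by (intro Un_least subsetI; elim CollectE exE conjE;
      simp only: F.minus_closed F.a_closed F.smult_closed e_closed M.M.a_closed N.M.a_closed M.smult_closed N.smult_closed)

lemma K: "submodule K R F"
  unfolding tensor_kernel_def by (rule generated_submodule[OF F relations_subset])

lemma T: "module R T"
  unfolding tensor_module_def by (rule module_quotient[OF F K])

lemma kernel_least:
  assumes Z: "submodule Z R F"
    and "\<And>x x' y. \<lbrakk>x \<in> carrier M; x' \<in> carrier M; y \<in> carrier N\<rbrakk> \<Longrightarrow> e (x \<oplus>\<^sub>M x', y) \<ominus>\<^sub>F (e (x, y) \<oplus>\<^sub>F e (x', y)) \<in> Z"
    and "\<And>x y y'. \<lbrakk>x \<in> carrier M; y \<in> carrier N; y' \<in> carrier N\<rbrakk> \<Longrightarrow> e (x, y \<oplus>\<^sub>N y') \<ominus>\<^sub>F (e (x, y) \<oplus>\<^sub>F e (x, y')) \<in> Z"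
    and "\<And>r x y. \<lbrakk>r \<in> carrier R; x \<in> carrier M; y \<in> carrier N\<rbrakk> \<Longrightarrow> e (r \<odot>\<^sub>M x, y) \<ominus>\<^sub>F r \<odot>\<^sub>F e (x, y) \<in> Z"
    and "\<And>r x y. \<lbrakk>r \<in> carrier R; x \<in> carrier M; y \<in> carrier N\<rbrakk> \<Longrightarrow> e (x, r \<odot>\<^sub>N y) \<ominus>\<^sub>F r \<odot>\<^sub>F e (x, y) \<in> Z"
  shows "K \<subseteq> Z"
  unfolding tensor_kernel_def
proof (rule generated_submodule(3)[OF F relations_subset Z])
  show "tensor_relations R M N \<subseteq> Z"
    unfolding tensor_relations_def Let_def
    by (intro Un_least subsetI; elim CollectE exE conjE; simp only: assms(2-5))
qed

lemma pure_closed: "x \<in> carrier M \<Longrightarrow> y \<in> carrier N \<Longrightarrow> pure_tensor R M N x y \<in> carrier T"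
  unfolding pure_tensor_def tensor_module_def by (rule coset_in_quotient[OF F K e_closed])

lemma relation_in_K:
  "\<lbrakk>x \<in> carrier M; x' \<in> carrier M; y \<in> carrier N\<rbrakk> \<Longrightarrow> e (x \<oplus>\<^sub>M x', y) \<ominus>\<^sub>F (e (x, y) \<oplus>\<^sub>F e (x', y)) \<in> K"
  "\<lbrakk>x \<in> carrier M; y \<in> carrier N; y' \<in> carrier N\<rbrakk> \<Longrightarrow> e (x, y \<oplus>\<^sub>N y') \<ominus>\<^sub>F (e (x, y) \<oplus>\<^sub>F e (x, y')) \<in> K"
  "\<lbrakk>r \<in> carrier R; x \<in> carrier M; y \<in> carrier N\<rbrakk> \<Longrightarrow> e (r \<odot>\<^sub>M x, y) \<ominus>\<^sub>F r \<odot>\<^sub>F e (x, y) \<in> K"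
  "\<lbrakk>r \<in> carrier R; x \<in> carrier M; y \<in> carrier N\<rbrakk> \<Longrightarrow> e (x, r \<odot>\<^sub>N y) \<ominus>\<^sub>F r \<odot>\<^sub>F e (x, y) \<in> K"
  unfolding tensor_kernel_def
  by ((rule subsetD[OF generated_submodule(2)[OF F relations_subset]]), simp only: tensor_relations_def Let_def, blast)+

lemma pure_add_left:
  assumes "x \<in> carrier M" "x' \<in> carrier M" "y \<in> carrier N"
  shows "pure_tensor R M N (x \<oplus>\<^sub>M x') y = pure_tensor R M N x y \<oplus>\<^sub>T pure_tensor R M N x' y"
  unfolding pure_tensor_def tensor_module_def
  using relation_in_K(1)[OF assms] assms
  by (simp only: coset_add[OF F K] coset_eq_iff[OF F K] e_closed M.M.a_closed F.a_closed)

lemma pure_add_right: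
  assumes "x \<in> carrier M" "y \<in> carrier N" "y' \<in> carrier N"
  shows "pure_tensor R M N x (y \<oplus>\<^sub>N y') = pure_tensor R M N x y \<oplus>\<^sub>T pure_tensor R M N x y'"
  unfolding pure_tensor_def tensor_module_def
  using relation_in_K(2)[OF assms] assms
  by (simp only: coset_add[OF F K] coset_eq_iff[OF F K] e_closed N.M.a_closed F.a_closed)

lemma pure_smult_left:
  assumes "r \<in> carrier R" "x \<in> carrier M" "y \<in> carrier N"
  shows "pure_tensor R M N (r \<odot>\<^sub>M x) y = r \<odot>\<^sub>T pure_tensor R M N x y"
  unfolding pure_tensor_def tensor_module_def
  using relation_in_K(3)[OF assms] assms
  by (simp only: coset_smult[OF F K] coset_eq_iff[OF F K] e_closed M.smult_closed F.smult_closed)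

lemma pure_smult_right:
  assumes "r \<in> carrier R" "x \<in> carrier M" "y \<in> carrier N"
  shows "pure_tensor R M N x (r \<odot>\<^sub>N y) = r \<odot>\<^sub>T pure_tensor R M N x y"
  unfolding pure_tensor_def tensor_module_def
  using relation_in_K(4)[OF assms] assms
  by (simp only: coset_smult[OF F K] coset_eq_iff[OF F K] e_closed N.smult_closed F.smult_closed)

lemma lin_pure_left: "y \<in> carrier N \<Longrightarrow> lin R M T (\<lambda>x. pure_tensor R M N x y)"
  by (rule linI) (simp_all add: pure_closed pure_add_left pure_smult_left)

lemma lin_pure_right: "x \<in> carrier M \<Longrightarrow> lin R N T (pure_tensor R M N x)"
  by (rule linI) (simp_all add: pure_closed pure_add_right pure_smult_right)

lemma pure_eq_zero_iff:
  assumes "x \<in> carrier M" "y \<in> carrier N"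
  shows "pure_tensor R M N x y = \<zero>\<^sub>T \<longleftrightarrow> e (x, y) \<in> K"
  using coset_zero_iff[OF F K e_closed[OF assms]] by (simp add: pure_tensor_def tensor_module_def)

lemma tensor_lift_pure:
  assumes P: "module R P" and b: "\<And>x. x \<in> carrier M \<Longrightarrow> lin R N P (b x)"
    "\<And>y. y \<in> carrier N \<Longrightarrow> lin R M P (\<lambda>x. b x y)" and xy: "x \<in> carrier M" "y \<in> carrier N"
  shows "tensor_lift R M N P b (pure_tensor R M N x y) = b x y"
proof -
  interpret P: module R P by (rule P)
  let ?S = "carrier M \<times> carrier N" and ?b = "\<lambda>(x, y). b x y"
  let ?L = "free_lift R ?S P ?b"
  have bc: "?b p \<in> carrier P" if "p \<in> ?S" for p
    using that lin_closed[OF b(1)] by auto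
  have L: "lin R F P ?L" by (rule lin_free_lift[OF P bc])
  have Lg: "?L (e (x, y)) = b x y" if "x \<in> carrier M" "y \<in> carrier N" for x y
    using free_lift_gen[of R P "carrier M \<times> carrier N" "\<lambda>(x, y). b x y" "(x, y)", OF P bc] that by simp
  let ?Z = "{f \<in> carrier F. ?L f = \<zero>\<^sub>P}"
  have Z: "submodule ?Z R F"
    by (rule module_submodule(1)[OF F Collect_restrict])
      (use lin_zero[OF F P L] in \<open>simp_all only: mem_Collect_eq lin_add[OF L] lin_smult[OF L] F.a_closed
        F.smult_closed F.zero_closed P.l_zero P.zero_closed P.smult_r_null simp_thms subset_iff\<close>)
  have bcl: "b x y \<in> carrier P" if "x \<in> carrier M" "y \<in> carrier N" for x y
    using bc[of "(x, y)"] that by simp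
  have "K \<subseteq> ?Z"
    by (rule kernel_least[OF Z])
      (simp_all only: mem_Collect_eq lin_add[OF L] lin_smult[OF L] lin_minus[OF F P L] F.a_closed F.minus_closed F.smult_closed
        e_closed Lg bcl M.M.a_closed N.M.a_closed M.smult_closed N.smult_closed lin_add[OF b(1)] lin_add[OF b(2)] lin_smult[OF b(1)]
        lin_smult[OF b(2)] P.a_closed P.smult_closed module_minus_self[OF P] simp_thms)
  then have k: "?L k = \<zero>\<^sub>P" "k \<in> carrier F" if "k \<in> K" for k
    using that by auto
  have "?L ` pure_tensor R M N x y = {b x y}"
  proof -
    have f1: "?L f = b x y" if "f \<in> pure_tensor R M N x y" for f
    proof -
      obtain k where kf: "k \<in> K" "f = k \<oplus>\<^sub>F e (x, y)"
        using \<open>f \<in> _\<close> by (auto simp: pure_tensor_def a_r_coset_def' simp del: free_module_simps)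
      then show ?thesis
        by (simp only: lin_add[OF L] k e_closed xy Lg P.l_zero bcl)
    qed
    have f2: "e (x, y) \<in> pure_tensor R M N x y"
      unfolding pure_tensor_def by (rule abelian_subgroup.a_rcos_self[OF submodule_abelian_subgroup[OF F K] e_closed[OF xy]])
    show ?thesis
    proof (intro equalityI subsetI)
      fix v assume "v \<in> ?L ` pure_tensor R M N x y"
      then show "v \<in> {b x y}" by (elim imageE) (simp only: f1 singleton_iff)
    next
      fix v assume "v \<in> {b x y}"
      then show "v \<in> ?L ` pure_tensor R M N x y" using f1[OF f2] f2 by (metis imageI singletonD)
    qed
  qed
  then show ?thesis
    using pure_closed[OF xy] by (simp add: tensor_lift_def)
qed

lemma kernel_finite:
  assumes "f \<in> K"
  shows "\<exists>A. finite A \<and> A \<subseteq> carrier M \<and> (\<forall>L. submodule L R M \<longrightarrow> A \<subseteq> L \<longrightarrow> f \<in> tensor_kernel R (M\<lparr>carrier := L\<rparr>) N)"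
proof -
  let ?Q = "\<lambda>f A. finite A \<and> A \<subseteq> carrier M \<and> (\<forall>L. submodule L R M \<longrightarrow> A \<subseteq> L \<longrightarrow> f \<in> tensor_kernel R (M\<lparr>carrier := L\<rparr>) N)"
  let ?FL = "\<lambda>L. free_module R (L \<times> carrier N)" and ?KL = "\<lambda>L. tensor_kernel R (M\<lparr>carrier := L\<rparr>) N"
  have L: "two_modules R (M\<lparr>carrier := L\<rparr>) N" "submodule (?KL L) R (?FL L)" "module R (?FL L)" if "submodule L R M" for L
  proof -
    note p = submodule_props[OF M that]
    have "module R (M\<lparr>carrier := L\<rparr>)" by (rule module_submodule(2)[OF M p(1-4)])
    then show "two_modules R (M\<lparr>carrier := L\<rparr>) N" using N by (simp add: two_modules_def)
    then interpret L: two_modules R "M\<lparr>carrier := L\<rparr>" N .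
    show "submodule (?KL L) R (?FL L)" "module R (?FL L)" using L.K L.F by simp_all
  qed
  \<comment> \<open>Subtraction is defined through inverses in the carrier, so unlike addition it
    has to be compared between the two free modules.\<close>
  have minus: "f \<ominus>\<^bsub>?FL L\<^esub> g = f \<ominus>\<^sub>F g" if "submodule L R M" "f \<in> carrier (?FL L)" "g \<in> carrier (?FL L)" for L f g
  proof -
    have "lin R (?FL L) F (\<lambda>f. f)" by (rule linI) (use submodule_props(1)[OF M that(1)] in auto)
    from lin_minus[OF L(3)[OF that(1)] F this that(2,3)] show ?thesis .
  qed
  let ?Z = "{f \<in> carrier F. \<exists>A. ?Q f A}"
  have ZI: "f \<in> ?Z" if "f \<in> carrier F" "A \<subseteq> carrier M" "finite A"
    "\<And>L. submodule L R M \<Longrightarrow> A \<subseteq> L \<Longrightarrow> f \<in> ?KL L" for f A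
    using that by blast
  have "K \<subseteq> ?Z"
  proof (rule kernel_least)
    show "submodule ?Z R F"
    proof (rule module_submodule(1)[OF F Collect_restrict])
      show "\<zero>\<^sub>F \<in> ?Z"
        by (rule ZI[OF F.zero_closed, of "{}"]) (use submodule_props(2)[OF L(3,2)] in auto)
      show "f \<oplus>\<^sub>F g \<in> ?Z" if fg: "f \<in> ?Z" "g \<in> ?Z" for f g
      proof -
        obtain A B where "?Q f A" "?Q g B" using fg by blast
        then show ?thesis
          using submodule_props(3)[OF L(3,2), of _ f g] fg F.a_closed[of f g] by (intro ZI[of _ "A \<union> B"]) auto
      qed
      show "r \<odot>\<^sub>F f \<in> ?Z" if rf: "r \<in> carrier R" "f \<in> ?Z" for r f
      proof -
        obtain A where "?Q f A" using rf by blast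
        then show ?thesis
          using submodule_props(4)[OF L(3,2), of _ r f] rf F.smult_closed[of r f] by (intro ZI[of _ A]) auto
      qed
    qed
  next
    fix x x' y assume h: "x \<in> carrier M" "x' \<in> carrier M" "y \<in> carrier N"
    show "e (x \<oplus>\<^sub>M x', y) \<ominus>\<^sub>F (e (x, y) \<oplus>\<^sub>F e (x', y)) \<in> ?Z"
    proof (rule ZI[of _ "{x, x'}"])
      fix L assume s: "submodule L R M" and x: "{x, x'} \<subseteq> L"
      interpret L: two_modules R "M\<lparr>carrier := L\<rparr>" N by (rule L(1)[OF s])
      show "e (x \<oplus>\<^sub>M x', y) \<ominus>\<^sub>F (e (x, y) \<oplus>\<^sub>F e (x', y)) \<in> ?KL L"
        using L.relation_in_K(1)[of x x' y] x h(3) minus[OF s, of "e (x \<oplus>\<^sub>M x', y)" "e (x, y) \<oplus>\<^bsub>?FL L\<^esub> e (x', y)"]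
          L.e_closed L.F.a_closed[OF L.e_closed L.e_closed] submodule_props(3)[OF M s, of x x'] by auto
    qed (use h e_closed F.minus_closed F.a_closed in auto)
  next
    fix x y y' assume h: "x \<in> carrier M" "y \<in> carrier N" "y' \<in> carrier N"
    show "e (x, y \<oplus>\<^sub>N y') \<ominus>\<^sub>F (e (x, y) \<oplus>\<^sub>F e (x, y')) \<in> ?Z"
    proof (rule ZI[of _ "{x}"])
      fix L assume s: "submodule L R M" and x: "{x} \<subseteq> L"
      interpret L: two_modules R "M\<lparr>carrier := L\<rparr>" N by (rule L(1)[OF s])
      show "e (x, y \<oplus>\<^sub>N y') \<ominus>\<^sub>F (e (x, y) \<oplus>\<^sub>F e (x, y')) \<in> ?KL L"
        using L.relation_in_K(2)[of x y y'] x h(2,3) minus[OF s, of "e (x, y \<oplus>\<^sub>N y')" "e (x, y) \<oplus>\<^bsub>?FL L\<^esub> e (x, y')"]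
          L.e_closed L.F.a_closed[OF L.e_closed L.e_closed] by auto
    qed (use h e_closed F.minus_closed F.a_closed in auto)
  next
    fix r x y assume h: "r \<in> carrier R" "x \<in> carrier M" "y \<in> carrier N"
    show "e (r \<odot>\<^sub>M x, y) \<ominus>\<^sub>F r \<odot>\<^sub>F e (x, y) \<in> ?Z"
    proof (rule ZI[of _ "{x}"])
      fix L assume s: "submodule L R M" and x: "{x} \<subseteq> L"
      interpret L: two_modules R "M\<lparr>carrier := L\<rparr>" N by (rule L(1)[OF s])
      show "e (r \<odot>\<^sub>M x, y) \<ominus>\<^sub>F r \<odot>\<^sub>F e (x, y) \<in> ?KL L"
        using L.relation_in_K(3)[of r x y] x h(1,3) minus[OF s, of "e (r \<odot>\<^sub>M x, y)" "r \<odot>\<^bsub>?FL L\<^esub> e (x, y)"]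
          L.e_closed L.F.smult_closed[OF _ L.e_closed] submodule_props(4)[OF M s, of r x] by auto
    qed (use h e_closed F.minus_closed F.smult_closed in auto)
    show "e (x, r \<odot>\<^sub>N y) \<ominus>\<^sub>F r \<odot>\<^sub>F e (x, y) \<in> ?Z"
    proof (rule ZI[of _ "{x}"])
      fix L assume s: "submodule L R M" and x: "{x} \<subseteq> L"
      interpret L: two_modules R "M\<lparr>carrier := L\<rparr>" N by (rule L(1)[OF s])
      show "e (x, r \<odot>\<^sub>N y) \<ominus>\<^sub>F r \<odot>\<^sub>F e (x, y) \<in> ?KL L"
        using L.relation_in_K(4)[of r x y] x h(1,3) minus[OF s, of "e (x, r \<odot>\<^sub>N y)" "r \<odot>\<^bsub>?FL L\<^esub> e (x, y)"]
          L.e_closed L.F.smult_closed[OF _ L.e_closed] by auto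
    qed (use h e_closed F.minus_closed F.smult_closed in auto)
  qed
  then show ?thesis using assms by blast
qed

end

lemma tensor_map_pure:
  assumes M: "module R M" and N: "module R N" and V: "module R V" and f: "lin R M N f"
    and x: "x \<in> carrier M" and y: "y \<in> carrier V"
  shows "tensor_map R M N V f (pure_tensor R M V x y) = pure_tensor R N V (f x) y"
proof -
  interpret MV: two_modules R M V by (rule two_modules.intro) fact+
  interpret NV: two_modules R N V by (rule two_modules.intro) fact+
  show ?thesis
    unfolding tensor_map_def
  proof (rule MV.tensor_lift_pure[OF NV.T _ _ x y])
    show "lin R V (tensor_module R N V) (\<lambda>y. pure_tensor R N V (f x) y)" if "x \<in> carrier M" for x
      by (rule NV.lin_pure_right[OF lin_closed[OF f that]])
    show "lin R M (tensor_module R N V) (\<lambda>x. pure_tensor R N V (f x) y)" if "y \<in> carrier V" for y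
      by (rule lin_comp[OF f NV.lin_pure_left[OF that]])
  qed
qed

section \<open>Flat epimorphisms\<close>

text \<open>The ideal of \<open>U\<close> generated by the image of \<open>A\<close>. Being
  inductive, it supports induction over the terms of a linear combination, and finite lists of
  coefficients can be read off from it.\<close>

inductive_set ext_ideal :: "('b, 's) ring_scheme \<Rightarrow> ('a \<Rightarrow> 'b) \<Rightarrow> 'a set \<Rightarrow> 'b set" for U u A where
  zero: "\<zero>\<^sub>U \<in> ext_ideal U u A"
| step: "\<lbrakk>a \<in> A; z \<in> carrier U; w \<in> ext_ideal U u A\<rbrakk> \<Longrightarrow> u a \<otimes>\<^sub>U z \<oplus>\<^sub>U w \<in> ext_ideal U u A"

lemma ext_ideal_mono: "A \<subseteq> B \<Longrightarrow> y \<in> ext_ideal U u A \<Longrightarrow> y \<in> ext_ideal U u B"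
  by (rotate_tac 1, induction rule: ext_ideal.induct) (auto intro: ext_ideal.intros)

lemma ext_ideal_finite:
  assumes "y \<in> ext_ideal U u A"
  obtains J where "finite J" "J \<subseteq> A" "y \<in> ext_ideal U u J"
proof -
  have "\<exists>J. finite J \<and> J \<subseteq> A \<and> y \<in> ext_ideal U u J"
    using assms
  proof (induction rule: ext_ideal.induct)
    case zero
    show ?case by (intro exI[of _ "{}"]) (auto intro: ext_ideal.zero)
  next
    case (step a z w)
    then obtain J where "finite J" "J \<subseteq> A" "w \<in> ext_ideal U u J" by blast
    then show ?case
      using step by (intro exI[of _ "insert a J"]) (auto intro!: ext_ideal.step intro: ext_ideal_mono[of J])
  qed
  then show thesis using that by blast
qed

locale ring_ext = ring_hom_cring R U u for R :: "'a ring" and U :: "'b ring" and u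
begin

abbreviation "V \<equiv> restrict_scalars u U"

lemma V: "module R V"
  by (rule module_restrict_scalars) (auto intro: R.is_cring S.is_cring)

context
  fixes A assumes A: "A \<subseteq> carrier R"
begin

lemma ext_ideal_closed: "y \<in> ext_ideal U u A \<Longrightarrow> y \<in> carrier U"
  by (induction rule: ext_ideal.induct) (use A in auto)

lemma ext_ideal_add: "y \<in> ext_ideal U u A \<Longrightarrow> z \<in> ext_ideal U u A \<Longrightarrow> y \<oplus>\<^sub>U z \<in> ext_ideal U u A"
proof (induction rule: ext_ideal.induct)
  case zero
  then show ?case using ext_ideal_closed by simp
next
  case (step a x w)
  have "u a \<in> carrier U" using step(1) A by auto
  then have "(u a \<otimes>\<^sub>U x \<oplus>\<^sub>U w) \<oplus>\<^sub>U z = u a \<otimes>\<^sub>U x \<oplus>\<^sub>U (w \<oplus>\<^sub>U z)"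
    using step(2) ext_ideal_closed[OF step(3)] ext_ideal_closed[OF step(5)] by (simp add: S.a_assoc)
  then show ?case using ext_ideal.step[OF step(1,2) step(4)[OF step(5)]] by simp
qed

lemma ext_ideal_mult: "y \<in> ext_ideal U u A \<Longrightarrow> x \<in> carrier U \<Longrightarrow> x \<otimes>\<^sub>U y \<in> ext_ideal U u A"
proof (induction rule: ext_ideal.induct)
  case zero
  then show ?case by (simp add: ext_ideal.zero)
next
  case (step a z w)
  have "u a \<in> carrier U" using step(1) A by auto
  then have "x \<otimes>\<^sub>U (u a \<otimes>\<^sub>U z \<oplus>\<^sub>U w) = u a \<otimes>\<^sub>U (x \<otimes>\<^sub>U z) \<oplus>\<^sub>U x \<otimes>\<^sub>U w"
    using step(2,5) ext_ideal_closed[OF step(3)] by (simp add: S.r_distr S.m_lcomm)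
  then show ?case using ext_ideal.step[OF step(1) _ step(4)[OF step(5)]] step(2,5) by simp
qed

lemma ext_ideal_gen: "a \<in> A \<Longrightarrow> x \<in> carrier U \<Longrightarrow> u a \<otimes>\<^sub>U x \<in> ext_ideal U u A"
  using ext_ideal.step[of a A x U "\<zero>\<^sub>U" u] ext_ideal.zero[of U u A] A by auto

lemma ext_ideal_submodule: "submodule (ext_ideal U u A) R V"
  by (rule module_submodule(1)[OF V])
    (auto intro: ext_ideal_closed ext_ideal.zero ext_ideal_add ext_ideal_mult)

end

text \<open>The intersection contains the product ideal \<open>I J\<close>. In a combination of
  elements of \<open>I\<close> representing 1, each term is multiplied by a combination of elements
  of \<open>J\<close> representing 1.\<close>

lemma ext_ideal_Int:
  assumes I: "ideal I R" and J: "ideal J R" and "\<one>\<^sub>U \<in> ext_ideal U u I" "\<one>\<^sub>U \<in> ext_ideal U u J"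
  shows "\<one>\<^sub>U \<in> ext_ideal U u (I \<inter> J)"
proof -
  interpret I: ideal I R by fact
  interpret J: ideal J R by fact
  have sub: "I \<subseteq> carrier R" "J \<subseteq> carrier R" "I \<inter> J \<subseteq> carrier R" using I.Icarr J.Icarr by auto
  have *: "u i \<otimes>\<^sub>U w \<in> ext_ideal U u (I \<inter> J)" if i: "i \<in> I" and w: "w \<in> ext_ideal U u J" for i w
    using w
  proof (induction rule: ext_ideal.induct)
    case zero
    then show ?case using i by (simp add: ext_ideal.zero I.Icarr)
  next
    case (step a z w)
    have "u i \<otimes>\<^sub>U (u a \<otimes>\<^sub>U z \<oplus>\<^sub>U w) = u (i \<otimes>\<^sub>R a) \<otimes>\<^sub>U z \<oplus>\<^sub>U u i \<otimes>\<^sub>U w"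
      using i step ext_ideal_closed[OF sub(2) step(3)] by (simp add: I.Icarr J.Icarr S.r_distr S.m_assoc)
    then show ?case
      using step i I.I_r_closed[of i a] J.I_l_closed[of a i] by (auto intro!: ext_ideal.step simp: I.Icarr J.Icarr simp del: hom_mult)
  qed
  have "w \<in> ext_ideal U u (I \<inter> J)" if "w \<in> ext_ideal U u I" for w
    using that
  proof (induction rule: ext_ideal.induct)
    case zero
    then show ?case by (rule ext_ideal.zero)
  next
    case (step a z w)
    have "z \<otimes>\<^sub>U (u a \<otimes>\<^sub>U \<one>\<^sub>U) \<in> ext_ideal U u (I \<inter> J)"
      by (rule ext_ideal_mult[OF sub(3) *[OF step(1) assms(4)] step(2)])
    then have "u a \<otimes>\<^sub>U z \<in> ext_ideal U u (I \<inter> J)"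
      using step(1,2) by (simp add: I.Icarr S.m_comm)
    then show ?case
      using ext_ideal_add[OF sub(3)] step(4) by blast
  qed
  then show ?thesis using assms(3) by blast
qed

text \<open>With \<open>A\<close> the annihilator of \<open>e\<close>, the module \<open>M\<close>
  is \<open>R/A\<close>, and tensoring it with \<open>U\<close> gives \<open>U/AU\<close>. The proof
  needs only the map towards \<open>U/AU\<close>, which sends \<open>r e\<close> and
  \<open>y\<close> to the class of \<open>u r\<close> times \<open>y\<close>; the vanishing tensor
  goes to the class of 1.\<close>

lemma cyclic_tensor_zero:
  assumes M: "module R M" and e: "e \<in> carrier M"
    and cyc: "\<And>m. m \<in> carrier M \<Longrightarrow> \<exists>r\<in>carrier R. m = r \<odot>\<^sub>M e"
    and z: "pure_tensor R M V e \<one>\<^sub>U = \<zero>\<^bsub>tensor_module R M V\<^esub>"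
  shows "\<one>\<^sub>U \<in> ext_ideal U u {r \<in> carrier R. r \<odot>\<^sub>M e = \<zero>\<^sub>M}"
proof -
  interpret MV: two_modules R M V by (rule two_modules.intro) (rule M V)+
  let ?A = "{r \<in> carrier R. r \<odot>\<^sub>M e = \<zero>\<^sub>M}"
  have A: "?A \<subseteq> carrier R" by auto
  note AU = ext_ideal_submodule[OF A]
  let ?N = "quotient_module V (ext_ideal U u ?A)"
  define q where "q y = ext_ideal U u ?A +>\<^bsub>V\<^esub> y" for y
  have N: "module R ?N" by (rule module_quotient[OF V AU])
  have q: "lin R V ?N q" using lin_quotient(1)[OF V AU] by (simp add: q_def[abs_def])
  have q0: "q y = \<zero>\<^bsub>?N\<^esub> \<longleftrightarrow> y \<in> ext_ideal U u ?A" if "y \<in> carrier U" for y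
    using coset_zero_iff[OF V AU, of y] that by (simp add: q_def)
  have l: "lin R (self_module R) V (\<lambda>r. u r \<otimes>\<^sub>U y)" if "y \<in> carrier U" for y
    by (rule linI) (use that in \<open>auto simp: S.l_distr S.m_assoc\<close>)
  have "\<forall>y\<in>carrier U. \<exists>h. lin R M ?N h \<and> (\<forall>r\<in>carrier R. h (r \<odot>\<^sub>M e) = q (u r \<otimes>\<^sub>U y))"
  proof
    fix y assume y: "y \<in> carrier U"
    obtain h where "lin R M ?N h" "\<And>r. r \<in> carrier (self_module R) \<Longrightarrow> h (r \<odot>\<^sub>M e) = q (u r \<otimes>\<^sub>U y)"
    proof (rule lin_factor[OF module_self[OF R.is_cring] M N lin_multiples[OF M e] _ lin_comp[OF l[OF y] q]])
      show "\<exists>r\<in>carrier (self_module R). r \<odot>\<^sub>M e = m" if "m \<in> carrier M" for m using cyc[OF that] by auto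
      fix r assume r: "r \<in> carrier (self_module R)" "r \<odot>\<^sub>M e = \<zero>\<^sub>M"
      then show "q (u r \<otimes>\<^sub>U y) = \<zero>\<^bsub>?N\<^esub>" using q0 ext_ideal_gen[OF A, of r y] y by simp
    qed (assumption | rule that)+
    then show "\<exists>h. lin R M ?N h \<and> (\<forall>r\<in>carrier R. h (r \<odot>\<^sub>M e) = q (u r \<otimes>\<^sub>U y))" by auto
  qed
  then obtain b where b: "\<forall>y\<in>carrier U. lin R M ?N (b y) \<and> (\<forall>r\<in>carrier R. b y (r \<odot>\<^sub>M e) = q (u r \<otimes>\<^sub>U y))" by (rule bchoice[THEN exE])
  have bl: "lin R M ?N (b y)" and be: "r \<in> carrier R \<Longrightarrow> b y (r \<odot>\<^sub>M e) = q (u r \<otimes>\<^sub>U y)" if "y \<in> carrier U" for y r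
    using b that by blast+
  have br: "lin R V ?N (\<lambda>y. b y m)" if m: "m \<in> carrier M" for m
  proof -
    obtain r where r: "r \<in> carrier R" "m = r \<odot>\<^sub>M e" using cyc[OF m] by blast
    have "lin R V V (\<lambda>y. u r \<otimes>\<^sub>U y)" by (rule linI) (use r(1) in \<open>auto simp: S.r_distr S.m_lcomm\<close>)
    from lin_comp[OF this q] show ?thesis
      by (rule lin_cong[OF V]) (use be[OF _ r(1)] r(2) in simp)
  qed
  have lift: "tensor_lift R M V ?N (\<lambda>m y. b y m) (pure_tensor R M V m \<one>\<^sub>U) = b \<one>\<^sub>U m" if "m \<in> carrier M" for m
    by (rule MV.tensor_lift_pure[OF N br]) (use bl that in simp_all)
  have "pure_tensor R M V \<zero>\<^sub>M \<one>\<^sub>U = \<zero>\<^sub>MV.T" using lin_zero[OF M MV.T MV.lin_pure_left, of "\<one>\<^sub>U"] by simp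
  then have "b \<one>\<^sub>U e = b \<one>\<^sub>U \<zero>\<^sub>M" using lift[OF e] lift[OF module_zero_closed[OF M]] z by simp
  also have "\<dots> = \<zero>\<^bsub>?N\<^esub>" by (rule lin_zero[OF M N bl[OF S.one_closed]])
  finally have "q \<one>\<^sub>U = \<zero>\<^bsub>?N\<^esub>" using be[OF S.one_closed R.one_closed] e by simp
  then show ?thesis using q0[OF S.one_closed] by simp
qed

text \<open>The tensor product of \<open>R/I\<close> and \<open>U\<close> is \<open>U/IU\<close>, so
  the defining condition of the filter says that \<open>I\<close> generates the unit ideal of
  \<open>U\<close>. From here on only this form is used.\<close>

lemma gabriel_iff: "I \<in> gabriel_ideals R U u \<longleftrightarrow> ideal I R \<and> \<one>\<^sub>U \<in> ext_ideal U u I"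
proof (cases "ideal I R")
  case False
  then show ?thesis by (simp add: gabriel_ideals_def)
next
  case True
  interpret I: ideal I R by fact
  define M where "M = restrict_scalars (\<lambda>r. I +>\<^sub>R r) (R Quot I)"
  have M: "module R M"
    unfolding M_def
    by (rule module_restrict_scalars[OF R.is_cring I.rcos_ring_hom I.quotient_is_cring[OF R.is_cring]])
  interpret MV: two_modules R M V by (rule two_modules.intro) (rule M V)+
  have carr: "carrier M = {I +>\<^sub>R r | r. r \<in> carrier R}"
    by (auto simp: M_def FactRing_def A_RCOSETS_def')
  have sm: "s \<odot>\<^sub>M (I +>\<^sub>R r) = I +>\<^sub>R (s \<otimes>\<^sub>R r)" if "r \<in> carrier R" "s \<in> carrier R" for r s
    using that by (simp add: M_def FactRing_def I.rcoset_mult_add)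
  have zeroM: "\<zero>\<^sub>M = I" by (simp add: M_def FactRing_def)
  have Izero: "I +>\<^sub>R r = I \<longleftrightarrow> r \<in> I" if "r \<in> carrier R" for r
    using that I.a_rcos_const I.rcos_const_imp_mem by blast
  let ?e = "I +>\<^sub>R \<one>\<^sub>R"
  have e: "?e \<in> carrier M" by (auto simp: carr)
  have G: "I \<in> gabriel_ideals R U u \<longleftrightarrow> zero_module MV.T"
    using True by (simp add: gabriel_ideals_def M_def)
  interpret T: module R MV.T by (rule MV.T)
  show ?thesis
  proof
    assume "I \<in> gabriel_ideals R U u"
    then have "pure_tensor R M V ?e \<one>\<^sub>U = \<zero>\<^sub>MV.T"
      using MV.pure_closed[OF e, of "\<one>\<^sub>U"] G by (simp add: zero_module_def)
    then have "\<one>\<^sub>U \<in> ext_ideal U u {r \<in> carrier R. r \<odot>\<^sub>M ?e = \<zero>\<^sub>M}"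
    proof (rule cyclic_tensor_zero[OF M e, rotated])
      fix m assume "m \<in> carrier M"
      then obtain r where "r \<in> carrier R" "m = I +>\<^sub>R r" by (auto simp: carr)
      then show "\<exists>r\<in>carrier R. m = r \<odot>\<^sub>M (I +>\<^sub>R \<one>\<^sub>R)"
        using sm[of "\<one>\<^sub>R" r] by auto
    qed
    moreover have "{r \<in> carrier R. r \<odot>\<^sub>M ?e = \<zero>\<^sub>M} \<subseteq> I"
    proof
      fix r assume r: "r \<in> {r \<in> carrier R. r \<odot>\<^sub>M ?e = \<zero>\<^sub>M}"
      then have "I +>\<^sub>R (r \<otimes>\<^sub>R \<one>\<^sub>R) = I"
        using sm[OF R.one_closed, of r] zeroM by simp
      moreover have "r \<in> carrier R" using r by blast
      ultimately show "r \<in> I" using Izero[of r] by (simp only: R.r_one)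
    qed
    ultimately have "\<one>\<^sub>U \<in> ext_ideal U u I" by (rule ext_ideal_mono[rotated])
    with True show "ideal I R \<and> \<one>\<^sub>U \<in> ext_ideal U u I" ..
  next
    assume "ideal I R \<and> \<one>\<^sub>U \<in> ext_ideal U u I"
    \<comment> \<open>A coefficient \<open>a\<close> from \<open>I\<close> can be moved across the
      tensor sign, where it kills \<open>m\<close>. Once 1 is known to lie in \<open>IU\<close>,
      taking \<open>w = 1\<close> makes every pure tensor zero.\<close>
    have "pure_tensor R M V m (y \<otimes>\<^sub>U w) = \<zero>\<^sub>MV.T"
      if "w \<in> ext_ideal U u I" "m \<in> carrier M" "y \<in> carrier U" for w m y
      using that
    proof (induction rule: ext_ideal.induct)
      case zero
      then show ?case using lin_zero[OF V MV.T MV.lin_pure_right] by simp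
    next
      case (step a z w)
      have a: "a \<in> carrier R" using step(1) I.Icarr by blast
      have w: "w \<in> carrier U" using ext_ideal_closed[OF _ step(3)] I.Icarr by blast
      have am: "a \<odot>\<^sub>M m = \<zero>\<^sub>M"
      proof -
        obtain r where r: "r \<in> carrier R" "m = I +>\<^sub>R r" using step(5) by (auto simp: carr)
        have "a \<odot>\<^sub>M m = I +>\<^sub>R (a \<otimes>\<^sub>R r)" unfolding r(2) by (rule sm[OF r(1) a])
        also have "\<dots> = I" using Izero[of "a \<otimes>\<^sub>R r"] a r(1) I.I_r_closed[OF step(1) r(1)] by blast
        finally show ?thesis by (simp only: zeroM)
      qed
      have yz: "y \<otimes>\<^sub>U z \<in> carrier V" "y \<otimes>\<^sub>U w \<in> carrier V" "a \<odot>\<^sub>V (y \<otimes>\<^sub>U z) \<in> carrier V"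
        using step w a by auto
      have "y \<otimes>\<^sub>U (u a \<otimes>\<^sub>U z \<oplus>\<^sub>U w) = a \<odot>\<^sub>V (y \<otimes>\<^sub>U z) \<oplus>\<^sub>V y \<otimes>\<^sub>U w"
        using step(2,6) a w by (simp add: S.r_distr S.m_lcomm)
      then have "pure_tensor R M V m (y \<otimes>\<^sub>U (u a \<otimes>\<^sub>U z \<oplus>\<^sub>U w)) =
          pure_tensor R M V m (a \<odot>\<^sub>V (y \<otimes>\<^sub>U z)) \<oplus>\<^sub>MV.T pure_tensor R M V m (y \<otimes>\<^sub>U w)"
        using MV.pure_add_right[OF step(5) yz(3) yz(2)] by (simp only:)
      also have "pure_tensor R M V m (y \<otimes>\<^sub>U w) = \<zero>\<^sub>MV.T"
        using step by blast
      also have "pure_tensor R M V m (a \<odot>\<^sub>V (y \<otimes>\<^sub>U z)) = pure_tensor R M V (a \<odot>\<^sub>M m) (y \<otimes>\<^sub>U z)"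
        by (simp only: MV.pure_smult_right[OF a step(5) yz(1)] MV.pure_smult_left[OF a step(5) yz(1)])
      also have "\<dots> = \<zero>\<^sub>MV.T"
        unfolding am by (rule lin_zero[OF M MV.T MV.lin_pure_left[OF yz(1)]])
      finally show ?case by simp
    qed
    then have pz: "pure_tensor R M V m y = \<zero>\<^sub>MV.T" if "m \<in> carrier M" "y \<in> carrier U" for m y
      using \<open>ideal I R \<and> _\<close> that by (metis S.r_one)
    have "f \<in> MV.K" if "f \<in> carrier MV.F" for f
      using R.is_cring that
    proof (induction rule: free_induct)
      case zero
      then show ?case by (rule submodule_props(2)[OF MV.F MV.K])
    next
      case (step r x f)
      have "free_gen R x \<in> MV.K"
        using pz[of "fst x" "snd x"] MV.pure_eq_zero_iff[of "fst x" "snd x"] step(2) by auto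
      then show ?case
        using step submodule_props(3,4)[OF MV.F MV.K] by blast
    qed
    then show "I \<in> gabriel_ideals R U u"
      unfolding G tensor_module_def zero_quotient_iff[OF MV.F MV.K] by blast
  qed
qed

text \<open>Flatness is only known for the test modules, so \<open>e \<otimes> 1 = 0\<close> is first moved to a finitely
  generated submodule and from there to an isomorphic quotient of \<open>R\<^sup>n\<close>.\<close>

lemma flat_annihilator:
  fixes N :: "('a, 'c, 'm) module_scheme"
  assumes flat: "flat_module R V" and N: "module R N" and e: "e \<in> carrier N"
    and z: "pure_tensor R N V e \<one>\<^sub>U = \<zero>\<^bsub>tensor_module R N V\<^esub>"
  shows "\<one>\<^sub>U \<in> ext_ideal U u {r \<in> carrier R. r \<odot>\<^sub>N e = \<zero>\<^sub>N}"
proof -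
  interpret NV: two_modules R N V by (rule two_modules.intro) (rule N V)+
  obtain A where A: "finite A" "A \<subseteq> carrier N" and AK: "\<And>L. submodule L R N \<Longrightarrow> A \<subseteq> L \<Longrightarrow> NV.e (e, \<one>\<^sub>U) \<in> tensor_kernel R (N\<lparr>carrier := L\<rparr>) V"
    using NV.kernel_finite[of "NV.e (e, \<one>\<^sub>U)"] NV.pure_eq_zero_iff[OF e, of "\<one>\<^sub>U"] z by auto
  obtain ws where ws: "set ws = insert e A" using finite_list[of "insert e A"] A(1) by auto
  define F where "F = free_module R (UNIV :: nat set)"
  have F: "module R F" unfolding F_def by (rule module_free[OF R.is_cring])
  \<comment> \<open>Padding the finite list of generators by zero gives a map from one free module
    on the naturals, whose cosets are the elements of the test modules.\<close>
  define at where "at i = (if i < length ws then ws ! i else \<zero>\<^sub>N)" for i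
  have at: "at i \<in> carrier N" for i using ws A(2) e nth_mem[of i ws] by (auto simp: at_def)
  define s where "s = free_lift R UNIV N at"
  have s: "lin R F N s" "s (free_gen R i) = at i" for i
    using lin_free_lift[OF N at, of UNIV] free_lift_gen[OF N at, of i UNIV] by (simp_all add: s_def F_def)
  let ?L = "s ` carrier F"
  define M where "M = N\<lparr>carrier := ?L\<rparr>"
  have L: "submodule ?L R N" by (rule lin_image_submodule[OF F N s(1)])
  have M: "module R M" unfolding M_def by (rule module_submodule(2)[OF N submodule_props(1-4)[OF N L]])
  have sM: "lin R F M s" using s(1) by (auto simp: lin_def M_def)
  have AL: "insert e A \<subseteq> ?L"
  proof
    fix x assume "x \<in> insert e A"
    then obtain i where "i < length ws" "x = ws ! i" using ws by (metis in_set_conv_nth)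
    then have "x = s (free_gen R i)" using s(2) by (simp add: at_def)
    then show "x \<in> ?L" using free_gen_closed[OF R.is_cring, of i UNIV] by (simp add: F_def)
  qed
  then have eM: "e \<in> carrier M" by (simp add: M_def)
  interpret MV: two_modules R M V by (rule two_modules.intro) (rule M V)+
  have "NV.e (e, \<one>\<^sub>U) \<in> MV.K" unfolding M_def by (rule AK[OF L]) (use AL in blast)
  then have zM: "pure_tensor R M V e \<one>\<^sub>U = \<zero>\<^sub>MV.T" using MV.pure_eq_zero_iff[OF eM, of "\<one>\<^sub>U"] by simp
  let ?k = "{k \<in> carrier F. s k = \<zero>\<^sub>N}"
  interpret F: module R F by (rule F)
  interpret N: module R N by (rule N)
  have k: "submodule ?k R F"
    by (rule module_submodule(1)[OF F Collect_restrict]) (use lin_zero[OF F N s(1)] in \<open>auto simp: lin_add[OF s(1)] lin_smult[OF s(1)]\<close>)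
  \<comment> \<open>\<open>?Q\<close> is a copy of \<open>M\<close> on the type of the test
    modules.\<close>
  let ?Q = "quotient_module F ?k"
  have Q: "module R ?Q" by (rule module_quotient[OF F k])
  define q where "q x = ?k +>\<^bsub>F\<^esub> x" for x
  have q: "lin R F ?Q q" using lin_quotient(1)[OF F k] by (simp add: q_def[abs_def])
  have q0: "q x = \<zero>\<^bsub>?Q\<^esub> \<longleftrightarrow> s x = \<zero>\<^sub>N" if "x \<in> carrier F" for x
    using coset_zero_iff[OF F k that] that by (simp add: q_def)
  obtain \<phi> where \<phi>: "lin R M ?Q \<phi>" "\<And>x. x \<in> carrier F \<Longrightarrow> \<phi> (s x) = q x"
  proof (rule lin_factor[OF F M Q sM _ q])
    show "q x = \<zero>\<^bsub>?Q\<^esub>" if "x \<in> carrier F" "s x = \<zero>\<^sub>M" for x using that q0 by (simp add: M_def)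
  qed (assumption | rule that | auto simp: M_def)+
  have \<phi>0: "x = \<zero>\<^sub>N" if "x \<in> carrier M" "\<phi> x = \<zero>\<^bsub>?Q\<^esub>" for x using that \<phi>(2) q0 by (auto simp: M_def)
  let ?e = "\<phi> e"
  have eQ: "?e \<in> carrier ?Q" by (rule lin_closed[OF \<phi>(1) eM])
  let ?C = "(\<lambda>r. r \<odot>\<^bsub>?Q\<^esub> ?e) ` carrier (self_module R)"
  have C: "submodule ?C R ?Q" by (rule lin_image_submodule[OF module_self[OF R.is_cring] Q lin_multiples[OF Q eQ]])
  \<comment> \<open>Flatness is applied to the inclusion into \<open>?Q\<close> of the cyclic
    submodule generated by the image of \<open>e\<close>. It reflects the vanishing of the tensor
    from \<open>?Q\<close> to \<open>D\<close>, where \<open>cyclic_tensor_zero\<close>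
    applies.\<close>
  define D where "D = ?Q\<lparr>carrier := ?C\<rparr>"
  have D: "module R D" unfolding D_def by (rule module_submodule(2)[OF Q submodule_props(1-4)[OF Q C]])
  have DQ: "carrier D \<subseteq> carrier ?Q" using submodule_props(1)[OF Q C] by (simp add: D_def)
  have ops: "\<zero>\<^sub>D = \<zero>\<^bsub>?Q\<^esub>" "smult D = smult ?Q" by (simp_all add: D_def)
  have eD: "?e \<in> carrier D" using module.smult_one[OF Q eQ] by (auto simp: D_def intro!: image_eqI[of _ _ "\<one>\<^sub>R"])
  let ?f = "\<lambda>x\<in>carrier D. x"
  have f: "?f \<in> module_hom R D ?Q" by (rule lin_restrict[OF D]) (use DQ in \<open>auto simp: lin_def D_def\<close>)
  have fl: "lin R D ?Q ?f" using f by (rule module_hom_lin)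
  interpret DV: two_modules R D V by (rule two_modules.intro) (rule D V)+
  interpret QV: two_modules R ?Q V by (rule two_modules.intro) (rule Q V)+
  have inj: "inj_on (tensor_map R D ?Q V ?f) (carrier DV.T)"
    using flat D Q f unfolding flat_module_def by (auto simp: inj_on_restrict_eq)
  have one: "\<one>\<^sub>U \<in> carrier V" by simp
  have zero: "pure_tensor R X V \<zero>\<^sub>X \<one>\<^sub>U = \<zero>\<^bsub>tensor_module R X V\<^esub>" if X: "module R X" for X :: "('a, 'x, 'k) module_scheme"
    using lin_zero[OF X two_modules.T two_modules.lin_pure_left[OF _ one]] two_modules.intro[OF X V] by blast
  have "pure_tensor R ?Q V ?e \<one>\<^sub>U = pure_tensor R ?Q V \<zero>\<^bsub>?Q\<^esub> \<one>\<^sub>U"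
    using tensor_map_pure[OF M Q V \<phi>(1) eM one] tensor_map_pure[OF M Q V \<phi>(1) module_zero_closed[OF M] one]
    unfolding zM zero[OF M] lin_zero[OF M Q \<phi>(1)] by simp
  then have "tensor_map R D ?Q V ?f (pure_tensor R D V ?e \<one>\<^sub>U) = tensor_map R D ?Q V ?f (pure_tensor R D V \<zero>\<^sub>D \<one>\<^sub>U)"
    using tensor_map_pure[OF D Q V fl eD one] tensor_map_pure[OF D Q V fl module_zero_closed[OF D] one] eD module_zero_closed[OF D] ops by simp
  then have "pure_tensor R D V ?e \<one>\<^sub>U = pure_tensor R D V \<zero>\<^sub>D \<one>\<^sub>U"
    by (rule inj_onD[OF inj]) (rule DV.pure_closed[OF eD one] DV.pure_closed[OF module_zero_closed[OF D] one])+
  then have "pure_tensor R D V ?e \<one>\<^sub>U = \<zero>\<^sub>DV.T" unfolding zero[OF D] .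
  then have "\<one>\<^sub>U \<in> ext_ideal U u {r \<in> carrier R. r \<odot>\<^sub>D ?e = \<zero>\<^sub>D}"
    by (rule cyclic_tensor_zero[OF D eD, rotated]) (auto simp: D_def)
  moreover have "{r \<in> carrier R. r \<odot>\<^sub>D ?e = \<zero>\<^sub>D} \<subseteq> {r \<in> carrier R. r \<odot>\<^sub>N e = \<zero>\<^sub>N}"
  proof (intro subsetI CollectI conjI; elim CollectE conjE)
    fix r assume r: "r \<in> carrier R" "r \<odot>\<^sub>D ?e = \<zero>\<^sub>D"
    have "r \<odot>\<^sub>M e = \<zero>\<^sub>N"
      by (rule \<phi>0[OF module.smult_closed[OF M r(1) eM]]) (use r lin_smult[OF \<phi>(1) r(1) eM] ops in simp)
    then show "r \<odot>\<^sub>N e = \<zero>\<^sub>N" by (simp add: M_def)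
  qed
  ultimately show ?thesis by (rule ext_ideal_mono[rotated])
qed

end

section \<open>Denominators and annihilators for a flat epimorphism\<close>

locale flat_epi = ring_ext +
  assumes flat_epi: "flat_epimorphism R U u"
begin

lemma flat: "flat_module R V"
  using flat_epi by (simp add: flat_epimorphism_def)

text \<open>In \<open>V/u(R) \<otimes> V\<close> we have \<open>x \<otimes> 1 = 1 \<otimes> x = 0\<close>.\<close>

lemma denominator_ext:
  assumes x: "x \<in> carrier U"
  shows "\<one>\<^sub>U \<in> ext_ideal U u {r \<in> carrier R. u r \<otimes>\<^sub>U x \<in> u ` carrier R}"
proof -
  interpret VV: two_modules R V V by (rule two_modules.intro) (rule V)+
  have "lin R (self_module R) V u" by (rule linI) auto
  then have I: "submodule (u ` carrier R) R V" using lin_image_submodule[OF module_self[OF R.is_cring] V] by fastforce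
  let ?N = "quotient_module V (u ` carrier R)"
  have N: "module R ?N" by (rule module_quotient[OF V I])
  interpret NV: two_modules R ?N V by (rule two_modules.intro) (rule N V)+
  define q where "q y = u ` carrier R +>\<^bsub>V\<^esub> y" for y
  have q: "lin R V ?N q" using lin_quotient(1)[OF V I] by (simp add: q_def[abs_def])
  have q0: "q y = \<zero>\<^bsub>?N\<^esub> \<longleftrightarrow> y \<in> u ` carrier R" if "y \<in> carrier U" for y
    using coset_zero_iff[OF V I, of y] that by (simp add: q_def)
  have xV: "x \<in> carrier V" "\<one>\<^sub>U \<in> carrier V" using x by simp_all
  let ?t = "tensor_lift R V V V (\<lambda>x y. x \<otimes>\<^sub>U y)"
  have inj: "inj_on ?t (carrier VV.T)"
    using flat_epi by (simp add: flat_epimorphism_def Let_def module_iso_def bij_betw_def)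
  have t: "?t (pure_tensor R V V a b) = a \<otimes>\<^sub>U b" if "a \<in> carrier U" "b \<in> carrier U" for a b
    by (rule VV.tensor_lift_pure[OF V]) (use that in \<open>auto simp: lin_def S.r_distr S.l_distr S.m_ac\<close>)
  have "pure_tensor R V V x \<one>\<^sub>U = pure_tensor R V V \<one>\<^sub>U x"
    by (rule inj_onD[OF inj _ VV.pure_closed[OF xV] VV.pure_closed[OF xV(2,1)]]) (use x in \<open>simp add: t\<close>)
  then have "pure_tensor R ?N V (q x) \<one>\<^sub>U = pure_tensor R ?N V (q \<one>\<^sub>U) x"
    using tensor_map_pure[OF V N V q xV] tensor_map_pure[OF V N V q xV(2,1)] by simp
  also have "q \<one>\<^sub>U = \<zero>\<^bsub>?N\<^esub>" using q0[OF S.one_closed] by (metis R.one_closed hom_one imageI)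
  also have "pure_tensor R ?N V \<zero>\<^bsub>?N\<^esub> x = \<zero>\<^sub>NV.T" by (rule lin_zero[OF N NV.T NV.lin_pure_left[OF xV(1)]])
  finally have "\<one>\<^sub>U \<in> ext_ideal U u {r \<in> carrier R. r \<odot>\<^bsub>?N\<^esub> q x = \<zero>\<^bsub>?N\<^esub>}"
    by (rule flat_annihilator[OF flat N lin_closed[OF q xV(1)]])
  then show ?thesis
    by (rule ext_ideal_mono[rotated]) (use q0 lin_smult[OF q _ xV(1), symmetric] x in auto)
qed

text \<open>In the tensor product of \<open>R\<close> and \<open>U\<close>, the tensor of
  \<open>a\<close> and 1 equals that of 1 and \<open>u a\<close>, hence is zero. Flatness turns this
  into a statement about the annihilator of \<open>a\<close>.\<close>

lemma annihilator_ext: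
  assumes a: "a \<in> carrier R" "u a = \<zero>\<^sub>U"
  shows "\<one>\<^sub>U \<in> ext_ideal U u {r \<in> carrier R. r \<otimes>\<^sub>R a = \<zero>\<^sub>R}"
proof -
  let ?N = "self_module R"
  have N: "module R ?N" by (rule module_self[OF R.is_cring])
  interpret NV: two_modules R ?N V by (rule two_modules.intro) (rule N V)+
  have c: "\<one>\<^sub>R \<in> carrier ?N" "\<one>\<^sub>U \<in> carrier V" by simp_all
  have "pure_tensor R ?N V (a \<odot>\<^bsub>?N\<^esub> \<one>\<^sub>R) \<one>\<^sub>U = pure_tensor R ?N V \<one>\<^sub>R (a \<odot>\<^bsub>V\<^esub> \<one>\<^sub>U)"
    unfolding NV.pure_smult_left[OF a(1) c] NV.pure_smult_right[OF a(1) c] ..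
  also have "a \<odot>\<^bsub>V\<^esub> \<one>\<^sub>U = \<zero>\<^bsub>V\<^esub>" using a by simp
  also have "pure_tensor R ?N V \<one>\<^sub>R \<zero>\<^bsub>V\<^esub> = \<zero>\<^sub>NV.T" by (rule lin_zero[OF V NV.T NV.lin_pure_right[OF c(1)]])
  finally show ?thesis using flat_annihilator[OF flat N, of a] a(1) by simp
qed

end

section \<open>Ideals\<close>

lemma ideal_of_closed:
  assumes "cring R" "I \<subseteq> carrier R" "\<zero>\<^sub>R \<in> I"
    and add: "\<And>x y. x \<in> I \<Longrightarrow> y \<in> I \<Longrightarrow> x \<oplus>\<^sub>R y \<in> I"
    and mul: "\<And>r x. r \<in> carrier R \<Longrightarrow> x \<in> I \<Longrightarrow> r \<otimes>\<^sub>R x \<in> I"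
  shows "ideal I R"
proof -
  interpret cring R by fact
  have neg: "\<ominus>\<^sub>R x \<in> I" if "x \<in> I" for x
    using mul[of "\<ominus>\<^sub>R \<one>\<^sub>R" x] that assms(2) by (auto simp: l_minus subset_iff)
  show ?thesis
  proof (rule idealI)
    show "ring R" by (rule ring_axioms)
    show "subgroup I (add_monoid R)"
      using assms neg by unfold_locales (auto simp: a_inv_def[symmetric])
    show "x \<otimes>\<^sub>R a \<in> I" "a \<otimes>\<^sub>R x \<in> I" if "a \<in> I" "x \<in> carrier R" for a x
      using mul[OF that(2,1)] that assms(2) by (auto simp: m_comm subset_iff)
  qed
qed

lemma ideal_facts:
  assumes "ideal I R"
  shows "I \<subseteq> carrier R" "\<zero>\<^sub>R \<in> I" "\<And>x y. x \<in> I \<Longrightarrow> y \<in> I \<Longrightarrow> x \<oplus>\<^sub>R y \<in> I"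
    "\<And>r x. r \<in> carrier R \<Longrightarrow> x \<in> I \<Longrightarrow> r \<otimes>\<^sub>R x \<in> I"
    "\<And>r x. r \<in> carrier R \<Longrightarrow> x \<in> I \<Longrightarrow> x \<otimes>\<^sub>R r \<in> I"
    "\<And>x y. x \<in> I \<Longrightarrow> y \<in> I \<Longrightarrow> x \<ominus>\<^sub>R y \<in> I"
proof -
  interpret ideal I R by fact
  show "I \<subseteq> carrier R" by (rule a_subset)
  show "\<zero>\<^sub>R \<in> I" by simp
  show "\<And>x y. x \<in> I \<Longrightarrow> y \<in> I \<Longrightarrow> x \<oplus>\<^sub>R y \<in> I" by simp
  show "\<And>r x. r \<in> carrier R \<Longrightarrow> x \<in> I \<Longrightarrow> r \<otimes>\<^sub>R x \<in> I" by (rule I_l_closed)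
  show "\<And>r x. r \<in> carrier R \<Longrightarrow> x \<in> I \<Longrightarrow> x \<otimes>\<^sub>R r \<in> I" by (rule I_r_closed)
  show "\<And>x y. x \<in> I \<Longrightarrow> y \<in> I \<Longrightarrow> x \<ominus>\<^sub>R y \<in> I" by (simp add: a_minus_def)
qed

text \<open>Zorn's lemma gives an ideal that is maximal among those containing \<open>I\<close> and
  disjoint from \<open>S\<close>, and such an ideal is prime: if neither factor lies in
  \<open>P\<close>, both enlarged ideals meet \<open>S\<close>, and multiplying the two elements
  found brings an element of \<open>S\<close> into \<open>P\<close>.\<close>

lemma (in cring) prime_avoiding:
  assumes I: "ideal I R" and S: "\<one> \<in> S" "\<And>s t. s \<in> S \<Longrightarrow> t \<in> S \<Longrightarrow> s \<otimes> t \<in> S" and disj: "S \<inter> I = {}"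
  obtains P where "primeideal P R" "I \<subseteq> P" "S \<inter> P = {}"
proof -
  define A where "A = {J. ideal J R \<and> I \<subseteq> J \<and> S \<inter> J = {}}"
  have "\<exists>M\<in>A. \<forall>X\<in>A. M \<subseteq> X \<longrightarrow> X = M"
  proof (rule subset_Zorn_nonempty)
    show "A \<noteq> {}" using I disj by (auto simp: A_def)
    fix C assume C: "C \<noteq> {}" "subset.chain A C"
    then have CA: "J \<in> A" if "J \<in> C" for J using that by (auto simp: subset.chain_def)
    have ch: "J \<subseteq> J' \<or> J' \<subseteq> J" if "J \<in> C" "J' \<in> C" for J J'
      using C(2) that unfolding subset_chain_def by blast
    have Ci: "ideal J R" if "J \<in> C" for J using CA[OF that] by (simp add: A_def)
    have "ideal (\<Union>C) R"
    proof (rule ideal_of_closed[OF is_cring])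
      show "\<Union>C \<subseteq> carrier R" using ideal_facts(1)[OF Ci] by blast
      show "\<zero> \<in> \<Union>C" using C(1) ideal_facts(2)[OF Ci] by blast
      show "x \<oplus> y \<in> \<Union>C" if xy: "x \<in> \<Union>C" "y \<in> \<Union>C" for x y
      proof -
        obtain J J' where J: "J \<in> C" "x \<in> J" "J' \<in> C" "y \<in> J'" using xy by blast
        then show ?thesis using ch[OF J(1,3)] ideal_facts(3)[OF Ci, of J] ideal_facts(3)[OF Ci, of J'] by blast
      qed
      show "r \<otimes> x \<in> \<Union>C" if "r \<in> carrier R" "x \<in> \<Union>C" for r x
        using that ideal_facts(4)[OF Ci] by blast
    qed
    then show "\<Union>C \<in> A" using C(1) CA by (auto simp: A_def)
  qed
  then obtain P where P: "ideal P R" "I \<subseteq> P" "S \<inter> P = {}" and max: "\<And>X. X \<in> A \<Longrightarrow> P \<subseteq> X \<Longrightarrow> X = P"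
    by (auto simp: A_def)
  note Pf = ideal_facts[OF P(1)]
  \<comment> \<open>Otherwise \<open>P\<close> together with the multiples of \<open>a\<close> would
    be a larger member of \<open>A\<close>.\<close>
  have meet: "\<exists>p\<in>P. \<exists>r\<in>carrier R. p \<oplus> r \<otimes> a \<in> S" if a: "a \<in> carrier R" "a \<notin> P" for a
  proof (rule ccontr)
    assume no: "\<not> ?thesis"
    let ?J = "{p \<oplus> r \<otimes> a | p r. p \<in> P \<and> r \<in> carrier R}"
    have "ideal ?J R"
    proof (rule ideal_of_closed[OF is_cring])
      show "?J \<subseteq> carrier R" using Pf(1) a(1) by auto
      have "\<zero> \<oplus> \<zero> \<otimes> a \<in> ?J" using Pf(2) zero_closed by blast
      then show "\<zero> \<in> ?J" using a by simp
      show "x \<oplus> y \<in> ?J" if xy: "x \<in> ?J" "y \<in> ?J" for x y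
      proof -
        obtain p r q s where "p \<in> P" "r \<in> carrier R" "x = p \<oplus> r \<otimes> a" "q \<in> P" "s \<in> carrier R" "y = q \<oplus> s \<otimes> a"
          using xy by blast
        moreover from this have "x \<oplus> y = (p \<oplus> q) \<oplus> (r \<oplus> s) \<otimes> a"
          using a Pf(1) by (auto simp: l_distr a_ac subset_iff)
        ultimately show ?thesis using Pf(3) a_closed by blast
      qed
      show "t \<otimes> x \<in> ?J" if t: "t \<in> carrier R" and x: "x \<in> ?J" for t x
      proof -
        obtain p r where "p \<in> P" "r \<in> carrier R" "x = p \<oplus> r \<otimes> a" using x by blast
        moreover from this have "t \<otimes> x = t \<otimes> p \<oplus> (t \<otimes> r) \<otimes> a"
          using a t Pf(1) by (auto simp: r_distr m_assoc subset_iff)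
        ultimately show ?thesis using Pf(4)[OF t] m_closed[OF t] by blast
      qed
    qed
    moreover have "P \<subseteq> ?J"
    proof
      fix p assume p: "p \<in> P"
      then have "p \<oplus> \<zero> \<otimes> a \<in> ?J" by blast
      then show "p \<in> ?J" using p a Pf(1) by (auto simp: subset_iff)
    qed
    ultimately have "?J \<in> A" "P \<subseteq> ?J" using P no by (auto simp: A_def)
    then have "?J = P" by (rule max)
    moreover have "\<zero> \<oplus> \<one> \<otimes> a \<in> ?J" using Pf(2) one_closed by blast
    ultimately show False using a by simp
  qed
  have "primeideal P R"
  proof (rule primeidealI[OF P(1) is_cring])
    show "carrier R \<noteq> P" using P(3) S(1) one_closed by blast
    fix a b assume ab: "a \<in> carrier R" "b \<in> carrier R" "a \<otimes> b \<in> P"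
    show "a \<in> P \<or> b \<in> P"
    proof (rule ccontr)
      assume "\<not> ?thesis"
      then obtain p r q s where pr: "p \<in> P" "r \<in> carrier R" "p \<oplus> r \<otimes> a \<in> S" "q \<in> P" "s \<in> carrier R" "q \<oplus> s \<otimes> b \<in> S"
        using meet ab by meson
      have c: "p \<in> carrier R" "q \<in> carrier R" using pr Pf(1) by auto
      have "(p \<oplus> r \<otimes> a) \<otimes> (q \<oplus> s \<otimes> b) = (q \<oplus> s \<otimes> b) \<otimes> p \<oplus> ((r \<otimes> a) \<otimes> q \<oplus> (r \<otimes> s) \<otimes> (a \<otimes> b))"
        using c pr ab by (simp add: l_distr r_distr m_ac a_ac)
      also have "\<dots> \<in> P" 
        using pr ab c by (intro Pf(3) Pf(4)[of _ p] Pf(4)[of _ q] Pf(4)[of _ "a \<otimes> b"]) auto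
      finally show False using S(2)[OF pr(3,6)] P(3) by blast
    qed
  qed
  then show thesis using that P by blast
qed

section \<open>Ideals of a quotient ring and nilpotence in dimension zero\<close>

context cring
begin

lemma quot_mem_image:
  assumes I: "ideal I R" and J: "ideal J R" "I \<subseteq> J" and r: "r \<in> carrier R"
  shows "I +> r \<in> (+>) I ` J \<longleftrightarrow> r \<in> J"
proof -
  have JQ: "(+>) I ` J \<subseteq> carrier (R Quot I)"
    using ideal_facts(1)[OF ring_ideal_imp_quot_ideal[OF I J(1)]] .
  have "\<Union> ((+>) I ` J) = J" using ideal_incl_iff[OF I J(1)] J(2) by blast
  then show ?thesis using canonical_proj_vimage_mem_iff[OF I JQ r] by simp
qed

lemma quot_carrier: "x \<in> carrier (R Quot I) \<longleftrightarrow> (\<exists>r\<in>carrier R. x = I +> r)"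
  by (auto simp: FactRing_def A_RCOSETS_def')

lemma quot_mult: "ideal I R \<Longrightarrow> r \<in> carrier R \<Longrightarrow> s \<in> carrier R \<Longrightarrow> (I +> r) \<otimes>\<^bsub>R Quot I\<^esub> (I +> s) = I +> (r \<otimes> s)"
  by (simp add: FactRing_def ideal.rcoset_mult_add)

lemma quot_image_inj:
  assumes "ideal I R" "ideal J R" "I \<subseteq> J" "ideal J' R" "I \<subseteq> J'" "(+>) I ` J = (+>) I ` J'"
  shows "J = J'"
  using ideal_incl_iff[OF assms(1,2)] ideal_incl_iff[OF assms(1,4)] assms(3,5,6) by auto

lemma quot_image_carrier:
  assumes "ideal I R" "ideal J R" "I \<subseteq> J" "(+>) I ` J = carrier (R Quot I)"
  shows "J = carrier R"
proof -
  have "(+>) I ` J = (+>) I ` carrier R" unfolding assms(4) by (auto simp: quot_carrier)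
  then show ?thesis using quot_image_inj[OF assms(1-3) oneideal] ideal_facts(1)[OF assms(1)] by blast
qed

lemma prime_quot:
  assumes I: "ideal I R" and P: "primeideal P R" "I \<subseteq> P"
  shows "primeideal ((+>) I ` P) (R Quot I)"
proof -
  interpret P: primeideal P R by fact
  have PI: "ideal P R" by (rule P.is_ideal)
  show ?thesis
  proof (rule primeidealI[OF ring_ideal_imp_quot_ideal[OF I PI] ideal.quotient_is_cring[OF I is_cring]])
    show "carrier (R Quot I) \<noteq> (+>) I ` P"
      using quot_image_carrier[OF I PI P(2)] P.I_notcarr by metis
    fix a b assume "a \<in> carrier (R Quot I)" "b \<in> carrier (R Quot I)" and ab: "a \<otimes>\<^bsub>R Quot I\<^esub> b \<in> (+>) I ` P"
    then obtain r s where rs: "r \<in> carrier R" "a = I +> r" "s \<in> carrier R" "b = I +> s" by (auto simp: quot_carrier)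
    then have "r \<otimes> s \<in> P" using ab quot_mult[OF I] quot_mem_image[OF I PI P(2)] by simp
    then show "a \<in> (+>) I ` P \<or> b \<in> (+>) I ` P"
      using P.I_prime rs by blast
  qed
qed

lemma maximal_quot:
  assumes I: "ideal I R" and m: "maximalideal m R" "I \<subseteq> m"
  shows "maximalideal ((+>) I ` m) (R Quot I)"
proof -
  interpret m: maximalideal m R by fact
  have mI: "ideal m R" by (rule m.is_ideal)
  show ?thesis
  proof (rule maximalidealI[OF ring_ideal_imp_quot_ideal[OF I mI]])
    show "carrier (R Quot I) \<noteq> (+>) I ` m"
      using quot_image_carrier[OF I mI m(2)] m.I_notcarr by metis
    fix J assume J: "ideal J (R Quot I)" "(+>) I ` m \<subseteq> J" "J \<subseteq> carrier (R Quot I)"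
    obtain J' where J': "ideal J' R" "I \<subseteq> J'" "J = (+>) I ` J'"
    proof -
      have "J \<in> (\<lambda>J. (+>) I ` J) ` {J. ideal J R \<and> I \<subseteq> J}"
        unfolding bij_betw_imp_surj_on[OF quot_ideal_correspondence[OF I]] using J(1) by blast
      then show thesis using that by blast
    qed
    have "m \<subseteq> J'"
    proof
      fix x assume "x \<in> m"
      then have "I +> x \<in> (+>) I ` J'" "x \<in> carrier R" using J(2) J'(3) ideal_facts(1)[OF mI] by auto
      then show "x \<in> J'" using quot_mem_image[OF I J'(1,2)] by blast
    qed
    then have "J' = m \<or> J' = carrier R" using m.I_maximal[OF J'(1)] ideal_facts(1)[OF J'(1)] by blast
    then show "J = (+>) I ` m \<or> J = carrier (R Quot I)"
      using J'(3) by (auto simp: quot_carrier)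
  qed
qed

lemma semilocal_quot_finite:
  assumes I: "ideal I R" and "semilocal (R Quot I)"
  shows "finite {m. maximalideal m R \<and> I \<subseteq> m}"
proof (rule finite_imageD)
  show "finite ((\<lambda>m. (+>) I ` m) ` {m. maximalideal m R \<and> I \<subseteq> m})"
    by (rule finite_subset[of _ "Max_ideals (R Quot I)"])
      (use assms maximal_quot[OF I] in \<open>auto simp: semilocal_def Max_ideals_def\<close>)
  show "inj_on (\<lambda>m. (+>) I ` m) {m. maximalideal m R \<and> I \<subseteq> m}"
    by (rule inj_onI, elim CollectE conjE, rule quot_image_inj[OF I]) (auto simp: maximalideal_def)
qed

lemma maximalideal_cofactor:
  assumes m: "maximalideal m R" and s: "s \<in> carrier R" "s \<notin> m"
  obtains a \<mu> where "a \<in> carrier R" "\<mu> \<in> m" "\<one> = a \<otimes> s \<oplus> \<mu>"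
proof -
  interpret m: maximalideal m R by fact
  note mf = ideal_facts[OF m.is_ideal]
  let ?J = "{a \<otimes> s \<oplus> \<mu> | a \<mu>. a \<in> carrier R \<and> \<mu> \<in> m}"
  have "ideal ?J R"
  proof (rule ideal_of_closed[OF is_cring])
    show "?J \<subseteq> carrier R" using mf(1) s by auto
    have "\<zero> \<otimes> s \<oplus> \<zero> \<in> ?J" using mf(2) by blast
    then show "\<zero> \<in> ?J" using s by simp
    show "x \<oplus> y \<in> ?J" if xy: "x \<in> ?J" "y \<in> ?J" for x y
    proof -
      obtain a p b q where "a \<in> carrier R" "p \<in> m" "x = a \<otimes> s \<oplus> p" "b \<in> carrier R" "q \<in> m" "y = b \<otimes> s \<oplus> q"
        using xy by blast
      moreover from this have "x \<oplus> y = (a \<oplus> b) \<otimes> s \<oplus> (p \<oplus> q)"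
        using s mf(1) by (auto simp: l_distr a_ac subset_iff)
      ultimately show ?thesis using mf(3) a_closed by blast
    qed
    show "t \<otimes> x \<in> ?J" if t: "t \<in> carrier R" and x: "x \<in> ?J" for t x
    proof -
      obtain a p where "a \<in> carrier R" "p \<in> m" "x = a \<otimes> s \<oplus> p" using x by blast
      moreover from this have "t \<otimes> x = (t \<otimes> a) \<otimes> s \<oplus> t \<otimes> p"
        using s t mf(1) by (auto simp: r_distr m_assoc subset_iff)
      ultimately show ?thesis using mf(4)[OF t] m_closed[OF t] by blast
    qed
  qed
  moreover have "m \<subseteq> ?J"
  proof
    fix p assume p: "p \<in> m"
    then have "\<zero> \<otimes> s \<oplus> p \<in> ?J" by blast
    then show "p \<in> ?J" using p s mf(1) by (auto simp: subset_iff)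
  qed
  moreover have "s \<in> ?J"
  proof -
    have "\<one> \<otimes> s \<oplus> \<zero> \<in> ?J" using mf(2) by blast
    then show ?thesis using s by simp
  qed
  moreover have "?J \<subseteq> carrier R" using mf(1) s by auto
  ultimately have "?J = carrier R" using m.I_maximal[of ?J] s(2) by blast
  then have "\<one> \<in> ?J" by simp
  then show thesis using that by blast
qed

lemma maximalideal_complement:
  assumes m: "maximalideal m R"
  shows "\<one> \<in> carrier R - m" "\<And>s t. s \<in> carrier R - m \<Longrightarrow> t \<in> carrier R - m \<Longrightarrow> s \<otimes> t \<in> carrier R - m"
proof -
  interpret m: primeideal m R using maximalideal_prime[OF m] .
  show "\<one> \<in> carrier R - m" using m.one_imp_carrier m.I_notcarr by blast
  show "\<And>s t. s \<in> carrier R - m \<Longrightarrow> t \<in> carrier R - m \<Longrightarrow> s \<otimes> t \<in> carrier R - m"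
    using m.I_prime by blast
qed

lemma maximalideal_neq:
  assumes "maximalideal m R" "maximalideal n R" "m \<noteq> n"
  obtains t where "t \<in> n" "t \<in> carrier R" "t \<notin> m"
proof -
  interpret m: maximalideal m R by fact
  interpret n: maximalideal n R by fact
  have "\<not> n \<subseteq> m"
    using n.I_maximal[OF m.is_ideal] ideal_facts(1)[OF m.is_ideal] m.I_notcarr assms(3) by blast
  then show thesis using that ideal_facts(1)[OF n.is_ideal] by blast
qed

text \<open>In the zero-dimensional local ring at \<open>m\<close> of \<open>R/I\<close>, the
  maximal ideal is the only prime, so \<open>t\<close> is nilpotent there. Without localizing: if
  the products of powers of \<open>t\<close> with elements outside \<open>m\<close> all avoided
  \<open>I\<close>, a prime over \<open>I\<close> avoiding them would lie inside \<open>m\<close>,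
  hence equal \<open>m\<close> by dimension zero, although it misses \<open>t\<close>.\<close>

lemma zero_dim_nilpotent:
  assumes I: "ideal I R" and dim: "krull_dim_zero (R Quot I)" and m: "maximalideal m R" and t: "t \<in> m"
  obtains k :: nat and s where "s \<in> carrier R" "s \<notin> m" "t [^] k \<otimes> s \<in> I"
proof (rule ccontr)
  note ob = that
  assume nt: "\<not> thesis"
  have no: "t [^] k \<otimes> s \<notin> I" if s: "s \<in> carrier R - m" for k :: nat and s
    using ob[of s k] nt s by blast
  interpret m: maximalideal m R by fact
  have tc: "t \<in> carrier R" using t ideal_facts(1)[OF m.is_ideal] by blast
  note mc = maximalideal_complement[OF m]
  let ?S = "{t [^] k \<otimes> s | (k::nat) s. s \<in> carrier R - m}"
  obtain P where P: "primeideal P R" "I \<subseteq> P" "?S \<inter> P = {}"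
  proof (rule prime_avoiding[OF I, of ?S])
    have "t [^] (0::nat) \<otimes> \<one> \<in> ?S" using mc(1) by blast
    then show "\<one> \<in> ?S" by simp
    show "x \<otimes> y \<in> ?S" if xy: "x \<in> ?S" "y \<in> ?S" for x y
    proof -
      obtain k l :: nat and r s where "r \<in> carrier R - m" "x = t [^] k \<otimes> r" "s \<in> carrier R - m" "y = t [^] l \<otimes> s"
        using xy by blast
      moreover from this have "x \<otimes> y = t [^] (k + l) \<otimes> (r \<otimes> s)"
        using tc by (auto simp: nat_pow_mult[symmetric] m_ac)
      ultimately show ?thesis using mc(2) by blast
    qed
    show "?S \<inter> I = {}" using no by blast
  qed
  have Pm: "P \<subseteq> m"
  proof (rule ccontr)
    assume "\<not> P \<subseteq> m"
    then obtain p where p: "p \<in> P" "p \<in> carrier R - m"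
      using ideal_facts(1)[OF primeideal.axioms(1)[OF P(1)]] by blast
    then have "t [^] (0::nat) \<otimes> p \<in> ?S" by blast
    then show False using P(3) p by auto
  qed
  interpret Q: maximalideal "(+>) I ` P" "R Quot I"
    using dim prime_quot[OF I P(1,2)] by (simp add: krull_dim_zero_def)
  have PI: "ideal P R" using P(1) by (rule primeideal.axioms)
  have Im: "I \<subseteq> m" using P(2) Pm by blast
  have "(+>) I ` m = (+>) I ` P \<or> (+>) I ` m = carrier (R Quot I)"
    by (rule Q.I_maximal[OF ring_ideal_imp_quot_ideal[OF I m.is_ideal] image_mono[OF Pm]
          ideal_facts(1)[OF ring_ideal_imp_quot_ideal[OF I m.is_ideal]]])
  then have "m = P"
    using quot_image_inj[OF I m.is_ideal Im PI P(2)] quot_image_carrier[OF I m.is_ideal Im] m.I_notcarr by blast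
  moreover have "t [^] (1::nat) \<otimes> \<one> \<in> ?S" using mc(1) by blast
  ultimately show False using P(3) t tc by auto
qed

end

section \<open>Localization\<close>

text \<open>A characterization of \<open>M -> X\<close> as localization at \<open>S\<close>:
  \<open>S\<close> acts bijectively on \<open>X\<close>, every element of \<open>X\<close> is a
  fraction, and the kernel is \<open>S\<close>-torsion. It is stated for modules because later a
  localization of \<open>R\<close> is recognized as \<open>R_m[1/t]\<close>, a localization of the
  module \<open>R_m\<close>.\<close>

definition is_localization ::
    "('a, 'r) ring_scheme \<Rightarrow> 'a set \<Rightarrow> ('a, 'b, 'm) module_scheme \<Rightarrow> ('a, 'c, 'n) module_scheme \<Rightarrow> ('b \<Rightarrow> 'c) \<Rightarrow> bool" where
  "is_localization R S M X \<iota> \<longleftrightarrow> module R M \<and> module R X \<and> lin R M X \<iota> \<and>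
     (\<forall>s\<in>S. \<forall>y\<in>carrier X. s \<odot>\<^sub>X y = \<zero>\<^sub>X \<longrightarrow> y = \<zero>\<^sub>X) \<and>
     (\<forall>s\<in>S. \<forall>y\<in>carrier X. \<exists>y'\<in>carrier X. s \<odot>\<^sub>X y' = y) \<and>
     (\<forall>y\<in>carrier X. \<exists>s\<in>S. \<exists>x\<in>carrier M. s \<odot>\<^sub>X y = \<iota> x) \<and>
     (\<forall>x\<in>carrier M. \<iota> x = \<zero>\<^sub>X \<longrightarrow> (\<exists>s\<in>S. s \<odot>\<^sub>M x = \<zero>\<^sub>M))"

lemma is_localizationD:
  assumes "is_localization R S M X \<iota>"
  shows "module R M" "module R X" "lin R M X \<iota>"
    "\<And>s y. s \<in> S \<Longrightarrow> y \<in> carrier X \<Longrightarrow> s \<odot>\<^sub>X y = \<zero>\<^sub>X \<Longrightarrow> y = \<zero>\<^sub>X"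
    "\<And>s y. s \<in> S \<Longrightarrow> y \<in> carrier X \<Longrightarrow> \<exists>y'\<in>carrier X. s \<odot>\<^sub>X y' = y"
    "\<And>y. y \<in> carrier X \<Longrightarrow> \<exists>s\<in>S. \<exists>x\<in>carrier M. s \<odot>\<^sub>X y = \<iota> x"
    "\<And>x. x \<in> carrier M \<Longrightarrow> \<iota> x = \<zero>\<^sub>X \<Longrightarrow> \<exists>s\<in>S. s \<odot>\<^sub>M x = \<zero>\<^sub>M"
  using assms unfolding is_localization_def by blast+

definition mult_closed :: "('a, 'r) ring_scheme \<Rightarrow> 'a set \<Rightarrow> bool" where
  "mult_closed R S \<longleftrightarrow> S \<subseteq> carrier R \<and> \<one>\<^sub>R \<in> S \<and> (\<forall>s\<in>S. \<forall>t\<in>S. s \<otimes>\<^sub>R t \<in> S)"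

text \<open>The value at \<open>y\<close> is forced: if \<open>s y\<close> comes from
  \<open>x\<close>, it must be \<open>f x\<close> divided by \<open>s\<close>, which makes sense
  because \<open>S\<close> acts bijectively on \<open>Y\<close>. Of \<open>X\<close> it is only
  assumed that its elements are fractions and that the kernel is torsion, so the lemma also applies
  to \<open>u : R -> U\<close>, where elements of \<open>S\<close> need not act invertibly on
  \<open>U\<close>.\<close>

lemma fraction_lift:
  assumes M: "module R M" and X: "module R X" and \<iota>: "lin R M X \<iota>"
    and frac: "\<And>y. y \<in> carrier X \<Longrightarrow> \<exists>s\<in>S. \<exists>x\<in>carrier M. s \<odot>\<^sub>X y = \<iota> x"
    and ker: "\<And>x. x \<in> carrier M \<Longrightarrow> \<iota> x = \<zero>\<^sub>X \<Longrightarrow> \<exists>s\<in>S. s \<odot>\<^sub>M x = \<zero>\<^sub>M"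
    and S: "mult_closed R S" and Y: "module R Y"
    and inj: "\<And>s y. s \<in> S \<Longrightarrow> y \<in> carrier Y \<Longrightarrow> s \<odot>\<^sub>Y y = \<zero>\<^sub>Y \<Longrightarrow> y = \<zero>\<^sub>Y"
    and surj: "\<And>s y. s \<in> S \<Longrightarrow> y \<in> carrier Y \<Longrightarrow> \<exists>y'\<in>carrier Y. s \<odot>\<^sub>Y y' = y"
    and f: "lin R M Y f"
  obtains g where "lin R X Y g" "\<And>x. x \<in> carrier M \<Longrightarrow> g (\<iota> x) = f x"
    "\<And>s y x. s \<in> S \<Longrightarrow> y \<in> carrier X \<Longrightarrow> x \<in> carrier M \<Longrightarrow> s \<odot>\<^sub>X y = \<iota> x \<Longrightarrow> s \<odot>\<^sub>Y g y = f x"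
proof -
  interpret M: module R M by (rule M)
  interpret X: module R X by (rule X)
  interpret Y: module R Y by (rule Y)
  have Sc: "s \<in> carrier R" if "s \<in> S" for s using S that by (auto simp: mult_closed_def)
  have Sm: "s \<otimes>\<^sub>R t \<in> S" if "s \<in> S" "t \<in> S" for s t using S that by (auto simp: mult_closed_def)
  let ?P = "\<lambda>y v. \<exists>s\<in>S. \<exists>x\<in>carrier M. s \<odot>\<^sub>X y = \<iota> x \<and> s \<odot>\<^sub>Y v = f x"
  obtain g where g: "lin R X Y g" "\<And>y v. y \<in> carrier X \<Longrightarrow> v \<in> carrier Y \<Longrightarrow> ?P y v \<Longrightarrow> g y = v"
  proof (rule lin_of_rel[OF X Y, of ?P])
    fix y assume y: "y \<in> carrier X"
    obtain s x where s: "s \<in> S" "x \<in> carrier M" "s \<odot>\<^sub>X y = \<iota> x" using frac[OF y] by blast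
    obtain v where "v \<in> carrier Y" "s \<odot>\<^sub>Y v = f x" using surj[OF s(1) lin_closed[OF f s(2)]] by blast
    then show "\<exists>v\<in>carrier Y. ?P y v" using s by blast
  next
    fix y v y' v' assume h: "y \<in> carrier X" "v \<in> carrier Y" "y' \<in> carrier X" "v' \<in> carrier Y" "?P y v" "?P y' v'"
    obtain s x s' x' where s: "s \<in> S" "x \<in> carrier M" "s \<odot>\<^sub>X y = \<iota> x" "s \<odot>\<^sub>Y v = f x"
      "s' \<in> S" "x' \<in> carrier M" "s' \<odot>\<^sub>X y' = \<iota> x'" "s' \<odot>\<^sub>Y v' = f x'" using h(5,6) by blast
    note c = Sc[OF s(1)] Sc[OF s(5)]
    have "(s \<otimes>\<^sub>R s') \<odot>\<^sub>X (y \<oplus>\<^sub>X y') = s' \<odot>\<^sub>X (s \<odot>\<^sub>X y) \<oplus>\<^sub>X s \<odot>\<^sub>X (s' \<odot>\<^sub>X y')"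
      using h c by (simp add: X.smult_r_distr flip: X.smult_assoc1) (simp add: M.R.m_comm)
    also have "\<dots> = \<iota> (s' \<odot>\<^sub>M x \<oplus>\<^sub>M s \<odot>\<^sub>M x')"
      using s c by (simp add: lin_add[OF \<iota>] lin_smult[OF \<iota>])
    finally have 1: "(s \<otimes>\<^sub>R s') \<odot>\<^sub>X (y \<oplus>\<^sub>X y') = \<iota> (s' \<odot>\<^sub>M x \<oplus>\<^sub>M s \<odot>\<^sub>M x')" .
    have "(s \<otimes>\<^sub>R s') \<odot>\<^sub>Y (v \<oplus>\<^sub>Y v') = s' \<odot>\<^sub>Y (s \<odot>\<^sub>Y v) \<oplus>\<^sub>Y s \<odot>\<^sub>Y (s' \<odot>\<^sub>Y v')"
      using h c by (simp add: Y.smult_r_distr flip: Y.smult_assoc1) (simp add: M.R.m_comm)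
    also have "\<dots> = f (s' \<odot>\<^sub>M x \<oplus>\<^sub>M s \<odot>\<^sub>M x')"
      using s c by (simp add: lin_add[OF f] lin_smult[OF f])
    finally have 2: "(s \<otimes>\<^sub>R s') \<odot>\<^sub>Y (v \<oplus>\<^sub>Y v') = f (s' \<odot>\<^sub>M x \<oplus>\<^sub>M s \<odot>\<^sub>M x')" .
    have "s' \<odot>\<^sub>M x \<oplus>\<^sub>M s \<odot>\<^sub>M x' \<in> carrier M" using s c by simp
    then show "?P (y \<oplus>\<^sub>X y') (v \<oplus>\<^sub>Y v')" using 1 2 Sm[OF s(1,5)] by blast
  next
    fix r y v assume h: "r \<in> carrier R" "y \<in> carrier X" "v \<in> carrier Y" "?P y v"
    obtain s x where s: "s \<in> S" "x \<in> carrier M" "s \<odot>\<^sub>X y = \<iota> x" "s \<odot>\<^sub>Y v = f x" using h(4) by blast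
    note c = Sc[OF s(1)]
    have "s \<odot>\<^sub>X (r \<odot>\<^sub>X y) = r \<odot>\<^sub>X (s \<odot>\<^sub>X y)"
      using h c by (simp flip: X.smult_assoc1) (simp add: M.R.m_comm)
    moreover have "s \<odot>\<^sub>Y (r \<odot>\<^sub>Y v) = r \<odot>\<^sub>Y (s \<odot>\<^sub>Y v)"
      using h c by (simp flip: Y.smult_assoc1) (simp add: M.R.m_comm)
    moreover have "r \<odot>\<^sub>M x \<in> carrier M" using s h by simp
    ultimately show "?P (r \<odot>\<^sub>X y) (r \<odot>\<^sub>Y v)"
      using s h(1) lin_smult[OF \<iota> h(1) s(2)] lin_smult[OF f h(1) s(2)] by metis
  next
    fix v assume h: "v \<in> carrier Y" "?P \<zero>\<^sub>X v"
    then obtain s x where s: "s \<in> S" "x \<in> carrier M" "s \<odot>\<^sub>X \<zero>\<^sub>X = \<iota> x" "s \<odot>\<^sub>Y v = f x" by blast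
    then have "\<iota> x = \<zero>\<^sub>X" using Sc by simp
    then obtain t where t: "t \<in> S" "t \<odot>\<^sub>M x = \<zero>\<^sub>M" using ker[OF s(2)] by blast
    then have "t \<odot>\<^sub>Y f x = \<zero>\<^sub>Y" using lin_smult[OF f Sc[OF t(1)] s(2)] lin_zero[OF M Y f] by simp
    then have "f x = \<zero>\<^sub>Y" using inj[OF t(1) lin_closed[OF f s(2)]] by simp
    then show "v = \<zero>\<^sub>Y" using inj[OF s(1) h(1)] s(4) by simp
  qed blast
  have *: "s \<odot>\<^sub>Y g y = f x" if h: "s \<in> S" "y \<in> carrier X" "x \<in> carrier M" "s \<odot>\<^sub>X y = \<iota> x" for s y x
  proof -
    obtain v where v: "v \<in> carrier Y" "s \<odot>\<^sub>Y v = f x" using surj[OF h(1) lin_closed[OF f h(3)]] by blast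
    have "g y = v" by (rule g(2)[OF h(2) v(1)]) (use h v in blast)
    then show ?thesis using v by simp
  qed
  have "g (\<iota> x) = f x" if x: "x \<in> carrier M" for x
  proof -
    have 1: "\<one>\<^sub>R \<in> S" using S by (simp add: mult_closed_def)
    show ?thesis
      using *[OF 1 lin_closed[OF \<iota> x] x] lin_closed[OF \<iota> x] lin_closed[OF g(1) lin_closed[OF \<iota> x]] by simp
  qed
  then show thesis using that[OF g(1)] * by blast
qed

lemma localization_lift:
  assumes loc: "is_localization R S M X \<iota>" and S: "mult_closed R S" and Y: "module R Y"
    and inj: "\<And>s y. s \<in> S \<Longrightarrow> y \<in> carrier Y \<Longrightarrow> s \<odot>\<^sub>Y y = \<zero>\<^sub>Y \<Longrightarrow> y = \<zero>\<^sub>Y"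
    and surj: "\<And>s y. s \<in> S \<Longrightarrow> y \<in> carrier Y \<Longrightarrow> \<exists>y'\<in>carrier Y. s \<odot>\<^sub>Y y' = y"
    and f: "lin R M Y f"
  obtains g where "lin R X Y g" "\<And>x. x \<in> carrier M \<Longrightarrow> g (\<iota> x) = f x"
    "\<And>s y x. s \<in> S \<Longrightarrow> y \<in> carrier X \<Longrightarrow> x \<in> carrier M \<Longrightarrow> s \<odot>\<^sub>X y = \<iota> x \<Longrightarrow> s \<odot>\<^sub>Y g y = f x"
proof -
  note L = is_localizationD[OF loc]
  show thesis
    by (rule fraction_lift[OF L(1-3,6,7) S Y inj surj f]) (assumption | rule that)+
qed

text \<open>The operations of \<open>localization\<close> are unions over all representatives. They
  collapse to a single fraction once the result does not depend on the representative and a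
  representative exists.\<close>

lemma UN_constant1:
  assumes "p \<in> X" "\<And>a s. (a, s) \<in> X \<Longrightarrow> f a s = c"
  shows "(\<Union>(a, s)\<in>X. f a s) = c"
proof -
  have "(\<Union>(a, s)\<in>X. f a s) = (\<Union>x\<in>X. c)"
    by (rule SUP_cong) (use assms(2) in auto)
  then show ?thesis using assms(1) by auto
qed

lemma UN_constant2:
  assumes "p \<in> X" "q \<in> Y" "\<And>a s b t. (a, s) \<in> X \<Longrightarrow> (b, t) \<in> Y \<Longrightarrow> f a s b t = c"
  shows "(\<Union>(a, s)\<in>X. \<Union>(b, t)\<in>Y. f a s b t) = c"
  by (rule UN_constant1[OF assms(1)], rule UN_constant1[OF assms(2)]) (rule assms(3))

section \<open>The explicit construction by fractions\<close>

locale mult_set = cring R for R :: "('a, 'r) ring_scheme" (structure) +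
  fixes S assumes S: "mult_closed R S"
begin

lemma S_carrier: "s \<in> S \<Longrightarrow> s \<in> carrier R"
  and S_one: "\<one> \<in> S"
  and S_mult: "s \<in> S \<Longrightarrow> t \<in> S \<Longrightarrow> s \<otimes> t \<in> S"
  using S by (auto simp: mult_closed_def)

abbreviation "L \<equiv> localization R S"
abbreviation "frac \<equiv> fraction R S"

lemma fraction_mem_iff:
  "(b, t) \<in> frac a s \<longleftrightarrow> b \<in> carrier R \<and> t \<in> S \<and> (\<exists>v\<in>S. v \<otimes> (t \<otimes> a) = v \<otimes> (s \<otimes> b))"
  by (simp add: fraction_def)

lemma fraction_eqI:
  assumes h: "a \<in> carrier R" "b \<in> carrier R" "s \<in> S" "t \<in> S" "v \<in> S" "v \<otimes> (t \<otimes> a) = v \<otimes> (s \<otimes> b)"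
  shows "frac a s = frac b t"
proof -
  have *: "(c, r) \<in> frac b t" if h: "a \<in> carrier R" "b \<in> carrier R" "s \<in> S" "t \<in> S" "v \<in> S" "v \<otimes> (t \<otimes> a) = v \<otimes> (s \<otimes> b)" and m: "(c, r) \<in> frac a s"
    for a b s t v c r
  proof -
    obtain w where c: "c \<in> carrier R" "r \<in> S" "w \<in> S" "w \<otimes> (r \<otimes> a) = w \<otimes> (s \<otimes> c)"
      using m by (auto simp: fraction_mem_iff)
    note k = h(1,2) S_carrier[OF h(3)] S_carrier[OF h(4)] S_carrier[OF h(5)] c(1) S_carrier[OF c(2)] S_carrier[OF c(3)]
    have "(v \<otimes> w \<otimes> s) \<otimes> (r \<otimes> b) = (w \<otimes> r) \<otimes> (v \<otimes> (s \<otimes> b))" using k by (simp add: m_ac)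
    also have "\<dots> = (v \<otimes> t) \<otimes> (w \<otimes> (r \<otimes> a))" using k unfolding h(6)[symmetric] by (simp add: m_ac)
    also have "\<dots> = (v \<otimes> w \<otimes> s) \<otimes> (t \<otimes> c)" using k unfolding c(4) by (simp add: m_ac)
    finally show ?thesis unfolding fraction_mem_iff using c(1,2) S_mult[OF S_mult[OF h(5) c(3)] h(3)] by blast
  qed
  show ?thesis
  proof (rule Set.set_eqI)
    fix p show "p \<in> frac a s \<longleftrightarrow> p \<in> frac b t"
      by (cases p) (use *[OF h] *[OF h(2,1,4,3,5) h(6)[symmetric]] in blast)
  qed
qed

lemma fraction_self: "a \<in> carrier R \<Longrightarrow> s \<in> S \<Longrightarrow> (a, s) \<in> frac a s"
  using S_one by (simp add: fraction_mem_iff) blast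

lemma fraction_eq_iff:
  assumes "a \<in> carrier R" "b \<in> carrier R" "s \<in> S" "t \<in> S"
  shows "frac a s = frac b t \<longleftrightarrow> (\<exists>v\<in>S. v \<otimes> (t \<otimes> a) = v \<otimes> (s \<otimes> b))"
proof
  assume "frac a s = frac b t"
  then have "(b, t) \<in> frac a s" using fraction_self[OF assms(2,4)] by simp
  then show "\<exists>v\<in>S. v \<otimes> (t \<otimes> a) = v \<otimes> (s \<otimes> b)" by (simp add: fraction_mem_iff)
qed (use fraction_eqI[OF assms] in blast)

lemma localization_elem_cases:
  assumes "y \<in> carrier L" obtains a s where "a \<in> carrier R" "s \<in> S" "y = frac a s"
  using assms by (auto simp: localization_def)

lemma frac_closed: "a \<in> carrier R \<Longrightarrow> s \<in> S \<Longrightarrow> frac a s \<in> carrier L"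
  by (auto simp: localization_def)

lemma localization_zero: "\<zero>\<^sub>L = frac \<zero> \<one>"
  by (auto simp: localization_def)

lemma frac_add:
  assumes h: "a \<in> carrier R" "s \<in> S" "b \<in> carrier R" "t \<in> S"
  shows "frac a s \<oplus>\<^sub>L frac b t = frac (t \<otimes> a \<oplus> s \<otimes> b) (s \<otimes> t)"
proof -
  have "frac (t' \<otimes> a' \<oplus> s' \<otimes> b') (s' \<otimes> t') = frac (t \<otimes> a \<oplus> s \<otimes> b) (s \<otimes> t)"
    if "(a', s') \<in> frac a s" "(b', t') \<in> frac b t" for a' s' b' t'
  proof -
    from that obtain v w where c: "a' \<in> carrier R" "s' \<in> S" "b' \<in> carrier R" "t' \<in> S" "v \<in> S" "w \<in> S"
      and e: "v \<otimes> (s' \<otimes> a) = v \<otimes> (s \<otimes> a')" "w \<otimes> (t' \<otimes> b) = w \<otimes> (t \<otimes> b')"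
      by (auto simp: fraction_mem_iff)
    note k = h(1,3) S_carrier[OF h(2)] S_carrier[OF h(4)] c(1,3) S_carrier[OF c(2)] S_carrier[OF c(4)] S_carrier[OF c(5)] S_carrier[OF c(6)]
    have "(v \<otimes> w) \<otimes> ((s \<otimes> t) \<otimes> (t' \<otimes> a' \<oplus> s' \<otimes> b')) = (w \<otimes> t \<otimes> t') \<otimes> (v \<otimes> (s \<otimes> a')) \<oplus> (v \<otimes> s \<otimes> s') \<otimes> (w \<otimes> (t \<otimes> b'))"
      using k by (simp add: r_distr m_ac)
    also have "\<dots> = (v \<otimes> w) \<otimes> ((s' \<otimes> t') \<otimes> (t \<otimes> a \<oplus> s \<otimes> b))"
      unfolding e[symmetric] using k by (simp add: r_distr m_ac)
    finally show ?thesis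
      by (intro fraction_eqI[of _ _ _ _ "v \<otimes> w"]) (use k h c S_mult in auto)
  qed
  then have "(\<Union>(a', s')\<in>frac a s. \<Union>(b', t')\<in>frac b t. frac (t' \<otimes> a' \<oplus> s' \<otimes> b') (s' \<otimes> t')) = frac (t \<otimes> a \<oplus> s \<otimes> b) (s \<otimes> t)"
    by (rule UN_constant2[OF fraction_self[OF h(1,2)] fraction_self[OF h(3,4)]])
  then show ?thesis by (simp add: localization_def)
qed

lemma frac_smult:
  assumes h: "r \<in> carrier R" "a \<in> carrier R" "s \<in> S"
  shows "r \<odot>\<^sub>L frac a s = frac (r \<otimes> a) s"
proof -
  have "frac (r \<otimes> a') s' = frac (r \<otimes> a) s" if "(a', s') \<in> frac a s" for a' s'
  proof -
    from that obtain v where c: "a' \<in> carrier R" "s' \<in> S" "v \<in> S" and e: "v \<otimes> (s' \<otimes> a) = v \<otimes> (s \<otimes> a')"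
      by (auto simp: fraction_mem_iff)
    note k = h(1,2) S_carrier[OF h(3)] c(1) S_carrier[OF c(2)] S_carrier[OF c(3)]
    have "v \<otimes> (s \<otimes> (r \<otimes> a')) = r \<otimes> (v \<otimes> (s \<otimes> a'))" using k by (simp add: m_ac)
    also have "\<dots> = v \<otimes> (s' \<otimes> (r \<otimes> a))" unfolding e[symmetric] using k by (simp add: m_ac)
    finally show ?thesis by (intro fraction_eqI[of _ _ _ _ v]) (use h c in auto)
  qed
  then have "(\<Union>(a', s')\<in>frac a s. frac (r \<otimes> a') s') = frac (r \<otimes> a) s"
    by (rule UN_constant1[OF fraction_self[OF h(2,3)]])
  then show ?thesis by (simp add: localization_def)
qed

lemma frac_cancel:
  assumes "a \<in> carrier R" "s \<in> S" "t \<in> S"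
  shows "frac (t \<otimes> a) (t \<otimes> s) = frac a s"
  using assms S_carrier S_one S_mult by (intro fraction_eqI[of _ _ _ _ \<one>]) (auto simp: m_ac)

lemma module_localization: "module R L"
proof (rule moduleI)
  show "abelian_group L"
  proof (rule abelian_groupI)
    fix x y assume "x \<in> carrier L" "y \<in> carrier L"
    then obtain a s b t where h: "a \<in> carrier R" "s \<in> S" "b \<in> carrier R" "t \<in> S" "x = frac a s" "y = frac b t"
      by (metis localization_elem_cases)
    note c = h S_carrier[OF h(2)] S_carrier[OF h(4)] S_mult[OF h(2,4)]
    show "x \<oplus>\<^sub>L y \<in> carrier L" using c by (simp add: frac_add frac_closed)
    show "x \<oplus>\<^sub>L y = y \<oplus>\<^sub>L x" using c by (simp add: frac_add a_comm m_comm)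
    fix z assume "z \<in> carrier L"
    then obtain d r where d: "d \<in> carrier R" "r \<in> S" "z = frac d r" by (metis localization_elem_cases)
    note d = d S_carrier[OF d(2)]
    show "x \<oplus>\<^sub>L y \<oplus>\<^sub>L z = x \<oplus>\<^sub>L (y \<oplus>\<^sub>L z)" using c d by (simp add: frac_add S_mult r_distr m_ac a_ac)
  next
    fix x assume "x \<in> carrier L"
    then obtain a s where h: "a \<in> carrier R" "s \<in> S" "x = frac a s" by (metis localization_elem_cases)
    note h = h S_carrier[OF h(2)]
    show "\<zero>\<^sub>L \<oplus>\<^sub>L x = x" using h by (simp add: localization_zero frac_add S_one)
    have "frac (\<ominus> a) s \<oplus>\<^sub>L x = frac \<zero> (s \<otimes> s)" using h by (simp add: frac_add r_minus l_neg)
    also have "\<dots> = \<zero>\<^sub>L" unfolding localization_zero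
      by (rule fraction_eqI[of _ _ _ _ \<one>]) (use h S_one S_mult in auto)
    finally show "\<exists>y\<in>carrier L. y \<oplus>\<^sub>L x = \<zero>\<^sub>L" using h frac_closed by blast
  qed (simp add: localization_zero frac_closed S_one)
next
  fix r q x assume r: "r \<in> carrier R" "q \<in> carrier R" and "x \<in> carrier L"
  then obtain a s where h: "a \<in> carrier R" "s \<in> S" "x = frac a s" by (metis localization_elem_cases)
  note h = r h S_carrier[OF h(2)]
  show "(r \<oplus> q) \<odot>\<^sub>L x = r \<odot>\<^sub>L x \<oplus>\<^sub>L q \<odot>\<^sub>L x"
    using h frac_cancel[of "(r \<oplus> q) \<otimes> a" s s] by (simp add: frac_smult frac_add l_distr r_distr)
  show "(r \<otimes> q) \<odot>\<^sub>L x = r \<odot>\<^sub>L (q \<odot>\<^sub>L x)" using h by (simp add: frac_smult m_assoc)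
next
  fix r x y assume r: "r \<in> carrier R" and "x \<in> carrier L" "y \<in> carrier L"
  then obtain a s b t where h: "a \<in> carrier R" "s \<in> S" "b \<in> carrier R" "t \<in> S" "x = frac a s" "y = frac b t"
    by (metis localization_elem_cases)
  note c = r h S_carrier[OF h(2)] S_carrier[OF h(4)] S_mult[OF h(2,4)]
  show "r \<odot>\<^sub>L (x \<oplus>\<^sub>L y) = r \<odot>\<^sub>L x \<oplus>\<^sub>L r \<odot>\<^sub>L y"
    using c by (simp add: frac_smult frac_add r_distr m_ac)
qed (auto elim!: localization_elem_cases simp: frac_smult frac_closed is_cring)

lemma frac_zero_iff:
  assumes "a \<in> carrier R" "s \<in> S" shows "frac a s = \<zero>\<^sub>L \<longleftrightarrow> (\<exists>v\<in>S. v \<otimes> a = \<zero>)"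
  unfolding localization_zero using assms S_carrier S_one by (subst fraction_eq_iff) auto

lemma frac_one_smult: "a \<in> carrier R \<Longrightarrow> s \<in> S \<Longrightarrow> s \<odot>\<^sub>L frac a s = frac a \<one>"
  using frac_cancel[of a \<one> s] S_carrier S_one by (simp add: frac_smult)

lemma is_localization_localization: "is_localization R S (self_module R) L (\<lambda>a. frac a \<one>)"
  unfolding is_localization_def
proof (intro conjI ballI impI)
  show "lin R (self_module R) L (\<lambda>a. frac a \<one>)"
    by (rule linI) (auto simp: frac_closed S_one frac_add frac_smult)
next
  fix s y assume h: "s \<in> S" "y \<in> carrier L"
  then obtain a t where a: "a \<in> carrier R" "t \<in> S" "y = frac a t" by (metis localization_elem_cases)
  show "y = \<zero>\<^sub>L" if z: "s \<odot>\<^sub>L y = \<zero>\<^sub>L"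
  proof -
    obtain v where v: "v \<in> S" "v \<otimes> (s \<otimes> a) = \<zero>"
      using z a S_carrier[OF h(1)] by (auto simp: frac_smult frac_zero_iff)
    then have "(v \<otimes> s) \<otimes> a = \<zero>" using a h S_carrier by (simp add: m_assoc)
    then show ?thesis using a h v S_mult by (auto simp: frac_zero_iff)
  qed
  have "s \<odot>\<^sub>L frac a (s \<otimes> t) = y"
    using a h S_carrier S_mult frac_cancel[of a t s] by (simp add: frac_smult)
  then show "\<exists>y'\<in>carrier L. s \<odot>\<^sub>L y' = y" using a h S_mult frac_closed by blast
next
  fix y assume "y \<in> carrier L"
  then show "\<exists>s\<in>S. \<exists>x\<in>carrier (self_module R). s \<odot>\<^sub>L y = frac x \<one>"
    by (metis localization_elem_cases frac_one_smult restrict_scalars_simps(1))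
next
  fix x assume h: "x \<in> carrier (self_module R)" "frac x \<one> = \<zero>\<^sub>L"
  then show "\<exists>s\<in>S. s \<odot>\<^bsub>self_module R\<^esub> x = \<zero>\<^bsub>self_module R\<^esub>"
    using S_one by (simp add: frac_zero_iff)
qed (rule module_self[OF is_cring] module_localization)+

end

lemma (in cring) mult_closed_powers: "t \<in> carrier R \<Longrightarrow> mult_closed R (range (\<lambda>n::nat. t [^] n))"
  by (auto simp: mult_closed_def nat_pow_mult) (metis nat_pow_0 rangeI)

lemma (in cring) mult_closed_complement: "maximalideal m R \<Longrightarrow> mult_closed R (carrier R - m)"
  unfolding mult_closed_def using maximalideal_complement by blast

section \<open>Infinite summation operators\<close>

text \<open>A solution stands for the infinite sum
  \<open>b n = a n + f (a (n + 1)) + f (f (a (n + 2))) + ...\<close>. Solvability is the existence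
  of such sums, and \<open>separated\<close> is their uniqueness, read off from the difference of
  two solutions. The set \<open>Z\<close> allows sums that stay in a submodule.\<close>

definition solvable :: "('a, 'b, 'm) module_scheme \<Rightarrow> 'b set \<Rightarrow> ('b \<Rightarrow> 'b) \<Rightarrow> bool" where
  "solvable G Z f \<longleftrightarrow> (\<forall>a. (\<forall>n::nat. a n \<in> Z) \<longrightarrow> (\<exists>b. \<forall>n. b n \<in> Z \<and> b n = a n \<oplus>\<^sub>G f (b (Suc n))))"

definition separated :: "('a, 'b, 'm) module_scheme \<Rightarrow> ('b \<Rightarrow> 'b) \<Rightarrow> bool" where
  "separated G f \<longleftrightarrow> (\<forall>b. (\<forall>n::nat. b n \<in> carrier G \<and> b n = f (b (Suc n))) \<longrightarrow> (\<forall>n. b n = \<zero>\<^sub>G))"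

text \<open>For \<open>f\<close> the multiplication by \<open>t\<close>, this is the condition that \<open>G\<close> is a \<open>t\<close>-contramodule,
  read off from the telescope resolving \<open>R[1/t]\<close>.\<close>

definition op_contra :: "('a, 'b, 'm) module_scheme \<Rightarrow> ('b \<Rightarrow> 'b) \<Rightarrow> bool" where
  "op_contra G f \<longleftrightarrow> solvable G (carrier G) f \<and> separated G f"

lemma solvableE:
  assumes "solvable G Z f" "\<And>n::nat. a n \<in> Z"
  obtains b where "\<And>n. b n \<in> Z" "\<And>n. b n = a n \<oplus>\<^sub>G f (b (Suc n))"
  using assms unfolding solvable_def by metis

lemma separatedD:
  assumes "separated G f" "\<And>n::nat. b n \<in> carrier G" "\<And>n. b n = f (b (Suc n))"
  shows "b n = \<zero>\<^sub>G"
  using assms unfolding separated_def by blast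

lemma op_contra_unique:
  assumes G: "module R G" and f: "lin R G G f" and sep: "separated G f" and a: "\<And>n::nat. a n \<in> carrier G"
    and b: "\<And>n. b n \<in> carrier G" "\<And>n. b n = a n \<oplus>\<^sub>G f (b (Suc n))"
    and c: "\<And>n. c n \<in> carrier G" "\<And>n. c n = a n \<oplus>\<^sub>G f (c (Suc n))"
  shows "b n = c n"
proof -
  interpret G: module R G by (rule G)
  have "b n \<ominus>\<^sub>G c n = \<zero>\<^sub>G"
  proof (rule separatedD[OF sep])
    fix n
    have "b n \<ominus>\<^sub>G c n = (a n \<oplus>\<^sub>G f (b (Suc n))) \<ominus>\<^sub>G (a n \<oplus>\<^sub>G f (c (Suc n)))"
      using b(2) c(2) by metis
    also have "\<dots> = f (b (Suc n)) \<ominus>\<^sub>G f (c (Suc n))"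
      using a[of n] lin_closed[OF f b(1)[of "Suc n"]] lin_closed[OF f c(1)[of "Suc n"]]
      by (simp add: a_minus_def G.minus_add G.a_ac G.r_neg2)
    finally show "b n \<ominus>\<^sub>G c n = f (b (Suc n) \<ominus>\<^sub>G c (Suc n))"
      by (simp add: lin_minus[OF G G f b(1) c(1)])
  qed (use b(1) c(1) in simp)
  then show ?thesis using module_diff_eq_zero[OF G b(1) c(1)] by blast
qed

text \<open>\<open>\<phi>\<close> is the inverse of \<open>1 - f\<close>, given by the geometric
  series: it sums the constant sequence \<open>x\<close>.\<close>

lemma geometric_inverse:
  assumes G: "module R G" and f: "lin R G G f" and con: "op_contra G f"
  obtains \<phi> where "lin R G G \<phi>" "\<And>x. x \<in> carrier G \<Longrightarrow> \<phi> x = x \<oplus>\<^sub>G f (\<phi> x)"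
    "\<And>x y. x \<in> carrier G \<Longrightarrow> y \<in> carrier G \<Longrightarrow> y = x \<oplus>\<^sub>G f y \<Longrightarrow> y = \<phi> x"
    "\<And>Z x. Z \<subseteq> carrier G \<Longrightarrow> solvable G Z f \<Longrightarrow> x \<in> Z \<Longrightarrow> \<phi> x \<in> Z"
proof -
  interpret G: module R G by (rule G)
  have sep: "separated G f" and sol: "solvable G (carrier G) f" using con by (auto simp: op_contra_def)
  have uniq: "y = z" if "x \<in> carrier G" "y \<in> carrier G" "z \<in> carrier G" "y = x \<oplus>\<^sub>G f y" "z = x \<oplus>\<^sub>G f z" for x y z
    by (rule op_contra_unique[OF G f sep, of "\<lambda>_. x" "\<lambda>_. y" "\<lambda>_. z"]) (rule that)+
  have ex: "\<exists>y\<in>Z. y = x \<oplus>\<^sub>G f y" if Z: "Z \<subseteq> carrier G" "solvable G Z f" "x \<in> Z" for Z x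
  proof -
    obtain b where b: "\<And>n. b n \<in> Z" "\<And>n. b n = x \<oplus>\<^sub>G f (b (Suc n))"
      using solvableE[OF Z(2), of "\<lambda>_. x"] Z(3) by blast
    \<comment> \<open>The shift of \<open>b\<close> solves the same system, because the sequence on
      the right is constant. By uniqueness \<open>b 0\<close> is a fixed point.\<close>
    have "b 0 = b (Suc 0)"
      by (rule op_contra_unique[OF G f sep, of "\<lambda>_. x" b "\<lambda>n. b (Suc n)"])
        ((rule b(2) subsetD[OF Z(1)] b(1) Z(3))+)
    then show ?thesis using b by metis
  qed
  define \<phi> where "\<phi> x = (SOME y. y \<in> carrier G \<and> y = x \<oplus>\<^sub>G f y)" for x
  have \<phi>: "\<phi> x \<in> carrier G" "\<phi> x = x \<oplus>\<^sub>G f (\<phi> x)" if x: "x \<in> carrier G" for x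
  proof -
    have "\<exists>y. y \<in> carrier G \<and> y = x \<oplus>\<^sub>G f y" using ex[OF subset_refl sol x] by blast
    then have "\<phi> x \<in> carrier G \<and> \<phi> x = x \<oplus>\<^sub>G f (\<phi> x)" unfolding \<phi>_def by (rule someI_ex)
    then show "\<phi> x \<in> carrier G" "\<phi> x = x \<oplus>\<^sub>G f (\<phi> x)" by blast+
  qed
  have eq: "y = \<phi> x" if "x \<in> carrier G" "y \<in> carrier G" "y = x \<oplus>\<^sub>G f y" for x y
    using uniq[OF that(1,2) \<phi>(1)[OF that(1)] that(3) \<phi>(2)[OF that(1)]] .
  have lin\<phi>: "lin R G G \<phi>"
  proof (rule linI)
    fix x y assume xy: "x \<in> carrier G" "y \<in> carrier G"
    have "\<phi> x \<oplus>\<^sub>G \<phi> y = (x \<oplus>\<^sub>G f (\<phi> x)) \<oplus>\<^sub>G (y \<oplus>\<^sub>G f (\<phi> y))"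
      using \<phi>(2)[OF xy(1)] \<phi>(2)[OF xy(2)] by metis
    also have "\<dots> = x \<oplus>\<^sub>G y \<oplus>\<^sub>G f (\<phi> x \<oplus>\<^sub>G \<phi> y)"
      using xy \<phi>(1) lin_closed[OF f \<phi>(1)] by (simp add: lin_add[OF f] G.a_ac)
    finally show "\<phi> (x \<oplus>\<^sub>G y) = \<phi> x \<oplus>\<^sub>G \<phi> y"
      using eq[of "x \<oplus>\<^sub>G y" "\<phi> x \<oplus>\<^sub>G \<phi> y"] xy \<phi>(1) G.a_closed by metis
  next
    fix r x assume r: "r \<in> carrier R" and x: "x \<in> carrier G"
    have "r \<odot>\<^sub>G \<phi> x = r \<odot>\<^sub>G (x \<oplus>\<^sub>G f (\<phi> x))" using \<phi>(2)[OF x] by metis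
    also have "\<dots> = r \<odot>\<^sub>G x \<oplus>\<^sub>G f (r \<odot>\<^sub>G \<phi> x)"
      using r x \<phi>(1) lin_closed[OF f \<phi>(1)] by (simp add: lin_smult[OF f] G.smult_r_distr)
    finally show "\<phi> (r \<odot>\<^sub>G x) = r \<odot>\<^sub>G \<phi> x"
      using eq[of "r \<odot>\<^sub>G x" "r \<odot>\<^sub>G \<phi> x"] r x \<phi>(1) G.smult_closed by metis
  qed (rule \<phi>)
  have Z\<phi>: "\<phi> x \<in> Z" if Z: "Z \<subseteq> carrier G" "solvable G Z f" "x \<in> Z" for Z x
    using ex[OF Z] eq Z by blast
  show thesis
  proof (rule that[OF lin\<phi>])
    show "\<phi> x = x \<oplus>\<^sub>G f (\<phi> x)" if "x \<in> carrier G" for x by (rule \<phi>(2)[OF that])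
    show "y = \<phi> x" if "x \<in> carrier G" "y \<in> carrier G" "y = x \<oplus>\<^sub>G f y" for x y by (rule eq[OF that])
    show "\<phi> x \<in> Z" if "Z \<subseteq> carrier G" "solvable G Z f" "x \<in> Z" for Z x by (rule Z\<phi>[OF that])
  qed
qed

lemma funpow_commute:
  assumes "\<And>x. x \<in> A \<Longrightarrow> p x \<in> A" "\<And>x. x \<in> A \<Longrightarrow> f (p x) = p (f x)" "\<And>x. x \<in> A \<Longrightarrow> f x \<in> A" "x \<in> A"
  shows "(p ^^ n) x \<in> A" "f ((p ^^ n) x) = (p ^^ n) (f x)"
proof -
  have "(p ^^ n) x \<in> A \<and> f ((p ^^ n) x) = (p ^^ n) (f x)"
    by (induction n) (simp_all add: assms(1,2,4))
  then show "(p ^^ n) x \<in> A" "f ((p ^^ n) x) = (p ^^ n) (f x)" by auto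
qed

lemma funpow_inverse:
  assumes "\<And>x. x \<in> A \<Longrightarrow> q x \<in> A" "\<And>x. x \<in> A \<Longrightarrow> p (q x) = x" "x \<in> A"
  shows "(p ^^ n) ((q ^^ n) x) = x"
  using assms(3)
proof (induction n arbitrary: x)
  case (Suc n)
  have "(q ^^ n) x \<in> A" by (induction n) (simp_all add: Suc.prems assms(1))
  moreover have "(p ^^ Suc n) ((q ^^ Suc n) x) = (p ^^ n) (p (q ((q ^^ n) x)))"
    by (simp only: funpow.simps comp_apply funpow_swap1[of p])
  ultimately show ?case using assms(2) Suc by simp
qed simp

lemma lin_funpow: "lin R G G f \<Longrightarrow> lin R G G (f ^^ n)"
  by (induction n) (auto simp: lin_def)

text \<open>To sum \<open>a\<close> with respect to \<open>f\<close> after \<open>\<phi>\<close>,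
  sum the sequence \<open>(\<phi> ^^ n) (a n)\<close> with respect to \<open>f\<close> and undo the
  twist by \<open>\<psi> ^^ n\<close>. This works because \<open>f\<close> commutes with
  \<open>\<phi>\<close>, hence with its inverse.\<close>

lemma solvable_twist:
  assumes G: "module R G" and Z: "Z \<subseteq> carrier G" "\<And>x. x \<in> Z \<Longrightarrow> f x \<in> Z"
    and f: "lin R G G f" and sol: "solvable G Z f"
    and \<phi>: "lin R G G \<phi>" "\<And>x. x \<in> Z \<Longrightarrow> \<phi> x \<in> Z" and \<psi>: "lin R G G \<psi>" "\<And>x. x \<in> Z \<Longrightarrow> \<psi> x \<in> Z"
    and inv: "\<And>x. x \<in> carrier G \<Longrightarrow> \<phi> (\<psi> x) = x" "\<And>x. x \<in> carrier G \<Longrightarrow> \<psi> (\<phi> x) = x"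
    and com: "\<And>x. x \<in> carrier G \<Longrightarrow> f (\<phi> x) = \<phi> (f x)"
  shows "solvable G Z (\<lambda>x. f (\<phi> x))"
  unfolding solvable_def
proof (intro allI impI)
  fix a :: "nat \<Rightarrow> 'c" assume a: "\<forall>n. a n \<in> Z"
  have aG: "a n \<in> carrier G" for n using a Z by auto
  have pZ: "(\<phi> ^^ n) x \<in> Z" "(\<psi> ^^ n) x \<in> Z" if "x \<in> Z" for n x
    using that \<phi>(2) \<psi>(2) by (induction n) auto
  note lp = lin_funpow[OF \<phi>(1)] lin_funpow[OF \<psi>(1)]
  obtain b where b: "\<And>n. b n \<in> Z" "\<And>n. b n = (\<phi> ^^ n) (a n) \<oplus>\<^sub>G f (b (Suc n))"
    using solvableE[OF sol, of "\<lambda>n. (\<phi> ^^ n) (a n)"] pZ(1) a by blast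
  have bG: "b n \<in> carrier G" for n using b(1) Z by auto
  have com': "f (\<psi> x) = \<psi> (f x)" if x: "x \<in> carrier G" for x
  proof -
    have "\<psi> (f (\<phi> (\<psi> x))) = \<psi> (\<phi> (f (\<psi> x)))"
      using com[OF lin_closed[OF \<psi>(1) x]] by simp
    then show ?thesis using x inv lin_closed[OF f lin_closed[OF \<psi>(1) x]] by simp
  qed
  have "(\<psi> ^^ n) (b n) = a n \<oplus>\<^sub>G f (\<phi> ((\<psi> ^^ Suc n) (b (Suc n))))" for n
  proof -
    have "(\<psi> ^^ n) (b n) = (\<psi> ^^ n) ((\<phi> ^^ n) (a n)) \<oplus>\<^sub>G (\<psi> ^^ n) (f (b (Suc n)))"
      using b(2)[of n] lin_add[OF lp(2) lin_closed[OF lp(1) aG] lin_closed[OF f bG]] by metis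
    moreover have "(\<psi> ^^ n) ((\<phi> ^^ n) (a n)) = a n"
      by (rule funpow_inverse[of "carrier G"]) (use lin_closed[OF \<phi>(1)] inv aG in auto)
    moreover have "(\<psi> ^^ n) (f (b (Suc n))) = f ((\<psi> ^^ n) (b (Suc n)))"
      by (rule funpow_commute(2)[of "carrier G", symmetric]) (use lin_closed[OF \<psi>(1)] lin_closed[OF f] com' bG in auto)
    moreover have "\<phi> ((\<psi> ^^ Suc n) (b (Suc n))) = (\<psi> ^^ n) (b (Suc n))"
      using inv(1)[OF lin_closed[OF lp(2) bG]] by simp
    ultimately show ?thesis by simp
  qed
  then show "\<exists>b. \<forall>n. b n \<in> Z \<and> b n = a n \<oplus>\<^sub>G f (\<phi> (b (Suc n)))"
    by (rule_tac exI[of _ "\<lambda>n. (\<psi> ^^ n) (b n)"], intro allI conjI) (rule pZ(2)[OF b(1)])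
qed

text \<open>A sequence killed by the twisted recursion becomes one for \<open>f\<close> when its
  \<open>n\<close>-th member is multiplied by \<open>\<phi> ^^ n\<close>, and that factor is
  injective.\<close>

lemma separated_twist:
  assumes G: "module R G" and f: "lin R G G f" and sep: "separated G f"
    and \<phi>: "lin R G G \<phi>" and \<psi>: "lin R G G \<psi>" and inv: "\<And>x. x \<in> carrier G \<Longrightarrow> \<psi> (\<phi> x) = x"
    and com: "\<And>x. x \<in> carrier G \<Longrightarrow> f (\<phi> x) = \<phi> (f x)"
  shows "separated G (\<lambda>x. f (\<phi> x))"
  unfolding separated_def
proof (intro allI impI)
  fix b :: "nat \<Rightarrow> 'c" and n assume b: "\<forall>n. b n \<in> carrier G \<and> b n = f (\<phi> (b (Suc n)))"
  then have bG: "b n \<in> carrier G" for n by blast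
  note lp = lin_funpow[OF \<phi>]
  have "(\<phi> ^^ n) (b n) = f ((\<phi> ^^ Suc n) (b (Suc n)))" for n
  proof -
    have "f ((\<phi> ^^ n) (\<phi> (b (Suc n)))) = (\<phi> ^^ n) (f (\<phi> (b (Suc n))))"
      by (rule funpow_commute(2)[of "carrier G"]) (use lin_closed[OF \<phi>] lin_closed[OF f] com bG in auto)
    then show ?thesis using b by (metis funpow_Suc_right comp_apply)
  qed
  then have "(\<phi> ^^ n) (b n) = \<zero>\<^sub>G"
    by (intro separatedD[OF sep, of "\<lambda>n. (\<phi> ^^ n) (b n)"] lin_closed[OF lp bG])
  moreover have "(\<psi> ^^ n) ((\<phi> ^^ n) (b n)) = b n"
    by (rule funpow_inverse[of "carrier G"]) (use lin_closed[OF \<phi>] inv bG in auto)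
  ultimately have "b n = (\<psi> ^^ n) \<zero>\<^sub>G" by simp
  then show "b n = \<zero>\<^sub>G" unfolding lin_zero[OF G G lin_funpow[OF \<psi>]] .
qed

text \<open>If commuting summation operators add up to the identity modulo \<open>Z\<close>, then \<open>Z\<close> is everything:
  for \<open>s\<close> one of them, the others become, after multiplication by \<open>(1 - s)\<^sup>-\<^sup>1\<close>, summation operators
  that add up to the identity.\<close>

lemma op_contra_exhaust:
  assumes G: "module R G" and Z: "submodule Z R G"
    and fs: "\<And>f. f \<in> set fs \<Longrightarrow> lin R G G f \<and> op_contra G f \<and> solvable G Z f \<and> f ` Z \<subseteq> Z"
    and com: "\<And>f g x. f \<in> set fs \<Longrightarrow> g \<in> set fs \<Longrightarrow> x \<in> carrier G \<Longrightarrow> f (g x) = g (f x)"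
    and sum: "\<And>x. x \<in> carrier G \<Longrightarrow> x \<ominus>\<^sub>G foldr (\<lambda>f. (\<oplus>\<^sub>G) (f x)) fs \<zero>\<^sub>G \<in> Z"
  shows "carrier G \<subseteq> Z"
  using fs com sum
proof (induction "length fs" arbitrary: fs)
  case 0
  interpret G: module R G by (rule G)
  have "x \<in> Z" if "x \<in> carrier G" for x
    using 0(1) 0(4)[OF that] module_diff_add[OF G that G.zero_closed] module_r_zero[OF G module_minus_closed[OF G that G.zero_closed]]
    by simp
  then show ?case by blast
next
  case (Suc n fs0)
  interpret G: module R G by (rule G)
  obtain s fs where fs0: "fs0 = s # fs" and len: "n = length fs" using Suc.hyps(2) by (cases fs0) auto
  note prems = Suc.prems[unfolded fs0]
  have s: "lin R G G s" "op_contra G s" "solvable G Z s" "s ` Z \<subseteq> Z"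
    using prems(1)[of s] by auto
  note Zp = submodule_props[OF G Z]
  obtain \<phi> where \<phi>: "lin R G G \<phi>" "\<And>x. x \<in> carrier G \<Longrightarrow> \<phi> x = x \<oplus>\<^sub>G s (\<phi> x)"
    "\<And>x y. x \<in> carrier G \<Longrightarrow> y \<in> carrier G \<Longrightarrow> y = x \<oplus>\<^sub>G s y \<Longrightarrow> y = \<phi> x"
    "\<And>Z x. Z \<subseteq> carrier G \<Longrightarrow> solvable G Z s \<Longrightarrow> x \<in> Z \<Longrightarrow> \<phi> x \<in> Z"
    using geometric_inverse[OF G s(1,2)] by blast
  note \<phi>G = lin_closed[OF \<phi>(1)]
  define \<psi> where "\<psi> x = x \<ominus>\<^sub>G s x" for x
  have \<psi>: "lin R G G \<psi>" unfolding \<psi>_def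
    by (rule lin_diff[OF G _ s(1)]) (auto intro: linI)
  have inv1: "\<phi> (\<psi> x) = x" if x: "x \<in> carrier G" for x
    using \<phi>(3)[OF lin_closed[OF \<psi> x] x] x lin_closed[OF s(1) x] by (simp add: \<psi>_def module_diff_add[OF G])
  have inv2: "\<psi> (\<phi> x) = x" if x: "x \<in> carrier G" for x
  proof -
    have "\<psi> (\<phi> x) = (x \<oplus>\<^sub>G s (\<phi> x)) \<ominus>\<^sub>G s (\<phi> x)" unfolding \<psi>_def using \<phi>(2)[OF x] by metis
    then show ?thesis using x lin_closed[OF s(1) \<phi>G[OF x]] by (simp add: a_minus_def G.a_assoc G.r_neg)
  qed
  have comm\<phi>: "f (\<phi> x) = \<phi> (f x)" if f: "f \<in> set fs" and x: "x \<in> carrier G" for f x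
  proof -
    have lf: "lin R G G f" using prems(1) f by auto
    have "f (\<phi> x) = f (x \<oplus>\<^sub>G s (\<phi> x))" using \<phi>(2)[OF x] by metis
    also have "\<dots> = f x \<oplus>\<^sub>G s (f (\<phi> x))"
      using prems(2)[of f s "\<phi> x"] f \<phi>G[OF x] by (simp add: lin_add[OF lf x lin_closed[OF s(1) \<phi>G[OF x]]])
    finally show ?thesis using \<phi>(3) lin_closed[OF lf] x \<phi>G[OF x] by blast
  qed
  have Z\<phi>: "\<phi> x \<in> Z" and Z\<psi>: "\<psi> x \<in> Z" if "x \<in> Z" for x
    using \<phi>(4)[OF Zp(1) s(3) that] that s(4) Zp(5) by (auto simp: \<psi>_def)
  have fs: "lin R G G f" "op_contra G f" "solvable G Z f" "f ` Z \<subseteq> Z" if "f \<in> set fs" for f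
    using prems(1)[of f] that by auto
  let ?t = "\<lambda>f x. f (\<phi> x)"
  have rec: "lin R G G (?t f) \<and> op_contra G (?t f) \<and> solvable G Z (?t f) \<and> ?t f ` Z \<subseteq> Z" if f: "f \<in> set fs" for f
  proof (intro conjI)
    note F = fs[OF f]
    show "lin R G G (?t f)" by (rule lin_comp[OF \<phi>(1) F(1)])
    show "solvable G Z (?t f)"
      by (rule solvable_twist[OF G Zp(1) _ F(1,3) \<phi>(1) Z\<phi> \<psi> Z\<psi> inv1 inv2 comm\<phi>[OF f]]) (use F(4) in auto)
    have "solvable G (carrier G) (?t f)"
      by (rule solvable_twist[OF G subset_refl _ F(1) _ \<phi>(1) _ \<psi> _ inv1 inv2 comm\<phi>[OF f]])
        (use F(2) lin_closed[OF F(1)] \<phi>G lin_closed[OF \<psi>] in \<open>auto simp: op_contra_def\<close>)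
    moreover have "separated G (?t f)"
      by (rule separated_twist[OF G F(1) _ \<phi>(1) \<psi> inv2 comm\<phi>[OF f]]) (use F(2) in \<open>auto simp: op_contra_def\<close>)
    ultimately show "op_contra G (?t f)" by (simp add: op_contra_def)
    show "?t f ` Z \<subseteq> Z" using F(4) Z\<phi> by auto
  qed
  show ?case
  proof (rule Suc.hyps(1)[of "map ?t fs"])
    fix x assume x: "x \<in> carrier G"
    \<comment> \<open>Since \<open>\<phi>\<close> inverts \<open>1 - s\<close>, the remainder of
      \<open>x\<close> for the twisted operators equals the remainder of \<open>\<phi> x\<close> for
      the original list including \<open>s\<close>.\<close>
    let ?w = "foldr (\<lambda>f. (\<oplus>\<^sub>G) (f (\<phi> x))) fs \<zero>\<^sub>G"
    have w: "foldr (\<lambda>f. (\<oplus>\<^sub>G) (f (\<phi> x))) gs \<zero>\<^sub>G \<in> carrier G" if "set gs \<subseteq> set fs" for gs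
      using that by (induction gs) (simp_all add: lin_closed[OF fs(1) \<phi>G[OF x]])
    note c = \<phi>G[OF x] lin_closed[OF s(1) \<phi>G[OF x]] w[OF subset_refl]
    have "x \<ominus>\<^sub>G ?w = (\<phi> x \<ominus>\<^sub>G s (\<phi> x)) \<ominus>\<^sub>G ?w" using inv2[OF x] by (simp add: \<psi>_def)
    also have "\<dots> = \<phi> x \<ominus>\<^sub>G (s (\<phi> x) \<oplus>\<^sub>G ?w)" using c by (simp add: a_minus_def G.minus_add G.a_ac)
    also have "\<dots> \<in> Z" using prems(3)[OF c(1)] by simp
    finally show "x \<ominus>\<^sub>G foldr (\<lambda>f. (\<oplus>\<^sub>G) (f x)) (map ?t fs) \<zero>\<^sub>G \<in> Z" by (simp add: foldr_map comp_def)
  next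
    fix f g x assume h: "f \<in> set (map ?t fs)" "g \<in> set (map ?t fs)" and x: "x \<in> carrier G"
    then obtain p q where p: "p \<in> set fs" "f = ?t p" "q \<in> set fs" "g = ?t q" by auto
    have "\<phi> (q (\<phi> x)) = q (\<phi> (\<phi> x))" "\<phi> (p (\<phi> x)) = p (\<phi> (\<phi> x))"
      using comm\<phi>[OF _ \<phi>G[OF x]] p by metis+
    then show "f (g x) = g (f x)" using prems(2)[of p q "\<phi> (\<phi> x)"] p \<phi>G[OF \<phi>G[OF x]] by simp
  qed (use rec len in auto)
qed

section \<open>Summation operators on modules of homomorphisms\<close>

lemma lin_scalar:
  assumes D: "module R D" and t: "t \<in> carrier R"
  shows "lin R D D (\<lambda>x. t \<odot>\<^sub>D x)"
  using lin_scale[OF D _ t, of D "\<lambda>x. x"] by (simp add: lin_def)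

text \<open>The infinite sum \<open>a n + t (a (n + 1)) + t^2 (a (n + 2)) + ...\<close>, meaningful
  over a \<open>t\<close>-contramodule.\<close>

definition telescope_sum :: "('a, 'b, 'm) module_scheme \<Rightarrow> 'a \<Rightarrow> (nat \<Rightarrow> 'b) \<Rightarrow> nat \<Rightarrow> 'b" where
  "telescope_sum D t a = (SOME b. \<forall>n. b n \<in> carrier D \<and> b n = a n \<oplus>\<^sub>D t \<odot>\<^sub>D b (Suc n))"

lemma
  assumes con: "op_contra D (\<lambda>x. t \<odot>\<^sub>D x)" and a: "\<And>n. a n \<in> carrier D"
  shows telescope_sum_closed: "telescope_sum D t a n \<in> carrier D"
    and telescope_sum_eq: "telescope_sum D t a n = a n \<oplus>\<^sub>D t \<odot>\<^sub>D telescope_sum D t a (Suc n)"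
proof -
  have "\<exists>b. \<forall>n. b n \<in> carrier D \<and> b n = a n \<oplus>\<^sub>D t \<odot>\<^sub>D b (Suc n)"
    using con a unfolding op_contra_def solvable_def by blast
  from someI_ex[OF this, folded telescope_sum_def]
  show "telescope_sum D t a n \<in> carrier D" "telescope_sum D t a n = a n \<oplus>\<^sub>D t \<odot>\<^sub>D telescope_sum D t a (Suc n)"
    by blast+
qed

lemma telescope_sum_unique:
  assumes D: "module R D" and t: "t \<in> carrier R" and con: "op_contra D (\<lambda>x. t \<odot>\<^sub>D x)"
    and a: "\<And>n. a n \<in> carrier D" and b: "\<And>n. b n \<in> carrier D" "\<And>n. b n = a n \<oplus>\<^sub>D t \<odot>\<^sub>D b (Suc n)"
  shows "b n = telescope_sum D t a n"
proof (rule op_contra_unique[OF D lin_scalar[OF D t]])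
  show "separated D (\<lambda>x. t \<odot>\<^sub>D x)" using con by (simp add: op_contra_def)
  show "telescope_sum D t a n = a n \<oplus>\<^sub>D t \<odot>\<^sub>D telescope_sum D t a (Suc n)" for n by (rule telescope_sum_eq[OF con a])
  show "telescope_sum D t a n \<in> carrier D" for n by (rule telescope_sum_closed[OF con a])
qed (rule a b)+

text \<open>The recursion for the operator sending \<open>h\<close> to \<open>t\<close> times
  \<open>h\<close> after \<open>X\<close> is solved pointwise: \<open>b n z\<close> is the sum over
  \<open>k\<close> of \<open>t^k\<close> times \<open>a (n + k)\<close> at
  \<open>(X ^^ k) z\<close>. Uniqueness of sums in \<open>D\<close> gives both the recursion and the
  linearity of \<open>b n\<close>, so \<open>X\<close> itself need not satisfy any convergence
  condition.\<close>

lemma hom_operator_solve: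
  assumes K: "module R K" and D: "module R D" and t: "t \<in> carrier R" and con: "op_contra D (\<lambda>x. t \<odot>\<^sub>D x)"
    and X: "lin R K K X" and a: "\<And>n::nat. lin R K D (a n)"
  shows "\<exists>b. (\<forall>n. lin R K D (b n)) \<and> (\<forall>n. \<forall>z\<in>carrier K. b n z = a n z \<oplus>\<^sub>D t \<odot>\<^sub>D b (Suc n) (X z))"
proof -
  interpret K: module R K by (rule K)
  interpret D: module R D by (rule D)
  let ?S = "telescope_sum D t"
  note S = telescope_sum_closed[OF con] telescope_sum_eq[OF con] telescope_sum_unique[OF D t con]
  define sq where "sq n z k = a (n + k) ((X ^^ k) z)" for n z k
  have lsq: "lin R K D (\<lambda>z. sq n z k)" for n k
    unfolding sq_def by (rule lin_comp[OF lin_funpow[OF X] a])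
  have sqc: "sq n z k \<in> carrier D" if "z \<in> carrier K" for n z k using lin_closed[OF lsq that] .
  \<comment> \<open>Dropping the first term of the sum at \<open>z\<close> leaves the sum at
    \<open>X z\<close> for the sequence starting one step later.\<close>
  have shift: "?S (sq n z) (Suc k) = ?S (sq (Suc n) (X z)) k" if z: "z \<in> carrier K" for n z k
  proof -
    have e: "sq (Suc n) (X z) k = sq n z (Suc k)" for k by (simp add: sq_def funpow_swap1)
    show ?thesis
      by (rule S(3)[of "sq (Suc n) (X z)" "\<lambda>k. ?S (sq n z) (Suc k)"])
        (unfold e, rule sqc[OF z], rule S(1), rule sqc[OF z], rule S(2), rule sqc[OF z])
  qed
  define b where "b n z = ?S (sq n z) 0" for n z
  have "b n z = a n z \<oplus>\<^sub>D t \<odot>\<^sub>D b (Suc n) (X z)" if z: "z \<in> carrier K" for n z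
    unfolding b_def shift[OF z, symmetric] by (subst S(2)) (auto simp: sqc z sq_def[of n z 0])
  moreover have "lin R K D (b n)" for n
  proof (rule linI)
    fix z w assume z: "z \<in> carrier K" and w: "w \<in> carrier K"
    note c = S(1)[of "sq n z", OF sqc[OF z]] S(1)[of "sq n w", OF sqc[OF w]]
    have "?S (sq n z) k \<oplus>\<^sub>D ?S (sq n w) k = ?S (sq n (z \<oplus>\<^sub>K w)) k" for k
    proof (rule S(3)[of "sq n (z \<oplus>\<^sub>K w)" "\<lambda>k. ?S (sq n z) k \<oplus>\<^sub>D ?S (sq n w) k"])
      fix k
      have "?S (sq n z) k \<oplus>\<^sub>D ?S (sq n w) k =
        (sq n z k \<oplus>\<^sub>D t \<odot>\<^sub>D ?S (sq n z) (Suc k)) \<oplus>\<^sub>D (sq n w k \<oplus>\<^sub>D t \<odot>\<^sub>D ?S (sq n w) (Suc k))"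
        using S(2)[of "sq n z" k, OF sqc[OF z]] S(2)[of "sq n w" k, OF sqc[OF w]] by presburger
      also have "\<dots> = sq n (z \<oplus>\<^sub>K w) k \<oplus>\<^sub>D t \<odot>\<^sub>D (?S (sq n z) (Suc k) \<oplus>\<^sub>D ?S (sq n w) (Suc k))"
        using c sqc z w t by (simp add: lin_add[OF lsq] D.smult_r_distr D.a_ac)
      finally show "?S (sq n z) k \<oplus>\<^sub>D ?S (sq n w) k = sq n (z \<oplus>\<^sub>K w) k \<oplus>\<^sub>D t \<odot>\<^sub>D (?S (sq n z) (Suc k) \<oplus>\<^sub>D ?S (sq n w) (Suc k))" .
    qed (use c sqc z w in auto)
    then show "b n (z \<oplus>\<^sub>K w) = b n z \<oplus>\<^sub>D b n w" by (simp add: b_def)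
  next
    fix r z assume r: "r \<in> carrier R" and z: "z \<in> carrier K"
    note c = S(1)[of "sq n z", OF sqc[OF z]]
    have "r \<odot>\<^sub>D ?S (sq n z) k = ?S (sq n (r \<odot>\<^sub>K z)) k" for k
    proof (rule S(3)[of "sq n (r \<odot>\<^sub>K z)" "\<lambda>k. r \<odot>\<^sub>D ?S (sq n z) k"])
      fix k
      have "r \<odot>\<^sub>D ?S (sq n z) k = r \<odot>\<^sub>D (sq n z k \<oplus>\<^sub>D t \<odot>\<^sub>D ?S (sq n z) (Suc k))"
        using S(2)[of "sq n z" k, OF sqc[OF z]] by presburger
      also have "\<dots> = sq n (r \<odot>\<^sub>K z) k \<oplus>\<^sub>D t \<odot>\<^sub>D (r \<odot>\<^sub>D ?S (sq n z) (Suc k))"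
        using c sqc z r t lin_smult[OF lin_scalar[OF D t] r c] by (simp add: lin_smult[OF lsq] D.smult_r_distr)
      finally show "r \<odot>\<^sub>D ?S (sq n z) k = sq n (r \<odot>\<^sub>K z) k \<oplus>\<^sub>D t \<odot>\<^sub>D (r \<odot>\<^sub>D ?S (sq n z) (Suc k))" .
    qed (use c sqc z r in auto)
    then show "b n (r \<odot>\<^sub>K z) = r \<odot>\<^sub>D b n z" by (simp add: b_def)
  qed (auto simp: b_def intro!: S(1) sqc)
  ultimately show ?thesis by (intro exI[of _ b] conjI allI ballI)
qed

text \<open>Along the orbit of \<open>z\<close> under \<open>X\<close> the values form a sequence in
  \<open>D\<close> in which each member is \<open>t\<close> times the next.\<close>

lemma hom_operator_separated:
  assumes con: "op_contra D (\<lambda>x. t \<odot>\<^sub>D x)" and X: "lin R K K X" and b: "\<And>n::nat. lin R K D (b n)"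
    and eq: "\<And>n z. z \<in> carrier K \<Longrightarrow> b n z = t \<odot>\<^sub>D b (Suc n) (X z)" and z: "z \<in> carrier K"
  shows "b n z = \<zero>\<^sub>D"
proof -
  have "b (n + k) ((X ^^ k) z) = \<zero>\<^sub>D" for k
  proof (rule separatedD[of D "\<lambda>x. t \<odot>\<^sub>D x" "\<lambda>k. b (n + k) ((X ^^ k) z)"])
    fix k show "b (n + k) ((X ^^ k) z) = t \<odot>\<^sub>D b (n + Suc k) ((X ^^ Suc k) z)"
      using eq[OF lin_closed[OF lin_funpow[OF X] z], of "n + k" k] by simp
  qed (use con lin_closed[OF b lin_closed[OF lin_funpow[OF X] z]] in \<open>auto simp: op_contra_def\<close>)
  from this[of 0] show ?thesis by simp
qed

definition hom_op :: "('a, 'b, 'm) module_scheme \<Rightarrow> ('a, 'c, 'n) module_scheme \<Rightarrow> 'a \<Rightarrow> ('b \<Rightarrow> 'b) \<Rightarrow> ('b \<Rightarrow> 'c) \<Rightarrow> 'b \<Rightarrow> 'c" where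
  "hom_op K D t X h = (\<lambda>z\<in>carrier K. t \<odot>\<^sub>D h (X z))"

lemma
  assumes K: "module R K" and D: "module R D" and t: "t \<in> carrier R" and X: "lin R K K X"
  shows hom_op_closed: "h \<in> module_hom R K D \<Longrightarrow> hom_op K D t X h \<in> module_hom R K D"
    and lin_hom_op: "lin R (Hom_module R K D) (Hom_module R K D) (hom_op K D t X)"
proof -
  interpret K: module R K by (rule K)
  interpret D: module R D by (rule D)
  show 1: "hom_op K D t X h \<in> module_hom R K D" if "h \<in> module_hom R K D" for h
    unfolding hom_op_def by (rule lin_restrict[OF K lin_scale[OF D lin_comp[OF X module_hom_lin[OF that]] t]])
  note Xc = lin_closed[OF X]
  show "lin R (Hom_module R K D) (Hom_module R K D) (hom_op K D t X)"
  proof (rule linI)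
    fix g h assume "g \<in> carrier (Hom_module R K D)" "h \<in> carrier (Hom_module R K D)"
    then have "lin R K D g" "lin R K D h" by (auto intro: module_hom_lin)
    note this[THEN lin_closed, OF Xc]
    then show "hom_op K D t X (g \<oplus>\<^bsub>Hom_module R K D\<^esub> h) = hom_op K D t X g \<oplus>\<^bsub>Hom_module R K D\<^esub> hom_op K D t X h"
      using t Xc by (auto simp: hom_op_def D.smult_r_distr fun_eq_iff restrict_def)
  next
    fix r h assume r: "r \<in> carrier R" and "h \<in> carrier (Hom_module R K D)"
    then have h: "lin R K D h" by (auto intro: module_hom_lin)
    then show "hom_op K D t X (r \<odot>\<^bsub>Hom_module R K D\<^esub> h) = r \<odot>\<^bsub>Hom_module R K D\<^esub> hom_op K D t X h"
      using t r Xc lin_smult[OF lin_scalar[OF D t] r lin_closed[OF h Xc]] by (auto simp: hom_op_def fun_eq_iff restrict_def)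
  qed (use 1 in simp)
qed

lemma op_contra_hom_op:
  assumes K: "module R K" and D: "module R D" and t: "t \<in> carrier R" and con: "op_contra D (\<lambda>x. t \<odot>\<^sub>D x)"
    and X: "lin R K K X"
  shows "op_contra (Hom_module R K D) (hom_op K D t X)"
proof -
  interpret K: module R K by (rule K)
  interpret D: module R D by (rule D)
  note Xc = lin_closed[OF X]
  have "solvable (Hom_module R K D) (module_hom R K D) (hom_op K D t X)"
    unfolding solvable_def
  proof (intro allI impI)
    fix a :: "nat \<Rightarrow> 'c \<Rightarrow> 'e" assume a: "\<forall>n. a n \<in> module_hom R K D"
    then have la: "lin R K D (a n)" for n by (auto intro: module_hom_lin)
    have "\<exists>b. (\<forall>n. lin R K D (b n)) \<and> (\<forall>n. \<forall>z\<in>carrier K. b n z = a n z \<oplus>\<^sub>D t \<odot>\<^sub>D b (Suc n) (X z))"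
      by (rule hom_operator_solve[OF K D t con X la])
    then obtain b where b0: "(\<forall>n. lin R K D (b n)) \<and> (\<forall>n. \<forall>z\<in>carrier K. b n z = a n z \<oplus>\<^sub>D t \<odot>\<^sub>D b (Suc n) (X z))"
      by (rule exE)
    note b = b0[THEN conjunct1, rule_format] b0[THEN conjunct2, rule_format]
    have "restrict (b n) (carrier K) = a n \<oplus>\<^bsub>Hom_module R K D\<^esub> hom_op K D t X (restrict (b (Suc n)) (carrier K))" for n
      unfolding Hom_module_simps hom_op_def by (rule restrict_ext) (simp add: Xc b(2)[symmetric])
    then show "\<exists>b. \<forall>n. b n \<in> module_hom R K D \<and> b n = a n \<oplus>\<^bsub>Hom_module R K D\<^esub> hom_op K D t X (b (Suc n))"
      by (rule_tac exI[of _ "\<lambda>n. restrict (b n) (carrier K)"], intro allI conjI) (rule lin_restrict[OF K b(1)])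
  qed
  moreover have "separated (Hom_module R K D) (hom_op K D t X)"
    unfolding separated_def
  proof (intro allI impI)
    fix b :: "nat \<Rightarrow> 'c \<Rightarrow> 'e" and n
    assume b: "\<forall>n. b n \<in> carrier (Hom_module R K D) \<and> b n = hom_op K D t X (b (Suc n))"
    then have "b n \<in> module_hom R K D" for n unfolding Hom_module_simps by blast
    then have lb: "lin R K D (b n)" "b n \<in> extensional (carrier K)" for n by (auto simp: module_hom_iff)
    have eq: "b n z = t \<odot>\<^sub>D b (Suc n) (X z)" if "z \<in> carrier K" for n z
      using b that by (metis hom_op_def restrict_apply')
    have "b n z = \<zero>\<^sub>D" if "z \<in> carrier K" for z
      by (rule hom_operator_separated[where b = b, OF con X lb(1) eq that])
    then show "b n = \<zero>\<^bsub>Hom_module R K D\<^esub>"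
      using lb(2)[of n] by (auto intro!: extensionalityI[of _ "carrier K"])
  qed
  ultimately show ?thesis by (simp add: op_contra_def)
qed

lemma lin_eval:
  "z \<in> carrier K \<Longrightarrow> lin R (Hom_module R K D) D (\<lambda>h. h z)"
  by (rule linI) (auto simp: module_hom_iff lin_closed)

text \<open>Let \<open>Z\<close> be the module of maps on \<open>K\<close> that extend to
  \<open>F\<close> along \<open>j\<close>. Each triple in \<open>ps\<close> gives the operator
  sending \<open>h\<close> to \<open>t\<close> times \<open>h\<close> after \<open>X\<close>; it
  preserves \<open>Z\<close>, and its sums stay in \<open>Z\<close>, because \<open>X\<close> is
  compatible with the operator \<open>Y\<close> on \<open>F\<close>. The identity minus the sum of
  all operators sends \<open>h\<close> to a map that factors through \<open>e\<close>, hence into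
  \<open>Z\<close>. Therefore \<open>op_contra_exhaust\<close> shows that \<open>Z\<close> is
  everything.\<close>

lemma hom_extend_by_operators:
  fixes ps :: "('a \<times> ('b \<Rightarrow> 'b) \<times> ('c \<Rightarrow> 'c)) list" and D :: "('a, 'd, 'n) module_scheme"
  assumes K: "module R K" and F: "module R F" and D: "module R D" and j: "lin R K F j"
    and ps: "\<And>t X Y. (t, X, Y) \<in> set ps \<Longrightarrow> t \<in> carrier R \<and> op_contra D (\<lambda>x. t \<odot>\<^sub>D x) \<and> lin R K K X \<and> lin R F F Y
      \<and> (\<forall>z\<in>carrier K. j (X z) = Y (j z))"
    and com: "\<And>t X Y t' X' Y' z. (t, X, Y) \<in> set ps \<Longrightarrow> (t', X', Y') \<in> set ps \<Longrightarrow> z \<in> carrier K \<Longrightarrow> X (X' z) = X' (X z)"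
    and e: "lin R F K e" "\<And>z. z \<in> carrier K \<Longrightarrow> z \<ominus>\<^sub>K foldr (\<lambda>(t, X, Y). (\<oplus>\<^sub>K) (t \<odot>\<^sub>K X z)) ps \<zero>\<^sub>K = e (j z)"
    and g: "lin R K D g"
  shows "\<exists>k. lin R F D k \<and> (\<forall>z\<in>carrier K. k (j z) = g z)"
proof -
  interpret K: module R K by (rule K)
  interpret F: module R F by (rule F)
  interpret D: module R D by (rule D)
  let ?G = "Hom_module R K D"
  have G: "module R ?G" by (rule module_Hom[OF K D])
  interpret G: module R ?G by (rule G)
  note jc = lin_closed[OF j]
  define Z where "Z = {h \<in> module_hom R K D. \<exists>k. lin R F D k \<and> (\<forall>z\<in>carrier K. k (j z) = h z)}"
  have ZI: "h \<in> Z" if "h \<in> carrier ?G" "lin R F D k" "\<And>z. z \<in> carrier K \<Longrightarrow> k (j z) = h z" for h k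
    using that by (auto simp: Z_def)
  have ZE: "\<exists>k. lin R F D k \<and> (\<forall>z\<in>carrier K. k (j z) = h z)" if "h \<in> Z" for h
    using that by (auto simp: Z_def)
  have ZG: "Z \<subseteq> carrier ?G" by (auto simp: Z_def)
  have Z: "submodule Z R ?G"
  proof (rule module_submodule(1)[OF G ZG])
    show "\<zero>\<^sub>?G \<in> Z" by (rule ZI[OF G.zero_closed lin_zero_map[OF D]]) simp
  next
    fix h h' assume h: "h \<in> Z" "h' \<in> Z"
    obtain k where k: "lin R F D k" "\<forall>z\<in>carrier K. k (j z) = h z" using ZE[OF h(1)] by blast
    obtain k' where k': "lin R F D k'" "\<forall>z\<in>carrier K. k' (j z) = h' z" using ZE[OF h(2)] by blast
    show "h \<oplus>\<^sub>?G h' \<in> Z"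
      by (rule ZI[OF G.a_closed lin_plus[OF D k(1) k'(1)]]) (use h ZG k k' in auto)
  next
    fix r h assume r: "r \<in> carrier R" and h: "h \<in> Z"
    obtain k where k: "lin R F D k" "\<forall>z\<in>carrier K. k (j z) = h z" using ZE[OF h(1)] by blast
    show "r \<odot>\<^sub>?G h \<in> Z"
      by (rule ZI[OF G.smult_closed[OF r] lin_scale[OF D k(1) r]]) (use h ZG k in auto)
  qed
  let ?f = "\<lambda>(t, X, Y :: 'c \<Rightarrow> 'c). hom_op K D t X"
  have "carrier ?G \<subseteq> Z"
  proof (rule op_contra_exhaust[OF G Z, of "map ?f ps"])
    fix f assume "f \<in> set (map ?f ps)"
    then obtain t X Y where m: "(t, X, Y) \<in> set ps" "f = hom_op K D t X" by auto
    note p = ps[OF m(1)]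
    have t: "t \<in> carrier R" and con: "op_contra D (\<lambda>x. t \<odot>\<^sub>D x)" and X: "lin R K K X" and Y: "lin R F F Y"
      and XY: "\<And>z. z \<in> carrier K \<Longrightarrow> j (X z) = Y (j z)" using p by auto
    note Xc = lin_closed[OF X]
    \<comment> \<open>The sums are formed for the extensions to \<open>F\<close>, with
      \<open>Y\<close> in the role of \<open>X\<close>, and then restricted along
      \<open>j\<close>.\<close>
    have "solvable ?G Z f" unfolding solvable_def
    proof (intro allI impI)
      fix a :: "nat \<Rightarrow> 'b \<Rightarrow> 'd" assume a: "\<forall>n. a n \<in> Z"
      then have "\<forall>n. \<exists>k. lin R F D k \<and> (\<forall>z\<in>carrier K. k (j z) = a n z)" using ZE by blast
      then obtain c where c: "\<And>n. lin R F D (c n)" "\<And>n z. z \<in> carrier K \<Longrightarrow> c n (j z) = a n z" by metis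
      have "\<exists>b. (\<forall>n. lin R F D (b n)) \<and> (\<forall>n. \<forall>z\<in>carrier F. b n z = c n z \<oplus>\<^sub>D t \<odot>\<^sub>D b (Suc n) (Y z))"
        by (rule hom_operator_solve[OF F D t con Y c(1)])
      then obtain b where b0: "(\<forall>n. lin R F D (b n)) \<and> (\<forall>n. \<forall>z\<in>carrier F. b n z = c n z \<oplus>\<^sub>D t \<odot>\<^sub>D b (Suc n) (Y z))"
        by (rule exE)
      note b = b0[THEN conjunct1, rule_format] b0[THEN conjunct2, rule_format]
      let ?b = "\<lambda>n. \<lambda>z\<in>carrier K. b n (j z)"
      have "?b n \<in> Z" for n
        by (rule ZI[OF _ b(1)[of n]]) (use lin_restrict[OF K lin_comp[OF j b(1)]] in auto)
      moreover have "?b n = a n \<oplus>\<^sub>?G f (?b (Suc n))" for n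
        unfolding m(2) Hom_module_simps hom_op_def
        by (rule restrict_ext) (simp add: Xc XY c(2)[symmetric] jc b(2)[symmetric])
      ultimately show "\<exists>b. \<forall>n. b n \<in> Z \<and> b n = a n \<oplus>\<^sub>?G f (b (Suc n))"
        by (intro exI[of _ ?b] allI conjI)
    qed
    moreover have "f ` Z \<subseteq> Z"
    proof (rule image_subsetI)
      fix h assume h: "h \<in> Z"
      obtain k where k: "lin R F D k" "\<forall>z\<in>carrier K. k (j z) = h z" using ZE[OF h(1)] by blast
      show "f h \<in> Z"
        by (rule ZI[OF _ lin_scale[OF D lin_comp[OF Y k(1)] t]])
          (use k h ZG hom_op_closed[OF K D t X] Xc in \<open>auto simp: m(2) hom_op_def XY[symmetric]\<close>)
    qed
    ultimately show "lin R ?G ?G f \<and> op_contra ?G f \<and> solvable ?G Z f \<and> f ` Z \<subseteq> Z"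
      unfolding m(2) using lin_hom_op[OF K D t X] op_contra_hom_op[OF K D t con X] by blast
  next
    fix f f' h assume "f \<in> set (map ?f ps)" "f' \<in> set (map ?f ps)" and h: "h \<in> carrier ?G"
    then obtain t X Y t' X' Y' where m: "(t, X, Y) \<in> set ps" "f = hom_op K D t X"
      "(t', X', Y') \<in> set ps" "f' = hom_op K D t' X'" by auto
    have c: "t \<in> carrier R" "t' \<in> carrier R" "\<And>z. z \<in> carrier K \<Longrightarrow> X z \<in> carrier K" "\<And>z. z \<in> carrier K \<Longrightarrow> X' z \<in> carrier K"
      using ps[OF m(1)] ps[OF m(3)] by (auto intro: lin_closed)
    have hc: "h z \<in> carrier D" if "z \<in> carrier K" for z using h that by (auto simp: module_hom_iff lin_closed)
    show "f (f' h) = f' (f h)"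
      unfolding m(2,4) hom_op_def
      by (rule restrict_ext) (use c hc com[OF m(1,3)] in \<open>simp add: D.smult_assoc1[symmetric] K.R.m_comm\<close>)
  next
    fix h assume h: "h \<in> carrier ?G"
    then have lh: "lin R K D h" by (simp add: module_hom_iff)
    let ?w = "\<lambda>ps. foldr (\<lambda>f. (\<oplus>\<^sub>?G) (f h)) (map ?f ps) \<zero>\<^sub>?G"
    let ?v = "\<lambda>z ps. foldr (\<lambda>(t, X, Y :: 'c \<Rightarrow> 'c). (\<oplus>\<^sub>K) (t \<odot>\<^sub>K X z)) ps \<zero>\<^sub>K"
    have *: "?w qs \<in> carrier ?G \<and> (\<forall>z\<in>carrier K. ?v z qs \<in> carrier K \<and> ?w qs z = h (?v z qs))" if "set qs \<subseteq> set ps" for qs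
      using that
    proof (induction qs)
      case Nil
      then show ?case using lin_zero[OF K D lh] G.zero_closed by (simp add: restrict_def)
    next
      case (Cons q qs)
      obtain t X Y where q: "q = (t, X, Y)" by (cases q)
      have qq: "t \<in> carrier R" "lin R K K X" using ps[of t X Y] Cons.prems q by auto
      have IH: "?w qs \<in> carrier ?G" "\<And>z. z \<in> carrier K \<Longrightarrow> ?v z qs \<in> carrier K" "\<And>z. z \<in> carrier K \<Longrightarrow> ?w qs z = h (?v z qs)"
        using Cons.IH Cons.prems by (simp_all del: Hom_module_simps)
      have 1: "?w (q # qs) = hom_op K D t X h \<oplus>\<^sub>?G ?w qs" by (simp add: q)
      have 2: "?v z (q # qs) = t \<odot>\<^sub>K X z \<oplus>\<^sub>K ?v z qs" for z by (simp add: q)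
      have "hom_op K D t X h \<in> carrier ?G" using hom_op_closed[OF K D qq] h by simp
      then have "?w (q # qs) \<in> carrier ?G" unfolding 1 using IH(1) by (rule G.a_closed)
      moreover have "?v z (q # qs) \<in> carrier K \<and> ?w (q # qs) z = h (?v z (q # qs))" if z: "z \<in> carrier K" for z
        unfolding 1 2 using IH(2,3)[OF z] z qq lin_closed[OF qq(2) z]
        by (simp add: lin_add[OF lh] lin_smult[OF lh] hom_op_def)
      ultimately show ?case by blast
    qed
    note w = *[OF subset_refl]
    have d: "h \<ominus>\<^sub>?G ?w ps \<in> carrier ?G" using h w by (intro G.minus_closed) auto
    show "h \<ominus>\<^sub>?G ?w ps \<in> Z"
    proof (rule ZI[OF d lin_comp[OF e(1) lh]])
      fix z assume z: "z \<in> carrier K"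
      have "h (e (j z)) = h z \<ominus>\<^sub>D h (?v z ps)"
        unfolding e(2)[OF z, symmetric] using w z by (intro lin_minus[OF K D lh]) auto
      also have "\<dots> = h z \<ominus>\<^sub>D ?w ps z" using w z by simp
      also have "\<dots> = (h \<ominus>\<^sub>?G ?w ps) z"
        by (rule lin_minus[OF G D lin_eval[OF z] h, symmetric]) (use w in blast)
      finally show "h (e (j z)) = (h \<ominus>\<^sub>?G ?w ps) z" .
    qed
  qed
  then have "restrict g (carrier K) \<in> Z" using lin_restrict[OF K g] by auto
  from ZE[OF this] show ?thesis by simp
qed

lemma lin_id: "lin R M M (\<lambda>x. x)"
  by (rule linI) auto

lemma zero_Hom_iff:
  assumes "module R K" "module R D"
  shows "zero_module (Hom_module R K D) \<longleftrightarrow> (\<forall>h. lin R K D h \<longrightarrow> (\<forall>z\<in>carrier K. h z = \<zero>\<^sub>D))"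
proof
  assume z: "zero_module (Hom_module R K D)"
  show "\<forall>h. lin R K D h \<longrightarrow> (\<forall>z\<in>carrier K. h z = \<zero>\<^sub>D)"
  proof (intro allI impI ballI)
    fix h z assume h: "lin R K D h" and z': "z \<in> carrier K"
    have "restrict h (carrier K) = (\<lambda>x\<in>carrier K. \<zero>\<^sub>D)"
      using lin_restrict[OF assms(1) h] z by (auto simp: zero_module_def)
    then show "h z = \<zero>\<^sub>D" using z' by (metis restrict_apply')
  qed
next
  assume *: "\<forall>h. lin R K D h \<longrightarrow> (\<forall>z\<in>carrier K. h z = \<zero>\<^sub>D)"
  have "h = (\<lambda>x\<in>carrier K. \<zero>\<^sub>D)" if "h \<in> module_hom R K D" for h
    using that * by (intro extensionalityI[of _ "carrier K"]) (auto simp: module_hom_iff)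
  moreover have "(\<lambda>x\<in>carrier K. \<zero>\<^sub>D) \<in> module_hom R K D"
    by (rule lin_restrict[OF assms(1) lin_zero_map[OF assms(2)]])
  ultimately show "zero_module (Hom_module R K D)" unfolding zero_module_def Hom_module_simps by blast
qed

lemma ext_ideal_list:
  assumes "y \<in> ext_ideal U u A"
  obtains ps where "set ps \<subseteq> A \<times> carrier U" "y = foldr (\<lambda>(a, z). (\<oplus>\<^sub>U) (u a \<otimes>\<^sub>U z)) ps \<zero>\<^sub>U"
proof -
  have "\<exists>ps. set ps \<subseteq> A \<times> carrier U \<and> y = foldr (\<lambda>(a, z). (\<oplus>\<^sub>U) (u a \<otimes>\<^sub>U z)) ps \<zero>\<^sub>U"
    using assms
  proof induction
    case zero
    show ?case by (intro exI[of _ "[]"]) simp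
  next
    case (step a z w)
    then obtain ps where "set ps \<subseteq> A \<times> carrier U" "w = foldr (\<lambda>(a, z). (\<oplus>\<^sub>U) (u a \<otimes>\<^sub>U z)) ps \<zero>\<^sub>U" by blast
    with step show ?case by (intro exI[of _ "(a, z) # ps"]) simp
  qed
  then show thesis using that by blast
qed

section \<open>From contramodules over elements to contramodules over \<open>u\<close>\<close>

context ring_ext
begin

text \<open>Both vanishing statements are extension problems for
  \<open>hom_extend_by_operators\<close>, with the operators taken from an expression of 1 as a
  combination of elements of \<open>A\<close>. For Hom the map is extended along the zero map, for
  Ext from the syzygy to the free cover.\<close>

lemma u_contramodule_of_op_contra:
  assumes A: "A \<subseteq> carrier R" and one: "\<one>\<^sub>U \<in> ext_ideal U u A" and D: "module R D"
    and con: "\<And>t. t \<in> A \<Longrightarrow> op_contra D (\<lambda>x. t \<odot>\<^sub>D x)"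
  shows "u_contramodule R U u D"
proof -
  interpret V: module R V by (rule V)
  interpret D: module R D by (rule D)
  obtain ps where ps: "set ps \<subseteq> A \<times> carrier U" "\<one>\<^sub>U = foldr (\<lambda>(a, z). (\<oplus>\<^sub>U) (u a \<otimes>\<^sub>U z)) ps \<zero>\<^sub>U"
    using ext_ideal_list[OF one] by blast
  have psc: "a \<in> carrier R \<and> x \<in> carrier U" if "(a, x) \<in> set ps" for a x
    using ps(1) A that by auto
  let ?y = "\<lambda>ps. foldr (\<lambda>(a, z). (\<oplus>\<^sub>U) (u a \<otimes>\<^sub>U z)) ps \<zero>\<^sub>U"
  have yc: "?y qs \<in> carrier U" if "set qs \<subseteq> set ps" for qs
    using that by (induction qs) (auto dest!: psc)
  have X: "lin R V V (\<lambda>z. x \<otimes>\<^sub>U z)" if "x \<in> carrier U" for x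
    by (rule linI) (use that in \<open>auto simp: S.r_distr S.m_ac\<close>)
  have Hom: "g z = \<zero>\<^sub>D" if g: "lin R V D g" and z: "z \<in> carrier U" for g z
  proof -
    \<comment> \<open>\<open>j\<close> is the zero map here, so the identity serves as second
      operator, and an extension \<open>k\<close> forces \<open>g z = k 0 = 0\<close>.\<close>
    let ?qs = "\<lambda>ps. map (\<lambda>(a, x). (a, \<lambda>z. x \<otimes>\<^sub>U z, \<lambda>z. z)) ps :: ('a \<times> ('b \<Rightarrow> 'b) \<times> ('b \<Rightarrow> 'b)) list"
    have "\<exists>k. lin R V D k \<and> (\<forall>z\<in>carrier V. k ((\<lambda>z. \<zero>\<^sub>U) z) = g z)"
    proof (rule hom_extend_by_operators[OF V V D _ _ _ lin_id _ g, of _ "?qs ps"])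
      show "lin R V V (\<lambda>z. \<zero>\<^sub>U)" using lin_zero_map[OF V] by simp
    next
      fix t X Y assume "(t, X, Y) \<in> set (?qs ps)"
      then obtain x where "(t, x) \<in> set ps" "X = (\<lambda>z. x \<otimes>\<^sub>U z)" "Y = (\<lambda>z. z)" by auto
      moreover from this have "t \<in> A" "x \<in> carrier U" using ps(1) by auto
      ultimately show "t \<in> carrier R \<and> op_contra D (\<lambda>x. t \<odot>\<^sub>D x) \<and> lin R V V X \<and> lin R V V Y \<and>
        (\<forall>z\<in>carrier V. \<zero>\<^sub>U = Y \<zero>\<^sub>U)"
        using A con X lin_id[of R V] by auto
    next
      fix t X Y t' X' Y' z assume "(t, X, Y) \<in> set (?qs ps)" "(t', X', Y') \<in> set (?qs ps)" and z: "z \<in> carrier V"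
      then obtain x x' where "(t, x) \<in> set ps" "X = (\<lambda>z. x \<otimes>\<^sub>U z)" "(t', x') \<in> set ps" "X' = (\<lambda>z. x' \<otimes>\<^sub>U z)" by auto
      moreover from this have "x \<in> carrier U" "x' \<in> carrier U" using ps(1) by auto
      ultimately show "X (X' z) = X' (X z)" using z by (simp add: S.m_ac)
    next
      fix z assume z: "z \<in> carrier V"
      have "foldr (\<lambda>(t, X, Y). (\<oplus>\<^sub>V) (t \<odot>\<^sub>V X z)) (?qs qs) \<zero>\<^sub>V = ?y qs \<otimes>\<^sub>U z" if "set qs \<subseteq> set ps" for qs
        using that
      proof (induction qs)
        case (Cons q qs)
        obtain a x where q: "q = (a, x)" by (cases q)
        then have "a \<in> carrier R" "x \<in> carrier U" using Cons.prems ps(1) A by auto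
        then show ?case using Cons yc[of qs] z by (simp add: q S.l_distr S.m_assoc)
      qed (use z in simp)
      from this[of ps] show "z \<ominus>\<^sub>V foldr (\<lambda>(t, X, Y). (\<oplus>\<^sub>V) (t \<odot>\<^sub>V X z)) (?qs ps) \<zero>\<^sub>V = \<zero>\<^sub>U"
        using z module_minus_self[OF V z] by (simp add: ps(2)[symmetric])
    qed
    then obtain k where "lin R V D k" "k \<zero>\<^sub>U = g z" using z by auto
    then show ?thesis using lin_zero[OF V D] by simp
  qed
  let ?F = "free_cover R V" and ?K = "syzygy R V" and ?c = "cover_map R V"
  note F = module_free_cover[OF V] and K = module_syzygy[OF V]
  note gen = free_gen_cover[OF V, simplified] and c = lin_cover_map[OF V]
  interpret F: module R ?F by (rule F)
  \<comment> \<open>Multiplication by \<open>x\<close> is lifted to the free cover by moving the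
    generator of \<open>w\<close> to the generator of the product. Lifts chosen on generators in
    this way commute exactly, as the summation argument requires.\<close>
  define X' where "X' x = free_lift R (carrier V) ?F (\<lambda>w. free_gen R (x \<otimes>\<^sub>U w))" for x
  have X': "lin R ?F ?F (X' x)" "\<And>w. w \<in> carrier U \<Longrightarrow> X' x (free_gen R w) = free_gen R (x \<otimes>\<^sub>U w)" if "x \<in> carrier U" for x
    using lin_free_lift[OF F, of "carrier V" "\<lambda>w. free_gen R (x \<otimes>\<^sub>U w)"]
      free_lift_gen[OF F, of "carrier V" "\<lambda>w. free_gen R (x \<otimes>\<^sub>U w)"] gen that
    by (auto simp: X'_def free_cover_def)
  have cX': "?c (X' x f) = x \<otimes>\<^sub>U ?c f" if x: "x \<in> carrier U" and f: "f \<in> carrier ?F" for x f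
    by (rule lin_free_eq[OF R.is_cring lin_comp[OF X'(1)[OF x] c, unfolded free_cover_def] lin_comp[OF c X[OF x], unfolded free_cover_def] V])
      (use f x X'(2) cover_map_gen[OF V] in \<open>auto simp: free_cover_def\<close>)
  have comX': "X' x (X' x' f) = X' x' (X' x f)" if x: "x \<in> carrier U" "x' \<in> carrier U" and f: "f \<in> carrier ?F" for x x' f
    by (rule lin_free_eq[OF R.is_cring lin_comp[OF X'(1)[OF x(2)] X'(1)[OF x(1)], unfolded free_cover_def]
          lin_comp[OF X'(1)[OF x(1)] X'(1)[OF x(2)], unfolded free_cover_def] F[unfolded free_cover_def]])
      (use f x X'(2) in \<open>auto simp: free_cover_def S.m_ac\<close>)
  have incl: "lin R ?K ?F (\<lambda>z. z)" by (rule linI) auto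
  have KX': "lin R ?K ?K (X' x)" if x: "x \<in> carrier U" for x
    by (rule linI) (use cX'[OF x] x lin_closed[OF X'(1)[OF x]] in \<open>simp_all add: lin_add[OF X'(1)[OF x]] lin_smult[OF X'(1)[OF x]]\<close>)
  let ?qs = "\<lambda>ps. map (\<lambda>(a, x). (a, X' x, X' x)) ps"
  let ?w = "\<lambda>f ps. foldr (\<lambda>(t, X, Y :: ('b \<Rightarrow> 'a) \<Rightarrow> 'b \<Rightarrow> 'a). (\<oplus>\<^sub>?F) (t \<odot>\<^sub>?F X f)) (?qs ps) \<zero>\<^sub>?F"
  have w: "lin R ?F ?F (\<lambda>f. ?w f qs) \<and> (\<forall>f\<in>carrier ?F. ?c (?w f qs) = ?y qs \<otimes>\<^sub>U ?c f)" if "set qs \<subseteq> set ps" for qs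
    using that
  proof (induction qs)
    case Nil
    show ?case using lin_zero_map[OF F] lin_zero[OF F V c] lin_closed[OF c] by simp
  next
    case (Cons q qs)
    obtain a x where q: "q = (a, x)" by (cases q)
    then have ax: "a \<in> carrier R" "x \<in> carrier U" using Cons.prems ps(1) A by auto
    have e: "?w f (q # qs) = a \<odot>\<^sub>?F X' x f \<oplus>\<^sub>?F ?w f qs" for f by (simp add: q)
    have IH: "lin R ?F ?F (\<lambda>f. ?w f qs)" "\<And>f. f \<in> carrier ?F \<Longrightarrow> ?c (?w f qs) = ?y qs \<otimes>\<^sub>U ?c f" using Cons by auto
    have "?c (?w f (q # qs)) = ?y (q # qs) \<otimes>\<^sub>U ?c f" if f: "f \<in> carrier ?F" for f
      unfolding e using ax f IH(2)[OF f] lin_closed[OF IH(1) f] lin_closed[OF X'(1)[OF ax(2)] f] lin_closed[OF c f] yc[of qs] Cons.prems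
      by (simp add: lin_add[OF c] lin_smult[OF c] cX' q S.l_distr S.m_assoc)
    moreover have "lin R ?F ?F (\<lambda>f. ?w f (q # qs))"
      unfolding e by (rule lin_plus[OF F lin_scale[OF F X'(1)[OF ax(2)] ax(1)] IH(1)])
    ultimately show ?case by blast
  qed
  \<comment> \<open>On the free cover the lifted operators add up to the identity only modulo
    syzygies. The defect is therefore a map into the syzygy, and it takes the part of the remainder
    map in \<open>hom_extend_by_operators\<close>.\<close>
  define e where "e f = f \<ominus>\<^sub>?F ?w f ps" for f
  note lw = w[OF subset_refl, THEN conjunct1] and cw = w[OF subset_refl, THEN conjunct2, rule_format]
  have eF: "lin R ?F ?F e" unfolding e_def by (rule lin_diff[OF F lin_id lw])
  have "?c (e f) = \<zero>\<^sub>U" if f: "f \<in> carrier ?F" for f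
  proof -
    have "?c (e f) = ?c f \<ominus>\<^sub>V ?c (?w f ps)"
      unfolding e_def by (rule lin_minus[OF F V c f lin_closed[OF lw f]])
    also have "?c (?w f ps) = ?c f" unfolding cw[OF f] ps(2)[symmetric] using lin_closed[OF c f] by simp
    finally show ?thesis using module_minus_self[OF V lin_closed[OF c f]] by simp
  qed
  then have e: "lin R ?F ?K e"
    using eF by (auto simp: lin_def)
  have Kops: "add ?K = add ?F" "smult ?K = smult ?F" "zero ?K = zero ?F" by (auto simp: syzygy_def)
  have "\<exists>k. lin R ?F D k \<and> (\<forall>z\<in>carrier ?K. k ((\<lambda>z. z) z) = g z)" if g: "lin R ?K D g" for g
  proof (rule hom_extend_by_operators[OF K F D incl _ _ e _ g, of "?qs ps"])
    fix t X Y assume "(t, X, Y) \<in> set (?qs ps)"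
    then obtain x where "(t, x) \<in> set ps" "X = X' x" "Y = X' x" by auto
    moreover from this have "t \<in> A" "x \<in> carrier U" using ps(1) by auto
    ultimately show "t \<in> carrier R \<and> op_contra D (\<lambda>x. t \<odot>\<^sub>D x) \<and> lin R ?K ?K X \<and> lin R ?F ?F Y \<and>
      (\<forall>z\<in>carrier ?K. X z = Y z)"
      using A con X' KX' by auto
  next
    fix t X Y t' X'' Y' z assume "(t, X, Y) \<in> set (?qs ps)" "(t', X'', Y') \<in> set (?qs ps)" and z: "z \<in> carrier ?K"
    then obtain x x' where "(t, x) \<in> set ps" "X = X' x" "(t', x') \<in> set ps" "X'' = X' x'" by auto
    moreover from this have "x \<in> carrier U" "x' \<in> carrier U" using ps(1) by auto
    ultimately show "X (X'' z) = X'' (X z)" using z comX' by simp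
  next
    fix z assume z: "z \<in> carrier ?K"
    have zF: "z \<in> carrier ?F" using z by simp
    have 0: "?c z = \<zero>\<^sub>U" using z by simp
    have wF: "?w z ps \<in> carrier ?F" by (rule lin_closed[OF lw zF])
    have wK: "?w z ps \<in> carrier ?K" using cw[OF zF] wF 0 yc[of ps] by simp
    show "z \<ominus>\<^sub>?K foldr (\<lambda>(t, X, Y). (\<oplus>\<^sub>?K) (t \<odot>\<^sub>?K X z)) (?qs ps) \<zero>\<^sub>?K = e z"
      unfolding Kops e_def by (rule lin_minus[OF K F incl z wK])
  qed
  then show ?thesis
    unfolding u_contramodule_def zero_Hom_iff[OF V D] zero_Ext1_iff[OF V D] restrict_scalars_simps(1)
    using D Hom by blast
qed

end

section \<open>The telescope\<close>

lemma scalar_inverse: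
  assumes X: "module R X" and s: "s \<in> carrier R"
    and inj: "\<And>y. y \<in> carrier X \<Longrightarrow> s \<odot>\<^sub>X y = \<zero>\<^sub>X \<Longrightarrow> y = \<zero>\<^sub>X"
    and surj: "\<And>y. y \<in> carrier X \<Longrightarrow> \<exists>y'\<in>carrier X. s \<odot>\<^sub>X y' = y"
  obtains g where "lin R X X g" "\<And>y. y \<in> carrier X \<Longrightarrow> s \<odot>\<^sub>X g y = y" "\<And>y. y \<in> carrier X \<Longrightarrow> g (s \<odot>\<^sub>X y) = y"
proof -
  interpret X: module R X by (rule X)
  obtain g where g: "lin R X X g" "\<And>y v. y \<in> carrier X \<Longrightarrow> v \<in> carrier X \<Longrightarrow> s \<odot>\<^sub>X v = y \<Longrightarrow> g y = v"
    "\<And>y. y \<in> carrier X \<Longrightarrow> s \<odot>\<^sub>X g y = y"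
  proof (rule lin_of_rel[OF X X, of "\<lambda>y v. s \<odot>\<^sub>X v = y"])
    fix r b v assume "r \<in> carrier R" "b \<in> carrier X" "v \<in> carrier X" "s \<odot>\<^sub>X v = b"
    then show "s \<odot>\<^sub>X (r \<odot>\<^sub>X v) = r \<odot>\<^sub>X b"
      using lin_smult[OF lin_scalar[OF X s]] by simp
  qed (use s inj surj X.smult_r_distr in blast)+
  have "g (s \<odot>\<^sub>X y) = y" if "y \<in> carrier X" for y using g(2)[of "s \<odot>\<^sub>X y" y] s that by simp
  then show thesis using that g by blast
qed

lemma lin_zero_of_factor:
  assumes Hom: "zero_module (Hom_module R X C)" and W: "module R W" and X: "module R X" and C: "module R C"
    and \<pi>: "lin R W X \<pi>" "\<And>x. x \<in> carrier X \<Longrightarrow> \<exists>w\<in>carrier W. \<pi> w = x"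
    and \<delta>: "lin R W C \<delta>" "\<And>w. w \<in> carrier W \<Longrightarrow> \<pi> w = \<zero>\<^sub>X \<Longrightarrow> \<delta> w = \<zero>\<^sub>C" and w: "w \<in> carrier W"
  shows "\<delta> w = \<zero>\<^sub>C"
proof -
  obtain h where h: "lin R X C h" "\<And>w. w \<in> carrier W \<Longrightarrow> h (\<pi> w) = \<delta> w"
    by (rule lin_factor[OF W X C \<pi> \<delta>(1)]) (use \<delta>(2) in blast)+
  then show ?thesis using Hom[unfolded zero_Hom_iff[OF X C], rule_format, OF h(1) lin_closed[OF \<pi>(1) w]] w by simp
qed

text \<open>\<open>X = M[1/t]\<close> is the direct limit of copies of \<open>M\<close> under
  multiplication by \<open>t\<close>. This is the exact sequence
  \<open>0 -> T -> T -> X -> 0\<close> with maps \<open>\<beta>\<close> and \<open>p\<close>, where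
  \<open>T\<close> is a sum of countably many copies of \<open>M\<close> and \<open>p\<close> sends
  \<open>y\<close> in place \<open>n\<close> to the fraction \<open>y / t^n\<close>. It is used with
  \<open>M = R\<close> to describe \<open>t\<close>-contramodules and with \<open>M = R_m\<close>
  for the colocalizations.\<close>

locale telescope =
  fixes R :: "('a, 'r) ring_scheme" and t and M :: "('a, 'b, 'm) module_scheme" and X :: "('a, 'c, 'n) module_scheme" and \<iota>
  assumes t: "t \<in> carrier R"
    and loc: "is_localization R (range (\<lambda>n::nat. t [^]\<^sub>R n)) M X \<iota>"
begin

lemma M: "module R M" and X: "module R X" and \<iota>: "lin R M X \<iota>"
  using is_localizationD[OF loc] by auto

sublocale M: module R M by (rule M)
sublocale X: module R X by (rule X)

lemma pow_closed [simp]: "t [^]\<^sub>R (n::nat) \<in> carrier R"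
  using t by simp

abbreviation "T \<equiv> dsum_module (UNIV :: nat set) (\<lambda>_. M)"
abbreviation "emb \<equiv> dsum_inj (UNIV :: nat set) (\<lambda>_. M)"

lemma T: "module R T" by (rule module_dsum[OF M.is_cring M])

sublocale T: module R T by (rule T)

lemma lin_emb: "lin R M T (emb n)" by (rule lin_dsum_inj[OF M]) simp

definition q :: "nat \<Rightarrow> 'b \<Rightarrow> 'c" where
  "q n y = (THE z. z \<in> carrier X \<and> t [^]\<^sub>R n \<odot>\<^sub>X z = \<iota> y)"

lemma lin_q: "lin R M X (q n)" and q: "\<And>y. y \<in> carrier M \<Longrightarrow> t [^]\<^sub>R n \<odot>\<^sub>X q n y = \<iota> y"
  and q_unique: "\<And>y z. y \<in> carrier M \<Longrightarrow> z \<in> carrier X \<Longrightarrow> t [^]\<^sub>R n \<odot>\<^sub>X z = \<iota> y \<Longrightarrow> q n y = z"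
proof -
  note L = is_localizationD[OF loc]
  obtain g where g: "lin R X X g" "\<And>y. y \<in> carrier X \<Longrightarrow> t [^]\<^sub>R n \<odot>\<^sub>X g y = y"
    "\<And>y. y \<in> carrier X \<Longrightarrow> g (t [^]\<^sub>R n \<odot>\<^sub>X y) = y"
    by (rule scalar_inverse[OF X pow_closed[of n] L(4) L(5)]) auto
  have eq: "q n y = z" if y: "y \<in> carrier M" and z: "z \<in> carrier X" "t [^]\<^sub>R n \<odot>\<^sub>X z = \<iota> y" for y z
    unfolding q_def by (rule the_equality) (use z g(3) in metis)+
  then show "\<And>y z. y \<in> carrier M \<Longrightarrow> z \<in> carrier X \<Longrightarrow> t [^]\<^sub>R n \<odot>\<^sub>X z = \<iota> y \<Longrightarrow> q n y = z" .
  have qg: "q n y = g (\<iota> y)" if y: "y \<in> carrier M" for y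
    by (rule eq[OF y lin_closed[OF g(1) lin_closed[OF \<iota> y]] g(2)[OF lin_closed[OF \<iota> y]]])
  show "lin R M X (q n)" by (rule lin_cong[OF M lin_comp[OF \<iota> g(1)]]) (simp add: qg)
  show "t [^]\<^sub>R n \<odot>\<^sub>X q n y = \<iota> y" if y: "y \<in> carrier M" for y
    using qg[OF y] g(2)[OF lin_closed[OF \<iota> y]] by simp
qed

lemma q_Suc: assumes y: "y \<in> carrier M" shows "q (Suc n) (t \<odot>\<^sub>M y) = q n y"
proof (rule q_unique)
  have "t [^]\<^sub>R Suc n \<odot>\<^sub>X q n y = t \<odot>\<^sub>X (t [^]\<^sub>R n \<odot>\<^sub>X q n y)"
    using t lin_closed[OF lin_q y] by (simp add: X.smult_assoc1[symmetric] M.R.m_comm)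
  then show "t [^]\<^sub>R Suc n \<odot>\<^sub>X q n y = \<iota> (t \<odot>\<^sub>M y)" using q[OF y] lin_smult[OF \<iota> t y] by simp
qed (use y t lin_closed[OF lin_q y] in auto)

abbreviation "p \<equiv> dsum_lift (UNIV :: nat set) (\<lambda>_. M) X q"

lemma lin_p: "lin R T X p" by (rule lin_dsum_lift[OF M.is_cring M X lin_q])

lemma p_emb: "y \<in> carrier M \<Longrightarrow> p (emb n y) = q n y"
  by (rule dsum_lift_inj[OF M.is_cring M X lin_q]) auto

text \<open>In terms of generators, place \<open>n\<close> goes to place \<open>n\<close> minus
  \<open>t\<close> times place \<open>n + 1\<close>. Nothing is shifted into place 0, so injectivity
  follows by induction from there.\<close>

definition \<beta> :: "(nat \<Rightarrow> 'b) \<Rightarrow> nat \<Rightarrow> 'b" where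
  "\<beta> x = (\<lambda>n. case n of 0 \<Rightarrow> x 0 | Suc k \<Rightarrow> x (Suc k) \<ominus>\<^sub>M t \<odot>\<^sub>M x k)"

lemma \<beta>_simps: "\<beta> x 0 = x 0" "\<beta> x (Suc k) = x (Suc k) \<ominus>\<^sub>M t \<odot>\<^sub>M x k"
  by (simp_all add: \<beta>_def)

lemma T_elem: "x \<in> carrier T \<Longrightarrow> x n \<in> carrier M" by auto

lemma T_eqI: "(\<And>n. x n = y n) \<Longrightarrow> x = (y :: nat \<Rightarrow> 'b)" by auto

lemma lin_\<beta>: "lin R T T \<beta>"
proof (rule linI)
  fix x assume x: "x \<in> carrier T"
  have "{n. \<beta> x n \<noteq> \<zero>\<^sub>M} \<subseteq> {n. x n \<noteq> \<zero>\<^sub>M} \<union> Suc ` {n. x n \<noteq> \<zero>\<^sub>M}"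
  proof
    fix n assume n: "n \<in> {n. \<beta> x n \<noteq> \<zero>\<^sub>M}"
    show "n \<in> {n. x n \<noteq> \<zero>\<^sub>M} \<union> Suc ` {n. x n \<noteq> \<zero>\<^sub>M}"
      using n t module_minus_self[OF M M.zero_closed] by (cases n) (auto simp: \<beta>_simps)
  qed
  then have "finite {n. \<beta> x n \<noteq> \<zero>\<^sub>M}" using x by (auto intro: finite_subset)
  moreover have "\<beta> x n \<in> carrier M" for n using T_elem[OF x] t by (cases n) (auto simp: \<beta>_simps module_minus_closed[OF M])
  ultimately show "\<beta> x \<in> carrier T" by auto
next
  fix x y assume x: "x \<in> carrier T" and y: "y \<in> carrier T"
  show "\<beta> (x \<oplus>\<^sub>T y) = \<beta> x \<oplus>\<^sub>T \<beta> y"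
  proof (rule T_eqI)
    fix n show "\<beta> (x \<oplus>\<^sub>T y) n = (\<beta> x \<oplus>\<^sub>T \<beta> y) n"
      using T_elem[OF x] T_elem[OF y] t
      by (cases n) (simp_all add: \<beta>_simps a_minus_def M.smult_r_distr M.minus_add M.a_ac)
  qed
next
  fix r x assume r: "r \<in> carrier R" and x: "x \<in> carrier T"
  show "\<beta> (r \<odot>\<^sub>T x) = r \<odot>\<^sub>T \<beta> x"
  proof (rule T_eqI)
    fix n show "\<beta> (r \<odot>\<^sub>T x) n = (r \<odot>\<^sub>T \<beta> x) n"
      using T_elem[OF x] t r lin_smult[OF lin_scalar[OF M t] r T_elem[OF x]]
      by (cases n) (simp_all add: \<beta>_simps a_minus_def M.smult_r_distr M.smult_r_minus)
  qed
qed

lemma \<beta>_injective: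
  assumes x: "x \<in> carrier T" and z: "\<beta> x = \<zero>\<^sub>T" shows "x = \<zero>\<^sub>T"
proof -
  have "\<beta> x n = \<zero>\<^sub>M" for n using z by simp
  then have "x n = \<zero>\<^sub>M" for n
  proof (induction n)
    case 0 then show ?case by (metis \<beta>_simps(1))
  next
    case (Suc n)
    then have "x (Suc n) \<ominus>\<^sub>M t \<odot>\<^sub>M \<zero>\<^sub>M = \<zero>\<^sub>M" by (metis \<beta>_simps(2))
    then show ?case using t T_elem[OF x] module_diff_eq_zero[OF M T_elem[OF x] M.zero_closed] by simp
  qed
  then show ?thesis by auto
qed

lemma emb_shift:
  assumes y: "y \<in> carrier M" shows "emb n y = \<beta> (emb n y) \<oplus>\<^sub>T emb (Suc n) (t \<odot>\<^sub>M y)"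
proof (rule T_eqI)
  have 0: "\<ominus>\<^sub>M \<zero>\<^sub>M = \<zero>\<^sub>M"
    using module_minus_self[OF M M.zero_closed] by (simp add: a_minus_def)
  fix k show "emb n y k = (\<beta> (emb n y) \<oplus>\<^sub>T emb (Suc n) (t \<odot>\<^sub>M y)) k"
    using y t by (cases k) (auto simp: \<beta>_simps dsum_inj_def a_minus_def 0 M.l_neg)
qed

lemma p_\<beta>:
  assumes x: "x \<in> carrier T" shows "p (\<beta> x) = \<zero>\<^sub>X"
proof (rule lin_dsum_eq[OF M.is_cring M X lin_comp[OF lin_\<beta> lin_p] lin_zero_map[OF X] _ x])
  fix n y assume y: "y \<in> carrier M"
  have c: "\<beta> (emb n y) \<in> carrier T" "emb (Suc n) (t \<odot>\<^sub>M y) \<in> carrier T"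
    using lin_closed[OF lin_\<beta> lin_closed[OF lin_emb y]] lin_closed[OF lin_emb] t y by auto
  have "q n y = p (\<beta> (emb n y)) \<oplus>\<^sub>X q n y"
    using lin_add[OF lin_p c] emb_shift[OF y, of n] p_emb[OF y, of n] p_emb[of "t \<odot>\<^sub>M y" "Suc n"] q_Suc[OF y] t y by simp
  then show "p (\<beta> (emb n y)) = \<zero>\<^sub>X"
    using lin_closed[OF lin_p c(1)] lin_closed[OF lin_q y] using X.add.r_cancel_one' by blast
qed

lemma emb_shift_iter:
  assumes y: "y \<in> carrier M"
  shows "\<exists>w\<in>carrier T. emb n y = \<beta> w \<oplus>\<^sub>T emb (n + k) (t [^]\<^sub>R k \<odot>\<^sub>M y)"
proof (induction k)
  case 0
  show ?case using lin_zero[OF T T lin_\<beta>] lin_closed[OF lin_emb y, of n] y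
    by (intro bexI[of _ "\<zero>\<^sub>T"] ) (simp_all del: dsum_module_simps add: T.zero_closed)
next
  case (Suc k)
  then obtain w where w: "w \<in> carrier T" "emb n y = \<beta> w \<oplus>\<^sub>T emb (n + k) (t [^]\<^sub>R k \<odot>\<^sub>M y)" by blast
  let ?z = "t [^]\<^sub>R k \<odot>\<^sub>M y" and ?w' = "emb (n + k) (t [^]\<^sub>R k \<odot>\<^sub>M y)"
  have z: "?z \<in> carrier M" using y by simp
  have w': "?w' \<in> carrier T" by (rule lin_closed[OF lin_emb z])
  have e: "t \<odot>\<^sub>M ?z = t [^]\<^sub>R Suc k \<odot>\<^sub>M y" using t y by (simp add: M.smult_assoc1[symmetric] M.R.m_comm)
  have z': "t [^]\<^sub>R Suc k \<odot>\<^sub>M y \<in> carrier M" using y pow_closed by blast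
  have "emb n y = \<beta> w \<oplus>\<^sub>T (\<beta> ?w' \<oplus>\<^sub>T emb (n + Suc k) (t [^]\<^sub>R Suc k \<odot>\<^sub>M y))"
    using w(2) emb_shift[OF z, of "n + k"] e by simp
  also have "\<dots> = \<beta> (w \<oplus>\<^sub>T ?w') \<oplus>\<^sub>T emb (n + Suc k) (t [^]\<^sub>R Suc k \<odot>\<^sub>M y)"
    unfolding lin_add[OF lin_\<beta> w(1) w']
    by (rule T.a_assoc[symmetric, OF lin_closed[OF lin_\<beta> w(1)] lin_closed[OF lin_\<beta> w'] lin_closed[OF lin_emb z']])
  finally show ?case using T.a_closed[OF w(1) w'] by blast
qed

text \<open>Modulo the image of \<open>\<beta>\<close>, an entry can be moved to any later place at
  the cost of a power of \<open>t\<close>, so every element is concentrated in one place. Allowing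
  all sufficiently late places lets two summands be moved to the same one.\<close>

lemma T_normal_form:
  assumes x: "x \<in> carrier T"
  shows "\<exists>N. \<forall>n\<ge>N. \<exists>y\<in>carrier M. \<exists>w\<in>carrier T. x = \<beta> w \<oplus>\<^sub>T emb n y"
proof (rule dsum_induct[OF M x])
  have "\<zero>\<^sub>T = \<beta> \<zero>\<^sub>T \<oplus>\<^sub>T emb n \<zero>\<^sub>M" for n
    unfolding lin_zero[OF T T lin_\<beta>] lin_zero[OF M T lin_emb] by (rule T.l_zero[OF T.zero_closed, symmetric])
  then show "\<exists>N. \<forall>n\<ge>N. \<exists>y\<in>carrier M. \<exists>w\<in>carrier T. \<zero>\<^sub>T = \<beta> w \<oplus>\<^sub>T emb n y"
    using T.zero_closed M.zero_closed by blast
next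
  fix i z x assume z: "z \<in> carrier M" and x: "x \<in> carrier T"
    and "\<exists>N. \<forall>n\<ge>N. \<exists>y\<in>carrier M. \<exists>w\<in>carrier T. x = \<beta> w \<oplus>\<^sub>T emb n y"
  then obtain N where N: "\<And>n. n \<ge> N \<Longrightarrow> \<exists>y\<in>carrier M. \<exists>w\<in>carrier T. x = \<beta> w \<oplus>\<^sub>T emb n y" by blast
  have "\<exists>y\<in>carrier M. \<exists>w\<in>carrier T. emb i z \<oplus>\<^sub>T x = \<beta> w \<oplus>\<^sub>T emb n y" if n: "n \<ge> max N i" for n
  proof -
    obtain y w where y: "y \<in> carrier M" "w \<in> carrier T" "x = \<beta> w \<oplus>\<^sub>T emb n y" using N[of n] n by auto
    obtain k where k: "n = i + k" using n le_Suc_ex by auto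
    let ?z = "t [^]\<^sub>R k \<odot>\<^sub>M z"
    obtain v where v: "v \<in> carrier T" "emb i z = \<beta> v \<oplus>\<^sub>T emb n ?z" using emb_shift_iter[OF z] k by metis
    have zc: "?z \<in> carrier M" using z by simp
    have "emb i z \<oplus>\<^sub>T x = (\<beta> v \<oplus>\<^sub>T emb n ?z) \<oplus>\<^sub>T (\<beta> w \<oplus>\<^sub>T emb n y)" using v y by simp
    also have "\<dots> = (\<beta> v \<oplus>\<^sub>T \<beta> w) \<oplus>\<^sub>T (emb n ?z \<oplus>\<^sub>T emb n y)"
      using lin_closed[OF lin_\<beta> v(1)] lin_closed[OF lin_\<beta> y(2)] lin_closed[OF lin_emb zc, of n] lin_closed[OF lin_emb y(1), of n]
      by (simp add: T.a_ac del: dsum_module_simps)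
    also have "\<dots> = \<beta> (v \<oplus>\<^sub>T w) \<oplus>\<^sub>T emb n (?z \<oplus>\<^sub>M y)"
      by (simp only: lin_add[OF lin_\<beta> v(1) y(2)] lin_add[OF lin_emb zc y(1)])
    finally show ?thesis using T.a_closed[OF v(1) y(2)] M.a_closed[OF zc y(1)] by blast
  qed
  then show "\<exists>N. \<forall>n\<ge>N. \<exists>y\<in>carrier M. \<exists>w\<in>carrier T. emb i z \<oplus>\<^sub>T x = \<beta> w \<oplus>\<^sub>T emb n y" by blast
qed

text \<open>In normal form the condition says that the fraction \<open>y / t^n\<close> vanishes, so
  some \<open>t^j\<close> kills \<open>y\<close>. Moving \<open>y\<close> another \<open>j\<close>
  places on turns it into zero.\<close>

lemma p_kernel:
  assumes x: "x \<in> carrier T" and z: "p x = \<zero>\<^sub>X"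
  shows "\<exists>w\<in>carrier T. x = \<beta> w"
proof -
  obtain n y w where y: "y \<in> carrier M" "w \<in> carrier T" "x = \<beta> w \<oplus>\<^sub>T emb n y" using T_normal_form[OF x] by blast
  have "q n y = \<zero>\<^sub>X"
    using z lin_add[OF lin_p lin_closed[OF lin_\<beta> y(2)] lin_closed[OF lin_emb y(1)], of n] p_\<beta>[OF y(2)] p_emb[OF y(1), of n] lin_closed[OF lin_q y(1), of n]
    by (simp add: y(3))
  then have "\<iota> y = \<zero>\<^sub>X" using q[OF y(1), of n] by simp
  then obtain j :: nat where j: "t [^]\<^sub>R j \<odot>\<^sub>M y = \<zero>\<^sub>M" using is_localizationD(7)[OF loc y(1)] by blast
  obtain v where v: "v \<in> carrier T" "emb n y = \<beta> v \<oplus>\<^sub>T emb (n + j) \<zero>\<^sub>M" using emb_shift_iter[OF y(1), of n j] j by auto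
  have "emb n y = \<beta> v"
    unfolding v(2) lin_zero[OF M T lin_emb] by (rule T.r_zero[OF lin_closed[OF lin_\<beta> v(1)]])
  then have "x = \<beta> (w \<oplus>\<^sub>T v)" using y(3) lin_add[OF lin_\<beta> y(2) v(1)] by simp
  then show ?thesis using T.a_closed[OF y(2) v(1)] by blast
qed

lemma X_elem:
  assumes z: "z \<in> carrier X"
  obtains n y where "y \<in> carrier M" "z = q n y"
proof -
  obtain s x where "s \<in> range (\<lambda>n::nat. t [^]\<^sub>R n)" "x \<in> carrier M" "s \<odot>\<^sub>X z = \<iota> x"
    using is_localizationD(6)[OF loc z] by blast
  then show thesis using that q_unique[OF _ z] by blast
qed

lemma p_surj:
  assumes "x \<in> carrier X" shows "\<exists>b\<in>carrier T. p b = x"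
  using assms by (rule X_elem) (metis p_emb lin_closed[OF lin_emb])

text \<open>A family of maps with \<open>b n = t (b (n + 1))\<close> is a cone under the direct
  system, so the induced map on \<open>T\<close> descends along \<open>p\<close>.\<close>

lemma lift_\<beta>:
  assumes C: "module R C" and b: "\<And>n. lin R M C (b n)" and eq: "\<And>n y. y \<in> carrier M \<Longrightarrow> b n y = t \<odot>\<^sub>C b (Suc n) y"
    and x: "x \<in> carrier T"
  shows "dsum_lift (UNIV :: nat set) (\<lambda>_. M) C b (\<beta> x) = \<zero>\<^sub>C"
proof -
  interpret C: module R C by (rule C)
  let ?k = "dsum_lift (UNIV :: nat set) (\<lambda>_. M) C b"
  have k: "lin R T C ?k" by (rule lin_dsum_lift[OF M.is_cring M C b])
  have ke: "?k (emb n y) = b n y" if "y \<in> carrier M" for n y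
    using dsum_lift_inj[where I = UNIV and h = b and i = n, OF M.is_cring M C b _ that] by simp
  show ?thesis
  proof (rule lin_dsum_eq[OF M.is_cring M C lin_comp[OF lin_\<beta> k] lin_zero_map[OF C] _ x])
    fix n y assume y: "y \<in> carrier M"
    note e = lin_closed[OF lin_emb y] and bc = lin_closed[OF b y]
    have "b n y = ?k (\<beta> (emb n y)) \<oplus>\<^sub>C b (Suc n) (t \<odot>\<^sub>M y)"
      using emb_shift[OF y, of n] ke[OF y, of n] ke[of "t \<odot>\<^sub>M y" "Suc n"] t y
        lin_add[OF k lin_closed[OF lin_\<beta> e] lin_closed[OF lin_emb M.smult_closed[OF t y]]] M.smult_closed[OF t y] by metis
    also have "b (Suc n) (t \<odot>\<^sub>M y) = b n y"
      using eq[OF y, of n] lin_smult[OF b t y, of "Suc n"] by metis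
    finally show "?k (\<beta> (emb n y)) = \<zero>\<^sub>C"
      using C.add.r_cancel_one'[OF bc lin_closed[OF k lin_closed[OF lin_\<beta> e]]] by blast
  qed
qed

text \<open>Vanishing of Ext makes composition with \<open>\<beta>\<close> surjective on maps
  \<open>T -> C\<close>. A map on \<open>T\<close> is a sequence of maps on \<open>M\<close>, and
  composing it with \<open>\<beta>\<close> turns \<open>b\<close> into the differences of
  \<open>b n\<close> and \<open>t\<close> times \<open>b (n + 1)\<close>.\<close>

lemma solve:
  assumes C: "module R C" and Ext: "zero_module (Ext1 R X C)" and a: "\<And>n. lin R M C (a n)"
  shows "\<exists>b. (\<forall>n. lin R M C (b n)) \<and> (\<forall>n. \<forall>y\<in>carrier M. b n y = a n y \<oplus>\<^sub>C t \<odot>\<^sub>C b (Suc n) y)"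
proof -
  let ?k = "dsum_lift (UNIV :: nat set) (\<lambda>_. M) C a"
  have k: "lin R T C ?k" by (rule lin_dsum_lift[OF M.is_cring M C a])
  obtain \<kappa> where \<kappa>: "lin R T C \<kappa>" "\<And>f. f \<in> carrier T \<Longrightarrow> \<kappa> (\<beta> f) = ?k f"
  proof (rule Ext1_extend[OF Ext X C T T lin_\<beta> _ lin_p p_surj _ _ k])
  qed (use \<beta>_injective p_kernel p_\<beta> in blast)+
  have "\<kappa> (emb n y) = a n y \<oplus>\<^sub>C t \<odot>\<^sub>C \<kappa> (emb (Suc n) y)" if y: "y \<in> carrier M" for n y
  proof -
    note e = lin_closed[OF lin_emb y]
    have "\<kappa> (emb n y) = \<kappa> (\<beta> (emb n y) \<oplus>\<^sub>T t \<odot>\<^sub>T emb (Suc n) y)"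
      using emb_shift[OF y] lin_smult[OF lin_emb t y] by metis
    also have "\<dots> = \<kappa> (\<beta> (emb n y)) \<oplus>\<^sub>C t \<odot>\<^sub>C \<kappa> (emb (Suc n) y)"
      unfolding lin_add[OF \<kappa>(1) lin_closed[OF lin_\<beta> e] T.smult_closed[OF t e]] lin_smult[OF \<kappa>(1) t e] ..
    also have "\<kappa> (\<beta> (emb n y)) = a n y"
      using \<kappa>(2)[OF e] dsum_lift_inj[where I = UNIV and h = a and i = n, OF M.is_cring M C a _ y] by simp
    finally show ?thesis .
  qed
  then show ?thesis using lin_comp[OF lin_emb \<kappa>(1)] by (intro exI[of _ "\<lambda>n y. \<kappa> (emb n y)"] conjI allI ballI)
qed

text \<open>The counterpart of \<open>solve\<close> for Hom: the sequence \<open>b\<close> is a map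
  on \<open>T\<close> that factors through \<open>X\<close>, and all maps \<open>X -> C\<close> are
  zero.\<close>

lemma separate:
  assumes C: "module R C" and Hom: "zero_module (Hom_module R X C)" and b: "\<And>n. lin R M C (b n)"
    and eq: "\<And>n y. y \<in> carrier M \<Longrightarrow> b n y = t \<odot>\<^sub>C b (Suc n) y" and y: "y \<in> carrier M"
  shows "b n y = \<zero>\<^sub>C"
proof -
  let ?k = "dsum_lift (UNIV :: nat set) (\<lambda>_. M) C b"
  have "?k (emb n y) = \<zero>\<^sub>C"
  proof (rule lin_zero_of_factor[OF Hom T X C lin_p p_surj lin_dsum_lift[OF M.is_cring M C b] _ lin_closed[OF lin_emb y]])
    fix w assume "w \<in> carrier T" "p w = \<zero>\<^sub>X"
    then obtain v where "v \<in> carrier T" "w = \<beta> v" using p_kernel by blast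
    then show "?k w = \<zero>\<^sub>C" using lift_\<beta>[where b = b, OF C b eq] by simp
  qed
  then show ?thesis using dsum_lift_inj[where I = UNIV and h = b and i = n, OF M.is_cring M C b _ y] by simp
qed

end

text \<open>From contramodule to summation, the telescope of \<open>R\<close> translates the two
  vanishing conditions into existence and uniqueness of sums. In the other direction a map on
  \<open>R[1/t]\<close> is determined by its values at the \<open>1 / t^n\<close>, which form a
  sequence ruled out by separatedness, and every extension of \<open>R[1/t]\<close> by
  \<open>C\<close> is shown to have a section.\<close>

lemma elem_contramodule_iff:
  assumes C: "module R C" and t: "t \<in> carrier R"
  shows "elem_contramodule R t C \<longleftrightarrow> op_contra C (\<lambda>x. t \<odot>\<^sub>C x)"
proof -
  interpret C: module R C by (rule C)
  let ?X = "localization_elem R t" and ?M = "self_module R"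
  interpret mult_set R "range (\<lambda>n::nat. t [^]\<^sub>R n)"
    by unfold_locales (rule C.R.mult_closed_powers[OF t])
  interpret T: telescope R t ?M ?X "\<lambda>a. fraction R (range (\<lambda>n::nat. t [^]\<^sub>R n)) a \<one>\<^sub>R"
    by unfold_locales (use t is_localization_localization in \<open>simp_all add: localization_elem_def\<close>)
  note X = T.X
  let ?q = "\<lambda>n. T.q n \<one>\<^sub>R"
  have qc: "?q n \<in> carrier ?X" for n by (rule lin_closed[OF T.lin_q]) simp
  have qr: "T.q n r = r \<odot>\<^bsub>?X\<^esub> ?q n" if "r \<in> carrier R" for n r
    using lin_smult[OF T.lin_q that, of "\<one>\<^sub>R" n] that by simp
  have qS: "?q n = t \<odot>\<^bsub>?X\<^esub> ?q (Suc n)" for n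
    using T.q_Suc[of "\<one>\<^sub>R" n] qr[OF t] t by simp
  show ?thesis
  proof
    assume con: "op_contra C (\<lambda>x. t \<odot>\<^sub>C x)"
    have "h z = \<zero>\<^sub>C" if h: "lin R ?X C h" and z: "z \<in> carrier ?X" for h z
    proof -
      have "h (?q n) = \<zero>\<^sub>C" for n
      proof (rule separatedD[of C "\<lambda>x. t \<odot>\<^sub>C x" "\<lambda>n. h (?q n)"])
        show "h (?q n) = t \<odot>\<^sub>C h (?q (Suc n))" for n using qS[of n] lin_smult[OF h t qc] by metis
      qed (use con lin_closed[OF h qc] in \<open>auto simp: op_contra_def\<close>)
      moreover obtain n r where r: "r \<in> carrier R" "z = T.q n r" using T.X_elem[OF z] by (metis restrict_scalars_simps(1))
      ultimately show ?thesis unfolding r(2) qr[OF r(1)] lin_smult[OF h r(1) qc] using r(1) by simp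
    qed
    then have Hom: "zero_module (Hom_module R ?X C)" unfolding zero_Hom_iff[OF X C] by blast
    have "zero_module (Ext1 R ?X C)"
    proof (rule Ext1_zero_of_sections[OF X C])
      fix E :: "('a, ((('a \<times> 'a) set \<Rightarrow> 'a) \<times> 'c) set) module" and j \<pi> assume ext: "extension R C E ?X j \<pi>"
      note e = extensionD[OF ext]
      interpret E: module R E by (rule e(2))
      \<comment> \<open>Arbitrary lifts of the fractions \<open>1 / t^n\<close> fail to satisfy
        \<open>y n = t (y (n + 1))\<close> by elements \<open>a n\<close> of \<open>C\<close>.
        Subtracting the infinite sums \<open>b n\<close> of these defects gives lifts
        \<open>z n\<close> that do satisfy it, and these define the section.\<close>
      obtain y where y: "\<And>n. y n \<in> carrier E" "\<And>n. \<pi> (y n) = ?q n" using e(7)[OF qc] by metis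
      have d: "y n \<ominus>\<^sub>E t \<odot>\<^sub>E y (Suc n) \<in> carrier E" for n using y(1) t by simp
      have "\<pi> (y n \<ominus>\<^sub>E t \<odot>\<^sub>E y (Suc n)) = \<zero>\<^bsub>?X\<^esub>" for n
        unfolding lin_minus[OF e(2,3,5) y(1) E.smult_closed[OF t y(1)]] lin_smult[OF e(5) t y(1)] y(2) qS[symmetric] by (rule module_minus_self[OF X qc])
      then have "\<exists>c\<in>carrier C. j c = y n \<ominus>\<^sub>E t \<odot>\<^sub>E y (Suc n)" for n by (rule e(9)[OF d])
      then obtain a where a: "\<And>n. a n \<in> carrier C" "\<And>n. j (a n) = y n \<ominus>\<^sub>E t \<odot>\<^sub>E y (Suc n)" by metis
      define b where "b = telescope_sum C t a"
      have b: "b n \<in> carrier C" "b n = a n \<oplus>\<^sub>C t \<odot>\<^sub>C b (Suc n)" for n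
        unfolding b_def by (rule telescope_sum_closed[OF con a(1)], rule telescope_sum_eq[OF con a(1)])
      note jb = lin_closed[OF e(4) b(1)]
      define z where "z n = y n \<ominus>\<^sub>E j (b n)" for n
      have z: "z n \<in> carrier E" "\<pi> (z n) = ?q n" for n
        using y(1) jb lin_minus[OF e(2,3,5) y(1) jb] e(8)[OF b(1)] module_diff_zero[OF X qc] y(2) by (simp_all add: z_def)
      have zS: "z n = t \<odot>\<^sub>E z (Suc n)" for n
      proof -
        let ?u = "t \<odot>\<^sub>E y (Suc n)" and ?v = "t \<odot>\<^sub>E j (b (Suc n))"
        have c: "?u \<in> carrier E" "?v \<in> carrier E" using t y(1) jb by simp_all
        have "j (b n) = (y n \<ominus>\<^sub>E ?u) \<oplus>\<^sub>E ?v"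
          using lin_add[OF e(4) a(1) C.smult_closed[OF t b(1)]] lin_smult[OF e(4) t b(1)] b(2)[of n] a(2)[of n] by metis
        then have "z n = y n \<ominus>\<^sub>E (y n \<oplus>\<^sub>E (?v \<ominus>\<^sub>E ?u))"
          unfolding z_def using y(1)[of n] c by (simp add: a_minus_def E.a_ac)
        also have "\<dots> = ?u \<ominus>\<^sub>E ?v" using y(1)[of n] c by (simp add: a_minus_def E.minus_add E.r_neg2 E.a_comm)
        also have "\<dots> = t \<odot>\<^sub>E z (Suc n)"
          unfolding z_def using lin_minus[OF e(2,2) lin_scalar[OF e(2) t] y(1) jb] by simp
        finally show ?thesis .
      qed
      let ?k = "dsum_lift (UNIV :: nat set) (\<lambda>_. ?M) E (\<lambda>n r. r \<odot>\<^sub>E z n)"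
      have k: "lin R T.T E ?k" by (rule lin_dsum_lift[OF C.is_cring T.M e(2) lin_multiples[OF e(2) z(1)]])
      have ke: "?k (T.emb n r) = r \<odot>\<^sub>E z n" if "r \<in> carrier ?M" for n r
        using dsum_lift_inj[where I = UNIV and h = "\<lambda>n r. r \<odot>\<^sub>E z n" and i = n, OF C.is_cring T.M e(2) lin_multiples[OF e(2) z(1)] _ that] by simp
      have k\<beta>: "?k (T.\<beta> x) = \<zero>\<^sub>E" if x: "x \<in> carrier T.T" for x
        by (rule T.lift_\<beta>[where b = "\<lambda>n r. r \<odot>\<^sub>E z n", OF e(2) lin_multiples[OF e(2) z(1)] _ x]) (use zS lin_smult[OF lin_scalar[OF e(2) t] _ z(1)] in \<open>metis restrict_scalars_simps(1)\<close>)
      obtain s where s: "lin R ?X E s" "\<And>x. x \<in> carrier T.T \<Longrightarrow> s (T.p x) = ?k x"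
      proof (rule lin_factor[OF T.T X e(2) T.lin_p T.p_surj k])
        fix x assume "x \<in> carrier T.T" "T.p x = \<zero>\<^bsub>?X\<^esub>"
        then show "?k x = \<zero>\<^sub>E" using T.p_kernel k\<beta> by blast
      qed (assumption | rule that)+
      have "\<pi> (s d) = d" if d: "d \<in> carrier ?X" for d
      proof -
        obtain n r where r: "r \<in> carrier R" "d = T.q n r" using T.X_elem[OF d] by (metis restrict_scalars_simps(1))
        then have rM: "r \<in> carrier ?M" by simp
        have "s d = r \<odot>\<^sub>E z n" using s(2)[OF lin_closed[OF T.lin_emb rM]] T.p_emb[OF rM] ke[OF rM] r(2) by metis
        then show ?thesis using lin_smult[OF e(5) r(1) z(1)] z(2) qr[OF r(1)] r(2) by simp
      qed
      then show "\<exists>s. lin R ?X E s \<and> (\<forall>d\<in>carrier ?X. \<pi> (s d) = d)" using s(1) by blast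
    qed
    then show "elem_contramodule R t C" unfolding elem_contramodule_def using Hom C by blast
  next
    assume e: "elem_contramodule R t C"
    then have z: "zero_module (Hom_module R ?X C)" "zero_module (Ext1 R ?X C)" by (auto simp: elem_contramodule_def)
    have "solvable C (carrier C) (\<lambda>x. t \<odot>\<^sub>C x)" unfolding solvable_def
    proof (intro allI impI)
      fix a :: "nat \<Rightarrow> 'c" assume a: "\<forall>n. a n \<in> carrier C"
      let ?a = "\<lambda>n r. r \<odot>\<^sub>C a n"
      have la: "lin R ?M C (?a n)" for n using lin_multiples[OF C] a by blast
      have "\<exists>b. (\<forall>n. lin R ?M C (b n)) \<and> (\<forall>n. \<forall>y\<in>carrier ?M. b n y = ?a n y \<oplus>\<^sub>C t \<odot>\<^sub>C b (Suc n) y)"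
        by (rule T.solve[OF C z(2) la])
      then obtain b where b: "\<And>n. lin R ?M C (b n)" "\<forall>n. \<forall>y\<in>carrier ?M. b n y = ?a n y \<oplus>\<^sub>C t \<odot>\<^sub>C b (Suc n) y"
        by blast
      have "b n \<one>\<^sub>R \<in> carrier C" for n by (rule lin_closed[OF b(1)]) simp
      moreover have "b n \<one>\<^sub>R = a n \<oplus>\<^sub>C t \<odot>\<^sub>C b (Suc n) \<one>\<^sub>R" for n
        using b(2)[THEN spec, of n, THEN bspec, of "\<one>\<^sub>R"] a C.smult_one[of "a n"] by simp
      ultimately show "\<exists>b. \<forall>n. b n \<in> carrier C \<and> b n = a n \<oplus>\<^sub>C t \<odot>\<^sub>C b (Suc n)"
        by (intro exI[of _ "\<lambda>n. b n \<one>\<^sub>R"] allI conjI)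
    qed
    moreover have "separated C (\<lambda>x. t \<odot>\<^sub>C x)" unfolding separated_def
    proof (intro allI impI)
      fix b :: "nat \<Rightarrow> 'c" and n assume b: "\<forall>n. b n \<in> carrier C \<and> b n = t \<odot>\<^sub>C b (Suc n)"
      then have bc: "b n \<in> carrier C" for n by blast
      have bt: "b n = t \<odot>\<^sub>C b (Suc n)" for n using b by blast
      have "\<one>\<^sub>R \<odot>\<^sub>C b n = \<zero>\<^sub>C"
      proof (rule T.separate[where b = "\<lambda>n r. r \<odot>\<^sub>C b n", OF C z(1) lin_multiples[OF C bc]])
        fix n r assume r: "r \<in> carrier ?M"
        have "r \<odot>\<^sub>C b n = r \<odot>\<^sub>C (t \<odot>\<^sub>C b (Suc n))" using bt by metis
        then show "r \<odot>\<^sub>C b n = t \<odot>\<^sub>C (r \<odot>\<^sub>C b (Suc n))"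
          using lin_smult[OF lin_scalar[OF C t] _ bc] r by simp
      qed simp
      then show "b n = \<zero>\<^sub>C" using bc[of n] by simp
    qed
    ultimately show "op_contra C (\<lambda>x. t \<odot>\<^sub>C x)" by (simp add: op_contra_def)
  qed
qed

section \<open>Approximation modulo a zero-dimensional semilocal quotient\<close>

context cring
begin

text \<open>\<open>w = 1 - \<mu>\<close> divides \<open>1 - \<mu>^k\<close>, by the finite geometric
  series.\<close>

lemma geometric_cofactor:
  assumes w: "w \<in> carrier R" and \<mu>: "\<mu> \<in> carrier R" and one: "\<one> = w \<oplus> \<mu>"
  shows "\<exists>c\<in>carrier R. \<one> = w \<otimes> c \<oplus> \<mu> [^] (k::nat)"
proof (induction k)
  case 0 show ?case using w by (intro bexI[of _ \<zero>]) auto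
next
  case (Suc k)
  then obtain c where c: "c \<in> carrier R" "\<one> = w \<otimes> c \<oplus> \<mu> [^] k" by blast
  have "\<one> = w \<oplus> \<mu> \<otimes> \<one>" using one \<mu> by (metis r_one)
  also have "\<dots> = w \<oplus> \<mu> \<otimes> (w \<otimes> c \<oplus> \<mu> [^] k)" by (simp only: c(2)[symmetric])
  also have "\<dots> = w \<otimes> (\<one> \<oplus> \<mu> \<otimes> c) \<oplus> \<mu> [^] Suc k" using w \<mu> c(1) by (simp add: r_distr m_ac a_ac)
  finally show ?case using \<mu> c(1) by blast
qed

text \<open>The condition on \<open>e\<close> at \<open>n\<close> says that \<open>e\<close>
  vanishes in the localization of \<open>R/I\<close> at \<open>n\<close>. For each \<open>n\<close>
  choose an element of \<open>n\<close> outside \<open>m\<close>; a power of it vanishes at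
  \<open>n\<close> by \<open>zero_dim_nilpotent\<close>, and the product of these powers stays
  outside \<open>m\<close>.\<close>

lemma zero_dim_separate:
  assumes I: "ideal I R" and dim: "krull_dim_zero (R Quot I)" and m: "maximalideal m R"
    and N: "finite N" "\<And>n. n \<in> N \<Longrightarrow> maximalideal n R \<and> n \<noteq> m"
  shows "\<exists>e\<in>carrier R - m. \<forall>n\<in>N. \<exists>\<sigma>\<in>carrier R - n. \<sigma> \<otimes> e \<in> I"
  using N
proof induction
  case empty
  then show ?case using maximalideal_complement(1)[OF m] by blast
next
  case (insert n N)
  then obtain e where e: "e \<in> carrier R - m" "\<And>n. n \<in> N \<Longrightarrow> \<exists>\<sigma>\<in>carrier R - n. \<sigma> \<otimes> e \<in> I" by auto
  have n: "maximalideal n R" "m \<noteq> n" using insert.prems by auto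
  obtain t where t: "t \<in> n" "t \<in> carrier R" "t \<notin> m" using maximalideal_neq[OF m n] by blast
  obtain k :: nat and s where s: "s \<in> carrier R" "s \<notin> n" "t [^] k \<otimes> s \<in> I" by (rule zero_dim_nilpotent[OF I dim n(1) t(1)])
  have tk: "t [^] k \<in> carrier R - m" using t maximalideal_complement[OF m] by (induction k) auto
  have "e \<otimes> t [^] k \<in> carrier R - m" by (rule maximalideal_complement(2)[OF m e(1) tk])
  moreover have "\<exists>\<sigma>\<in>carrier R - n'. \<sigma> \<otimes> (e \<otimes> t [^] k) \<in> I" if "n' \<in> insert n N" for n'
  proof (cases "n' = n")
    case True
    have "s \<otimes> (e \<otimes> t [^] k) = e \<otimes> (t [^] k \<otimes> s)" using s e t by (simp add: m_ac)
    then show ?thesis using ideal_facts(4)[OF I, of e] s e True by (intro bexI[of _ s]) auto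
  next
    case False
    then have "n' \<in> N" using that by blast
    then obtain \<sigma> where \<sigma>: "\<sigma> \<in> carrier R - n'" "\<sigma> \<otimes> e \<in> I" using e(2) by blast
    have "\<sigma> \<otimes> (e \<otimes> t [^] k) = t [^] k \<otimes> (\<sigma> \<otimes> e)" using \<sigma> e t by (simp add: m_ac)
    then show ?thesis using ideal_facts(4)[OF I, of "t [^] k"] \<sigma> tk by (intro bexI[of _ \<sigma>]) auto
  qed
  ultimately show ?case by blast
qed

text \<open>In \<open>R/I\<close>, the element \<open>b\<close> is inverse to \<open>s\<close> at \<open>m\<close>
  and vanishes at all other maximal ideals.\<close>

lemma zero_dim_approximation:
  assumes I: "ideal I R" and sl: "semilocal (R Quot I)" and dim: "krull_dim_zero (R Quot I)"
    and m: "maximalideal m R" and s: "s \<in> carrier R - m"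
  obtains b where "b \<in> carrier R" "\<exists>\<sigma>\<in>carrier R - m. \<sigma> \<otimes> (\<one> \<ominus> b \<otimes> s) \<in> I"
    "\<And>n. maximalideal n R \<Longrightarrow> n \<noteq> m \<Longrightarrow> \<exists>\<sigma>\<in>carrier R - n. \<sigma> \<otimes> b \<in> I"
proof -
  have "finite ({n. maximalideal n R \<and> I \<subseteq> n} - {m})" using semilocal_quot_finite[OF I sl] by simp
  then obtain e where e: "e \<in> carrier R - m" "\<And>n. maximalideal n R \<Longrightarrow> I \<subseteq> n \<Longrightarrow> n \<noteq> m \<Longrightarrow> \<exists>\<sigma>\<in>carrier R - n. \<sigma> \<otimes> e \<in> I"
    using zero_dim_separate[OF I dim m, of "{n. maximalideal n R \<and> I \<subseteq> n} - {m}"] by blast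
  have se: "s \<otimes> e \<in> carrier R - m" by (rule maximalideal_complement(2)[OF m s e(1)])
  obtain a \<mu> where a: "a \<in> carrier R" "\<mu> \<in> m" "\<one> = a \<otimes> (s \<otimes> e) \<oplus> \<mu>"
    using maximalideal_cofactor[OF m, of "s \<otimes> e"] se by auto
  have \<mu>: "\<mu> \<in> carrier R" using a(2) ideal_facts(1)[OF maximalideal.axioms(1)[OF m]] by blast
  obtain k :: nat and \<sigma> where \<sigma>: "\<sigma> \<in> carrier R" "\<sigma> \<notin> m" "\<mu> [^] k \<otimes> \<sigma> \<in> I" by (rule zero_dim_nilpotent[OF I dim m a(2)])
  obtain c where c: "c \<in> carrier R" "\<one> = a \<otimes> (s \<otimes> e) \<otimes> c \<oplus> \<mu> [^] k"
    using geometric_cofactor[OF _ \<mu> a(3), of k] a(1) se by auto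
  \<comment> \<open>\<open>e\<close> makes \<open>?b\<close> vanish at the other maximal ideals. At
    \<open>m\<close>, the product of \<open>?b\<close> and \<open>s\<close> is
    \<open>1 - \<mu>^k\<close>, and \<open>k\<close> was chosen so that \<open>\<mu>^k\<close>
    vanishes there modulo \<open>I\<close>.\<close>
  let ?b = "a \<otimes> e \<otimes> c"
  have k: "a \<in> carrier R" "e \<in> carrier R" "c \<in> carrier R" "s \<in> carrier R" "\<mu> [^] k \<in> carrier R" using a c e s \<mu> by auto
  have "\<one> = \<mu> [^] k \<oplus> ?b \<otimes> s" using c(2) k by (simp add: m_ac a_ac)
  then have "\<one> \<ominus> ?b \<otimes> s = \<mu> [^] k" using k by (metis a_minus_def add.inv_solve_right m_closed one_closed)
  then have "\<sigma> \<otimes> (\<one> \<ominus> ?b \<otimes> s) \<in> I" using \<sigma> k by (simp add: m_comm)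
  moreover have "\<exists>\<sigma>\<in>carrier R - n. \<sigma> \<otimes> ?b \<in> I" if n: "maximalideal n R" "n \<noteq> m" for n
  proof (cases "I \<subseteq> n")
    case True
    obtain \<tau> where \<tau>: "\<tau> \<in> carrier R - n" "\<tau> \<otimes> e \<in> I" using e(2)[OF n(1) True n(2)] by blast
    have "\<tau> \<otimes> ?b = (a \<otimes> c) \<otimes> (\<tau> \<otimes> e)" using \<tau> k by (simp add: m_ac)
    then show ?thesis using ideal_facts(4)[OF I, of "a \<otimes> c"] \<tau> k by (intro bexI[of _ \<tau>]) auto
  next
    \<comment> \<open>At a maximal ideal not containing \<open>I\<close> everything vanishes modulo
      \<open>I\<close>: an element of \<open>I\<close> outside \<open>n\<close> is the required
      factor.\<close>
    case False
    then obtain i where "i \<in> I" "i \<notin> n" by blast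
    moreover from this have "i \<otimes> ?b \<in> I" using ideal_facts(5)[OF I, of ?b] k by simp
    ultimately show ?thesis using ideal_facts(1)[OF I] by blast
  qed
  ultimately show thesis using that[of ?b] k \<sigma> by blast
qed

end

section \<open>Modules over the epimorphic extension\<close>

context ring_ext
begin

text \<open>Up to isomorphism, these are the \<open>R\<close>-modules that underlie \<open>U\<close>-modules.\<close>

definition u_local :: "('a, 'c, 'n) module_scheme \<Rightarrow> bool" where
  "u_local D \<longleftrightarrow> module R D \<and> (\<forall>d\<in>carrier D. \<exists>g. lin R V D g \<and> g \<one>\<^sub>U = d) \<and>
     (\<forall>g. lin R V D g \<and> g \<one>\<^sub>U = \<zero>\<^sub>D \<longrightarrow> (\<forall>z\<in>carrier U. g z = \<zero>\<^sub>D))"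

text \<open>An extension of \<open>D\<close> by \<open>C\<close> splits, by lifting each map \<open>V \<rightarrow> D\<close>: the lifts are unique because
  \<open>Hom(V, C)\<close> vanishes, so their values at \<open>1\<close> form a linear section.\<close>

lemma u_perp:
  fixes C :: "('a, 'd, 'm) module_scheme" and D :: "('a, 'c, 'n) module_scheme"
  assumes uC: "u_contramodule R U u C" and D: "u_local D"
  shows "zero_module (Hom_module R D C)" "zero_module (Ext1 R D C)"
proof -
  have C: "module R C" and Hom: "zero_module (Hom_module R V C)" and Ext: "zero_module (Ext1 R V C)"
    using uC by (auto simp: u_contramodule_def)
  have DM: "module R D" and ex: "\<And>d. d \<in> carrier D \<Longrightarrow> \<exists>g. lin R V D g \<and> g \<one>\<^sub>U = d"
    and un: "\<And>g z. lin R V D g \<Longrightarrow> g \<one>\<^sub>U = \<zero>\<^sub>D \<Longrightarrow> z \<in> carrier U \<Longrightarrow> g z = \<zero>\<^sub>D"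
    using D unfolding u_local_def by blast+
  note Hom0 = Hom[unfolded zero_Hom_iff[OF V C], rule_format]
  have "f d = \<zero>\<^sub>C" if f: "lin R D C f" and d: "d \<in> carrier D" for f d
    using ex[OF d] Hom0[OF lin_comp[OF _ f], of _ "\<one>\<^sub>U"] by auto
  then show "zero_module (Hom_module R D C)" unfolding zero_Hom_iff[OF DM C] by blast
  show "zero_module (Ext1 R D C)"
  proof (rule Ext1_zero_of_sections[OF DM C])
    fix E j \<pi> assume ext: "extension R C (E :: ('a, (('c \<Rightarrow> 'a) \<times> 'd) set) module) D j \<pi>"
    note e = extensionD[OF ext]
    let ?P = "\<lambda>d v. \<pi> v = d \<and> (\<exists>\<gamma>. lin R V E \<gamma> \<and> \<gamma> \<one>\<^sub>U = v)"
    obtain s where "lin R D E s" "\<And>d. d \<in> carrier D \<Longrightarrow> ?P d (s d)"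
    proof (rule lin_of_rel[OF DM e(2), of ?P])
      fix d assume d: "d \<in> carrier D"
      obtain g where g: "lin R V D g" "g \<one>\<^sub>U = d" using ex[OF d] by blast
      obtain \<gamma> where "lin R V E \<gamma>" "\<And>x. x \<in> carrier V \<Longrightarrow> \<pi> (\<gamma> x) = g x" by (rule Ext1_lift[OF Ext V ext g(1)]) (rule that)
      then show "\<exists>v\<in>carrier E. ?P d v" using g(2) lin_closed[of R V E \<gamma> "\<one>\<^sub>U"] by (intro bexI[of _ "\<gamma> \<one>\<^sub>U"] conjI exI[of _ \<gamma>]) auto
    next
      fix d v d' v' assume v: "v \<in> carrier E" "v' \<in> carrier E" and "?P d v" "?P d' v'"
      then obtain \<gamma> \<gamma>' where "lin R V E \<gamma>" "\<gamma> \<one>\<^sub>U = v" "lin R V E \<gamma>'" "\<gamma>' \<one>\<^sub>U = v'" "\<pi> v = d" "\<pi> v' = d'" by blast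
      then show "?P (d \<oplus>\<^sub>D d') (v \<oplus>\<^sub>E v')"
        using lin_plus[OF e(2), of V \<gamma> \<gamma>'] lin_add[OF e(5) v] by (intro conjI exI[of _ "\<lambda>x. \<gamma> x \<oplus>\<^sub>E \<gamma>' x"]) simp_all
    next
      fix r d v assume r: "r \<in> carrier R" and v: "v \<in> carrier E" and "?P d v"
      then obtain \<gamma> where "lin R V E \<gamma>" "\<gamma> \<one>\<^sub>U = v" "\<pi> v = d" by blast
      then show "?P (r \<odot>\<^sub>D d) (r \<odot>\<^sub>E v)"
        using lin_scale[OF e(2) _ r, of V \<gamma>] lin_smult[OF e(5) r v] by (intro conjI exI[of _ "\<lambda>x. r \<odot>\<^sub>E \<gamma> x"]) simp_all
    next
      fix v assume "v \<in> carrier E" "?P \<zero>\<^sub>D v"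
      then obtain \<gamma> where \<gamma>: "lin R V E \<gamma>" "\<gamma> \<one>\<^sub>U = v" "\<pi> v = \<zero>\<^sub>D" by blast
      have "\<pi> (\<gamma> x) = \<zero>\<^sub>D" if "x \<in> carrier V" for x
        using un[OF lin_comp[OF \<gamma>(1) e(5)]] \<gamma>(2,3) that by simp
      then obtain k where k: "lin R V C k" "\<And>x. x \<in> carrier V \<Longrightarrow> j (k x) = \<gamma> x"
        by (rule lin_extension_kernel[OF ext V \<gamma>(1)]) (assumption | rule that)+
      show "v = \<zero>\<^sub>E" using k(2)[of "\<one>\<^sub>U"] Hom0[OF k(1), of "\<one>\<^sub>U"] \<gamma>(2) lin_zero[OF C e(2,4)] by simp
    qed (rule that)
    then show "\<exists>s. lin R D E s \<and> (\<forall>d\<in>carrier D. \<pi> (s d) = d)" by blast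
  qed
qed

end

lemma (in cring) zero_dim_prime_maximal:
  assumes J: "ideal J R" and dim: "krull_dim_zero (R Quot J)" and P: "primeideal P R" "J \<subseteq> P"
  shows "maximalideal P R"
proof (rule maximalidealI)
  interpret P: primeideal P R by (rule P(1))
  show PI: "ideal P R" by (rule P.is_ideal)
  show "carrier R \<noteq> P" using P.I_notcarr by blast
  fix K assume K: "ideal K R" "P \<subseteq> K" "K \<subseteq> carrier R"
  interpret Q: maximalideal "(+>) J ` P" "R Quot J"
    using dim prime_quot[OF J P] by (simp add: krull_dim_zero_def)
  have JK: "J \<subseteq> K" using P(2) K(2) by blast
  have "(+>) J ` K = (+>) J ` P \<or> (+>) J ` K = carrier (R Quot J)"
    by (rule Q.I_maximal[OF ring_ideal_imp_quot_ideal[OF J K(1)] image_mono[OF K(2)]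
          ideal_facts(1)[OF ring_ideal_imp_quot_ideal[OF J K(1)]]])
  then show "K = P \<or> K = carrier R"
    using quot_image_inj[OF J K(1) JK PI P(2)] quot_image_carrier[OF J K(1) JK] by blast
qed

section \<open>The Gabriel filter and modules over \<open>U\<close>\<close>

context flat_epi
begin

abbreviation "gab \<equiv> gabriel_ideals R U u"

lemma gab_ideal: "I \<in> gab \<Longrightarrow> ideal I R" and gab_one: "I \<in> gab \<Longrightarrow> \<one>\<^sub>U \<in> ext_ideal U u I"
  by (simp_all add: gabriel_iff)

lemma gabI: "ideal I R \<Longrightarrow> \<one>\<^sub>U \<in> ext_ideal U u I \<Longrightarrow> I \<in> gab"
  by (simp add: gabriel_iff)

lemma gab_subset: "I \<in> gab \<Longrightarrow> I \<subseteq> carrier R"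
  by (rule ideal_facts(1)[OF gab_ideal])

lemma gab_mono: "I \<in> gab \<Longrightarrow> ideal J R \<Longrightarrow> I \<subseteq> J \<Longrightarrow> J \<in> gab"
  by (rule gabI[OF _ ext_ideal_mono[OF _ gab_one]])

lemma gab_Int: "I \<in> gab \<Longrightarrow> J \<in> gab \<Longrightarrow> I \<inter> J \<in> gab"
  by (rule gabI[OF R.i_intersect ext_ideal_Int]) (erule gab_ideal gab_one)+

lemma gab_carrier: "carrier R \<in> gab"
proof (rule gabI[OF R.oneideal])
  have "u \<one>\<^sub>R \<otimes>\<^sub>U \<one>\<^sub>U \<in> ext_ideal U u (carrier R)" by (rule ext_ideal_gen) auto
  then show "\<one>\<^sub>U \<in> ext_ideal U u (carrier R)" by simp
qed

lemma gab_annihilator: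
  assumes a: "a \<in> carrier R" "u a = \<zero>\<^sub>U" shows "{r \<in> carrier R. r \<otimes>\<^sub>R a = \<zero>\<^sub>R} \<in> gab"
  by (rule gabI[OF ideal_of_closed[OF R.is_cring] annihilator_ext[OF a]])
    (use a in \<open>auto simp: R.l_distr R.m_assoc\<close>)

lemma gab_denominators:
  assumes x: "x \<in> carrier U" shows "{r \<in> carrier R. u r \<otimes>\<^sub>U x \<in> u ` carrier R} \<in> gab"
proof (rule gabI[OF ideal_of_closed[OF R.is_cring] denominator_ext[OF x]])
  let ?J = "{r \<in> carrier R. u r \<otimes>\<^sub>U x \<in> u ` carrier R}"
  have "u \<zero>\<^sub>R \<otimes>\<^sub>U x \<in> u ` carrier R" by (rule image_eqI[OF _ R.zero_closed]) (use x in simp)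
  then show "\<zero>\<^sub>R \<in> ?J" by blast
  show "r \<oplus>\<^sub>R s \<in> ?J" if rs: "r \<in> ?J" "s \<in> ?J" for r s
  proof -
    obtain a b where "a \<in> carrier R" "u r \<otimes>\<^sub>U x = u a" "b \<in> carrier R" "u s \<otimes>\<^sub>U x = u b" using rs by auto
    then have "u (r \<oplus>\<^sub>R s) \<otimes>\<^sub>U x = u (a \<oplus>\<^sub>R b)" using rs x by (simp add: S.l_distr)
    moreover have "r \<oplus>\<^sub>R s \<in> carrier R" "a \<oplus>\<^sub>R b \<in> carrier R"
      using rs \<open>a \<in> carrier R\<close> \<open>b \<in> carrier R\<close> by auto
    ultimately show ?thesis by blast
  qed
  show "s \<otimes>\<^sub>R r \<in> ?J" if s: "s \<in> carrier R" and r: "r \<in> ?J" for r s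
  proof -
    obtain a where "a \<in> carrier R" "u r \<otimes>\<^sub>U x = u a" using r by auto
    then have "u (s \<otimes>\<^sub>R r) \<otimes>\<^sub>U x = u (s \<otimes>\<^sub>R a)" using r s x by (simp add: S.m_assoc)
    moreover have "s \<otimes>\<^sub>R r \<in> carrier R" "s \<otimes>\<^sub>R a \<in> carrier R"
      using r s \<open>a \<in> carrier R\<close> by auto
    ultimately show ?thesis by blast
  qed
qed auto

text \<open>Expressing 1 takes only finitely many elements of \<open>I\<close>, and the ideal they
  generate still belongs to the filter.\<close>

lemma gab_finite:
  assumes "I \<in> gab" obtains J where "finite J" "J \<subseteq> I" "\<one>\<^sub>U \<in> ext_ideal U u J" "Idl\<^bsub>R\<^esub> J \<in> gab"
proof -
  obtain J where J: "finite J" "J \<subseteq> I" "\<one>\<^sub>U \<in> ext_ideal U u J" using ext_ideal_finite[OF gab_one[OF assms]] by blast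
  have JR: "J \<subseteq> carrier R" using J(2) gab_subset[OF assms] by blast
  have "Idl\<^bsub>R\<^esub> J \<in> gab"
    by (rule gabI[OF R.genideal_ideal[OF JR] ext_ideal_mono[OF R.genideal_self[OF JR] J(3)]])
  then show thesis by (rule that[OF J])
qed

text \<open>Existence is multiplication of \<open>d\<close> by scalars. For uniqueness,
  \<open>g z\<close> is killed by \<open>u r\<close> whenever \<open>u r\<close> times
  \<open>z\<close> lies in the image of \<open>R\<close>, and by \<open>denominator_ext\<close> such
  \<open>r\<close> generate the unit ideal of \<open>U\<close>. This is where the epimorphism
  property makes linear maps over \<open>R\<close> determined by their value at 1.\<close>

lemma u_local_restrict:
  assumes D: "module U D" shows "u_local (restrict_module u D)"
proof -
  interpret D: module U D by (rule D)
  let ?D = "restrict_module u D"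
  have DM: "module R ?D" by (rule module_restrict_module[OF R.is_cring homh D])
  have "\<exists>g. lin R V ?D g \<and> g \<one>\<^sub>U = d" if d: "d \<in> carrier D" for d
    by (rule exI[of _ "\<lambda>z. z \<odot>\<^sub>D d"], intro conjI linI) (use d in \<open>simp_all add: D.smult_l_distr D.smult_assoc1\<close>)
  moreover have "g z = \<zero>\<^sub>D" if g: "lin R V ?D g" and g1: "g \<one>\<^sub>U = \<zero>\<^sub>D" and z: "z \<in> carrier U" for g z
  proof -
    let ?J = "{r \<in> carrier R. u r \<otimes>\<^sub>U z \<in> u ` carrier R}"
    have gz: "g z \<in> carrier D" using lin_closed[OF g, of z] z by simp
    have "y \<odot>\<^sub>D g z = \<zero>\<^sub>D" if "y \<in> ext_ideal U u ?J" for y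
      using that
    proof induction
      case (step r x w)
      obtain b where b: "b \<in> carrier R" "u r \<otimes>\<^sub>U z = u b" using step(1) by auto
      have r: "r \<in> carrier R" and w: "w \<in> carrier U" using step(1) ext_ideal_closed[OF _ step(3)] by auto
      have "u r \<odot>\<^sub>D g z = g (u r \<otimes>\<^sub>U z)" using lin_smult[OF g r, of z] z by simp
      also have "\<dots> = u b \<odot>\<^sub>D g \<one>\<^sub>U" unfolding b(2) using lin_smult[OF g b(1), of "\<one>\<^sub>U"] b(1) by simp
      finally have 0: "u r \<odot>\<^sub>D g z = \<zero>\<^sub>D" using g1 b(1) by simp
      have "(u r \<otimes>\<^sub>U x) \<odot>\<^sub>D g z = x \<odot>\<^sub>D (u r \<odot>\<^sub>D g z)"
        using r step(2) gz by (simp add: D.smult_assoc1[symmetric] S.m_comm)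
      then have "(u r \<otimes>\<^sub>U x) \<odot>\<^sub>D g z = \<zero>\<^sub>D" using 0 step(2) by simp
      then show ?case using step w r gz by (simp add: D.smult_l_distr)
    qed (use gz in simp)
    from this[OF denominator_ext[OF z]] show ?thesis using gz by simp
  qed
  ultimately show ?thesis unfolding u_local_def using DM by auto
qed

text \<open>Every ideal of denominators and every annihilator from the filter contains an element of
  \<open>S\<close>, so \<open>U\<close> consists of fractions of \<open>R\<close> with denominators
  from \<open>S\<close>. As \<open>S\<close> acts bijectively on \<open>X\<close>, a map out of
  \<open>U\<close> exists and is unique for each value at 1.\<close>

lemma u_local_localization:
  assumes S: "mult_closed R S" and X: "module R X"
    and inj: "\<And>s y. s \<in> S \<Longrightarrow> y \<in> carrier X \<Longrightarrow> s \<odot>\<^sub>X y = \<zero>\<^sub>X \<Longrightarrow> y = \<zero>\<^sub>X"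
    and surj: "\<And>s y. s \<in> S \<Longrightarrow> y \<in> carrier X \<Longrightarrow> \<exists>y'\<in>carrier X. s \<odot>\<^sub>X y' = y"
    and meet: "\<And>I. I \<in> gab \<Longrightarrow> S \<inter> I \<noteq> {}"
  shows "u_local X"
proof -
  interpret X: module R X by (rule X)
  have Sc: "s \<in> carrier R" if "s \<in> S" for s using S that by (auto simp: mult_closed_def)
  have den: "\<exists>s\<in>S. \<exists>a\<in>carrier R. u s \<otimes>\<^sub>U z = u a" if "z \<in> carrier U" for z
    using meet[OF gab_denominators[OF that]] by auto
  have "\<exists>g. lin R V X g \<and> g \<one>\<^sub>U = d" if d: "d \<in> carrier X" for d
  proof -
    obtain g where g: "lin R V X g" "\<And>x. x \<in> carrier (self_module R) \<Longrightarrow> g (u x) = x \<odot>\<^sub>X d"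
    proof (rule fraction_lift[OF module_self[OF R.is_cring] V _ _ _ S X inj surj lin_multiples[OF X d]])
      show "lin R (self_module R) V u" by (rule linI) auto
      show "\<exists>s\<in>S. \<exists>x\<in>carrier (self_module R). s \<odot>\<^sub>V y = u x" if "y \<in> carrier V" for y using den[of y] that by simp
      show "\<exists>s\<in>S. s \<odot>\<^bsub>self_module R\<^esub> x = \<zero>\<^bsub>self_module R\<^esub>" if "x \<in> carrier (self_module R)" "u x = \<zero>\<^sub>V" for x
        using meet[OF gab_annihilator[of x]] that by auto
    qed (assumption | rule that)+
    then show ?thesis using g(2)[of "\<one>\<^sub>R"] d by auto
  qed
  moreover have "g z = \<zero>\<^sub>X" if g: "lin R V X g" and g1: "g \<one>\<^sub>U = \<zero>\<^sub>X" and z: "z \<in> carrier U" for g z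
  proof -
    obtain s a where s: "s \<in> S" "a \<in> carrier R" "u s \<otimes>\<^sub>U z = u a" using den[OF z] by blast
    note c = Sc[OF s(1)]
    have "s \<odot>\<^sub>X g z = g (u s \<otimes>\<^sub>U z)" using lin_smult[OF g c, of z] z by simp
    also have "\<dots> = a \<odot>\<^sub>X g \<one>\<^sub>U" unfolding s(3) using lin_smult[OF g s(2), of "\<one>\<^sub>U"] s(2) by simp
    finally have "s \<odot>\<^sub>X g z = \<zero>\<^sub>X" using g1 s(2) by simp
    then show ?thesis using inj[OF s(1)] lin_closed[OF g, of z] z by simp
  qed
  ultimately show ?thesis unfolding u_local_def using X by blast
qed

end

section \<open>Finiteness properties of the filter\<close>

locale local_zero_dim = flat_epi +
  fixes \<Lambda>
  assumes zero_dim: "\<forall>I\<in>gabriel_ideals R U u. semilocal (R Quot I) \<and> krull_dim_zero (R Quot I)"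
    and \<Lambda>: "\<Lambda> = gabriel_ideals R U u \<inter> Max_ideals R"
begin

lemma \<Lambda>_iff: "m \<in> \<Lambda> \<longleftrightarrow> m \<in> gab \<and> maximalideal m R"
  by (auto simp: \<Lambda> Max_ideals_def)

lemma gab_semilocal: "I \<in> gab \<Longrightarrow> semilocal (R Quot I)" and gab_dim: "I \<in> gab \<Longrightarrow> krull_dim_zero (R Quot I)"
  using zero_dim by auto

lemma gab_finite_primes: "I \<in> gab \<Longrightarrow> finite {m \<in> \<Lambda>. I \<subseteq> m}"
  by (rule finite_subset[OF _ R.semilocal_quot_finite[OF gab_ideal gab_semilocal]]) (auto simp: \<Lambda>_iff)

text \<open>A finitely generated member of the filter inside \<open>I\<close> lies in only finitely
  many members of \<open>\<Lambda>\<close>. So finitely many elements of \<open>I\<close> suffice to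
  provide, at all other \<open>m\<close>, one that is invertible in \<open>R_m\<close>.\<close>

lemma gab_avoiding:
  assumes I: "I \<in> gab" obtains J where "finite J" "J \<subseteq> I" "finite {m \<in> \<Lambda>. J \<subseteq> m}"
proof -
  obtain J where J: "finite J" "J \<subseteq> I" "\<one>\<^sub>U \<in> ext_ideal U u J" "Idl\<^bsub>R\<^esub> J \<in> gab"
    by (rule gab_finite[OF I])
  have "Idl\<^bsub>R\<^esub> J \<subseteq> m" if "m \<in> \<Lambda>" "J \<subseteq> m" for m
    by (rule R.genideal_minimal[OF gab_ideal that(2)]) (use that(1) in \<open>simp add: \<Lambda>_iff\<close>)
  then have "{m \<in> \<Lambda>. J \<subseteq> m} \<subseteq> {m \<in> \<Lambda>. Idl\<^bsub>R\<^esub> J \<subseteq> m}" by blast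
  then have "finite {m \<in> \<Lambda>. J \<subseteq> m}" using finite_subset[OF _ gab_finite_primes[OF J(4)]] by blast
  then show thesis using that J by blast
qed

text \<open>This is the passage from local to global: a proper member of the filter lies in a prime,
  which also belongs to the filter and is maximal because the quotient has dimension zero.\<close>

lemma gab_whole:
  assumes J: "J \<in> gab" and av: "\<And>m. m \<in> \<Lambda> \<Longrightarrow> \<not> J \<subseteq> m" shows "J = carrier R"
proof (rule ccontr)
  assume ne: "J \<noteq> carrier R"
  then have "\<one>\<^sub>R \<notin> J" using ideal.one_imp_carrier[OF gab_ideal[OF J]] by blast
  then obtain P where P: "primeideal P R" "J \<subseteq> P"
    using R.prime_avoiding[OF gab_ideal[OF J], of "{\<one>\<^sub>R}"] by auto
  have "maximalideal P R" by (rule R.zero_dim_prime_maximal[OF gab_ideal[OF J] gab_dim[OF J] P])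
  moreover have "P \<in> gab" by (rule gab_mono[OF J primeideal.axioms(1)[OF P(1)] P(2)])
  ultimately show False using av P(2) by (auto simp: \<Lambda>_iff)
qed

section \<open>The localizations \<open>R_m\<close>\<close>

abbreviation "S m \<equiv> carrier R - m"
abbreviation "L \<equiv> localization_prime R"
abbreviation "\<iota> m a \<equiv> fraction R (S m) a \<one>\<^sub>R"

lemma mult_S: "m \<in> \<Lambda> \<Longrightarrow> mult_closed R (S m)"
  by (simp add: \<Lambda>_iff R.mult_closed_complement)

lemma loc: "m \<in> \<Lambda> \<Longrightarrow> is_localization R (S m) (self_module R) (L m) (\<iota> m)"
  unfolding localization_prime_def
  by (rule mult_set.is_localization_localization) (unfold_locales, rule mult_S)

lemma L_one: "m \<in> \<Lambda> \<Longrightarrow> \<one>\<^bsub>L m\<^esub> = \<iota> m \<one>\<^sub>R"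
  by (simp add: localization_prime_def localization_def)

lemma L_module: "m \<in> \<Lambda> \<Longrightarrow> module R (L m)"
  by (rule is_localizationD(2)[OF loc])

lemma L_lin: "m \<in> \<Lambda> \<Longrightarrow> lin R (self_module R) (L m) (\<iota> m)"
  by (rule is_localizationD(3)[OF loc])

lemma L_inj: "m \<in> \<Lambda> \<Longrightarrow> s \<in> S m \<Longrightarrow> y \<in> carrier (L m) \<Longrightarrow> s \<odot>\<^bsub>L m\<^esub> y = \<zero>\<^bsub>L m\<^esub> \<Longrightarrow> y = \<zero>\<^bsub>L m\<^esub>"
  by (rule is_localizationD(4)[OF loc])

lemma L_div: "m \<in> \<Lambda> \<Longrightarrow> s \<in> S m \<Longrightarrow> y \<in> carrier (L m) \<Longrightarrow> \<exists>y'\<in>carrier (L m). s \<odot>\<^bsub>L m\<^esub> y' = y"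
  by (rule is_localizationD(5)[OF loc])

lemma L_frac: "m \<in> \<Lambda> \<Longrightarrow> y \<in> carrier (L m) \<Longrightarrow> \<exists>s\<in>S m. \<exists>a\<in>carrier R. s \<odot>\<^bsub>L m\<^esub> y = \<iota> m a"
  by (rule is_localizationD(6)[OF loc, unfolded restrict_scalars_simps])

lemma L_zero: "m \<in> \<Lambda> \<Longrightarrow> a \<in> carrier R \<Longrightarrow> \<iota> m a = \<zero>\<^bsub>L m\<^esub> \<Longrightarrow> \<exists>s\<in>S m. s \<otimes>\<^sub>R a = \<zero>\<^sub>R"
  by (rule is_localizationD(7)[OF loc, unfolded restrict_scalars_simps])

lemma \<iota>_closed: "m \<in> \<Lambda> \<Longrightarrow> a \<in> carrier R \<Longrightarrow> \<iota> m a \<in> carrier (L m)"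
  by (rule lin_closed[OF L_lin, unfolded restrict_scalars_simps])

lemma \<iota>_add: "m \<in> \<Lambda> \<Longrightarrow> a \<in> carrier R \<Longrightarrow> b \<in> carrier R \<Longrightarrow> \<iota> m (a \<oplus>\<^sub>R b) = \<iota> m a \<oplus>\<^bsub>L m\<^esub> \<iota> m b"
  by (rule lin_add[OF L_lin, unfolded restrict_scalars_simps])

lemma \<iota>_smult: "m \<in> \<Lambda> \<Longrightarrow> a \<in> carrier R \<Longrightarrow> b \<in> carrier R \<Longrightarrow> \<iota> m (a \<otimes>\<^sub>R b) = a \<odot>\<^bsub>L m\<^esub> \<iota> m b"
  by (rule lin_smult[OF L_lin, unfolded restrict_scalars_simps])

lemma \<iota>_zero: "m \<in> \<Lambda> \<Longrightarrow> \<iota> m \<zero>\<^sub>R = \<zero>\<^bsub>L m\<^esub>"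
  by (rule lin_zero[OF module_self[OF R.is_cring] L_module L_lin, unfolded restrict_scalars_simps])

lemma L_hom_zero:
  assumes m: "m \<in> \<Lambda>" and C: "module R C" and h: "lin R (L m) C h" and h1: "h (\<iota> m \<one>\<^sub>R) = \<zero>\<^sub>C"
    and inj: "\<And>s c. s \<in> S m \<Longrightarrow> c \<in> carrier C \<Longrightarrow> s \<odot>\<^sub>C c = \<zero>\<^sub>C \<Longrightarrow> c = \<zero>\<^sub>C" and y: "y \<in> carrier (L m)"
  shows "h y = \<zero>\<^sub>C"
proof -
  interpret C: module R C by (rule C)
  obtain s a where s: "s \<in> S m" "a \<in> carrier R" "s \<odot>\<^bsub>L m\<^esub> y = \<iota> m a" using L_frac[OF m y] by blast
  have "s \<odot>\<^sub>C h y = h (\<iota> m (a \<otimes>\<^sub>R \<one>\<^sub>R))" using lin_smult[OF h _ y, of s] s by simp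
  also have "\<dots> = a \<odot>\<^sub>C h (\<iota> m \<one>\<^sub>R)"
    unfolding \<iota>_smult[OF m s(2) R.one_closed] by (rule lin_smult[OF h s(2) \<iota>_closed[OF m R.one_closed]])
  finally have "s \<odot>\<^sub>C h y = \<zero>\<^sub>C" using h1 s(2) by simp
  then show ?thesis using inj[OF s(1) lin_closed[OF h y]] by blast
qed

text \<open>Since \<open>R/I\<close> is zero-dimensional, every ideal in \<open>gab\<close> meets \<open>{t\<^sup>k s}\<close> for \<open>t \<in> m\<close>, \<open>s \<notin> m\<close>; hence
  \<open>R\<^sub>m[1/t]\<close> is a \<open>U\<close>-module.\<close>

lemma telescope_L:
  assumes m: "m \<in> \<Lambda>" and t: "t \<in> m"
  obtains X :: "('a, ('a \<times> 'a) set) module" and \<tau> where "u_local X" "telescope R t (L m) X \<tau>"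
proof -
  have mm: "maximalideal m R" and mg: "m \<in> gab" using m by (auto simp: \<Lambda>_iff)
  have tc: "t \<in> carrier R" using t gab_subset[OF mg] by blast
  note mc = R.maximalideal_complement[OF mm]
  let ?T = "{t [^]\<^sub>R k \<otimes>\<^sub>R s | (k::nat) s. s \<in> S m}"
  have pw: "t [^]\<^sub>R k \<in> ?T" for k :: nat
  proof -
    have "t [^]\<^sub>R k = t [^]\<^sub>R k \<otimes>\<^sub>R \<one>\<^sub>R" using tc by simp
    then show ?thesis using mc(1) by blast
  qed
  have sT: "s \<in> ?T" if "s \<in> S m" for s
  proof -
    have "s = t [^]\<^sub>R (0::nat) \<otimes>\<^sub>R s" using that by simp
    then show ?thesis using that by blast
  qed
  have T: "mult_closed R ?T" unfolding mult_closed_def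
  proof (intro conjI ballI)
    show "?T \<subseteq> carrier R" using tc by auto
    show "\<one>\<^sub>R \<in> ?T" by (rule sT[OF mc(1)])
    fix x y assume xy: "x \<in> ?T" "y \<in> ?T"
    obtain k l :: nat and r s where "r \<in> S m" "x = t [^]\<^sub>R k \<otimes>\<^sub>R r" "s \<in> S m" "y = t [^]\<^sub>R l \<otimes>\<^sub>R s"
      using xy by blast
    moreover from this have "x \<otimes>\<^sub>R y = t [^]\<^sub>R (k + l) \<otimes>\<^sub>R (r \<otimes>\<^sub>R s)"
      using tc by (auto simp: R.nat_pow_mult[symmetric] R.m_ac)
    ultimately show "x \<otimes>\<^sub>R y \<in> ?T" using mc(2) by blast
  qed
  define X where "X = localization R ?T"
  define \<xi> where "\<xi> = (\<lambda>a. fraction R ?T a \<one>\<^sub>R)"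
  have X: "is_localization R ?T (self_module R) X \<xi>"
    unfolding X_def \<xi>_def by (rule mult_set.is_localization_localization) (unfold_locales, rule T)
  note XD = is_localizationD[OF X]
  interpret X: module R X by (rule XD(2))
  interpret L: module R "L m" by (rule L_module[OF m])
  have "u_local X"
  proof (rule u_local_localization[OF T XD(2,4,5)])
    fix I assume I: "I \<in> gab"
    obtain k :: nat and s where "s \<in> carrier R" "s \<notin> m" "t [^]\<^sub>R k \<otimes>\<^sub>R s \<in> I"
      by (rule R.zero_dim_nilpotent[OF gab_ideal[OF I] gab_dim[OF I] mm t])
    then show "?T \<inter> I \<noteq> {}" by blast
  qed
  obtain g where g0: "lin R (L m) X g" "\<And>a. a \<in> carrier (self_module R) \<Longrightarrow> g (\<iota> m a) = \<xi> a"
  proof (rule localization_lift[OF loc[OF m] mult_S[OF m] XD(2) _ _ XD(3)])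
    show "y = \<zero>\<^sub>X" if "s \<in> S m" "y \<in> carrier X" "s \<odot>\<^sub>X y = \<zero>\<^sub>X" for s y
      by (rule XD(4)[OF sT[OF that(1)] that(2,3)])
    show "\<exists>y'\<in>carrier X. s \<odot>\<^sub>X y' = y" if "s \<in> S m" "y \<in> carrier X" for s y
      by (rule XD(5)[OF sT[OF that(1)] that(2)])
  next
    fix g assume "lin R (L m) X g" "\<And>x. x \<in> carrier (self_module R) \<Longrightarrow> g (\<iota> m x) = \<xi> x"
    then show thesis by (rule that)
  qed
  note g = g0[unfolded restrict_scalars_simps(1)]
  \<comment> \<open>Inverting all products of powers of \<open>t\<close> with elements outside
    \<open>m\<close> in one go is the same as inverting \<open>t\<close> in
    \<open>R_m\<close>.\<close>
  have "is_localization R (range (\<lambda>n::nat. t [^]\<^sub>R n)) (L m) X g"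
    unfolding is_localization_def
  proof (intro conjI ballI impI)
    fix s y assume s: "s \<in> range (\<lambda>n::nat. t [^]\<^sub>R n)" and y: "y \<in> carrier X"
    obtain k :: nat where "s = t [^]\<^sub>R k" using s by blast
    then have sT: "s \<in> ?T" using pw by (simp only:)
    show "y = \<zero>\<^sub>X" if "s \<odot>\<^sub>X y = \<zero>\<^sub>X" by (rule XD(4)[OF sT y that])
    show "\<exists>y'\<in>carrier X. s \<odot>\<^sub>X y' = y" by (rule XD(5)[OF sT y])
  next
    fix y assume y: "y \<in> carrier X"
    obtain k :: nat and s a where s: "s \<in> S m" "a \<in> carrier R" "(t [^]\<^sub>R k \<otimes>\<^sub>R s) \<odot>\<^sub>X y = \<xi> a"
      using XD(6)[OF y] by auto
    \<comment> \<open>For \<open>y = a / (t^k s)\<close> the element \<open>x = a / s\<close> of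
      \<open>R_m\<close> satisfies \<open>t^k y = g x\<close>; the equality is checked after
      multiplication by \<open>s\<close>, which acts injectively.\<close>
    obtain x where x: "x \<in> carrier (L m)" "s \<odot>\<^bsub>L m\<^esub> x = \<iota> m a" using L_div[OF m s(1) \<iota>_closed[OF m s(2)]] by blast
    have sc: "s \<in> carrier R" and tk: "t [^]\<^sub>R k \<in> carrier R" using s tc by auto
    have "s \<odot>\<^sub>X (t [^]\<^sub>R k \<odot>\<^sub>X y) = \<xi> a"
      using s(3) X.smult_assoc1[OF sc tk y] by (simp add: R.m_comm[OF sc tk])
    moreover have "s \<odot>\<^sub>X g x = \<xi> a" using lin_smult[OF g(1) sc x(1)] x(2) g(2)[OF s(2)] by simp
    ultimately have "s \<odot>\<^sub>X (t [^]\<^sub>R k \<odot>\<^sub>X y \<ominus>\<^sub>X g x) = \<zero>\<^sub>X"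
      using lin_minus[OF XD(2) XD(2) lin_scalar[OF XD(2) sc] X.smult_closed[OF tk y] lin_closed[OF g(1) x(1)]]
        module_minus_self[OF XD(2), of "\<xi> a"] lin_closed[OF XD(3), of a] s(2) by simp
    then have "t [^]\<^sub>R k \<odot>\<^sub>X y \<ominus>\<^sub>X g x = \<zero>\<^sub>X"
      by (rule XD(4)[OF sT[OF s(1)] module_minus_closed[OF XD(2) X.smult_closed[OF tk y] lin_closed[OF g(1) x(1)]]])
    then have "t [^]\<^sub>R k \<odot>\<^sub>X y = g x"
      using module_diff_eq_zero[OF XD(2) X.smult_closed[OF tk y] lin_closed[OF g(1) x(1)]] by blast
    then show "\<exists>s\<in>range (\<lambda>n::nat. t [^]\<^sub>R n). \<exists>x\<in>carrier (L m). s \<odot>\<^sub>X y = g x" using x(1) by blast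
  next
    fix y assume y: "y \<in> carrier (L m)" and z: "g y = \<zero>\<^sub>X"
    obtain s a where s: "s \<in> S m" "a \<in> carrier R" "s \<odot>\<^bsub>L m\<^esub> y = \<iota> m a" using L_frac[OF m y] by blast
    have sc: "s \<in> carrier R" using s by auto
    have "\<xi> a = \<zero>\<^sub>X" using lin_smult[OF g(1) sc y] z s g(2)[OF s(2)] by simp
    then obtain k :: nat and s' where s': "s' \<in> S m" "(t [^]\<^sub>R k \<otimes>\<^sub>R s') \<otimes>\<^sub>R a = \<zero>\<^sub>R"
      using XD(7)[of a] s(2) by auto
    have c: "s' \<in> carrier R" "t [^]\<^sub>R k \<in> carrier R" using s' tc by auto
    have ss: "s' \<otimes>\<^sub>R s \<in> S m" by (rule mc(2)[OF s'(1) s(1)])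
    have "(s' \<otimes>\<^sub>R s) \<odot>\<^bsub>L m\<^esub> (t [^]\<^sub>R k \<odot>\<^bsub>L m\<^esub> y) = (t [^]\<^sub>R k \<otimes>\<^sub>R s') \<odot>\<^bsub>L m\<^esub> (s \<odot>\<^bsub>L m\<^esub> y)"
      using c sc y by (simp flip: L.smult_assoc1) (simp add: R.m_ac)
    also have "\<dots> = \<iota> m ((t [^]\<^sub>R k \<otimes>\<^sub>R s') \<otimes>\<^sub>R a)"
      unfolding s(3) by (rule \<iota>_smult[OF m R.m_closed[OF c(2,1)] s(2), symmetric])
    finally have "(s' \<otimes>\<^sub>R s) \<odot>\<^bsub>L m\<^esub> (t [^]\<^sub>R k \<odot>\<^bsub>L m\<^esub> y) = \<zero>\<^bsub>L m\<^esub>"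
      unfolding s'(2) by (simp add: \<iota>_zero[OF m])
    then have "t [^]\<^sub>R k \<odot>\<^bsub>L m\<^esub> y = \<zero>\<^bsub>L m\<^esub>" by (rule L_inj[OF m ss L.smult_closed[OF c(2) y]])
    then show "\<exists>s\<in>range (\<lambda>n::nat. t [^]\<^sub>R n). s \<odot>\<^bsub>L m\<^esub> y = \<zero>\<^bsub>L m\<^esub>" by blast
  qed (rule XD(2) L_module[OF m] g(1))+
  then have "telescope R t (L m) X g" by unfold_locales (rule tc)
  then show thesis by (rule that[OF \<open>u_local X\<close>])
qed

end

section \<open>Gluing \<open>R\<close> from its localizations\<close>

context local_zero_dim
begin

abbreviation "LP \<equiv> product_module \<Lambda> L"
abbreviation "LS \<equiv> dsum_module \<Lambda> L"

lemma LP_module: "module R LP" by (rule module_product[OF R.is_cring L_module])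
lemma LS_module: "module R LS" by (rule module_dsum[OF R.is_cring L_module])

lemma \<iota>_killed:
  assumes m: "m \<in> \<Lambda>" and a: "a \<in> carrier R" and K: "\<not> {r \<in> carrier R. r \<otimes>\<^sub>R a = \<zero>\<^sub>R} \<subseteq> m"
  shows "\<iota> m a = \<zero>\<^bsub>L m\<^esub>"
proof -
  obtain s where s: "s \<in> S m" "s \<otimes>\<^sub>R a = \<zero>\<^sub>R" using K by blast
  have sc: "s \<in> carrier R" using s(1) by blast
  have "s \<odot>\<^bsub>L m\<^esub> \<iota> m a = \<zero>\<^bsub>L m\<^esub>" using \<iota>_smult[OF m sc a] s(2) \<iota>_zero[OF m] by simp
  then show ?thesis by (rule L_inj[OF m s(1) \<iota>_closed[OF m a]])
qed

lemma \<iota>_eq_iff: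
  assumes m: "m \<in> \<Lambda>" and a: "a \<in> carrier R" "b \<in> carrier R" and z: "\<iota> m (a \<ominus>\<^sub>R b) = \<zero>\<^bsub>L m\<^esub>"
  shows "\<iota> m a = \<iota> m b"
proof -
  have "a = (a \<ominus>\<^sub>R b) \<oplus>\<^sub>R b" using a by (simp add: a_minus_def R.a_assoc R.l_neg)
  then have "\<iota> m a = \<iota> m (a \<ominus>\<^sub>R b) \<oplus>\<^bsub>L m\<^esub> \<iota> m b" using \<iota>_add[OF m R.minus_closed[OF a] a(2)] by simp
  then show ?thesis unfolding z using module_l_zero[OF L_module[OF m] \<iota>_closed[OF m a(2)]] by simp
qed

text \<open>A section of all \<open>R\<^sub>m\<close> is compatible with \<open>x \<in> U\<close> if, away from finitely many \<open>m\<close>, it is given by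
  the same fractions as \<open>x\<close>.\<close>

definition compatible :: "'b \<times> ('a set \<Rightarrow> ('a \<times> 'a) set) \<Rightarrow> bool" where
  "compatible b \<longleftrightarrow> (\<exists>I\<in>gab. \<forall>r\<in>I. \<exists>a\<in>carrier R. u r \<otimes>\<^sub>U fst b = u a \<and> finite {m \<in> \<Lambda>. r \<odot>\<^bsub>L m\<^esub> snd b m \<noteq> \<iota> m a})"

definition B :: "('a, 'b \<times> ('a set \<Rightarrow> ('a \<times> 'a) set)) module" where
  "B = (pair_module V LP)\<lparr>carrier := {b \<in> carrier (pair_module V LP). compatible b}\<rparr>"

lemma B_mem: "(x, \<rho>) \<in> carrier B \<longleftrightarrow> x \<in> carrier U \<and> \<rho> \<in> carrier LP \<and> compatible (x, \<rho>)"
  by (simp add: B_def)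

lemma B_ops: "(x, \<rho>) \<oplus>\<^sub>B (x', \<rho>') = (x \<oplus>\<^sub>U x', \<rho> \<oplus>\<^sub>LP \<rho>')" "r \<odot>\<^sub>B (x, \<rho>) = (u r \<otimes>\<^sub>U x, r \<odot>\<^sub>LP \<rho>)"
  "\<zero>\<^sub>B = (\<zero>\<^sub>U, \<zero>\<^sub>LP)"
  by (simp_all add: B_def)

lemma compatible_zero:
  assumes \<rho>: "\<rho> \<in> carrier LS" shows "compatible (\<zero>\<^sub>U, \<rho>)"
  unfolding compatible_def fst_conv snd_conv
proof (intro bexI[OF _ gab_carrier] ballI bexI[OF _ R.zero_closed] conjI)
  fix r assume r: "r \<in> carrier R"
  then show "u r \<otimes>\<^sub>U \<zero>\<^sub>U = u \<zero>\<^sub>R" by simp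
  have "{m \<in> \<Lambda>. r \<odot>\<^bsub>L m\<^esub> \<rho> m \<noteq> \<iota> m \<zero>\<^sub>R} \<subseteq> {m \<in> \<Lambda>. \<rho> m \<noteq> \<zero>\<^bsub>L m\<^esub>}"
    using \<iota>_zero module.smult_r_null[OF L_module r] by auto
  then show "finite {m \<in> \<Lambda>. r \<odot>\<^bsub>L m\<^esub> \<rho> m \<noteq> \<iota> m \<zero>\<^sub>R}" by (rule finite_subset) (use \<rho> in simp)
qed

lemma compatible_add:
  assumes b: "b \<in> carrier (pair_module V LP)" "compatible b" and c: "c \<in> carrier (pair_module V LP)" "compatible c"
  shows "compatible (b \<oplus>\<^bsub>pair_module V LP\<^esub> c)"
proof -
  obtain x \<rho> where bx: "b = (x, \<rho>)" by (cases b)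
  obtain y \<sigma> where cy: "c = (y, \<sigma>)" by (cases c)
  have xc: "x \<in> carrier U" "y \<in> carrier U" and \<rho>: "\<And>m. m \<in> \<Lambda> \<Longrightarrow> \<rho> m \<in> carrier (L m)" and \<sigma>: "\<And>m. m \<in> \<Lambda> \<Longrightarrow> \<sigma> m \<in> carrier (L m)"
    using b(1) c(1) by (auto simp: bx cy)
  obtain I where I: "I \<in> gab" "\<forall>r\<in>I. \<exists>a\<in>carrier R. u r \<otimes>\<^sub>U x = u a \<and> finite {m \<in> \<Lambda>. r \<odot>\<^bsub>L m\<^esub> \<rho> m \<noteq> \<iota> m a}"
    using b(2) by (auto simp: compatible_def bx)
  obtain J where J: "J \<in> gab" "\<forall>r\<in>J. \<exists>a\<in>carrier R. u r \<otimes>\<^sub>U y = u a \<and> finite {m \<in> \<Lambda>. r \<odot>\<^bsub>L m\<^esub> \<sigma> m \<noteq> \<iota> m a}"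
    using c(2) by (auto simp: compatible_def cy)
  have "\<exists>a\<in>carrier R. u r \<otimes>\<^sub>U (x \<oplus>\<^sub>U y) = u a \<and> finite {m \<in> \<Lambda>. r \<odot>\<^bsub>L m\<^esub> (\<rho> m \<oplus>\<^bsub>L m\<^esub> \<sigma> m) \<noteq> \<iota> m a}" if r: "r \<in> I \<inter> J" for r
  proof -
    have rc: "r \<in> carrier R" using r gab_subset[OF I(1)] by blast
    obtain a where a: "a \<in> carrier R" "u r \<otimes>\<^sub>U x = u a" "finite {m \<in> \<Lambda>. r \<odot>\<^bsub>L m\<^esub> \<rho> m \<noteq> \<iota> m a}" using I(2) r by blast
    obtain d where d: "d \<in> carrier R" "u r \<otimes>\<^sub>U y = u d" "finite {m \<in> \<Lambda>. r \<odot>\<^bsub>L m\<^esub> \<sigma> m \<noteq> \<iota> m d}" using J(2) r by blast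
    have "u r \<otimes>\<^sub>U (x \<oplus>\<^sub>U y) = u (a \<oplus>\<^sub>R d)" using a d rc xc by (simp add: S.r_distr)
    moreover have "{m \<in> \<Lambda>. r \<odot>\<^bsub>L m\<^esub> (\<rho> m \<oplus>\<^bsub>L m\<^esub> \<sigma> m) \<noteq> \<iota> m (a \<oplus>\<^sub>R d)} \<subseteq>
        {m \<in> \<Lambda>. r \<odot>\<^bsub>L m\<^esub> \<rho> m \<noteq> \<iota> m a} \<union> {m \<in> \<Lambda>. r \<odot>\<^bsub>L m\<^esub> \<sigma> m \<noteq> \<iota> m d}"
      using module.smult_r_distr[OF L_module rc \<rho> \<sigma>] \<iota>_add[OF _ a(1) d(1)] by auto
    ultimately show ?thesis
      using finite_subset[OF _ finite_UnI[OF a(3) d(3)]] R.a_closed[OF a(1) d(1)] by blast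
  qed
  moreover have "{m \<in> \<Lambda>. r \<odot>\<^bsub>L m\<^esub> snd (b \<oplus>\<^bsub>pair_module V LP\<^esub> c) m \<noteq> \<iota> m a} = {m \<in> \<Lambda>. r \<odot>\<^bsub>L m\<^esub> (\<rho> m \<oplus>\<^bsub>L m\<^esub> \<sigma> m) \<noteq> \<iota> m a}" for r a
    by (rule Collect_cong) (auto simp: bx cy)
  moreover have "fst (b \<oplus>\<^bsub>pair_module V LP\<^esub> c) = x \<oplus>\<^sub>U y" by (simp add: bx cy)
  ultimately show ?thesis unfolding compatible_def using gab_Int[OF I(1) J(1)] by (simp only:) blast
qed

lemma compatible_smult:
  assumes t: "t \<in> carrier R" and b: "b \<in> carrier (pair_module V LP)" "compatible b"
  shows "compatible (t \<odot>\<^bsub>pair_module V LP\<^esub> b)"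
proof -
  obtain x \<rho> where bx: "b = (x, \<rho>)" by (cases b)
  have xc: "x \<in> carrier U" and \<rho>: "\<And>m. m \<in> \<Lambda> \<Longrightarrow> \<rho> m \<in> carrier (L m)"
    using b(1) by (auto simp: bx)
  obtain I where I: "I \<in> gab" "\<forall>r\<in>I. \<exists>a\<in>carrier R. u r \<otimes>\<^sub>U x = u a \<and> finite {m \<in> \<Lambda>. r \<odot>\<^bsub>L m\<^esub> \<rho> m \<noteq> \<iota> m a}"
    using b(2) by (auto simp: compatible_def bx)
  have "\<exists>a\<in>carrier R. u r \<otimes>\<^sub>U (u t \<otimes>\<^sub>U x) = u a \<and> finite {m \<in> \<Lambda>. r \<odot>\<^bsub>L m\<^esub> (t \<odot>\<^bsub>L m\<^esub> \<rho> m) \<noteq> \<iota> m a}" if r: "r \<in> I" for r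
  proof -
    have rc: "r \<in> carrier R" using r gab_subset[OF I(1)] by blast
    obtain a where a: "a \<in> carrier R" "u r \<otimes>\<^sub>U x = u a" "finite {m \<in> \<Lambda>. r \<odot>\<^bsub>L m\<^esub> \<rho> m \<noteq> \<iota> m a}" using I(2) r by blast
    have "u r \<otimes>\<^sub>U (u t \<otimes>\<^sub>U x) = u t \<otimes>\<^sub>U (u r \<otimes>\<^sub>U x)" using rc t xc by (simp add: S.m_ac)
    then have "u r \<otimes>\<^sub>U (u t \<otimes>\<^sub>U x) = u (t \<otimes>\<^sub>R a)" using a t by simp
    moreover have "{m \<in> \<Lambda>. r \<odot>\<^bsub>L m\<^esub> (t \<odot>\<^bsub>L m\<^esub> \<rho> m) \<noteq> \<iota> m (t \<otimes>\<^sub>R a)} \<subseteq> {m \<in> \<Lambda>. r \<odot>\<^bsub>L m\<^esub> \<rho> m \<noteq> \<iota> m a}"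
      using lin_smult[OF lin_scalar[OF L_module rc] t \<rho>] \<iota>_smult[OF _ t a(1)] by auto
    ultimately show ?thesis using finite_subset[OF _ a(3)] R.m_closed[OF t a(1)] by blast
  qed
  moreover have "{m \<in> \<Lambda>. r \<odot>\<^bsub>L m\<^esub> snd (t \<odot>\<^bsub>pair_module V LP\<^esub> b) m \<noteq> \<iota> m a} = {m \<in> \<Lambda>. r \<odot>\<^bsub>L m\<^esub> (t \<odot>\<^bsub>L m\<^esub> \<rho> m) \<noteq> \<iota> m a}" for r a
    by (rule Collect_cong) (auto simp: bx)
  moreover have "fst (t \<odot>\<^bsub>pair_module V LP\<^esub> b) = u t \<otimes>\<^sub>U x" by (simp add: bx)
  ultimately show ?thesis unfolding compatible_def using I(1) by (simp only:) blast
qed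

lemma LS_LP: "\<rho> \<in> carrier LS \<Longrightarrow> \<rho> \<in> carrier LP" by simp

lemma B_module: "module R B"
  unfolding B_def
proof (rule module_submodule(2)[OF module_pair[OF V LP_module]])
  have "compatible (\<zero>\<^sub>U, \<zero>\<^sub>LP)"
    by (rule compatible_zero) (use module_zero_closed[OF LS_module] in simp)
  then show "\<zero>\<^bsub>pair_module V LP\<^esub> \<in> {b \<in> carrier (pair_module V LP). compatible b}"
    using module_zero_closed[OF module_pair[OF V LP_module]] by simp
next
  fix x y assume "x \<in> {b \<in> carrier (pair_module V LP). compatible b}" "y \<in> {b \<in> carrier (pair_module V LP). compatible b}"
  then show "x \<oplus>\<^bsub>pair_module V LP\<^esub> y \<in> {b \<in> carrier (pair_module V LP). compatible b}"
    using compatible_add[of x y] module_add_closed[OF module_pair[OF V LP_module], of x y] by blast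
next
  fix r x assume "r \<in> carrier R" "x \<in> {b \<in> carrier (pair_module V LP). compatible b}"
  then show "r \<odot>\<^bsub>pair_module V LP\<^esub> x \<in> {b \<in> carrier (pair_module V LP). compatible b}"
    using compatible_smult[of r x] module.smult_closed[OF module_pair[OF V LP_module], of r x] by blast
qed blast

lemma B_lin_sum: "lin R LS B (\<lambda>\<rho>. (\<zero>\<^sub>U, \<rho>))"
  by (rule linI) (use compatible_zero LS_LP in \<open>auto simp: B_mem B_ops simp del: dsum_module_simps(1) product_module_simps(1)\<close>)

lemma B_lin_fst: "lin R B V fst"
  by (rule linI) (auto simp: B_def)

text \<open>Choose finitely many denominators \<open>J\<close> of \<open>x\<close>. At every
  \<open>m\<close> that misses some \<open>j\<close> in \<open>J\<close>, let the section be the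
  fraction given by that \<open>j\<close>; the finitely many other \<open>m\<close> do not matter
  for compatibility. The choice of \<open>j\<close> varies with \<open>m\<close>, so compatibility
  has to compare it with every other denominator \<open>r\<close> of \<open>x\<close>.\<close>

lemma B_fst_surj:
  assumes x: "x \<in> carrier U" shows "\<exists>b\<in>carrier B. fst b = x"
proof -
  let ?I = "{r \<in> carrier R. u r \<otimes>\<^sub>U x \<in> u ` carrier R}"
  have I: "?I \<in> gab" by (rule gab_denominators[OF x])
  obtain J where J: "finite J" "J \<subseteq> ?I" "finite {m \<in> \<Lambda>. J \<subseteq> m}" by (rule gab_avoiding[OF I])
  have JR: "j \<in> carrier R" if "j \<in> J" for j using J(2) that by blast
  have "\<forall>j\<in>J. \<exists>a\<in>carrier R. u j \<otimes>\<^sub>U x = u a" using J(2) by blast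
  then obtain \<alpha> where \<alpha>: "\<And>j. j \<in> J \<Longrightarrow> \<alpha> j \<in> carrier R" "\<And>j. j \<in> J \<Longrightarrow> u j \<otimes>\<^sub>U x = u (\<alpha> j)" by metis
  have "\<exists>y\<in>carrier (L m). J \<subseteq> m \<or> (\<exists>j\<in>J. j \<notin> m \<and> j \<odot>\<^bsub>L m\<^esub> y = \<iota> m (\<alpha> j))" if m: "m \<in> \<Lambda>" for m
  proof (cases "J \<subseteq> m")
    case True then show ?thesis using module_zero_closed[OF L_module[OF m]] by blast
  next
    case False
    then obtain j where j: "j \<in> J" "j \<notin> m" by blast
    then show ?thesis using L_div[OF m _ \<iota>_closed[OF m \<alpha>(1)[OF j(1)]], of j] JR by blast
  qed
  then have "\<forall>m\<in>\<Lambda>. \<exists>y. y \<in> carrier (L m) \<and> (J \<subseteq> m \<or> (\<exists>j\<in>J. j \<notin> m \<and> j \<odot>\<^bsub>L m\<^esub> y = \<iota> m (\<alpha> j)))" by blast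
  then obtain \<rho>0 where \<rho>0: "\<forall>m\<in>\<Lambda>. \<rho>0 m \<in> carrier (L m) \<and> (J \<subseteq> m \<or> (\<exists>j\<in>J. j \<notin> m \<and> j \<odot>\<^bsub>L m\<^esub> \<rho>0 m = \<iota> m (\<alpha> j)))"
    by (rule bchoice[THEN exE])
  define \<rho> where "\<rho> = restrict \<rho>0 \<Lambda>"
  have \<rho>: "\<rho> \<in> carrier LP" "\<And>m. m \<in> \<Lambda> \<Longrightarrow> \<rho> m \<in> carrier (L m)"
    "\<And>m. m \<in> \<Lambda> \<Longrightarrow> \<not> J \<subseteq> m \<Longrightarrow> \<exists>j\<in>J. j \<notin> m \<and> j \<odot>\<^bsub>L m\<^esub> \<rho> m = \<iota> m (\<alpha> j)"
    using \<rho>0 by (auto simp: \<rho>_def)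
  have "\<exists>a\<in>carrier R. u r \<otimes>\<^sub>U x = u a \<and> finite {m \<in> \<Lambda>. r \<odot>\<^bsub>L m\<^esub> \<rho> m \<noteq> \<iota> m a}" if r: "r \<in> ?I" for r
  proof -
    have rc: "r \<in> carrier R" using r by blast
    obtain a where a: "a \<in> carrier R" "u r \<otimes>\<^sub>U x = u a" using r by blast
    \<comment> \<open>Where \<open>?d j\<close> vanishes, the fractions of \<open>x\<close> with
      denominators \<open>j\<close> and \<open>r\<close> agree. \<open>u\<close> kills
      \<open>?d j\<close>, so its annihilator is in the filter and it vanishes at almost all
      \<open>m\<close>; finiteness of \<open>J\<close> keeps the exceptional set finite.\<close>
    let ?d = "\<lambda>j. r \<otimes>\<^sub>R \<alpha> j \<ominus>\<^sub>R j \<otimes>\<^sub>R a"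
    let ?K = "\<lambda>j. {s \<in> carrier R. s \<otimes>\<^sub>R ?d j = \<zero>\<^sub>R}"
    have d: "?d j \<in> carrier R" "?K j \<in> gab" if j: "j \<in> J" for j
    proof -
      show dc: "?d j \<in> carrier R" using rc \<alpha>(1)[OF j] JR[OF j] a by simp
      have "u r \<otimes>\<^sub>U u (\<alpha> j) = u j \<otimes>\<^sub>U u a"
        unfolding \<alpha>(2)[OF j, symmetric] a(2)[symmetric] using rc JR[OF j] x by (simp add: S.m_ac)
      then have "u (?d j) = \<zero>\<^sub>U"
        using rc \<alpha>(1)[OF j] JR[OF j] a(1) by (simp add: a_minus_def S.r_neg)
      then show "?K j \<in> gab" by (rule gab_annihilator[OF dc])
    qed
    have "{m \<in> \<Lambda>. r \<odot>\<^bsub>L m\<^esub> \<rho> m \<noteq> \<iota> m a} \<subseteq> {m \<in> \<Lambda>. J \<subseteq> m} \<union> (\<Union>j\<in>J. {m \<in> \<Lambda>. ?K j \<subseteq> m})"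
    proof
      fix m assume mm: "m \<in> {m \<in> \<Lambda>. r \<odot>\<^bsub>L m\<^esub> \<rho> m \<noteq> \<iota> m a}"
      then have m: "m \<in> \<Lambda>" and ne: "r \<odot>\<^bsub>L m\<^esub> \<rho> m \<noteq> \<iota> m a" by auto
      interpret Lm: module R "L m" by (rule L_module[OF m])
      show "m \<in> {m \<in> \<Lambda>. J \<subseteq> m} \<union> (\<Union>j\<in>J. {m \<in> \<Lambda>. ?K j \<subseteq> m})"
      proof (rule ccontr)
        assume no: "\<not> ?thesis"
        then have "\<not> J \<subseteq> m" using m by blast
        then obtain j where j: "j \<in> J" "j \<notin> m" "j \<odot>\<^bsub>L m\<^esub> \<rho> m = \<iota> m (\<alpha> j)" using \<rho>(3)[OF m] by blast
        have Kj: "\<not> ?K j \<subseteq> m" using no m j(1) by blast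
        have "\<iota> m (r \<otimes>\<^sub>R \<alpha> j) = \<iota> m (j \<otimes>\<^sub>R a)"
          by (rule \<iota>_eq_iff[OF m R.m_closed[OF rc \<alpha>(1)[OF j(1)]] R.m_closed[OF JR[OF j(1)] a(1)] \<iota>_killed[OF m d(1)[OF j(1)] Kj]])
        then have e: "r \<odot>\<^bsub>L m\<^esub> \<iota> m (\<alpha> j) = j \<odot>\<^bsub>L m\<^esub> \<iota> m a"
          using \<iota>_smult[OF m rc \<alpha>(1)[OF j(1)]] \<iota>_smult[OF m JR[OF j(1)] a(1)] by simp
        have rr: "r \<odot>\<^bsub>L m\<^esub> \<rho> m \<in> carrier (L m)" by (rule Lm.smult_closed[OF rc \<rho>(2)[OF m]])
        have "j \<odot>\<^bsub>L m\<^esub> (r \<odot>\<^bsub>L m\<^esub> \<rho> m) = j \<odot>\<^bsub>L m\<^esub> \<iota> m a"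
          using lin_smult[OF lin_scalar[OF Lm.module_axioms JR[OF j(1)]] rc \<rho>(2)[OF m]] j(3) e by simp
        then have "j \<odot>\<^bsub>L m\<^esub> (r \<odot>\<^bsub>L m\<^esub> \<rho> m \<ominus>\<^bsub>L m\<^esub> \<iota> m a) = \<zero>\<^bsub>L m\<^esub>"
          using lin_minus[OF Lm.module_axioms Lm.module_axioms lin_scalar[OF Lm.module_axioms JR[OF j(1)]] rr \<iota>_closed[OF m a(1)]]
            module_minus_self[OF Lm.module_axioms Lm.smult_closed[OF JR[OF j(1)] \<iota>_closed[OF m a(1)]]] by simp
        then have "r \<odot>\<^bsub>L m\<^esub> \<rho> m \<ominus>\<^bsub>L m\<^esub> \<iota> m a = \<zero>\<^bsub>L m\<^esub>"
          using L_inj[OF m, of j] j(2) JR[OF j(1)] module_minus_closed[OF Lm.module_axioms rr \<iota>_closed[OF m a(1)]] by blast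
        then show False using ne module_diff_eq_zero[OF Lm.module_axioms rr \<iota>_closed[OF m a(1)]] by blast
      qed
    qed
    moreover have "finite ({m \<in> \<Lambda>. J \<subseteq> m} \<union> (\<Union>j\<in>J. {m \<in> \<Lambda>. ?K j \<subseteq> m}))"
      using J(1,3) gab_finite_primes[OF d(2)] by (intro finite_UnI finite_UN_I)
    ultimately show ?thesis using a finite_subset by blast
  qed
  then have "compatible (x, \<rho>)" unfolding compatible_def fst_conv snd_conv using I by (rule_tac bexI[of _ ?I]) blast+
  then have "(x, \<rho>) \<in> carrier B" using x \<rho>(1) unfolding B_mem by blast
  then show ?thesis by (intro bexI[of _ "(x, \<rho>)"]) simp_all
qed

text \<open>For a finite set \<open>J\<close> of denominators and almost all \<open>m\<close>, some
  \<open>j\<close> in \<open>J\<close> is invertible at \<open>m\<close>, and \<open>j\<close> times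
  the section is the image of an element \<open>\<alpha> j\<close> killed by \<open>u\<close>. Such
  an element vanishes at almost all \<open>m\<close>, and then so does the section.\<close>

lemma B_fst_kernel:
  assumes b: "b \<in> carrier B" "fst b = \<zero>\<^sub>U" shows "snd b \<in> carrier LS" "b = (\<zero>\<^sub>U, snd b)"
proof -
  show e: "b = (\<zero>\<^sub>U, snd b)" using b(2) by (metis prod.collapse)
  have bP: "snd b \<in> carrier LP" and cb: "compatible b" using b(1) by (auto simp: B_def)
  have \<rho>: "snd b m \<in> carrier (L m)" if "m \<in> \<Lambda>" for m using bP that by auto
  obtain I where I: "I \<in> gab" "\<forall>r\<in>I. \<exists>a\<in>carrier R. u r \<otimes>\<^sub>U \<zero>\<^sub>U = u a \<and> finite {m \<in> \<Lambda>. r \<odot>\<^bsub>L m\<^esub> snd b m \<noteq> \<iota> m a}"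
    using cb unfolding compatible_def b(2) by blast
  obtain J where J: "finite J" "J \<subseteq> I" "finite {m \<in> \<Lambda>. J \<subseteq> m}" by (rule gab_avoiding[OF I(1)])
  have JR: "j \<in> carrier R" if "j \<in> J" for j using J(2) gab_subset[OF I(1)] that by blast
  have "\<forall>j\<in>J. \<exists>a. a \<in> carrier R \<and> u a = \<zero>\<^sub>U \<and> finite {m \<in> \<Lambda>. j \<odot>\<^bsub>L m\<^esub> snd b m \<noteq> \<iota> m a}"
  proof
    fix j assume j: "j \<in> J"
    then obtain a where "a \<in> carrier R" "u j \<otimes>\<^sub>U \<zero>\<^sub>U = u a" "finite {m \<in> \<Lambda>. j \<odot>\<^bsub>L m\<^esub> snd b m \<noteq> \<iota> m a}"
      using I(2) J(2) by blast
    then show "\<exists>a. a \<in> carrier R \<and> u a = \<zero>\<^sub>U \<and> finite {m \<in> \<Lambda>. j \<odot>\<^bsub>L m\<^esub> snd b m \<noteq> \<iota> m a}"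
      using JR[OF j] by (intro exI[of _ a]) auto
  qed
  then obtain \<alpha> where \<alpha>0: "\<forall>j\<in>J. \<alpha> j \<in> carrier R \<and> u (\<alpha> j) = \<zero>\<^sub>U \<and>
      finite {m \<in> \<Lambda>. j \<odot>\<^bsub>L m\<^esub> snd b m \<noteq> \<iota> m (\<alpha> j)}"
    by (rule bchoice[THEN exE])
  have \<alpha>: "\<alpha> j \<in> carrier R" "u (\<alpha> j) = \<zero>\<^sub>U" "finite {m \<in> \<Lambda>. j \<odot>\<^bsub>L m\<^esub> snd b m \<noteq> \<iota> m (\<alpha> j)}"
    if "j \<in> J" for j using \<alpha>0 that by blast+
  let ?K = "\<lambda>j. {s \<in> carrier R. s \<otimes>\<^sub>R \<alpha> j = \<zero>\<^sub>R}"
  let ?E = "{m \<in> \<Lambda>. J \<subseteq> m} \<union> (\<Union>j\<in>J. {m \<in> \<Lambda>. ?K j \<subseteq> m} \<union> {m \<in> \<Lambda>. j \<odot>\<^bsub>L m\<^esub> snd b m \<noteq> \<iota> m (\<alpha> j)})"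
  have "finite ?E"
    using J(1,3) gab_finite_primes[OF gab_annihilator[OF \<alpha>(1,2)]] \<alpha>(3) by (intro finite_UnI finite_UN_I)
  moreover have "{m \<in> \<Lambda>. snd b m \<noteq> \<zero>\<^bsub>L m\<^esub>} \<subseteq> ?E"
  proof
    fix m assume mm: "m \<in> {m \<in> \<Lambda>. snd b m \<noteq> \<zero>\<^bsub>L m\<^esub>}"
    then have m: "m \<in> \<Lambda>" and ne: "snd b m \<noteq> \<zero>\<^bsub>L m\<^esub>" by auto
    show "m \<in> ?E"
    proof (rule ccontr)
      assume no: "m \<notin> ?E"
      then obtain j where j: "j \<in> J" "j \<notin> m" using m by blast
      have "j \<odot>\<^bsub>L m\<^esub> snd b m = \<iota> m (\<alpha> j)" "\<not> ?K j \<subseteq> m" using no m j by blast+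
      then have "j \<odot>\<^bsub>L m\<^esub> snd b m = \<zero>\<^bsub>L m\<^esub>" using \<iota>_killed[OF m \<alpha>(1)[OF j(1)]] by simp
      then show False using ne L_inj[OF m _ \<rho>[OF m], of j] j JR by blast
    qed
  qed
  ultimately have "finite {m \<in> \<Lambda>. snd b m \<noteq> \<zero>\<^bsub>L m\<^esub>}" by (rule finite_subset[rotated])
  then show "snd b \<in> carrier LS" using bP by simp
qed

end

lemma scalar_cancel:
  assumes X: "module R X" and s: "s \<in> carrier R" and inj: "\<And>y. y \<in> carrier X \<Longrightarrow> s \<odot>\<^sub>X y = \<zero>\<^sub>X \<Longrightarrow> y = \<zero>\<^sub>X"
    and y: "y \<in> carrier X" "y' \<in> carrier X" and e: "s \<odot>\<^sub>X y = s \<odot>\<^sub>X y'"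
  shows "y = y'"
proof -
  have "s \<odot>\<^sub>X (y \<ominus>\<^sub>X y') = \<zero>\<^sub>X"
    using lin_minus[OF X X lin_scalar[OF X s] y] e module_minus_self[OF X module.smult_closed[OF X s y(2)]] by simp
  then have "y \<ominus>\<^sub>X y' = \<zero>\<^sub>X" by (rule inj[OF module_minus_closed[OF X y]])
  then show ?thesis using module_diff_eq_zero[OF X y] by blast
qed

section \<open>The sequence from \<open>R\<close> through \<open>B\<close> to the sum of the
  \<open>U_m\<close>\<close>

context local_zero_dim
begin

text \<open>\<open>U_m\<close> is formed over the ring \<open>U\<close>, so the sum of these modules
  is a \<open>U\<close>-module by construction; \<open>W m\<close> is the underlying
  \<open>R\<close>-module.\<close>

abbreviation "LU m \<equiv> localization U (u ` S m)"
abbreviation "W m \<equiv> restrict_module u (LU m)"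
abbreviation "w m x \<equiv> fraction U (u ` S m) x \<one>\<^sub>U"

lemma mult_US: assumes m: "m \<in> \<Lambda>" shows "mult_closed U (u ` S m)"
proof -
  have S1: "\<one>\<^sub>R \<in> S m" and S2: "\<And>s t. s \<in> S m \<Longrightarrow> t \<in> S m \<Longrightarrow> s \<otimes>\<^sub>R t \<in> S m"
    using mult_S[OF m] unfolding mult_closed_def by blast+
  show ?thesis unfolding mult_closed_def
  proof (intro conjI ballI)
    show "u ` S m \<subseteq> carrier U" by auto
    show "\<one>\<^sub>U \<in> u ` S m" by (rule image_eqI[OF _ S1]) simp
    fix x y assume "x \<in> u ` S m" "y \<in> u ` S m"
    then obtain s t where st: "s \<in> S m" "x = u s" "t \<in> S m" "y = u t" by blast
    show "x \<otimes>\<^sub>U y \<in> u ` S m" by (rule image_eqI[OF _ S2[OF st(1,3)]]) (use st in simp)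
  qed
qed

lemma LU_loc: "m \<in> \<Lambda> \<Longrightarrow> is_localization U (u ` S m) (self_module U) (LU m) (w m)"
  by (rule mult_set.is_localization_localization) (unfold_locales, rule mult_US)

lemma W_module: "m \<in> \<Lambda> \<Longrightarrow> module R (W m)"
  by (rule module_restrict_module[OF R.is_cring homh is_localizationD(2)[OF LU_loc]])

lemma w_lin: assumes m: "m \<in> \<Lambda>" shows "lin R V (W m) (w m)"
proof -
  note l = is_localizationD(3)[OF LU_loc[OF m]]
  show ?thesis
    by (rule linI) (use lin_closed[OF l] lin_add[OF l] lin_smult[OF l] in simp_all)
qed

lemma W_inj: assumes m: "m \<in> \<Lambda>" and s: "s \<in> S m" and y: "y \<in> carrier (W m)" and z: "s \<odot>\<^bsub>W m\<^esub> y = \<zero>\<^bsub>W m\<^esub>" shows "y = \<zero>\<^bsub>W m\<^esub>"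
  using is_localizationD(4)[OF LU_loc[OF m] imageI[OF s, of u], of y] y z by simp

lemma W_div: assumes m: "m \<in> \<Lambda>" and s: "s \<in> S m" and y: "y \<in> carrier (W m)" shows "\<exists>y'\<in>carrier (W m). s \<odot>\<^bsub>W m\<^esub> y' = y"
  using is_localizationD(5)[OF LU_loc[OF m] imageI[OF s, of u], of y] y by simp

lemma W_frac: assumes m: "m \<in> \<Lambda>" and y: "y \<in> carrier (W m)" shows "\<exists>s\<in>S m. \<exists>x\<in>carrier U. s \<odot>\<^bsub>W m\<^esub> y = w m x"
  using is_localizationD(6)[OF LU_loc[OF m], of y] y by auto

lemma w_zero: assumes m: "m \<in> \<Lambda>" and x: "x \<in> carrier U" and z: "w m x = \<zero>\<^bsub>W m\<^esub>" shows "\<exists>s\<in>S m. u s \<otimes>\<^sub>U x = \<zero>\<^sub>U"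
  using is_localizationD(7)[OF LU_loc[OF m], of x] x z by auto

lemma W_cancel:
  assumes m: "m \<in> \<Lambda>" and s: "s \<in> S m" and y: "y \<in> carrier (W m)" "y' \<in> carrier (W m)" and e: "s \<odot>\<^bsub>W m\<^esub> y = s \<odot>\<^bsub>W m\<^esub> y'"
  shows "y = y'"
  by (rule scalar_cancel[OF W_module[OF m] _ W_inj[OF m s] y e]) (use s in blast)

lemma L_cancel:
  assumes m: "m \<in> \<Lambda>" and s: "s \<in> S m" and y: "y \<in> carrier (L m)" "y' \<in> carrier (L m)" and e: "s \<odot>\<^bsub>L m\<^esub> y = s \<odot>\<^bsub>L m\<^esub> y'"
  shows "y = y'"
  by (rule scalar_cancel[OF L_module[OF m] _ L_inj[OF m s] y e]) (use s in blast)

text \<open>The localization \<open>R_m -> U_m\<close> of \<open>u\<close>.\<close>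

definition \<theta> :: "'a set \<Rightarrow> ('a \<times> 'a) set \<Rightarrow> ('b \<times> 'b) set" where
  "\<theta> m = (SOME g. lin R (L m) (W m) g \<and> (\<forall>a\<in>carrier R. g (\<iota> m a) = w m (u a)))"

lemma
  assumes m: "m \<in> \<Lambda>"
  shows \<theta>_lin: "lin R (L m) (W m) (\<theta> m)" and \<theta>_\<iota>: "\<And>a. a \<in> carrier R \<Longrightarrow> \<theta> m (\<iota> m a) = w m (u a)"
proof -
  have f: "lin R (self_module R) (W m) (\<lambda>a. w m (u a))"
    by (rule lin_comp[OF _ w_lin[OF m]]) (rule linI, simp_all)
  have "\<exists>g. lin R (L m) (W m) g \<and> (\<forall>a\<in>carrier R. g (\<iota> m a) = w m (u a))"
  proof (rule localization_lift[OF loc[OF m] mult_S[OF m] W_module[OF m] W_inj[OF m] W_div[OF m] f])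
    fix g assume "lin R (L m) (W m) g" "\<And>x. x \<in> carrier (self_module R) \<Longrightarrow> g (\<iota> m x) = w m (u x)"
    then show ?thesis by (intro exI[of _ g]) simp
  qed
  from someI_ex[OF this, folded \<theta>_def]
  show "lin R (L m) (W m) (\<theta> m)" "\<And>a. a \<in> carrier R \<Longrightarrow> \<theta> m (\<iota> m a) = w m (u a)" by blast+
qed

abbreviation "WS \<equiv> restrict_module u (dsum_module \<Lambda> LU)"

lemma WS_local: "u_local WS"
  by (rule u_local_restrict[OF module_dsum[OF S.is_cring is_localizationD(2)[OF LU_loc]]])

lemma WS_module: "module R WS"
  using WS_local by (simp add: u_local_def)

text \<open>The defect of compatibility at \<open>m\<close>: both components of \<open>b\<close>
  have an image in \<open>U_m\<close>, and this is their difference.\<close>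

definition \<delta> :: "'a set \<Rightarrow> 'b \<times> ('a set \<Rightarrow> ('a \<times> 'a) set) \<Rightarrow> ('b \<times> 'b) set" where
  "\<delta> m b = \<theta> m (snd b m) \<ominus>\<^bsub>W m\<^esub> w m (fst b)"

lemma B_lin_component: "m \<in> \<Lambda> \<Longrightarrow> lin R B (L m) (\<lambda>b. snd b m)"
  by (rule linI) (auto simp: B_def)

lemma \<delta>_lin: "m \<in> \<Lambda> \<Longrightarrow> lin R B (W m) (\<delta> m)"
  unfolding \<delta>_def by (rule lin_diff[OF W_module lin_comp[OF B_lin_component \<theta>_lin] lin_comp[OF B_lin_fst w_lin]])

lemma \<delta>_zero_iff:
  assumes m: "m \<in> \<Lambda>" and b: "b \<in> carrier B" shows "\<delta> m b = \<zero>\<^bsub>W m\<^esub> \<longleftrightarrow> \<theta> m (snd b m) = w m (fst b)"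
  unfolding \<delta>_def
  by (rule module_diff_eq_zero[OF W_module[OF m] lin_closed[OF \<theta>_lin[OF m] lin_closed[OF B_lin_component[OF m] b]]
        lin_closed[OF w_lin[OF m] lin_closed[OF B_lin_fst b]]])

definition p :: "'b \<times> ('a set \<Rightarrow> ('a \<times> 'a) set) \<Rightarrow> 'a set \<Rightarrow> ('b \<times> 'b) set" where
  "p b = (\<lambda>m\<in>\<Lambda>. \<delta> m b)"

text \<open>At almost all \<open>m\<close> some denominator \<open>j\<close> of the first component
  is outside \<open>m\<close> and the two components give the same fraction with denominator
  \<open>j\<close>. As \<open>j\<close> can be cancelled in \<open>U_m\<close>, the defect is zero
  there.\<close>

lemma \<delta>_finite:
  assumes b: "b \<in> carrier B" shows "finite {m \<in> \<Lambda>. \<delta> m b \<noteq> \<zero>\<^bsub>W m\<^esub>}"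
proof -
  have cb: "compatible b" and x: "fst b \<in> carrier U" using b by (auto simp: B_def)
  obtain I where I: "I \<in> gab" "\<forall>r\<in>I. \<exists>a\<in>carrier R. u r \<otimes>\<^sub>U fst b = u a \<and> finite {m \<in> \<Lambda>. r \<odot>\<^bsub>L m\<^esub> snd b m \<noteq> \<iota> m a}"
    using cb unfolding compatible_def by blast
  obtain J where J: "finite J" "J \<subseteq> I" "finite {m \<in> \<Lambda>. J \<subseteq> m}" by (rule gab_avoiding[OF I(1)])
  have JR: "j \<in> carrier R" if "j \<in> J" for j using J(2) gab_subset[OF I(1)] that by blast
  have "\<forall>j\<in>J. \<exists>a. a \<in> carrier R \<and> u j \<otimes>\<^sub>U fst b = u a \<and> finite {m \<in> \<Lambda>. j \<odot>\<^bsub>L m\<^esub> snd b m \<noteq> \<iota> m a}"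
    using I(2) J(2) by blast
  then obtain \<alpha> where \<alpha>0: "\<forall>j\<in>J. \<alpha> j \<in> carrier R \<and> u j \<otimes>\<^sub>U fst b = u (\<alpha> j) \<and> finite {m \<in> \<Lambda>. j \<odot>\<^bsub>L m\<^esub> snd b m \<noteq> \<iota> m (\<alpha> j)}"
    by (rule bchoice[THEN exE])
  have \<alpha>: "\<alpha> j \<in> carrier R" "u j \<otimes>\<^sub>U fst b = u (\<alpha> j)" "finite {m \<in> \<Lambda>. j \<odot>\<^bsub>L m\<^esub> snd b m \<noteq> \<iota> m (\<alpha> j)}"
    if "j \<in> J" for j using \<alpha>0 that by blast+
  let ?E = "{m \<in> \<Lambda>. J \<subseteq> m} \<union> (\<Union>j\<in>J. {m \<in> \<Lambda>. j \<odot>\<^bsub>L m\<^esub> snd b m \<noteq> \<iota> m (\<alpha> j)})"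
  have "finite ?E" using J(1,3) \<alpha>(3) by (intro finite_UnI finite_UN_I)
  moreover have "{m \<in> \<Lambda>. \<delta> m b \<noteq> \<zero>\<^bsub>W m\<^esub>} \<subseteq> ?E"
  proof
    fix m assume mm: "m \<in> {m \<in> \<Lambda>. \<delta> m b \<noteq> \<zero>\<^bsub>W m\<^esub>}"
    then have m: "m \<in> \<Lambda>" and ne: "\<delta> m b \<noteq> \<zero>\<^bsub>W m\<^esub>" by blast+
    show "m \<in> ?E"
    proof (rule ccontr)
      assume no: "m \<notin> ?E"
      then obtain j where j: "j \<in> J" "j \<notin> m" using m by blast
      have jS: "j \<in> S m" using j JR by blast
      have e: "j \<odot>\<^bsub>L m\<^esub> snd b m = \<iota> m (\<alpha> j)" using no m j by blast
      have \<rho>: "snd b m \<in> carrier (L m)" by (rule lin_closed[OF B_lin_component[OF m] b])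
      have "j \<odot>\<^bsub>W m\<^esub> \<theta> m (snd b m) = w m (u (\<alpha> j))"
        unfolding lin_smult[OF \<theta>_lin[OF m] JR[OF j(1)] \<rho>, symmetric] e by (rule \<theta>_\<iota>[OF m \<alpha>(1)[OF j(1)]])
      also have "\<dots> = w m (j \<odot>\<^sub>V fst b)" using \<alpha>(2)[OF j(1)] by simp
      also have "\<dots> = j \<odot>\<^bsub>W m\<^esub> w m (fst b)" by (rule lin_smult[OF w_lin[OF m] JR[OF j(1)] lin_closed[OF B_lin_fst b]])
      finally have "\<theta> m (snd b m) = w m (fst b)"
        by (rule W_cancel[OF m jS lin_closed[OF \<theta>_lin[OF m] \<rho>] lin_closed[OF w_lin[OF m] lin_closed[OF B_lin_fst b]]])
      then show False using ne \<delta>_zero_iff[OF m b] by blast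
    qed
  qed
  ultimately show ?thesis by (rule finite_subset[rotated])
qed

lemma p_lin: "lin R B WS p"
proof (rule linI)
  fix b assume b: "b \<in> carrier B"
  have "{m \<in> \<Lambda>. p b m \<noteq> \<zero>\<^bsub>LU m\<^esub>} = {m \<in> \<Lambda>. \<delta> m b \<noteq> \<zero>\<^bsub>W m\<^esub>}" by (auto simp: p_def)
  then show "p b \<in> carrier WS" using \<delta>_finite[OF b] lin_closed[OF \<delta>_lin b] by (auto simp: p_def)
next
  fix b b' assume b: "b \<in> carrier B" "b' \<in> carrier B"
  have "\<delta> m (b \<oplus>\<^sub>B b') = \<delta> m b \<oplus>\<^bsub>LU m\<^esub> \<delta> m b'" if "m \<in> \<Lambda>" for m
    using lin_add[OF \<delta>_lin[OF that] b] by simp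
  then show "p (b \<oplus>\<^sub>B b') = p b \<oplus>\<^sub>WS p b'" by (auto simp: p_def intro!: restrict_ext)
next
  fix r b assume r: "r \<in> carrier R" and b: "b \<in> carrier B"
  have "\<delta> m (r \<odot>\<^sub>B b) = u r \<odot>\<^bsub>LU m\<^esub> \<delta> m b" if "m \<in> \<Lambda>" for m
    using lin_smult[OF \<delta>_lin[OF that] r b] by simp
  then show "p (r \<odot>\<^sub>B b) = r \<odot>\<^sub>WS p b" by (auto simp: p_def intro!: restrict_ext)
qed

lemma p_zero_iff: "b \<in> carrier B \<Longrightarrow> p b = \<zero>\<^sub>WS \<longleftrightarrow> (\<forall>m\<in>\<Lambda>. \<delta> m b = \<zero>\<^bsub>W m\<^esub>)"
  by (auto simp: p_def restrict_def fun_eq_iff)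

definition diag :: "'a \<Rightarrow> 'b \<times> ('a set \<Rightarrow> ('a \<times> 'a) set)" where
  "diag a = (u a, \<lambda>m\<in>\<Lambda>. \<iota> m a)"

lemma diag_lin: "lin R (self_module R) B diag"
proof (rule linI)
  fix a assume "a \<in> carrier (self_module R)"
  then have a: "a \<in> carrier R" by simp
  have "compatible (diag a)"
    unfolding compatible_def diag_def fst_conv snd_conv
  proof (intro bexI[OF _ gab_carrier] ballI)
    fix r assume r: "r \<in> carrier R"
    have "{m \<in> \<Lambda>. r \<odot>\<^bsub>L m\<^esub> (\<lambda>m\<in>\<Lambda>. \<iota> m a) m \<noteq> \<iota> m (r \<otimes>\<^sub>R a)} = {}" using \<iota>_smult[OF _ r a] by auto
    then show "\<exists>c\<in>carrier R. u r \<otimes>\<^sub>U u a = u c \<and> finite {m \<in> \<Lambda>. r \<odot>\<^bsub>L m\<^esub> (\<lambda>m\<in>\<Lambda>. \<iota> m a) m \<noteq> \<iota> m c}"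
      using r a by (intro bexI[of _ "r \<otimes>\<^sub>R a"] conjI) simp_all
  qed
  then show "diag a \<in> carrier B" using a \<iota>_closed by (auto simp: diag_def B_mem)
next
  fix a b assume "a \<in> carrier (self_module R)" "b \<in> carrier (self_module R)"
  then show "diag (a \<oplus>\<^bsub>self_module R\<^esub> b) = diag a \<oplus>\<^sub>B diag b"
    using \<iota>_add by (auto simp: diag_def B_ops intro!: restrict_ext)
next
  fix r b assume "r \<in> carrier R" "b \<in> carrier (self_module R)"
  then show "diag (r \<odot>\<^bsub>self_module R\<^esub> b) = r \<odot>\<^sub>B diag b"
    using \<iota>_smult by (auto simp: diag_def B_ops intro!: restrict_ext)
qed

lemma diag_closed: "a \<in> carrier R \<Longrightarrow> diag a \<in> carrier B"
  using lin_closed[OF diag_lin] by simp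

lemma p_diag: assumes a: "a \<in> carrier R" shows "p (diag a) = \<zero>\<^sub>WS"
  unfolding p_zero_iff[OF diag_closed[OF a]]
proof
  fix m assume m: "m \<in> \<Lambda>"
  show "\<delta> m (diag a) = \<zero>\<^bsub>W m\<^esub>"
    unfolding \<delta>_zero_iff[OF m diag_closed[OF a]] using m \<theta>_\<iota>[OF m a] by (simp add: diag_def)
qed

text \<open>The annihilator of \<open>a\<close> is in the filter because \<open>u a = 0\<close>, and
  it is contained in no \<open>m\<close> because \<open>a\<close> vanishes in every
  \<open>R_m\<close>.\<close>

lemma diag_injective:
  assumes a: "a \<in> carrier R" and z: "diag a = \<zero>\<^sub>B" shows "a = \<zero>\<^sub>R"
proof -
  have ua: "u a = \<zero>\<^sub>U" and e: "(\<lambda>m\<in>\<Lambda>. \<iota> m a) = (\<lambda>m\<in>\<Lambda>. \<zero>\<^bsub>L m\<^esub>)" using z by (auto simp: diag_def B_ops)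
  let ?K = "{r \<in> carrier R. r \<otimes>\<^sub>R a = \<zero>\<^sub>R}"
  have "?K = carrier R"
  proof (rule gab_whole[OF gab_annihilator[OF a ua]])
    fix m assume m: "m \<in> \<Lambda>"
    have "\<iota> m a = \<zero>\<^bsub>L m\<^esub>" using fun_cong[OF e, of m] m by simp
    then obtain s where "s \<in> S m" "s \<otimes>\<^sub>R a = \<zero>\<^sub>R" using L_zero[OF m a] by blast
    then show "\<not> ?K \<subseteq> m" by blast
  qed
  then have "\<one>\<^sub>R \<in> ?K" by blast
  then show ?thesis using a by simp
qed

lemma approximation:
  assumes I: "I \<in> gab" and m: "m \<in> \<Lambda>" and s: "s \<in> S m"
  obtains b \<sigma> where "b \<in> carrier R" "\<sigma> \<in> S m" "\<sigma> \<otimes>\<^sub>R (\<one>\<^sub>R \<ominus>\<^sub>R b \<otimes>\<^sub>R s) \<in> I"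
    "\<forall>n\<in>\<Lambda>. n \<noteq> m \<longrightarrow> (\<exists>\<sigma>\<in>S n. \<sigma> \<otimes>\<^sub>R b \<in> I)"
proof -
  have mm: "maximalideal m R" using m \<Lambda>_iff by blast
  show thesis
  proof (rule R.zero_dim_approximation[OF gab_ideal[OF I] gab_semilocal[OF I] gab_dim[OF I] mm s])
    fix b assume b: "b \<in> carrier R" "\<exists>\<sigma>\<in>S m. \<sigma> \<otimes>\<^sub>R (\<one>\<^sub>R \<ominus>\<^sub>R b \<otimes>\<^sub>R s) \<in> I"
      "\<And>n. maximalideal n R \<Longrightarrow> n \<noteq> m \<Longrightarrow> \<exists>\<sigma>\<in>S n. \<sigma> \<otimes>\<^sub>R b \<in> I"
    obtain \<sigma> where \<sigma>: "\<sigma> \<in> S m" "\<sigma> \<otimes>\<^sub>R (\<one>\<^sub>R \<ominus>\<^sub>R b \<otimes>\<^sub>R s) \<in> I" using b(2) by (rule bexE)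
    have "\<forall>n\<in>\<Lambda>. n \<noteq> m \<longrightarrow> (\<exists>\<sigma>\<in>S n. \<sigma> \<otimes>\<^sub>R b \<in> I)"
      using b(3) \<Lambda>_iff by (intro ballI impI) simp
    then show thesis by (rule that[OF b(1) \<sigma>])
  qed
qed

text \<open>Enlarging the denominator, \<open>y = d / r\<close> with \<open>u d = 0\<close>, so the
  annihilator of \<open>d\<close> is in the filter. Modulo this annihilator some \<open>b\<close> is
  inverse to \<open>r\<close> at \<open>m\<close> and zero at the other members of
  \<open>\<Lambda>\<close>. Multiplication by \<open>d\<close> removes the error of the
  approximation, so \<open>b d\<close> is exactly \<open>y\<close> at \<open>m\<close> and exactly
  zero elsewhere.\<close>

lemma kernel_lift:
  assumes m: "m \<in> \<Lambda>" and y: "y \<in> carrier (L m)" and z: "\<theta> m y = \<zero>\<^bsub>W m\<^esub>"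
  shows "\<exists>a\<in>carrier R. u a = \<zero>\<^sub>U \<and> \<iota> m a = y \<and> (\<forall>n\<in>\<Lambda>. n \<noteq> m \<longrightarrow> \<iota> n a = \<zero>\<^bsub>L n\<^esub>)"
proof -
  interpret Lm: module R "L m" by (rule L_module[OF m])
  have mm: "maximalideal m R" using m \<Lambda>_iff by blast
  obtain s c where s: "s \<in> S m" "c \<in> carrier R" "s \<odot>\<^bsub>L m\<^esub> y = \<iota> m c" using L_frac[OF m y] by blast
  have sc: "s \<in> carrier R" using s(1) by blast
  interpret Wm: module R "W m" by (rule W_module[OF m])
  have "w m (u c) = s \<odot>\<^bsub>W m\<^esub> \<theta> m y" unfolding \<theta>_\<iota>[OF m s(2), symmetric] s(3)[symmetric] by (rule lin_smult[OF \<theta>_lin[OF m] sc y])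
  then have "w m (u c) = \<zero>\<^bsub>W m\<^esub>" unfolding z Wm.smult_r_null[OF sc] .
  then obtain t where t: "t \<in> S m" "u t \<otimes>\<^sub>U u c = \<zero>\<^sub>U" using w_zero[OF m hom_closed[OF s(2)]] by blast
  have tc: "t \<in> carrier R" using t(1) by blast
  define d where "d = t \<otimes>\<^sub>R c"
  define r where "r = t \<otimes>\<^sub>R s"
  have d: "d \<in> carrier R" "u d = \<zero>\<^sub>U" using tc s(2) t(2) by (auto simp: d_def)
  have r: "r \<in> S m" unfolding r_def by (rule R.maximalideal_complement(2)[OF mm t(1) s(1)])
  have rc: "r \<in> carrier R" using r by blast
  have ry: "r \<odot>\<^bsub>L m\<^esub> y = \<iota> m d"
    unfolding r_def d_def Lm.smult_assoc1[OF tc sc y] s(3) by (rule \<iota>_smult[OF m tc s(2), symmetric])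
  let ?K = "{k \<in> carrier R. k \<otimes>\<^sub>R d = \<zero>\<^sub>R}"
  obtain b \<sigma> where b: "b \<in> carrier R" "\<sigma> \<in> S m" "\<sigma> \<otimes>\<^sub>R (\<one>\<^sub>R \<ominus>\<^sub>R b \<otimes>\<^sub>R r) \<in> ?K"
    "\<forall>n\<in>\<Lambda>. n \<noteq> m \<longrightarrow> (\<exists>\<sigma>\<in>S n. \<sigma> \<otimes>\<^sub>R b \<in> ?K)"
    by (rule approximation[OF gab_annihilator[OF d] m r])
  have \<sigma>: "\<sigma> \<in> carrier R" using b(2) by blast
  have bd: "b \<otimes>\<^sub>R d \<in> carrier R" using b(1) d(1) by simp
  have "\<iota> m (b \<otimes>\<^sub>R d) = y"
  proof (rule L_cancel[OF m R.maximalideal_complement(2)[OF mm b(2) r] \<iota>_closed[OF m bd] y])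
    have "\<sigma> \<otimes>\<^sub>R (\<one>\<^sub>R \<ominus>\<^sub>R b \<otimes>\<^sub>R r) \<otimes>\<^sub>R d = \<sigma> \<otimes>\<^sub>R d \<ominus>\<^sub>R (\<sigma> \<otimes>\<^sub>R r) \<otimes>\<^sub>R (b \<otimes>\<^sub>R d)"
      using \<sigma> b(1) rc d(1) by (simp add: a_minus_def R.r_distr R.l_distr R.l_minus R.r_minus R.m_ac)
    then have "\<sigma> \<otimes>\<^sub>R d \<ominus>\<^sub>R (\<sigma> \<otimes>\<^sub>R r) \<otimes>\<^sub>R (b \<otimes>\<^sub>R d) = \<zero>\<^sub>R" using b(3) by simp
    then have "\<iota> m (\<sigma> \<otimes>\<^sub>R d \<ominus>\<^sub>R (\<sigma> \<otimes>\<^sub>R r) \<otimes>\<^sub>R (b \<otimes>\<^sub>R d)) = \<zero>\<^bsub>L m\<^esub>" by (simp add: \<iota>_zero[OF m])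
    then have e: "\<iota> m (\<sigma> \<otimes>\<^sub>R d) = \<iota> m ((\<sigma> \<otimes>\<^sub>R r) \<otimes>\<^sub>R (b \<otimes>\<^sub>R d))"
      by (rule \<iota>_eq_iff[OF m R.m_closed[OF \<sigma> d(1)] R.m_closed[OF R.m_closed[OF \<sigma> rc] bd]])
    have "(\<sigma> \<otimes>\<^sub>R r) \<odot>\<^bsub>L m\<^esub> y = \<iota> m (\<sigma> \<otimes>\<^sub>R d)"
      unfolding Lm.smult_assoc1[OF \<sigma> rc y] ry by (rule \<iota>_smult[OF m \<sigma> d(1), symmetric])
    then show "(\<sigma> \<otimes>\<^sub>R r) \<odot>\<^bsub>L m\<^esub> \<iota> m (b \<otimes>\<^sub>R d) = (\<sigma> \<otimes>\<^sub>R r) \<odot>\<^bsub>L m\<^esub> y"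
      unfolding e \<iota>_smult[OF m R.m_closed[OF \<sigma> rc] bd] by simp
  qed
  moreover have "\<iota> n (b \<otimes>\<^sub>R d) = \<zero>\<^bsub>L n\<^esub>" if n: "n \<in> \<Lambda>" "n \<noteq> m" for n
  proof (rule \<iota>_killed[OF n(1) bd])
    obtain \<tau> where \<tau>: "\<tau> \<in> S n" "\<tau> \<otimes>\<^sub>R b \<in> ?K" using b(4) n by blast
    have "\<tau> \<otimes>\<^sub>R (b \<otimes>\<^sub>R d) = \<zero>\<^sub>R" using \<tau> b(1) d(1) by (simp add: R.m_assoc)
    then show "\<not> {s \<in> carrier R. s \<otimes>\<^sub>R (b \<otimes>\<^sub>R d) = \<zero>\<^sub>R} \<subseteq> n" using \<tau>(1) by blast
  qed
  moreover have "u (b \<otimes>\<^sub>R d) = \<zero>\<^sub>U" using b(1) d by simp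
  ultimately show ?thesis using bd by blast
qed

text \<open>Each lift vanishes at all other members of \<open>\<Lambda>\<close>, so the lifts for
  different \<open>m\<close> can be added without interference.\<close>

lemma kernel_lift_finite:
  assumes T: "finite T" "T \<subseteq> \<Lambda>" and \<rho>: "\<And>m. m \<in> T \<Longrightarrow> \<rho> m \<in> carrier (L m) \<and> \<theta> m (\<rho> m) = \<zero>\<^bsub>W m\<^esub>"
  shows "\<exists>a\<in>carrier R. u a = \<zero>\<^sub>U \<and> (\<forall>n\<in>\<Lambda>. \<iota> n a = (if n \<in> T then \<rho> n else \<zero>\<^bsub>L n\<^esub>))"
  using T \<rho>
proof induction
  case empty
  show ?case using \<iota>_zero by (intro bexI[of _ "\<zero>\<^sub>R"]) auto
next
  case (insert m T)
  obtain a where a: "a \<in> carrier R" "u a = \<zero>\<^sub>U" "\<forall>n\<in>\<Lambda>. \<iota> n a = (if n \<in> T then \<rho> n else \<zero>\<^bsub>L n\<^esub>)"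
    using insert.IH insert.prems by auto
  have m: "m \<in> \<Lambda>" using insert.prems by blast
  obtain c where c: "c \<in> carrier R" "u c = \<zero>\<^sub>U" "\<iota> m c = \<rho> m" "\<forall>n\<in>\<Lambda>. n \<noteq> m \<longrightarrow> \<iota> n c = \<zero>\<^bsub>L n\<^esub>"
    using kernel_lift[OF m, of "\<rho> m"] insert.prems(2)[of m] by auto
  have "\<iota> n (a \<oplus>\<^sub>R c) = (if n \<in> insert m T then \<rho> n else \<zero>\<^bsub>L n\<^esub>)" if n: "n \<in> \<Lambda>" for n
  proof (cases "n = m")
    case True
    then show ?thesis unfolding \<iota>_add[OF n a(1) c(1)]
      using a(3) c(3) n insert.hyps(2) insert.prems(2)[of m] module_l_zero[OF L_module[OF m]] by simp
  next
    case False
    then have "\<iota> n (a \<oplus>\<^sub>R c) = \<iota> n a" unfolding \<iota>_add[OF n a(1) c(1)]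
      using c(4) n module_r_zero[OF L_module[OF n] \<iota>_closed[OF n a(1)]] by simp
    then show ?thesis using a(3) n False by simp
  qed
  then show ?case using a c by (intro bexI[of _ "a \<oplus>\<^sub>R c"]) auto
qed

text \<open>At each \<open>m\<close> the first component \<open>x\<close> agrees in
  \<open>U_m\<close> with an element of \<open>R_m\<close>, so its denominators are not contained in
  \<open>m\<close>; by \<open>gab_whole\<close> it comes from some \<open>c\<close> in
  \<open>R\<close>. After subtraction of \<open>diag c\<close> a finitely supported section remains
  that dies in every \<open>U_m\<close>, and \<open>kernel_lift_finite\<close> lifts it to an
  element of \<open>R\<close>.\<close>

lemma p_kernel:
  assumes b: "b \<in> carrier B" and z: "p b = \<zero>\<^sub>WS" shows "\<exists>a\<in>carrier R. b = diag a"
proof -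
  let ?x = "fst b"
  have x: "?x \<in> carrier U" using lin_closed[OF B_lin_fst b] by simp
  have \<theta>x: "\<theta> m (snd b m) = w m ?x" if m: "m \<in> \<Lambda>" for m
    using z m unfolding p_zero_iff[OF b] \<delta>_zero_iff[OF m b, symmetric] by blast
  let ?I = "{r \<in> carrier R. u r \<otimes>\<^sub>U ?x \<in> u ` carrier R}"
  have "?I = carrier R"
  proof (rule gab_whole[OF gab_denominators[OF x]])
    fix m assume m: "m \<in> \<Lambda>"
    have mm: "maximalideal m R" using m \<Lambda>_iff by blast
    have \<rho>: "snd b m \<in> carrier (L m)" by (rule lin_closed[OF B_lin_component[OF m] b])
    obtain s c where s: "s \<in> S m" "c \<in> carrier R" "s \<odot>\<^bsub>L m\<^esub> snd b m = \<iota> m c" using L_frac[OF m \<rho>] by blast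
    have sc: "s \<in> carrier R" using s(1) by blast
    have "w m (s \<odot>\<^sub>V ?x) = s \<odot>\<^bsub>W m\<^esub> w m ?x" by (rule lin_smult[OF w_lin[OF m] sc lin_closed[OF B_lin_fst b]])
    also have "\<dots> = w m (u c)"
      unfolding \<theta>x[OF m, symmetric] lin_smult[OF \<theta>_lin[OF m] sc \<rho>, symmetric] s(3) by (rule \<theta>_\<iota>[OF m s(2)])
    finally have e: "w m (u s \<otimes>\<^sub>U ?x) = w m (u c)" by simp
    have sx: "u s \<otimes>\<^sub>U ?x \<in> carrier V" and uc: "u c \<in> carrier V" using sc s(2) x by simp_all
    have "w m (u s \<otimes>\<^sub>U ?x \<ominus>\<^sub>V u c) = \<zero>\<^bsub>W m\<^esub>"
      unfolding lin_minus[OF V W_module[OF m] w_lin[OF m] sx uc] e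
      by (rule module_minus_self[OF W_module[OF m] lin_closed[OF w_lin[OF m] uc]])
    moreover have dc: "u s \<otimes>\<^sub>U ?x \<ominus>\<^sub>V u c \<in> carrier V" by (rule module_minus_closed[OF V sx uc])
    ultimately obtain t where t: "t \<in> S m" "u t \<otimes>\<^sub>U (u s \<otimes>\<^sub>U ?x \<ominus>\<^sub>V u c) = \<zero>\<^sub>U" using w_zero[OF m] by auto
    have tc: "t \<in> carrier R" using t(1) by blast
    have "t \<odot>\<^sub>V (u s \<otimes>\<^sub>U ?x) \<ominus>\<^sub>V t \<odot>\<^sub>V u c = \<zero>\<^sub>V"
      using t(2) lin_minus[OF V V lin_scalar[OF V tc] sx uc] by simp
    then have "t \<odot>\<^sub>V (u s \<otimes>\<^sub>U ?x) = t \<odot>\<^sub>V u c"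
      using module_diff_eq_zero[OF V module.smult_closed[OF V tc sx] module.smult_closed[OF V tc uc]] by blast
    then have "u (t \<otimes>\<^sub>R s) \<otimes>\<^sub>U ?x = u (t \<otimes>\<^sub>R c)" using tc sc s(2) x by (simp add: S.m_assoc)
    then have "t \<otimes>\<^sub>R s \<in> ?I" using R.m_closed[OF tc sc] R.m_closed[OF tc s(2)] by blast
    then show "\<not> ?I \<subseteq> m" using R.maximalideal_complement(2)[OF mm t(1) s(1)] by blast
  qed
  then have "\<one>\<^sub>R \<in> ?I" by blast
  then obtain c where c: "c \<in> carrier R" "?x = u c" using x by auto
  let ?b = "b \<ominus>\<^sub>B diag c"
  have bc: "?b \<in> carrier B" by (rule module_minus_closed[OF B_module b diag_closed[OF c(1)]])
  have "fst ?b = ?x \<ominus>\<^sub>V u c" unfolding lin_minus[OF B_module V B_lin_fst b diag_closed[OF c(1)]] by (simp add: diag_def)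
  then have f0: "fst ?b = \<zero>\<^sub>U" using c module_minus_self[OF V, of "u c"] by simp
  have p0: "p ?b = \<zero>\<^sub>WS"
    unfolding lin_minus[OF B_module WS_module p_lin b diag_closed[OF c(1)]] z p_diag[OF c(1)]
    by (rule module_minus_self[OF WS_module module_zero_closed[OF WS_module]])
  note k = B_fst_kernel[OF bc f0]
  let ?\<rho> = "snd ?b"
  let ?T = "{m \<in> \<Lambda>. ?\<rho> m \<noteq> \<zero>\<^bsub>L m\<^esub>}"
  have \<theta>0: "\<theta> m (?\<rho> m) = \<zero>\<^bsub>W m\<^esub>" if m: "m \<in> \<Lambda>" for m
  proof -
    have "\<theta> m (?\<rho> m) = w m (fst ?b)" using p0 m unfolding p_zero_iff[OF bc] \<delta>_zero_iff[OF m bc, symmetric] by blast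
    then show ?thesis unfolding f0 using lin_zero[OF V W_module[OF m] w_lin[OF m]] by simp
  qed
  have "\<exists>a\<in>carrier R. u a = \<zero>\<^sub>U \<and> (\<forall>n\<in>\<Lambda>. \<iota> n a = (if n \<in> ?T then ?\<rho> n else \<zero>\<^bsub>L n\<^esub>))"
  proof (rule kernel_lift_finite)
    show "finite ?T" using k(1) by simp
    show "?\<rho> m \<in> carrier (L m) \<and> \<theta> m (?\<rho> m) = \<zero>\<^bsub>W m\<^esub>" if "m \<in> ?T" for m
      using \<theta>0[of m] lin_closed[OF B_lin_component bc, of m] that by blast
  qed blast
  then obtain a where a: "a \<in> carrier R" "u a = \<zero>\<^sub>U" "\<forall>n\<in>\<Lambda>. \<iota> n a = (if n \<in> ?T then ?\<rho> n else \<zero>\<^bsub>L n\<^esub>)" by blast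
  have "?\<rho> = (\<lambda>m\<in>\<Lambda>. \<iota> m a)"
  proof (rule extensionalityI[of _ \<Lambda>])
    show "?\<rho> \<in> extensional \<Lambda>" using k(1) by (simp add: PiE_def)
    show "?\<rho> m = (\<lambda>m\<in>\<Lambda>. \<iota> m a) m" if "m \<in> \<Lambda>" for m using a(3) that by auto
  qed simp
  then have "?b = diag a" using k(2) a(2) by (simp add: diag_def)
  then have "b = diag a \<oplus>\<^sub>B diag c" using module_diff_add[OF B_module b diag_closed[OF c(1)]] by simp
  then have "b = diag (a \<oplus>\<^sub>R c)" using lin_add[OF diag_lin, of a c] a(1) c(1) by simp
  then show ?thesis using a(1) c(1) by (intro bexI[of _ "a \<oplus>\<^sub>R c"]) auto
qed

lemma \<delta>_sum:
  assumes m: "m \<in> \<Lambda>" and d: "d \<in> carrier LS" shows "\<delta> m (\<zero>\<^sub>U, d) = \<theta> m (d m)"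
proof -
  have dm: "d m \<in> carrier (L m)" using d m by auto
  have w0: "w m \<zero>\<^sub>U = \<zero>\<^bsub>W m\<^esub>" using lin_zero[OF V W_module[OF m] w_lin[OF m]] by simp
  have t: "\<theta> m (d m) \<in> carrier (W m)" by (rule lin_closed[OF \<theta>_lin[OF m] dm])
  note z = module_zero_closed[OF W_module[OF m]]
  show ?thesis unfolding \<delta>_def fst_conv snd_conv w0
    using module_diff_add[OF W_module[OF m] t z] module_r_zero[OF W_module[OF m] module_minus_closed[OF W_module[OF m] t z]] by simp
qed

text \<open>Let \<open>z = x / s\<close>. With \<open>c\<close> inverse to \<open>s\<close> at
  \<open>m\<close> and zero at the other members of \<open>\<Lambda>\<close>, modulo the
  denominators of \<open>x\<close>, the element \<open>c x\<close> of \<open>U\<close> equals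
  \<open>z\<close> in \<open>U_m\<close> up to \<open>R_m\<close> and lies in the image of
  \<open>R_n\<close> for every other \<open>n\<close>. An element of \<open>B\<close> over
  \<open>- c x\<close> therefore has the prescribed defects after its section is changed at finitely
  many places.\<close>

lemma p_surj_component:
  assumes m: "m \<in> \<Lambda>" and z: "z \<in> carrier (W m)"
  shows "\<exists>b\<in>carrier B. p b = dsum_inj \<Lambda> LU m z"
proof -
  have mm: "maximalideal m R" using m \<Lambda>_iff by blast
  obtain s x where s: "s \<in> S m" "x \<in> carrier U" "s \<odot>\<^bsub>W m\<^esub> z = w m x" using W_frac[OF m z] by blast
  have sc: "s \<in> carrier R" using s(1) by blast
  let ?I = "{r \<in> carrier R. u r \<otimes>\<^sub>U x \<in> u ` carrier R}"
  obtain c \<sigma> where c: "c \<in> carrier R" "\<sigma> \<in> S m" "\<sigma> \<otimes>\<^sub>R (\<one>\<^sub>R \<ominus>\<^sub>R c \<otimes>\<^sub>R s) \<in> ?I"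
    "\<forall>n\<in>\<Lambda>. n \<noteq> m \<longrightarrow> (\<exists>\<sigma>\<in>S n. \<sigma> \<otimes>\<^sub>R c \<in> ?I)"
    by (rule approximation[OF gab_denominators[OF s(2)] m s(1)])
  have \<sigma>: "\<sigma> \<in> carrier R" using c(2) by blast
  \<comment> \<open>The sign compensates for the subtraction of the first component in
    \<open>\<delta>\<close>.\<close>
  define x' where "x' = \<ominus>\<^sub>U (u c \<otimes>\<^sub>U x)"
  have x': "x' \<in> carrier U" using c(1) s(2) by (simp add: x'_def)
  let ?t = "dsum_inj \<Lambda> LU m z"
  have tW: "?t n \<in> carrier (W n)" if n: "n \<in> \<Lambda>" for n
    using z n module_zero_closed[OF W_module[OF n]] by (simp add: dsum_inj_def)
  have goal: "\<exists>y\<in>carrier (L n). \<theta> n y = ?t n \<oplus>\<^bsub>W n\<^esub> w n x'" if n: "n \<in> \<Lambda>" for n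
  proof (cases "n = m")
    case True
    let ?e = "\<sigma> \<otimes>\<^sub>R (\<one>\<^sub>R \<ominus>\<^sub>R c \<otimes>\<^sub>R s)"
    obtain d where d: "d \<in> carrier R" "u ?e \<otimes>\<^sub>U x = u d" using c(3) by blast
    have r: "\<sigma> \<otimes>\<^sub>R s \<in> S m" by (rule R.maximalideal_complement(2)[OF mm c(2) s(1)])
    have rc: "\<sigma> \<otimes>\<^sub>R s \<in> carrier R" using r by blast
    obtain y where y: "y \<in> carrier (L m)" "(\<sigma> \<otimes>\<^sub>R s) \<odot>\<^bsub>L m\<^esub> y = \<iota> m d" using L_div[OF m r \<iota>_closed[OF m d(1)]] by blast
    interpret Wm: module R "W m" by (rule W_module[OF m])
    have wx': "w m x' \<in> carrier (W m)" using lin_closed[OF w_lin[OF m], of x'] x' by (simp del: restrict_module_simps)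
    have "\<theta> m y = z \<oplus>\<^bsub>W m\<^esub> w m x'"
    proof (rule W_cancel[OF m r lin_closed[OF \<theta>_lin[OF m] y(1)] Wm.a_closed[OF z wx']])
      have 1: "(\<sigma> \<otimes>\<^sub>R s) \<odot>\<^bsub>W m\<^esub> \<theta> m y = w m (u d)"
        unfolding lin_smult[OF \<theta>_lin[OF m] rc y(1), symmetric] y(2) by (rule \<theta>_\<iota>[OF m d(1)])
      have sxV: "x \<in> carrier V" "x' \<in> carrier V" using s(2) x' by simp_all
      have "(\<sigma> \<otimes>\<^sub>R s) \<odot>\<^bsub>W m\<^esub> (z \<oplus>\<^bsub>W m\<^esub> w m x') = \<sigma> \<odot>\<^bsub>W m\<^esub> (s \<odot>\<^bsub>W m\<^esub> z) \<oplus>\<^bsub>W m\<^esub> (\<sigma> \<otimes>\<^sub>R s) \<odot>\<^bsub>W m\<^esub> w m x'"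
        unfolding Wm.smult_r_distr[OF rc z wx'] Wm.smult_assoc1[OF \<sigma> sc z] ..
      also have "\<dots> = w m (\<sigma> \<odot>\<^sub>V x \<oplus>\<^sub>V (\<sigma> \<otimes>\<^sub>R s) \<odot>\<^sub>V x')"
        unfolding s(3) lin_add[OF w_lin[OF m] module.smult_closed[OF V \<sigma> sxV(1)] module.smult_closed[OF V rc sxV(2)]]
          lin_smult[OF w_lin[OF m] \<sigma> sxV(1)] lin_smult[OF w_lin[OF m] rc sxV(2)] ..
      also have "\<sigma> \<odot>\<^sub>V x \<oplus>\<^sub>V (\<sigma> \<otimes>\<^sub>R s) \<odot>\<^sub>V x' = u ?e \<otimes>\<^sub>U x"
        using \<sigma> sc c(1) s(2) by (simp add: x'_def a_minus_def S.r_distr S.l_distr S.l_minus S.r_minus S.m_ac)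
      finally show "(\<sigma> \<otimes>\<^sub>R s) \<odot>\<^bsub>W m\<^esub> \<theta> m y = (\<sigma> \<otimes>\<^sub>R s) \<odot>\<^bsub>W m\<^esub> (z \<oplus>\<^bsub>W m\<^esub> w m x')" unfolding 1 d(2) ..
    qed
    then show ?thesis using y(1) m True by (intro bexI[of _ y]) (simp_all add: dsum_inj_def)
  next
    case False
    then obtain \<tau> where \<tau>: "\<tau> \<in> S n" "\<tau> \<otimes>\<^sub>R c \<in> ?I" using c(4) n by blast
    have \<tau>c: "\<tau> \<in> carrier R" using \<tau>(1) by blast
    obtain a where a: "a \<in> carrier R" "u (\<tau> \<otimes>\<^sub>R c) \<otimes>\<^sub>U x = u a" using \<tau>(2) by blast
    have na: "\<ominus>\<^sub>R a \<in> carrier R" using a(1) by simp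
    obtain y where y: "y \<in> carrier (L n)" "\<tau> \<odot>\<^bsub>L n\<^esub> y = \<iota> n (\<ominus>\<^sub>R a)" using L_div[OF n \<tau>(1) \<iota>_closed[OF n na]] by blast
    have xV: "x' \<in> carrier V" using x' by simp
    note wx' = lin_closed[OF w_lin[OF n] xV]
    have "\<theta> n y = w n x'"
    proof (rule W_cancel[OF n \<tau>(1) lin_closed[OF \<theta>_lin[OF n] y(1)] wx'])
      have "\<tau> \<odot>\<^sub>V x' = \<ominus>\<^sub>U (u (\<tau> \<otimes>\<^sub>R c) \<otimes>\<^sub>U x)" using \<tau>c c(1) s(2) by (simp add: x'_def S.r_minus S.m_assoc)
      then have e: "\<tau> \<odot>\<^sub>V x' = u (\<ominus>\<^sub>R a)" unfolding a(2) using a(1) by simp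
      have "\<tau> \<odot>\<^bsub>W n\<^esub> \<theta> n y = w n (u (\<ominus>\<^sub>R a))"
        unfolding lin_smult[OF \<theta>_lin[OF n] \<tau>c y(1), symmetric] y(2) by (rule \<theta>_\<iota>[OF n na])
      also have "\<dots> = \<tau> \<odot>\<^bsub>W n\<^esub> w n x'" unfolding e[symmetric] by (rule lin_smult[OF w_lin[OF n] \<tau>c xV])
      finally show "\<tau> \<odot>\<^bsub>W n\<^esub> \<theta> n y = \<tau> \<odot>\<^bsub>W n\<^esub> w n x'" .
    qed
    moreover have "?t n = \<zero>\<^bsub>W n\<^esub>" using False n by (simp add: dsum_inj_def)
    ultimately show ?thesis using y(1) module_l_zero[OF W_module[OF n] wx'] by (intro bexI[of _ y]) (simp_all del: restrict_module_simps)
  qed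
  obtain b where b: "b \<in> carrier B" "fst b = x'" using B_fst_surj[OF x'] by blast
  have "\<forall>n\<in>\<Lambda>. \<exists>y. y \<in> carrier (L n) \<and> \<theta> n y = ?t n \<oplus>\<^bsub>W n\<^esub> w n x'" using goal by blast
  then obtain y where y0: "\<forall>n\<in>\<Lambda>. y n \<in> carrier (L n) \<and> \<theta> n (y n) = ?t n \<oplus>\<^bsub>W n\<^esub> w n x'" by (rule bchoice[THEN exE])
  have y: "y n \<in> carrier (L n)" "\<theta> n (y n) = ?t n \<oplus>\<^bsub>W n\<^esub> w n x'" if "n \<in> \<Lambda>" for n using y0 that by blast+
  have bn: "snd b n \<in> carrier (L n)" if "n \<in> \<Lambda>" for n by (rule lin_closed[OF B_lin_component[OF that] b(1)])
  let ?T = "{n \<in> \<Lambda>. \<delta> n b \<noteq> ?t n}"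
  \<comment> \<open>The section is replaced by \<open>y\<close> only at the places where the defect
    is wrong. There are finitely many, so the correction lies in the direct sum and hence in
    \<open>B\<close>.\<close>
  define d where "d = (\<lambda>n\<in>\<Lambda>. if n \<in> ?T then y n \<ominus>\<^bsub>L n\<^esub> snd b n else \<zero>\<^bsub>L n\<^esub>)"
  have "?T \<subseteq> {n \<in> \<Lambda>. \<delta> n b \<noteq> \<zero>\<^bsub>W n\<^esub>} \<union> {m}" by (auto simp: dsum_inj_def)
  then have fT: "finite ?T" by (rule finite_subset) (simp only: finite_Un \<delta>_finite[OF b(1)] finite.intros)
  have d: "d \<in> carrier LS"
  proof -
    have "{n \<in> \<Lambda>. d n \<noteq> \<zero>\<^bsub>L n\<^esub>} \<subseteq> ?T" by (auto simp: d_def)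
    then have "finite {n \<in> \<Lambda>. d n \<noteq> \<zero>\<^bsub>L n\<^esub>}" by (rule finite_subset[OF _ fT])
    moreover have "d n \<in> carrier (L n)" if "n \<in> \<Lambda>" for n
      using that module_minus_closed[OF L_module[OF that] y(1)[OF that] bn[OF that]] module_zero_closed[OF L_module[OF that]] by (simp add: d_def)
    moreover have "d \<in> extensional \<Lambda>" by (simp add: d_def)
    ultimately show ?thesis by (auto simp: PiE_def)
  qed
  let ?b = "b \<oplus>\<^sub>B (\<zero>\<^sub>U, d)"
  have dB: "(\<zero>\<^sub>U, d) \<in> carrier B" by (rule lin_closed[OF B_lin_sum d])
  have "\<delta> n ?b = ?t n" if n: "n \<in> \<Lambda>" for n
  proof -
    interpret Wn: module R "W n" by (rule W_module[OF n])
    have e: "\<delta> n ?b = \<delta> n b \<oplus>\<^bsub>W n\<^esub> \<theta> n (d n)" unfolding lin_add[OF \<delta>_lin[OF n] b(1) dB] \<delta>_sum[OF n d] ..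
    show ?thesis
    proof (cases "n \<in> ?T")
      case True
      have wx: "w n x' \<in> carrier (W n)" using lin_closed[OF w_lin[OF n], of x'] x' by (simp del: restrict_module_simps)
      have tb: "\<theta> n (snd b n) \<in> carrier (W n)" by (rule lin_closed[OF \<theta>_lin[OF n] bn[OF n]])
      have "d n = y n \<ominus>\<^bsub>L n\<^esub> snd b n" using True n by (simp add: d_def)
      then have "\<theta> n (d n) = (?t n \<oplus>\<^bsub>W n\<^esub> w n x') \<ominus>\<^bsub>W n\<^esub> \<theta> n (snd b n)"
        unfolding lin_minus[OF L_module[OF n] W_module[OF n] \<theta>_lin[OF n] y(1)[OF n] bn[OF n], symmetric] y(2)[OF n, symmetric] by simp
      moreover have "\<delta> n b = \<theta> n (snd b n) \<ominus>\<^bsub>W n\<^esub> w n x'" by (simp only: \<delta>_def b(2))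
      ultimately have "\<delta> n ?b = (\<theta> n (snd b n) \<ominus>\<^bsub>W n\<^esub> w n x') \<oplus>\<^bsub>W n\<^esub> ((?t n \<oplus>\<^bsub>W n\<^esub> w n x') \<ominus>\<^bsub>W n\<^esub> \<theta> n (snd b n))" using e by simp
      also have "\<dots> = ?t n"
      proof -
        have q: "(A \<ominus>\<^bsub>W n\<^esub> X) \<oplus>\<^bsub>W n\<^esub> ((Y \<oplus>\<^bsub>W n\<^esub> X) \<ominus>\<^bsub>W n\<^esub> A) = Y"
          if "A \<in> carrier (W n)" "X \<in> carrier (W n)" "Y \<in> carrier (W n)" for A X Y
        proof -
          have "(A \<ominus>\<^bsub>W n\<^esub> X) \<oplus>\<^bsub>W n\<^esub> ((Y \<oplus>\<^bsub>W n\<^esub> X) \<ominus>\<^bsub>W n\<^esub> A) = Y \<oplus>\<^bsub>W n\<^esub> ((A \<ominus>\<^bsub>W n\<^esub> A) \<oplus>\<^bsub>W n\<^esub> (X \<ominus>\<^bsub>W n\<^esub> X))"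
            using that Wn.a_inv_closed[OF that(1)] Wn.a_inv_closed[OF that(2)]
            by (simp only: a_minus_def Wn.a_ac Wn.a_closed)
          then show ?thesis
            unfolding module_minus_self[OF W_module[OF n] that(1)] module_minus_self[OF W_module[OF n] that(2)]
            using that(3) Wn.l_zero[OF Wn.zero_closed] Wn.r_zero[OF that(3)] by simp
        qed
        show ?thesis by (rule q[OF tb wx tW[OF n]])
      qed
      finally show ?thesis .
    next
      case False
      then have "d n = \<zero>\<^bsub>L n\<^esub>" "\<delta> n b = ?t n" using n by (simp_all add: d_def)
      then show ?thesis unfolding e using lin_zero[OF L_module[OF n] W_module[OF n] \<theta>_lin[OF n]] Wn.r_zero[OF tW[OF n]] by simp
    qed
  qed
  then have "p ?b = ?t" by (auto simp: p_def dsum_inj_def intro!: restrict_ext)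
  then show ?thesis using module_add_closed[OF B_module b(1) dB] by blast
qed

lemma p_surj:
  assumes y: "y \<in> carrier WS" shows "\<exists>b\<in>carrier B. p b = y"
proof -
  have y': "y \<in> carrier (dsum_module \<Lambda> LU)" using y by simp
  show ?thesis
  proof (rule dsum_induct[OF is_localizationD(2)[OF LU_loc] y'])
    show "\<exists>b\<in>carrier B. p b = \<zero>\<^bsub>dsum_module \<Lambda> LU\<^esub>"
      using lin_zero[OF B_module WS_module p_lin] module_zero_closed[OF B_module] by auto
  next
    fix m z y assume m: "m \<in> \<Lambda>" and z: "z \<in> carrier (LU m)" and "\<exists>b\<in>carrier B. p b = y"
    then obtain b where b: "b \<in> carrier B" "p b = y" by blast
    obtain c where c: "c \<in> carrier B" "p c = dsum_inj \<Lambda> LU m z" using p_surj_component[OF m, of z] z by auto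
    have "p (c \<oplus>\<^sub>B b) = dsum_inj \<Lambda> LU m z \<oplus>\<^bsub>dsum_module \<Lambda> LU\<^esub> y"
      unfolding lin_add[OF p_lin c(1) b(1)] b(2) c(2) by simp
    then show "\<exists>b\<in>carrier B. p b = dsum_inj \<Lambda> LU m z \<oplus>\<^bsub>dsum_module \<Lambda> LU\<^esub> y"
      using module_add_closed[OF B_module c(1) b(1)] by blast
  qed
qed

end

lemma module_isoI:
  assumes M: "module R M" and N: "module R N" and f: "lin R M N f"
    and inj: "\<And>x. x \<in> carrier M \<Longrightarrow> f x = \<zero>\<^sub>N \<Longrightarrow> x = \<zero>\<^sub>M"
    and surj: "\<And>y. y \<in> carrier N \<Longrightarrow> \<exists>x\<in>carrier M. f x = y"
  shows "restrict f (carrier M) \<in> module_iso R M N"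
proof -
  have "x = y" if "x \<in> carrier M" "y \<in> carrier M" "f x = f y" for x y
  proof -
    have "f (x \<ominus>\<^sub>M y) = \<zero>\<^sub>N"
      using lin_minus[OF M N f that(1,2)] that(3) module_minus_self[OF N lin_closed[OF f that(2)]] by simp
    then have "x \<ominus>\<^sub>M y = \<zero>\<^sub>M" by (rule inj[OF module_minus_closed[OF M that(1,2)]])
    then show ?thesis using module_diff_eq_zero[OF M that(1,2)] by blast
  qed
  then have "inj_on f (carrier M)" by (rule inj_onI)
  moreover have "f ` carrier M = carrier N" using lin_closed[OF f] surj by blast
  ultimately have "bij_betw (restrict f (carrier M)) (carrier M) (carrier N)" by (simp add: bij_betw_def)
  then show ?thesis unfolding module_iso_def using lin_restrict[OF M f] by blast
qed

lemma module_isoD: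
  assumes "module R M" "module R N" "f \<in> module_iso R M N"
  shows "lin R M N f" "\<And>x. x \<in> carrier M \<Longrightarrow> f x = \<zero>\<^sub>N \<Longrightarrow> x = \<zero>\<^sub>M"
proof -
  show f: "lin R M N f" using assms(3) by (auto simp: module_iso_def intro: module_hom_lin)
  fix x assume x: "x \<in> carrier M" "f x = \<zero>\<^sub>N"
  have "inj_on f (carrier M)" using assms(3) by (simp add: module_iso_def bij_betw_def)
  then show "x = \<zero>\<^sub>M"
    using x lin_zero[OF assms(1,2) f] module_zero_closed[OF assms(1)] by (simp add: inj_on_def)
qed

lemma module_iso_inverse:
  assumes M: "module R M" and N: "module R N" and f: "f \<in> module_iso R M N"
  obtains g where "lin R N M g" "\<And>y. y \<in> carrier N \<Longrightarrow> f (g y) = y"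
proof -
  note fl = module_isoD[OF M N f]
  have "f ` carrier M = carrier N" using f by (simp add: module_iso_def bij_betw_def)
  then have surj: "\<exists>x\<in>carrier M. f x = y" if "y \<in> carrier N" for y using that by (metis image_iff)
  show thesis by (rule lin_lift[OF N M N lin_id fl surj]) (assumption | rule that)+
qed

section \<open>The decomposition of a contramodule\<close>

context local_zero_dim
begin

text \<open>Together with \<open>B_unique\<close> this identifies the maps \<open>B -> C\<close>
  with \<open>C\<close> by evaluation at \<open>diag 1\<close>. Both apply the sequence from
  \<open>R\<close> through \<open>B\<close> to the sum of the \<open>U_m\<close>, which is a
  \<open>U\<close>-module: its Ext gives existence and its Hom gives uniqueness.\<close>

lemma B_extend:
  assumes uC: "u_contramodule R U u C" and c: "c \<in> carrier C"
  shows "\<exists>\<kappa>. lin R B C \<kappa> \<and> \<kappa> (diag \<one>\<^sub>R) = c"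
proof -
  have C: "module R C" using uC by (simp add: u_contramodule_def)
  interpret C: module R C by (rule C)
  show ?thesis
  proof (rule Ext1_extend[OF u_perp(2)[OF uC WS_local] WS_module C B_module module_self[OF R.is_cring] diag_lin _ p_lin _ _ _ lin_multiples[OF C c]])
    fix \<kappa> assume k: "lin R B C \<kappa>" "\<And>f. f \<in> carrier (self_module R) \<Longrightarrow> \<kappa> (diag f) = f \<odot>\<^sub>C c"
    show ?thesis using k(1) k(2)[of "\<one>\<^sub>R"] c by (intro exI[of _ \<kappa>]) simp
  qed (use diag_injective p_surj p_kernel p_diag in auto)
qed

lemma B_unique:
  assumes uC: "u_contramodule R U u C" and \<kappa>: "lin R B C \<kappa>" "\<kappa> (diag \<one>\<^sub>R) = \<zero>\<^sub>C" and b: "b \<in> carrier B"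
  shows "\<kappa> b = \<zero>\<^sub>C"
proof -
  have C: "module R C" using uC by (simp add: u_contramodule_def)
  interpret C: module R C by (rule C)
  show ?thesis
  proof (rule lin_zero_of_factor[OF u_perp(1)[OF uC WS_local] B_module WS_module C p_lin p_surj \<kappa>(1) _ b])
    fix b assume "b \<in> carrier B" "p b = \<zero>\<^sub>WS"
    then obtain a where a: "a \<in> carrier R" "b = diag a" using p_kernel by blast
    have "b = a \<odot>\<^sub>B diag \<one>\<^sub>R" using a lin_smult[OF diag_lin a(1), of "\<one>\<^sub>R"] by simp
    then show "\<kappa> b = \<zero>\<^sub>C" using lin_smult[OF \<kappa>(1) a(1) diag_closed[OF R.one_closed]] \<kappa>(2) a(1) by simp
  qed
qed

definition eps :: "'a set \<Rightarrow> ('a \<times> 'a) set \<Rightarrow> 'b \<times> ('a set \<Rightarrow> ('a \<times> 'a) set)" where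
  "eps m y = (\<zero>\<^sub>U, dsum_inj \<Lambda> L m y)"

lemma eps_lin: "m \<in> \<Lambda> \<Longrightarrow> lin R (L m) B (eps m)"
  unfolding eps_def by (rule lin_comp[OF lin_dsum_inj[OF L_module] B_lin_sum])

text \<open>\<open>R_m\<close> is a direct summand of \<open>B\<close>. Composing \<open>h\<close>
  with the projection gives a map on \<open>B\<close> that vanishes at \<open>diag 1\<close>, hence
  everywhere by \<open>B_unique\<close>. So evaluation at 1 embeds the maps \<open>R_m -> C\<close>
  into \<open>C\<close>, although a map on a localization is in general not determined by its value
  at 1.\<close>

lemma L_rigid:
  assumes uC: "u_contramodule R U u C" and m: "m \<in> \<Lambda>" and h: "lin R (L m) C h" and h1: "h (\<iota> m \<one>\<^sub>R) = \<zero>\<^sub>C"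
    and y: "y \<in> carrier (L m)"
  shows "h y = \<zero>\<^sub>C"
proof -
  have "h (snd (eps m y) m) = \<zero>\<^sub>C"
    by (rule B_unique[OF uC lin_comp[OF B_lin_component[OF m] h] _ lin_closed[OF eps_lin[OF m] y]])
      (use h1 m in \<open>simp add: diag_def\<close>)
  then show ?thesis using m by (simp add: eps_def dsum_inj_def)
qed

text \<open>The image of the colocalization under evaluation at 1. By \<open>L_rigid\<close> it is a
  faithful copy when \<open>C\<close> is a \<open>u\<close>-contramodule, and its elements have the
  type of the elements of \<open>C\<close>.\<close>

definition colocal :: "('a, 'c, 'n) module_scheme \<Rightarrow> 'a set \<Rightarrow> 'c set" where
  "colocal C m = {h (\<iota> m \<one>\<^sub>R) | h. lin R (L m) C h}"

lemma colocalI: "lin R (L m) C h \<Longrightarrow> h (\<iota> m \<one>\<^sub>R) \<in> colocal C m"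
  by (auto simp: colocal_def)

lemma colocal_closed: assumes m: "m \<in> \<Lambda>" and d: "d \<in> colocal C m" shows "d \<in> carrier C"
  using d lin_closed[OF _ \<iota>_closed[OF m R.one_closed]] by (auto simp: colocal_def)

lemma colocal_module:
  assumes C: "module R C" and m: "m \<in> \<Lambda>" shows "module R (C\<lparr>carrier := colocal C m\<rparr>)"
proof (rule module_submodule(2)[OF C])
  show "colocal C m \<subseteq> carrier C" by (rule subsetI) (rule colocal_closed[OF m])
  show "\<zero>\<^sub>C \<in> colocal C m" by (rule colocalI[OF lin_zero_map[OF C]])
  show "x \<oplus>\<^sub>C y \<in> colocal C m" if "x \<in> colocal C m" "y \<in> colocal C m" for x y
    using that colocalI[OF lin_plus[OF C]] by (auto simp: colocal_def)
  show "r \<odot>\<^sub>C x \<in> colocal C m" if "r \<in> carrier R" "x \<in> colocal C m" for r x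
    using that colocalI[OF lin_scale[OF C]] by (auto simp: colocal_def)
qed

text \<open>Since \<open>R_m[1/t]\<close> is a \<open>U\<close>-module, its Hom and Ext to
  \<open>C\<close> vanish, and the telescope over \<open>M = R_m\<close> sums and separates
  sequences of maps \<open>R_m -> C\<close>. For separation, the recursion is given only at 1;
  \<open>L_rigid\<close> extends it to all of \<open>R_m\<close>.\<close>

lemma colocal_contramodule:
  assumes uC: "u_contramodule R U u C" and m: "m \<in> \<Lambda>" and t: "t \<in> m"
  shows "op_contra (C\<lparr>carrier := colocal C m\<rparr>) (\<lambda>x. t \<odot>\<^sub>C x)"
proof -
  have C: "module R C" using uC by (simp add: u_contramodule_def)
  interpret C: module R C by (rule C)
  have tc: "t \<in> carrier R" using t m gab_subset by (auto simp: \<Lambda>_iff)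
  have add_eq: "add (C\<lparr>carrier := colocal C m\<rparr>) = add C" by simp
  have one: "\<iota> m \<one>\<^sub>R \<in> carrier (L m)" by (rule \<iota>_closed[OF m R.one_closed])
  show ?thesis
  proof (rule telescope_L[OF m t])
    fix X :: "('a, ('a \<times> 'a) set) module" and \<tau> assume X: "u_local X" and tel: "telescope R t (L m) X \<tau>"
    interpret T: telescope R t "L m" X \<tau> by (rule tel)
    note Hom = u_perp(1)[OF uC X] and Ext = u_perp(2)[OF uC X]
    have "solvable (C\<lparr>carrier := colocal C m\<rparr>) (colocal C m) (\<lambda>x. t \<odot>\<^sub>C x)" unfolding solvable_def
    proof (intro allI impI)
      fix a :: "nat \<Rightarrow> 'c" assume a: "\<forall>n. a n \<in> colocal C m"
      then have "\<forall>n. \<exists>h. lin R (L m) C h \<and> a n = h (\<iota> m \<one>\<^sub>R)" by (auto simp: colocal_def)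
      then obtain h where h: "\<forall>n. lin R (L m) C (h n) \<and> a n = h n (\<iota> m \<one>\<^sub>R)" by (rule choice[THEN exE])
      have lh: "lin R (L m) C (h n)" and ah: "a n = h n (\<iota> m \<one>\<^sub>R)" for n using h by blast+
      have "\<exists>b. (\<forall>n. lin R (L m) C (b n)) \<and> (\<forall>n. \<forall>y\<in>carrier (L m). b n y = h n y \<oplus>\<^sub>C t \<odot>\<^sub>C b (Suc n) y)"
        by (rule T.solve[OF C Ext lh])
      then obtain b where b: "(\<forall>n. lin R (L m) C (b n)) \<and> (\<forall>n. \<forall>y\<in>carrier (L m). b n y = h n y \<oplus>\<^sub>C t \<odot>\<^sub>C b (Suc n) y)"
        by (rule exE)
      have "b n (\<iota> m \<one>\<^sub>R) \<in> colocal C m" for n by (rule colocalI) (use b in blast)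
      moreover have "b n (\<iota> m \<one>\<^sub>R) = a n \<oplus>\<^sub>C t \<odot>\<^sub>C b (Suc n) (\<iota> m \<one>\<^sub>R)" for n
        unfolding ah by (rule b[THEN conjunct2, rule_format, OF one])
      ultimately show "\<exists>b. \<forall>n. b n \<in> colocal C m \<and> b n = a n \<oplus>\<^bsub>C\<lparr>carrier := colocal C m\<rparr>\<^esub> t \<odot>\<^sub>C b (Suc n)"
        unfolding add_eq by (rule_tac exI[of _ "\<lambda>n. b n (\<iota> m \<one>\<^sub>R)"], intro allI conjI)
    qed
    moreover have "separated (C\<lparr>carrier := colocal C m\<rparr>) (\<lambda>x. t \<odot>\<^sub>C x)" unfolding separated_def
    proof (intro allI impI)
      fix b :: "nat \<Rightarrow> 'c" and n assume b: "\<forall>n. b n \<in> carrier (C\<lparr>carrier := colocal C m\<rparr>) \<and> b n = t \<odot>\<^sub>C b (Suc n)"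
      have "\<forall>n. \<exists>h. lin R (L m) C h \<and> b n = h (\<iota> m \<one>\<^sub>R)"
      proof
        fix n have "b n \<in> colocal C m" using b[THEN spec, of n, THEN conjunct1] by simp
        then show "\<exists>h. lin R (L m) C h \<and> b n = h (\<iota> m \<one>\<^sub>R)" by (auto simp: colocal_def)
      qed
      then obtain h where h: "\<forall>n. lin R (L m) C (h n) \<and> b n = h n (\<iota> m \<one>\<^sub>R)" by (rule choice[THEN exE])
      have lh: "lin R (L m) C (h n)" and bh: "b n = h n (\<iota> m \<one>\<^sub>R)" for n using h by blast+
      have "h n (\<iota> m \<one>\<^sub>R) = \<zero>\<^sub>C"
      proof (rule T.separate[OF C Hom lh _ one])
        fix n y assume y: "y \<in> carrier (L m)"
        have l: "lin R (L m) C (\<lambda>y. h n y \<ominus>\<^sub>C t \<odot>\<^sub>C h (Suc n) y)"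
          by (rule lin_diff[OF C lh lin_scale[OF C lh tc]])
        have e: "h n (\<iota> m \<one>\<^sub>R) = t \<odot>\<^sub>C h (Suc n) (\<iota> m \<one>\<^sub>R)" unfolding bh[symmetric] using b by blast
        have "h n (\<iota> m \<one>\<^sub>R) \<ominus>\<^sub>C t \<odot>\<^sub>C h (Suc n) (\<iota> m \<one>\<^sub>R) = \<zero>\<^sub>C"
          unfolding e by (rule module_minus_self[OF C C.smult_closed[OF tc lin_closed[OF lh one]]])
        then have "h n y \<ominus>\<^sub>C t \<odot>\<^sub>C h (Suc n) y = \<zero>\<^sub>C" by (rule L_rigid[OF uC m l _ y])
        then show "h n y = t \<odot>\<^sub>C h (Suc n) y"
          using module_diff_eq_zero[OF C lin_closed[OF lh y] C.smult_closed[OF tc lin_closed[OF lh y]]] by blast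
      qed
      then show "b n = \<zero>\<^bsub>C\<lparr>carrier := colocal C m\<rparr>\<^esub>" unfolding bh by simp
    qed
    ultimately show ?thesis by (simp add: op_contra_def)
  qed
qed

text \<open>\<open>K c\<close> is the unique map on \<open>B\<close> with value \<open>c\<close> at
  \<open>diag 1\<close>. Restricting it to the summands \<open>R_m\<close> and evaluating at 1 gives
  the components of \<open>c\<close>. Bijectivity is the statement that maps \<open>B -> C\<close>
  restrict bijectively to the sum of the \<open>R_m\<close>, which comes from the sequence with
  quotient \<open>U\<close>.\<close>

lemma decomposition:
  assumes uC: "u_contramodule R U u C"
  shows "\<exists>f. f \<in> module_iso R C (product_module \<Lambda> (\<lambda>m. C\<lparr>carrier := colocal C m\<rparr>))"
proof -
  have C: "module R C" and Hom: "zero_module (Hom_module R V C)" and Ext: "zero_module (Ext1 R V C)"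
    using uC by (auto simp: u_contramodule_def)
  interpret C: module R C by (rule C)
  let ?D = "\<lambda>m. C\<lparr>carrier := colocal C m\<rparr>"
  let ?P = "product_module \<Lambda> ?D"
  have P: "module R ?P" by (rule module_product[OF R.is_cring colocal_module[OF C]])
  define K where "K c = (SOME \<kappa>. lin R B C \<kappa> \<and> \<kappa> (diag \<one>\<^sub>R) = c)" for c
  have K: "lin R B C (K c)" "K c (diag \<one>\<^sub>R) = c" if "c \<in> carrier C" for c
    using someI_ex[OF B_extend[OF uC that], folded K_def] by blast+
  have K_unique: "\<kappa> b = K c b" if c: "c \<in> carrier C" and k: "lin R B C \<kappa>" "\<kappa> (diag \<one>\<^sub>R) = c" and b: "b \<in> carrier B" for c \<kappa> b
  proof -
    have "\<kappa> b \<ominus>\<^sub>C K c b = \<zero>\<^sub>C"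
      by (rule B_unique[OF uC lin_diff[OF C k(1) K(1)[OF c]] _ b]) (simp only: k(2) K(2)[OF c] module_minus_self[OF C c])
    then show ?thesis using module_diff_eq_zero[OF C lin_closed[OF k(1) b] lin_closed[OF K(1)[OF c] b]] by blast
  qed
  let ?e = "\<lambda>m. eps m (\<iota> m \<one>\<^sub>R)"
  have e: "?e m \<in> carrier B" if m: "m \<in> \<Lambda>" for m by (rule lin_closed[OF eps_lin[OF m] \<iota>_closed[OF m R.one_closed]])
  let ?f = "\<lambda>c. \<lambda>m\<in>\<Lambda>. K c (?e m)"
  have lin: "lin R C ?P ?f"
  proof (rule linI)
    fix c assume c: "c \<in> carrier C"
    then show "?f c \<in> carrier ?P" using colocalI[OF lin_comp[OF eps_lin K(1)[OF c]]] by auto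
  next
    fix c c' assume c: "c \<in> carrier C" "c' \<in> carrier C"
    have "K (c \<oplus>\<^sub>C c') (?e m) = K c (?e m) \<oplus>\<^sub>C K c' (?e m)" if m: "m \<in> \<Lambda>" for m
      by (rule K_unique[OF C.a_closed[OF c] lin_plus[OF C K(1)[OF c(1)] K(1)[OF c(2)]] _ e[OF m], symmetric])
        (simp only: K(2) c)
    then show "?f (c \<oplus>\<^sub>C c') = ?f c \<oplus>\<^sub>?P ?f c'" by (auto intro!: restrict_ext)
  next
    fix r c assume r: "r \<in> carrier R" and c: "c \<in> carrier C"
    have "K (r \<odot>\<^sub>C c) (?e m) = r \<odot>\<^sub>C K c (?e m)" if m: "m \<in> \<Lambda>" for m
      by (rule K_unique[OF C.smult_closed[OF r c] lin_scale[OF C K(1)[OF c] r] _ e[OF m], symmetric])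
        (simp only: K(2) c)
    then show "?f (r \<odot>\<^sub>C c) = r \<odot>\<^sub>?P ?f c" by (auto intro!: restrict_ext)
  qed
  have "restrict ?f (carrier C) \<in> module_iso R C ?P"
  proof (rule module_isoI[OF C P lin])
    fix c assume c: "c \<in> carrier C" and z: "?f c = \<zero>\<^sub>?P"
    have k1: "K c (?e m) = \<zero>\<^sub>C" if m: "m \<in> \<Lambda>" for m using fun_cong[OF z, of m] m by simp
    have k2: "K c (\<zero>\<^sub>U, d) = \<zero>\<^sub>C" if d: "d \<in> carrier LS" for d
    proof (rule lin_dsum_eq[OF R.is_cring L_module C lin_comp[OF B_lin_sum K(1)[OF c]] lin_zero_map[OF C] _ d])
      fix m y assume m: "m \<in> \<Lambda>" and y: "y \<in> carrier (L m)"
      show "K c (\<zero>\<^sub>U, dsum_inj \<Lambda> L m y) = \<zero>\<^sub>C"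
        using L_rigid[OF uC m lin_comp[OF eps_lin[OF m] K(1)[OF c]] k1[OF m] y] by (simp add: eps_def)
    qed
    \<comment> \<open>\<open>K c\<close> vanishes on the sum of the \<open>R_m\<close>, so it
      factors through the first projection to \<open>U\<close>, and every map \<open>U -> C\<close>
      is zero.\<close>
    have "K c (diag \<one>\<^sub>R) = \<zero>\<^sub>C"
    proof (rule lin_zero_of_factor[OF Hom B_module V C B_lin_fst _ K(1)[OF c] _ diag_closed[OF R.one_closed]])
      show "\<exists>b\<in>carrier B. fst b = x" if "x \<in> carrier V" for x using B_fst_surj that by simp
      fix b assume b: "b \<in> carrier B" "fst b = \<zero>\<^sub>V"
      then have "fst b = \<zero>\<^sub>U" by simp
      note k = B_fst_kernel[OF b(1) this]
      show "K c b = \<zero>\<^sub>C" using k2[OF k(1)] k(2) by simp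
    qed
    then show "c = \<zero>\<^sub>C" using K(2)[OF c] by simp
  next
    fix d assume d: "d \<in> carrier ?P"
    then have "\<forall>m\<in>\<Lambda>. \<exists>h. lin R (L m) C h \<and> d m = h (\<iota> m \<one>\<^sub>R)" by (auto simp: colocal_def PiE_def Pi_def)
    then obtain h where h0: "\<forall>m\<in>\<Lambda>. lin R (L m) C (h m) \<and> d m = h m (\<iota> m \<one>\<^sub>R)" by (rule bchoice[THEN exE])
    have h: "lin R (L m) C (h m)" "d m = h m (\<iota> m \<one>\<^sub>R)" if "m \<in> \<Lambda>" for m using h0 that by blast+
    let ?k = "dsum_lift \<Lambda> L C h"
    have k: "lin R LS C ?k" by (rule lin_dsum_lift[OF R.is_cring L_module C h(1)])
    show "\<exists>c\<in>carrier C. ?f c = d"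
    \<comment> \<open>Prescribed components define a map on the sum of the \<open>R_m\<close>. It
      extends to \<open>B\<close> because Ext from \<open>U\<close> to \<open>C\<close> vanishes,
      and the value of the extension at \<open>diag 1\<close> is the preimage.\<close>
    proof (rule Ext1_extend[OF Ext V C B_module LS_module B_lin_sum _ B_lin_fst _ _ _ k])
      fix \<kappa> assume \<kappa>: "lin R B C \<kappa>" "\<And>f. f \<in> carrier LS \<Longrightarrow> \<kappa> (\<zero>\<^sub>U, f) = ?k f"
      let ?c = "\<kappa> (diag \<one>\<^sub>R)"
      have c: "?c \<in> carrier C" by (rule lin_closed[OF \<kappa>(1) diag_closed[OF R.one_closed]])
      have "K ?c (?e m) = d m" if m: "m \<in> \<Lambda>" for m
      proof -
        note i1 = \<iota>_closed[OF m R.one_closed]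
        have "K ?c (?e m) = \<kappa> (?e m)" by (rule K_unique[OF c \<kappa>(1) refl e[OF m], symmetric])
        also have "\<dots> = ?k (dsum_inj \<Lambda> L m (\<iota> m \<one>\<^sub>R))"
          unfolding eps_def by (rule \<kappa>(2)[OF lin_closed[OF lin_dsum_inj[where M = L, OF L_module m] i1]])
        also have "\<dots> = h m (\<iota> m \<one>\<^sub>R)" by (rule dsum_lift_inj[where M = L, OF R.is_cring L_module C h(1) m i1])
        finally show ?thesis using h(2)[OF m] by simp
      qed
      moreover have "d \<in> extensional \<Lambda>" using d by (simp add: PiE_def)
      ultimately have "?f ?c = d" by (intro extensionalityI[of _ \<Lambda>]) auto
      then show ?thesis using c by (rule bexI)
    next
      fix x assume "x \<in> carrier V"
      then show "\<exists>b\<in>carrier B. fst b = x" using B_fst_surj by simp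
    next
      fix b assume b: "b \<in> carrier B" "fst b = \<zero>\<^sub>V"
      then have "fst b = \<zero>\<^sub>U" by simp
      note k = B_fst_kernel[OF b(1) this]
      show "\<exists>f\<in>carrier LS. b = (\<zero>\<^sub>U, f)" by (rule bexI[of _ "snd b"]) (rule k)+
    qed (simp_all add: B_ops)
  qed
  then show ?thesis by blast
qed

end

section \<open>Products and isomorphic copies of contramodules; divisibility\<close>

lemma lin_dsum_inj_product:
  assumes "\<And>i. i \<in> I \<Longrightarrow> module R (M i)" "i \<in> I"
  shows "lin R (M i) (product_module I M) (dsum_inj I M i)"
  using lin_dsum_inj[where M = M and I = I, OF assms] by (auto simp: lin_def)

lemma u_contramodule_product:
  assumes R: "cring R" and V: "module R (restrict_scalars u U)" and D: "\<And>m. m \<in> \<Lambda> \<Longrightarrow> u_contramodule R U u (D m)"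
  shows "u_contramodule R U u (product_module \<Lambda> D)"
proof -
  let ?V = "restrict_scalars u U" and ?P = "product_module \<Lambda> D"
  have DM: "module R (D m)" and Hom: "zero_module (Hom_module R ?V (D m))" and Ext: "zero_module (Ext1 R ?V (D m))" if "m \<in> \<Lambda>" for m
    using D[OF that] by (auto simp: u_contramodule_def)
  have P: "module R ?P" by (rule module_product[OF R DM])
  have proj: "lin R ?P (D m) (\<lambda>x. x m)" if "m \<in> \<Lambda>" for m by (rule linI) (use that in auto)
  have "h z = \<zero>\<^sub>?P" if h: "lin R ?V ?P h" and z: "z \<in> carrier ?V" for h z
  proof (rule extensionalityI[of _ \<Lambda>])
    show "h z \<in> extensional \<Lambda>" using lin_closed[OF h z] by (simp add: PiE_def)
    show "h z m = \<zero>\<^sub>?P m" if m: "m \<in> \<Lambda>" for m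
      using Hom[OF m, unfolded zero_Hom_iff[OF V DM[OF m]], rule_format, OF lin_comp[OF h proj[OF m]] z] m by simp
  qed simp
  then have 1: "zero_module (Hom_module R ?V ?P)" unfolding zero_Hom_iff[OF V P] by blast
  have "\<exists>k. lin R (free_cover R ?V) ?P k \<and> (\<forall>f\<in>carrier (syzygy R ?V). k f = h f)" if h: "lin R (syzygy R ?V) ?P h" for h
  proof -
    have "\<forall>m\<in>\<Lambda>. \<exists>k. lin R (free_cover R ?V) (D m) k \<and> (\<forall>f\<in>carrier (syzygy R ?V). k f = h f m)"
    proof
      fix m assume m: "m \<in> \<Lambda>"
      show "\<exists>k. lin R (free_cover R ?V) (D m) k \<and> (\<forall>f\<in>carrier (syzygy R ?V). k f = h f m)"
        by (rule Ext[OF m, unfolded zero_Ext1_iff[OF V DM[OF m]], rule_format, OF lin_comp[OF h proj[OF m]]])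
    qed
    then obtain k where k0: "\<forall>m\<in>\<Lambda>. lin R (free_cover R ?V) (D m) (k m) \<and> (\<forall>f\<in>carrier (syzygy R ?V). k m f = h f m)"
      by (rule bchoice[THEN exE])
    have k: "lin R (free_cover R ?V) (D m) (k m)" "\<forall>f\<in>carrier (syzygy R ?V). k m f = h f m" if "m \<in> \<Lambda>" for m
      using k0 that by blast+
    have "lin R (free_cover R ?V) ?P (\<lambda>f. \<lambda>m\<in>\<Lambda>. k m f)"
      by (rule linI) (use lin_closed[OF k(1)] lin_add[OF k(1)] lin_smult[OF k(1)] in \<open>auto intro!: restrict_ext\<close>)
    moreover have "(\<lambda>m\<in>\<Lambda>. k m f) = h f" if f: "f \<in> carrier (syzygy R ?V)" for f
    proof (rule extensionalityI[of _ \<Lambda>])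
      show "h f \<in> extensional \<Lambda>" using lin_closed[OF h f] by (simp add: PiE_def)
      show "(\<lambda>m\<in>\<Lambda>. k m f) m = h f m" if "m \<in> \<Lambda>" for m using k(2)[OF that] f that by (simp del: syzygy_simps)
    qed simp
    ultimately show ?thesis by blast
  qed
  then have 2: "zero_module (Ext1 R ?V ?P)" unfolding zero_Ext1_iff[OF V P] by blast
  show ?thesis unfolding u_contramodule_def using P 1 2 by blast
qed

lemma u_contramodule_iso:
  assumes V: "module R (restrict_scalars u U)" and C: "module R C" and P: "u_contramodule R U u P" and f: "f \<in> module_iso R C P"
  shows "u_contramodule R U u C"
proof -
  let ?V = "restrict_scalars u U"
  have PM: "module R P" and Hom: "zero_module (Hom_module R ?V P)" and Ext: "zero_module (Ext1 R ?V P)"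
    using P by (auto simp: u_contramodule_def)
  note fl = module_isoD[OF C PM f]
  obtain g where g: "lin R P C g" "\<And>y. y \<in> carrier P \<Longrightarrow> f (g y) = y" using module_iso_inverse[OF C PM f] by blast
  have gf: "g (f x) = x" if x: "x \<in> carrier C" for x
  proof -
    have c: "g (f x) \<in> carrier C" by (rule lin_closed[OF g(1) lin_closed[OF fl(1) x]])
    have "f (g (f x) \<ominus>\<^sub>C x) = \<zero>\<^sub>P"
      unfolding lin_minus[OF C PM fl(1) c x] g(2)[OF lin_closed[OF fl(1) x]] by (rule module_minus_self[OF PM lin_closed[OF fl(1) x]])
    then show ?thesis using fl(2)[OF module_minus_closed[OF C c x]] module_diff_eq_zero[OF C c x] by blast
  qed
  have "h z = \<zero>\<^sub>C" if h: "lin R ?V C h" and z: "z \<in> carrier ?V" for h z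
    by (rule fl(2)[OF lin_closed[OF h z]])
      (rule Hom[unfolded zero_Hom_iff[OF V PM], rule_format, OF lin_comp[OF h fl(1)] z])
  then have 1: "zero_module (Hom_module R ?V C)" unfolding zero_Hom_iff[OF V C] by blast
  have "\<exists>k. lin R (free_cover R ?V) C k \<and> (\<forall>x\<in>carrier (syzygy R ?V). k x = h x)" if h: "lin R (syzygy R ?V) C h" for h
  proof -
    have "\<exists>k. lin R (free_cover R ?V) P k \<and> (\<forall>x\<in>carrier (syzygy R ?V). k x = f (h x))"
      by (rule Ext[unfolded zero_Ext1_iff[OF V PM], rule_format, OF lin_comp[OF h fl(1)]])
    then obtain k where k: "lin R (free_cover R ?V) P k" "\<forall>x\<in>carrier (syzygy R ?V). k x = f (h x)" by blast
    have "g (k x) = h x" if x: "x \<in> carrier (syzygy R ?V)" for x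
      using k(2) x gf[OF lin_closed[OF h x]] by (simp del: syzygy_simps)
    then show ?thesis using lin_comp[OF k(1) g(1)] by (intro exI[of _ "\<lambda>x. g (k x)"] conjI ballI)
  qed
  then have 2: "zero_module (Ext1 R ?V C)" unfolding zero_Ext1_iff[OF V C] by blast
  show ?thesis unfolding u_contramodule_def using C 1 2 by blast
qed

text \<open>An element with a compatible sequence of quotients by powers of \<open>t\<close> is the
  value at \<open>1 / t^0\<close> of a map out of \<open>R[1/t]\<close>; its image in a
  \<open>t\<close>-separated module has to vanish.\<close>

lemma separated_orbit:
  assumes h: "lin R X E h" and t: "t \<in> carrier R" and sep: "separated E (\<lambda>x. t \<odot>\<^sub>E x)"
    and y: "\<And>k::nat. y k \<in> carrier X" "\<And>k. y k = t \<odot>\<^sub>X y (Suc k)"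
  shows "h (y 0) = \<zero>\<^sub>E"
proof (rule separatedD[OF sep, of "\<lambda>k. h (y k)"])
  show "h (y k) \<in> carrier E" for k by (rule lin_closed[OF h y(1)])
  show "h (y k) = t \<odot>\<^sub>E h (y (Suc k))" for k using lin_smult[OF h t y(1), of "Suc k"] y(2)[of k] by simp
qed

text \<open>Some multiple \<open>a s\<close> equals \<open>1 - \<mu>\<close> with
  \<open>\<mu>\<close> in \<open>m\<close>, and \<open>1 - \<mu>\<close> is inverted on
  \<open>D\<close> by the geometric series in \<open>\<mu>\<close>. So an
  \<open>m\<close>-contramodule is automatically an \<open>R_m\<close>-module.\<close>

lemma (in cring) contramodule_local:
  assumes m: "maximalideal m R" and D: "module R D" and con: "\<And>t. t \<in> m \<Longrightarrow> op_contra D (\<lambda>x. t \<odot>\<^sub>D x)"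
    and s: "s \<in> carrier R" "s \<notin> m"
  shows "\<And>x. x \<in> carrier D \<Longrightarrow> s \<odot>\<^sub>D x = \<zero>\<^sub>D \<Longrightarrow> x = \<zero>\<^sub>D"
    and "\<And>x. x \<in> carrier D \<Longrightarrow> \<exists>y\<in>carrier D. s \<odot>\<^sub>D y = x"
proof -
  interpret D: module R D by (rule D)
  obtain a \<mu> where a: "a \<in> carrier R" "\<mu> \<in> m" "\<one> = a \<otimes> s \<oplus> \<mu>" by (rule maximalideal_cofactor[OF m s])
  have \<mu>: "\<mu> \<in> carrier R" using a(2) ideal_facts(1)[OF maximalideal.axioms(1)[OF m]] by blast
  obtain \<phi> where \<phi>: "lin R D D \<phi>" "\<And>x. x \<in> carrier D \<Longrightarrow> \<phi> x = x \<oplus>\<^sub>D \<mu> \<odot>\<^sub>D \<phi> x"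
    "\<And>x y. x \<in> carrier D \<Longrightarrow> y \<in> carrier D \<Longrightarrow> y = x \<oplus>\<^sub>D \<mu> \<odot>\<^sub>D y \<Longrightarrow> y = \<phi> x"
    using geometric_inverse[OF D lin_scalar[OF D \<mu>] con[OF a(2)]] by metis
  have split: "x = a \<odot>\<^sub>D (s \<odot>\<^sub>D x) \<oplus>\<^sub>D \<mu> \<odot>\<^sub>D x" if x: "x \<in> carrier D" for x
  proof -
    have "x = (a \<otimes> s \<oplus> \<mu>) \<odot>\<^sub>D x" unfolding a(3)[symmetric] using x by simp
    also have "\<dots> = a \<odot>\<^sub>D (s \<odot>\<^sub>D x) \<oplus>\<^sub>D \<mu> \<odot>\<^sub>D x"
      using a(1) s(1) \<mu> x by (simp add: D.smult_l_distr D.smult_assoc1)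
    finally show ?thesis .
  qed
  show "x = \<zero>\<^sub>D" if x: "x \<in> carrier D" and z: "s \<odot>\<^sub>D x = \<zero>\<^sub>D" for x
  proof -
    have "x = \<zero>\<^sub>D \<oplus>\<^sub>D \<mu> \<odot>\<^sub>D x" using split[OF x] unfolding z D.smult_r_null[OF a(1)] .
    then have "x = \<phi> \<zero>\<^sub>D" by (rule \<phi>(3)[OF D.zero_closed x])
    then show ?thesis using lin_zero[OF D D \<phi>(1)] by simp
  qed
  show "\<exists>y\<in>carrier D. s \<odot>\<^sub>D y = x" if x: "x \<in> carrier D" for x
  proof -
    have p: "\<phi> x \<in> carrier D" by (rule lin_closed[OF \<phi>(1) x])
    have "a \<odot>\<^sub>D (s \<odot>\<^sub>D \<phi> x) \<oplus>\<^sub>D \<mu> \<odot>\<^sub>D \<phi> x = x \<oplus>\<^sub>D \<mu> \<odot>\<^sub>D \<phi> x"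
      using split[OF p] \<phi>(2)[OF x] by presburger
    then have "a \<odot>\<^sub>D (s \<odot>\<^sub>D \<phi> x) = x"
      using D.add.right_cancel[of "\<mu> \<odot>\<^sub>D \<phi> x" "a \<odot>\<^sub>D (s \<odot>\<^sub>D \<phi> x)" x] a(1) s(1) \<mu> p x by simp
    then have "s \<odot>\<^sub>D (a \<odot>\<^sub>D \<phi> x) = x"
      using lin_smult[OF lin_scalar[OF D s(1)] a(1) p] by simp
    then show ?thesis using D.smult_closed[OF a(1) p] by blast
  qed
qed

section \<open>Recovery of the factors, functoriality and uniqueness\<close>

context local_zero_dim
begin

lemma family:
  assumes D: "contramodule_family R \<Lambda> D" and m: "m \<in> \<Lambda>"
  shows "module R (D m)" "\<And>t. t \<in> m \<Longrightarrow> op_contra (D m) (\<lambda>x. t \<odot>\<^bsub>D m\<^esub> x)"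
proof -
  show DM: "module R (D m)" using D m by (simp add: contramodule_family_def)
  fix t assume t: "t \<in> m"
  have "m \<in> gab" using m by (simp add: \<Lambda>_iff)
  then have "t \<in> carrier R" using t gab_subset by blast
  moreover have "elem_contramodule R t (D m)" using D m t by (simp add: contramodule_family_def ideal_contramodule_def)
  ultimately show "op_contra (D m) (\<lambda>x. t \<odot>\<^bsub>D m\<^esub> x)" using elem_contramodule_iff[OF DM] by blast
qed

lemma \<Lambda>_max: "m \<in> \<Lambda> \<Longrightarrow> maximalideal m R" and \<Lambda>_gab: "m \<in> \<Lambda> \<Longrightarrow> m \<in> gab" and \<Lambda>_carrier: "m \<in> \<Lambda> \<Longrightarrow> t \<in> m \<Longrightarrow> t \<in> carrier R"
  using gab_subset by (auto simp: \<Lambda>_iff)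

lemma family_product:
  assumes D: "contramodule_family R \<Lambda> D"
  shows "u_contramodule R U u (product_module \<Lambda> D)"
proof (rule u_contramodule_product[OF R.is_cring V])
  fix m assume m: "m \<in> \<Lambda>"
  show "u_contramodule R U u (D m)"
    by (rule u_contramodule_of_op_contra[OF gab_subset[OF \<Lambda>_gab[OF m]] gab_one[OF \<Lambda>_gab[OF m]] family(1)[OF D m] family(2)[OF D m]])
qed

text \<open>An element \<open>t\<close> of \<open>n\<close> outside \<open>m\<close> acts invertibly
  on \<open>R_m\<close>, so every element of \<open>R_m\<close> has quotients by all powers of
  \<open>t\<close>, whereas \<open>E\<close> is \<open>t\<close>-separated.\<close>

lemma colocalization_vanish:
  assumes m: "m \<in> \<Lambda>" and n: "n \<in> \<Lambda>" and mn: "m \<noteq> n" and E: "module R E" and con: "\<And>t. t \<in> n \<Longrightarrow> op_contra E (\<lambda>x. t \<odot>\<^sub>E x)"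
    and h: "lin R (L m) E h" and y: "y \<in> carrier (L m)"
  shows "h y = \<zero>\<^sub>E"
proof -
  obtain t where t: "t \<in> n" "t \<in> carrier R" "t \<notin> m" using R.maximalideal_neq[OF \<Lambda>_max[OF m] \<Lambda>_max[OF n] mn] by blast
  have tS: "t \<in> S m" using t by blast
  obtain g where g: "lin R (L m) (L m) g" "\<And>y. y \<in> carrier (L m) \<Longrightarrow> t \<odot>\<^bsub>L m\<^esub> g y = y"
  proof (rule scalar_inverse[OF L_module[OF m] t(2)])
    show "y = \<zero>\<^bsub>L m\<^esub>" if "y \<in> carrier (L m)" "t \<odot>\<^bsub>L m\<^esub> y = \<zero>\<^bsub>L m\<^esub>" for y by (rule L_inj[OF m tS that])
    show "\<exists>y'\<in>carrier (L m). t \<odot>\<^bsub>L m\<^esub> y' = y" if "y \<in> carrier (L m)" for y by (rule L_div[OF m tS that])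
  qed (rule that)
  have gk: "(g ^^ k) y \<in> carrier (L m)" for k by (rule lin_closed[OF lin_funpow[OF g(1)] y])
  have "h ((g ^^ 0) y) = \<zero>\<^sub>E"
  proof (rule separated_orbit[where y = "\<lambda>k. (g ^^ k) y", OF h t(2) _ gk])
    show "separated E (\<lambda>x. t \<odot>\<^sub>E x)" using con[OF t(1)] by (simp add: op_contra_def)
    show "(g ^^ k) y = t \<odot>\<^bsub>L m\<^esub> (g ^^ Suc k) y" for k using g(2)[OF gk[of k]] by simp
  qed
  then show ?thesis by simp
qed

text \<open>A map from \<open>R_m\<close> to the product has zero components at all \<open>n\<close>
  other than \<open>m\<close> by \<open>colocalization_vanish\<close>. The component at
  \<open>m\<close> is determined by its value at 1, and any value occurs, because \<open>D m\<close>
  is an \<open>R_m\<close>-module.\<close>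

lemma recovery:
  assumes C: "module R C" and D: "contramodule_family R \<Lambda> D" and f: "f \<in> module_iso R C (product_module \<Lambda> D)" and m: "m \<in> \<Lambda>"
  shows "(\<lambda>h\<in>carrier (Hom_module R (L m) C). f (h \<one>\<^bsub>L m\<^esub>) m) \<in> module_iso R (Hom_module R (L m) C) (D m)"
proof -
  let ?P = "product_module \<Lambda> D" and ?H = "Hom_module R (L m) C"
  have P: "module R ?P" by (rule module_product[OF R.is_cring family(1)[OF D]])
  note fl = module_isoD[OF C P f]
  obtain g where g: "lin R ?P C g" "\<And>y. y \<in> carrier ?P \<Longrightarrow> f (g y) = y" using module_iso_inverse[OF C P f] by blast
  have one: "\<iota> m \<one>\<^sub>R \<in> carrier (L m)" by (rule \<iota>_closed[OF m R.one_closed])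
  have proj: "lin R ?P (D n) (\<lambda>x. x n)" if "n \<in> \<Lambda>" for n by (rule linI) (use that in auto)
  note loc_inj = R.contramodule_local(1)[OF \<Lambda>_max[OF m] family(1)[OF D m] family(2)[OF D m]]
  note loc_div = R.contramodule_local(2)[OF \<Lambda>_max[OF m] family(1)[OF D m] family(2)[OF D m]]
  show ?thesis unfolding L_one[OF m]
  proof (rule module_isoI[OF module_Hom[OF L_module[OF m] C] family(1)[OF D m]])
    show "lin R ?H (D m) (\<lambda>h. f (h (\<iota> m \<one>\<^sub>R)) m)"
      by (rule lin_comp[OF lin_eval[OF one] lin_comp[OF fl(1) proj[OF m]]])
  next
    fix h assume h: "h \<in> carrier ?H" and z: "f (h (\<iota> m \<one>\<^sub>R)) m = \<zero>\<^bsub>D m\<^esub>"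
    have hl: "lin R (L m) C h" and he: "h \<in> extensional (carrier (L m))" using h by (auto simp: module_hom_iff)
    have "h y = \<zero>\<^sub>C" if y: "y \<in> carrier (L m)" for y
    proof (rule fl(2)[OF lin_closed[OF hl y]])
      have fn: "lin R (L m) (D n) (\<lambda>y. f (h y) n)" if "n \<in> \<Lambda>" for n
        by (rule lin_comp[OF lin_comp[OF hl fl(1)] proj[OF that]])
      show "f (h y) = \<zero>\<^sub>?P"
      proof (rule extensionalityI[of _ \<Lambda>])
        show "f (h y) \<in> extensional \<Lambda>" using lin_closed[OF fl(1) lin_closed[OF hl y]] by (simp add: PiE_def)
        fix n assume n: "n \<in> \<Lambda>"
        have "f (h y) n = \<zero>\<^bsub>D n\<^esub>"
        proof (cases "n = m")
          case True
          show ?thesis unfolding True by (rule L_hom_zero[OF m family(1)[OF D m] fn[OF m] z _ y]) (rule loc_inj, auto)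
        next
          case False
          then show ?thesis using colocalization_vanish[OF m n _ family(1)[OF D n] family(2)[OF D n] fn[OF n] y] by blast
        qed
        then show "f (h y) n = \<zero>\<^sub>?P n" using n by simp
      qed simp
    qed
    then show "h = \<zero>\<^sub>?H" using he by (auto intro!: extensionalityI[of _ "carrier (L m)"])
  next
    fix d assume d: "d \<in> carrier (D m)"
    show "\<exists>h\<in>carrier ?H. f (h (\<iota> m \<one>\<^sub>R)) m = d"
    proof (rule localization_lift[OF loc[OF m] mult_S[OF m] family(1)[OF D m] _ _ lin_multiples[OF family(1)[OF D m] d]])
      show "y = \<zero>\<^bsub>D m\<^esub>" if "s \<in> S m" "y \<in> carrier (D m)" "s \<odot>\<^bsub>D m\<^esub> y = \<zero>\<^bsub>D m\<^esub>" for s y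
        by (rule loc_inj[OF _ _ _ that(2,3)]) (use that(1) in auto)
      show "\<exists>y'\<in>carrier (D m). s \<odot>\<^bsub>D m\<^esub> y' = y" if "s \<in> S m" "y \<in> carrier (D m)" for s y
        by (rule loc_div[OF _ _ _ that(2)]) (use that(1) in auto)
    next
      fix k assume k: "lin R (L m) (D m) k" "\<And>x. x \<in> carrier (self_module R) \<Longrightarrow> k (\<iota> m x) = x \<odot>\<^bsub>D m\<^esub> d"
      have e: "lin R (D m) ?P (dsum_inj \<Lambda> D m)"
        by (rule lin_dsum_inj_product[OF family(1)[OF D] m])
      let ?h = "\<lambda>y. g (dsum_inj \<Lambda> D m (k y))"
      have h: "lin R (L m) C ?h" by (rule lin_comp[OF lin_comp[OF k(1) e] g(1)])
      have kd: "k (\<iota> m \<one>\<^sub>R) = d"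
        using k(2)[of "\<one>\<^sub>R"] module.smult_one[OF family(1)[OF D m] d] by simp
      have "f (?h (\<iota> m \<one>\<^sub>R)) m = dsum_inj \<Lambda> D m d m" unfolding kd by (rule fun_cong[OF g(2)[OF lin_closed[OF e d]]])
      then have "f (restrict ?h (carrier (L m)) (\<iota> m \<one>\<^sub>R)) m = d" using one m by (simp add: dsum_inj_def)
      moreover have "restrict ?h (carrier (L m)) \<in> carrier ?H" using lin_restrict[OF L_module[OF m] h] by simp
      ultimately show ?thesis by (rule bexI)
    qed
  qed
qed

text \<open>An element of the product that is supported away from \<open>m\<close> is a finite sum of elements that are
  uniquely divisible by some \<open>t \<in> m\<close>.\<close>

lemma product_vanish:
  assumes D: "contramodule_family R \<Lambda> D" and m: "m \<in> \<Lambda>" and E: "module R E" and con: "\<And>t. t \<in> m \<Longrightarrow> op_contra E (\<lambda>x. t \<odot>\<^sub>E x)"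
    and h: "lin R (product_module \<Lambda> D) E h" and x: "x \<in> carrier (product_module \<Lambda> D)" and xm: "x m = \<zero>\<^bsub>D m\<^esub>"
  shows "h x = \<zero>\<^sub>E"
proof -
  let ?P = "product_module \<Lambda> D"
  interpret E: module R E by (rule E)
  have P: "module R ?P" by (rule module_product[OF R.is_cring family(1)[OF D]])
  have xD: "x n \<in> carrier (D n)" if "x \<in> carrier ?P" "n \<in> \<Lambda>" for x n using that by auto
  \<comment> \<open>Induction on a finite set \<open>T\<close> of elements of \<open>m\<close>: for
    a new \<open>t\<close> the element \<open>x\<close> is split into the part at the
    \<open>n\<close> not containing \<open>t\<close> and the part at the \<open>n\<close> containing
    \<open>t\<close>. The first is divisible by \<open>t\<close>, and the second falls under the
    induction hypothesis.\<close>
  have claim: "h x = \<zero>\<^sub>E" if "finite T" "T \<subseteq> m" "x \<in> carrier ?P" "\<And>n. n \<in> \<Lambda> \<Longrightarrow> T \<subseteq> n \<Longrightarrow> x n = \<zero>\<^bsub>D n\<^esub>" for T x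
    using that
  proof (induction T arbitrary: x)
    case empty
    have "x = \<zero>\<^sub>?P"
      by (rule extensionalityI[of _ \<Lambda>]) (use empty.prems in \<open>auto simp: PiE_def\<close>)
    then show ?case using lin_zero[OF P E h] by (simp only:)
  next
    case (insert t T)
    have tm: "t \<in> m" using insert.prems(1) by blast
    have tc: "t \<in> carrier R" by (rule \<Lambda>_carrier[OF m tm])
    have "\<forall>n\<in>\<Lambda>. \<exists>g. t \<notin> n \<longrightarrow> (lin R (D n) (D n) g \<and> (\<forall>y\<in>carrier (D n). t \<odot>\<^bsub>D n\<^esub> g y = y))"
    proof
      fix n assume n: "n \<in> \<Lambda>"
      show "\<exists>g. t \<notin> n \<longrightarrow> (lin R (D n) (D n) g \<and> (\<forall>y\<in>carrier (D n). t \<odot>\<^bsub>D n\<^esub> g y = y))"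
      proof (cases "t \<in> n")
        case False
        note l = R.contramodule_local[OF \<Lambda>_max[OF n] family(1)[OF D n] family(2)[OF D n] tc False]
        obtain g where "lin R (D n) (D n) g" "\<And>y. y \<in> carrier (D n) \<Longrightarrow> t \<odot>\<^bsub>D n\<^esub> g y = y"
        proof (rule scalar_inverse[OF family(1)[OF D n] tc])
          show "y = \<zero>\<^bsub>D n\<^esub>" if "y \<in> carrier (D n)" "t \<odot>\<^bsub>D n\<^esub> y = \<zero>\<^bsub>D n\<^esub>" for y by (rule l(1)[OF _ that])
          show "\<exists>y'\<in>carrier (D n). t \<odot>\<^bsub>D n\<^esub> y' = y" if "y \<in> carrier (D n)" for y by (rule l(2)[OF _ that])
        qed (rule that)
        then show ?thesis by (intro exI[of _ g]) blast
      qed simp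
    qed
    then obtain g where g0: "\<forall>n\<in>\<Lambda>. t \<notin> n \<longrightarrow> (lin R (D n) (D n) (g n) \<and> (\<forall>y\<in>carrier (D n). t \<odot>\<^bsub>D n\<^esub> g n y = y))" by (rule bchoice[THEN exE])
    have g: "lin R (D n) (D n) (g n)" "\<And>y. y \<in> carrier (D n) \<Longrightarrow> t \<odot>\<^bsub>D n\<^esub> g n y = y" if "n \<in> \<Lambda>" "t \<notin> n" for n
      using g0 that by blast+
    \<comment> \<open>The quotients of the first part by the powers of \<open>t\<close>, formed
      componentwise with the inverses \<open>g n\<close> of \<open>t\<close>.\<close>
    define b where "b k = (\<lambda>n\<in>\<Lambda>. if t \<in> n then \<zero>\<^bsub>D n\<^esub> else (g n ^^ k) (x n))" for k :: nat
    have gk: "(g n ^^ k) (x n) \<in> carrier (D n)" if "n \<in> \<Lambda>" "t \<notin> n" for n k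
      by (rule lin_closed[OF lin_funpow[OF g(1)[OF that]] xD[OF insert.prems(2) that(1)]])
    have b: "b k \<in> carrier ?P" for k using gk module_zero_closed[OF family(1)[OF D]] by (auto simp: b_def)
    have "h (b 0) = \<zero>\<^sub>E"
    proof (rule separated_orbit[where y = b, OF h tc _ b])
      show "separated E (\<lambda>x. t \<odot>\<^sub>E x)" using con[OF tm] by (simp add: op_contra_def)
      fix k
      have "b k n = t \<odot>\<^bsub>D n\<^esub> b (Suc k) n" if n: "n \<in> \<Lambda>" for n
        using n g(2)[OF n _ gk[OF n, of k]] module.smult_r_null[OF family(1)[OF D n] tc] by (simp add: b_def)
      then show "b k = t \<odot>\<^sub>?P b (Suc k)"
        by (intro extensionalityI[of _ \<Lambda>]) (simp_all add: b_def)
    qed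
    moreover define x' where "x' = (\<lambda>n\<in>\<Lambda>. if t \<in> n then x n else \<zero>\<^bsub>D n\<^esub>)"
    have x': "x' \<in> carrier ?P" using xD[OF insert.prems(2)] module_zero_closed[OF family(1)[OF D]] by (auto simp: x'_def)
    have "h x' = \<zero>\<^sub>E"
      by (rule insert.IH[OF _ x']) (use insert.prems in \<open>auto simp: x'_def\<close>)
    moreover have "x = b 0 \<oplus>\<^sub>?P x'"
    proof (rule extensionalityI[of _ \<Lambda>])
      show "x \<in> extensional \<Lambda>" using insert.prems(2) by (simp add: PiE_def)
      show "x n = (b 0 \<oplus>\<^sub>?P x') n" if n: "n \<in> \<Lambda>" for n
        using n xD[OF insert.prems(2) n] module_l_zero[OF family(1)[OF D n]] module_r_zero[OF family(1)[OF D n]] by (simp add: b_def x'_def)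
    qed simp
    ultimately show ?case using lin_add[OF h b x', of 0] E.M.l_zero[OF E.M.zero_closed] by (simp only:)
  qed
  \<comment> \<open>Finitely many elements of \<open>m\<close> that lie together in only finitely
    many members of \<open>\<Lambda>\<close>. Adding one separating element for each of these other
    than \<open>m\<close> leaves \<open>m\<close> as the only member containing them all.\<close>
  obtain J where J: "finite J" "J \<subseteq> m" "finite {n \<in> \<Lambda>. J \<subseteq> n}" by (rule gab_avoiding[OF \<Lambda>_gab[OF m]])
  let ?N = "{n \<in> \<Lambda>. J \<subseteq> n} - {m}"
  have "\<forall>n\<in>?N. \<exists>t. t \<in> m \<and> t \<notin> n"
  proof
    fix n assume "n \<in> ?N"
    then have n: "n \<in> \<Lambda>" "n \<noteq> m" by auto
    obtain t where "t \<in> m" "t \<in> carrier R" "t \<notin> n" by (rule R.maximalideal_neq[OF \<Lambda>_max[OF n(1)] \<Lambda>_max[OF m] n(2)])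
    then show "\<exists>t. t \<in> m \<and> t \<notin> n" by blast
  qed
  then obtain \<tau> where \<tau>: "\<forall>n\<in>?N. \<tau> n \<in> m \<and> \<tau> n \<notin> n" by (rule bchoice[THEN exE])
  show ?thesis
  proof (rule claim[of "J \<union> \<tau> ` ?N", OF _ _ x])
    show "finite (J \<union> \<tau> ` ?N)" using J by blast
    show "J \<union> \<tau> ` ?N \<subseteq> m" using J(2) \<tau> by blast
    fix n assume n: "n \<in> \<Lambda>" "J \<union> \<tau> ` ?N \<subseteq> n"
    have "n = m"
    proof (rule ccontr)
      assume "n \<noteq> m"
      then have "n \<in> ?N" using n by blast
      then show False using \<tau> n(2) by blast
    qed
    then show "x n = \<zero>\<^bsub>D n\<^esub>" using xm by simp
  qed
qed

text \<open>The component of \<open>f x\<close> at \<open>m\<close> depends only on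
  \<open>x m\<close>: the difference of \<open>x\<close> and its part at \<open>m\<close> is
  supported away from \<open>m\<close>, so \<open>product_vanish\<close> applies. Hence
  \<open>g m\<close> must be, and is, the diagonal entry of \<open>f\<close> at \<open>m\<close>;
  evaluating on elements supported at \<open>m\<close> gives uniqueness.\<close>

lemma functoriality:
  assumes D: "contramodule_family R \<Lambda> D" and E: "contramodule_family R \<Lambda> E"
    and f: "f \<in> module_hom R (product_module \<Lambda> D) (product_module \<Lambda> E)"
  shows "\<exists>!g. g \<in> (\<Pi>\<^sub>E m\<in>\<Lambda>. module_hom R (D m) (E m)) \<and> f = product_map \<Lambda> D g"
proof
  let ?P = "product_module \<Lambda> D" and ?Q = "product_module \<Lambda> E"
  have P: "module R ?P" by (rule module_product[OF R.is_cring family(1)[OF D]])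
  have Q: "module R ?Q" by (rule module_product[OF R.is_cring family(1)[OF E]])
  have fl: "lin R ?P ?Q f" and fe: "f \<in> extensional (carrier ?P)" using f by (auto simp: module_hom_iff)
  have proj: "lin R ?Q (E n) (\<lambda>x. x n)" if "n \<in> \<Lambda>" for n by (rule linI) (use that in auto)
  have fm: "lin R ?P (E m) (\<lambda>x. f x m)" if "m \<in> \<Lambda>" for m by (rule lin_comp[OF fl proj[OF that]])
  have e: "lin R (D m) ?P (dsum_inj \<Lambda> D m)" if m: "m \<in> \<Lambda>" for m
    by (rule lin_dsum_inj_product[OF family(1)[OF D] m])
  define g where "g = (\<lambda>m\<in>\<Lambda>. restrict (\<lambda>d. f (dsum_inj \<Lambda> D m d) m) (carrier (D m)))"
  have g: "g \<in> (\<Pi>\<^sub>E m\<in>\<Lambda>. module_hom R (D m) (E m))"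
  proof (rule PiE_I)
    fix m assume m: "m \<in> \<Lambda>"
    show "g m \<in> module_hom R (D m) (E m)"
      using lin_restrict[OF family(1)[OF D m] lin_comp[OF e[OF m] fm[OF m]]] m by (simp add: g_def)
  qed (simp add: g_def)
  have "f x = product_map \<Lambda> D g x" if x: "x \<in> carrier ?P" for x
  proof (rule extensionalityI[of _ \<Lambda>])
    show "f x \<in> extensional \<Lambda>" using lin_closed[OF fl x] by (simp add: PiE_def)
    show "product_map \<Lambda> D g x \<in> extensional \<Lambda>" using x by (simp add: product_map_def del: product_module_simps)
    fix m assume m: "m \<in> \<Lambda>"
    have xm: "x m \<in> carrier (D m)" using x m by auto
    let ?y = "dsum_inj \<Lambda> D m (x m)"
    have y: "?y \<in> carrier ?P" by (rule lin_closed[OF e[OF m] xm])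
    have "(x \<ominus>\<^sub>?P ?y) m = x m \<ominus>\<^bsub>D m\<^esub> ?y m"
      by (rule lin_minus[OF P family(1)[OF D m] _ x y]) (rule linI, use m in auto)
    then have z: "(x \<ominus>\<^sub>?P ?y) m = \<zero>\<^bsub>D m\<^esub>" using module_minus_self[OF family(1)[OF D m] xm] m by (simp add: dsum_inj_def)
    have "f (x \<ominus>\<^sub>?P ?y) m = \<zero>\<^bsub>E m\<^esub>"
      by (rule product_vanish[OF D m family(1)[OF E m] family(2)[OF E m] fm[OF m] module_minus_closed[OF P x y] z])
    then have "f x m \<ominus>\<^bsub>E m\<^esub> f ?y m = \<zero>\<^bsub>E m\<^esub>" using lin_minus[OF P family(1)[OF E m] fm[OF m] x y] by simp
    then have "f x m = f ?y m"
      using module_diff_eq_zero[OF family(1)[OF E m] lin_closed[OF fm[OF m] x] lin_closed[OF fm[OF m] y]] by blast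
    then show "f x m = product_map \<Lambda> D g x m" using x xm m by (simp add: product_map_def g_def del: product_module_simps)
  qed
  then have "f = product_map \<Lambda> D g"
    by (intro extensionalityI[of _ "carrier ?P"] fe) (auto simp: product_map_def)
  with g show "g \<in> (\<Pi>\<^sub>E m\<in>\<Lambda>. module_hom R (D m) (E m)) \<and> f = product_map \<Lambda> D g" by blast
  fix k assume k: "k \<in> (\<Pi>\<^sub>E m\<in>\<Lambda>. module_hom R (D m) (E m)) \<and> f = product_map \<Lambda> D k"
  show "k = g"
  proof (rule extensionalityI[of _ \<Lambda>])
    show "k \<in> extensional \<Lambda>" using k by (auto simp: PiE_def)
    show "g \<in> extensional \<Lambda>" by (simp add: g_def)
    fix m assume m: "m \<in> \<Lambda>"
    show "k m = g m"
    proof (rule extensionalityI[of _ "carrier (D m)"])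
      show "k m \<in> extensional (carrier (D m))" using k m by (auto simp: module_hom_iff)
      show "g m \<in> extensional (carrier (D m))" using m by (simp add: g_def)
      fix d assume d: "d \<in> carrier (D m)"
      have y: "dsum_inj \<Lambda> D m d \<in> carrier ?P" by (rule lin_closed[OF e[OF m] d])
      have "g m d = f (dsum_inj \<Lambda> D m d) m" using m d by (simp add: g_def)
      also have "\<dots> = product_map \<Lambda> D k (dsum_inj \<Lambda> D m d) m" using k by (metis (no_types))
      also have "\<dots> = k m (dsum_inj \<Lambda> D m d m)" using y m by (simp add: product_map_def del: product_module_simps)
      also have "dsum_inj \<Lambda> D m d m = d" using m by (simp add: dsum_inj_def)
      finally show "k m d = g m d" by simp
    qed
  qed
qed

lemma colocal_family:
  assumes "u_contramodule R U u C"
  shows "contramodule_family R \<Lambda> (\<lambda>m. C\<lparr>carrier := colocal C m\<rparr>)"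
  unfolding contramodule_family_def ideal_contramodule_def
proof (intro ballI conjI)
  have C: "module R C" using assms by (simp add: u_contramodule_def)
  fix m assume m: "m \<in> \<Lambda>"
  show M: "module R (C\<lparr>carrier := colocal C m\<rparr>)" by (rule colocal_module[OF C m])
  fix t assume t: "t \<in> m"
  show "elem_contramodule R t (C\<lparr>carrier := colocal C m\<rparr>)"
    unfolding elem_contramodule_iff[OF M \<Lambda>_carrier[OF m t]] using colocal_contramodule[OF assms m t] by simp
qed

end

theorem theorem26:
  fixes R :: "'a ring" and U :: "'b ring" and u :: "'a \<Rightarrow> 'b"
    and \<Lambda> :: "'a set set"
    and C :: "('a, 'c) module"
  assumes "flat_epimorphism R U u"
    and "\<forall>I\<in>gabriel_ideals R U u. semilocal (R Quot I) \<and> krull_dim_zero (R Quot I)"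
    and "\<Lambda> = gabriel_ideals R U u \<inter> Max_ideals R"
    and "module R C"
  \<comment> \<open>First conjunct: the criterion. Every factor of a decomposition of \<open>C\<close> is isomorphic to a
      submodule of \<open>C\<close>, so nothing is lost by letting the factors live on the type of \<open>C\<close>.
      Second conjunct: sufficiency, and recovery of the factors, for factors over an arbitrary type;
      the isomorphism from the colocalization is evaluation at \<open>1\<close> followed by the projection
      to the factor. Third conjunct: uniqueness and functoriality.\<close>
  shows
    "(u_contramodule R U u C \<longleftrightarrow>
       (\<exists>D :: 'a set \<Rightarrow> ('a, 'c) module.
          contramodule_family R \<Lambda> D \<and> module_iso R C (product_module \<Lambda> D) \<noteq> {})) \<and>
     (\<forall>(D :: 'a set \<Rightarrow> ('a, 'd) module) \<phi>.
       contramodule_family R \<Lambda> D \<and> \<phi> \<in> module_iso R C (product_module \<Lambda> D) \<longrightarrow>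
         u_contramodule R U u C \<and>
         (\<forall>m\<in>\<Lambda>. (\<lambda>h\<in>carrier (Hom_module R (localization_prime R m) C).
                    \<phi> (h \<one>\<^bsub>localization_prime R m\<^esub>) m)
            \<in> module_iso R (Hom_module R (localization_prime R m) C) (D m))) \<and>
     (\<forall>(D :: 'a set \<Rightarrow> ('a, 'd) module) (E :: 'a set \<Rightarrow> ('a, 'e) module).
       contramodule_family R \<Lambda> D \<and> contramodule_family R \<Lambda> E \<longrightarrow>
         (\<forall>f\<in>module_hom R (product_module \<Lambda> D) (product_module \<Lambda> E).
            \<exists>!g. g \<in> (\<Pi>\<^sub>E m\<in>\<Lambda>. module_hom R (D m) (E m)) \<and> f = product_map \<Lambda> D g))"
proof -
  have RU: "cring R" "cring U" "u \<in> ring_hom R U" using assms(1) by (auto simp: flat_epimorphism_def)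
  interpret R: cring R by (rule RU(1))
  interpret U: cring U by (rule RU(2))
  interpret local_zero_dim R U u \<Lambda>
    by unfold_locales (use assms RU in auto)
  note C = assms(4)
  have "u_contramodule R U u C \<longleftrightarrow>
       (\<exists>D :: 'a set \<Rightarrow> ('a, 'c) module.
          contramodule_family R \<Lambda> D \<and> module_iso R C (product_module \<Lambda> D) \<noteq> {})" (is "?l = ?r")
  proof
    assume ?l
    then show ?r using decomposition[of C] colocal_family[of C] by blast
  next
    assume ?r
    then show ?l using u_contramodule_iso[OF V C family_product] by blast
  qed
  moreover have "u_contramodule R U u C \<and>
         (\<forall>m\<in>\<Lambda>. (\<lambda>h\<in>carrier (Hom_module R (localization_prime R m) C).
                    \<phi> (h \<one>\<^bsub>localization_prime R m\<^esub>) m)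
            \<in> module_iso R (Hom_module R (localization_prime R m) C) (D m))"
    if "contramodule_family R \<Lambda> D" "\<phi> \<in> module_iso R C (product_module \<Lambda> D)" for D :: "'a set \<Rightarrow> ('a, 'd) module" and \<phi>
    using u_contramodule_iso[OF V C family_product[OF that(1)] that(2)] recovery[OF C that] by blast
  moreover have "\<exists>!g. g \<in> (\<Pi>\<^sub>E m\<in>\<Lambda>. module_hom R (D m) (E m)) \<and> f = product_map \<Lambda> D g"
    if "contramodule_family R \<Lambda> D" "contramodule_family R \<Lambda> E" "f \<in> module_hom R (product_module \<Lambda> D) (product_module \<Lambda> E)"
    for D :: "'a set \<Rightarrow> ('a, 'd) module" and E :: "'a set \<Rightarrow> ('a, 'e) module" and f
    by (rule functoriality[OF that])
  ultimately show ?thesis by blast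
qed

end
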